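(* Let $\alpha\in(0,2)$ and let $(Z_i)_{i\in\mathbb{Z}}$ be an i.i.d. sequence of real random variables that are regularly varying with index $\alpha$. When $\alpha=1$, suppose further that $Z_1$ is symmetric (i.e. $Z_1$ and $-Z_1$ have the same distribution). Let $(a_n)_{n\ge 1}$ be a sequence of positive real numbers such that $n\operatorname{P}(|Z_1|>a_n)\to 1$ as $n\to\infty$. Let $(\varphi_i)_{i\ge 0}$ be a sequence of real numbers such that $$\sum_{i=0}^{\infty}|\varphi_i|^{\delta}<\infty \quad\text{for some } 0<\delta<\min\{1,\alpha\},$$ put $\Phi=\sum_{i=0}^{\infty}\varphi_i$, and suppose that $\Phi\neq 0$ and $$0\le \frac{\sum_{i=0}^{s}\varphi_i}{\sum_{i=0}^{\infty}\varphi_i}\le 1\qquad\text{for every } s=0,1,2,\ldots.$$ Let $X_t=\sum_{i=0}^{\infty}\varphi_i Z_{t-i}$ for $t\in\mathbb{Z}$ (the series converges almost surely), and define $$V_n(t)=\frac{1}{a_n}\Bigg(\sum_{i=1}^{\lfloor nt\rfloor}X_i-\lfloor nt\rfloor b_n\Bigg),\quad t\in[0,1],\qquad b_n=\begin{cases}0,&\alpha\in(0,1],\\ \Phi\,\mathrm{E}(Z_1),&\alpha\in(1,2).\end{cases}$$ Then there is an $\alpha$-stable L\'evy process $V$ such that, as $n\to\infty$, $$V_n(\,\cdot\,)\xrightarrow{d}\Phi\,V(\,\cdot\,)$$ in $D[0,1]$ endowed with the Skorohod $M_2$ topology.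
   Context: A real random variable $Z$ is regularly varying with index $\alpha>0$ if $\operatorname{P}(|Z|>x)=x^{-\alpha}L(x)$ for $x>0$, with $L$ slowly varying at $\infty$, and the limits $p=\lim_{x\to\infty}\operatorname{P}(Z>x)/\operatorname{P}(|Z|>x)$ and $r=\lim_{x\to\infty}\operatorname{P}(Z<-x)/\operatorname{P}(|Z|>x)$ exist. $D[0,1]$ is the space of right-continuous functions $x:[0,1]\to\mathbb{R}$ with left limits. For $x\in D[0,1]$ the completed graph is $$\Gamma_x=\{(t,z)\in[0,1]\times\mathbb{R}: z=\lambda x(t-)+(1-\lambda)x(t)\text{ for some }\lambda\in[0,1]\},$$ where $x(t-)$ is the left limit of $x$ at $t$ (with the convention $x(0-)=x(0)$). The Skorohod $M_2$ topology on $D[0,1]$ is the topology induced by the metric $$d_{M_2}(x_1,x_2)=\Big(\sup_{a\in\Gamma_{x_1}}\inf_{b\in\Gamma_{x_2}}d(a,b)\Big)\vee\Big(\sup_{a\in\Gamma_{x_2}}\inf_{b\in\Gamma_{x_1}}d(a,b)\Big),$$ where $d((s_1,y_1),(s_2,y_2))=|s_1-s_2|\vee|y_1-y_2|$ on $\mathbb{R}^2$ and $u\vee v=\max\{u,v\}$. The symbol $\xrightarrow{d}$ denotes convergence in distribution (weak convergence of laws) of random elements of $D[0,1]$ with respect to this topology. An $\alpha$-stable L\'evy process is a L\'evy process (stationary independent increments, started at $0$, c\`adl\`ag paths) whose value at time $1$ has a non-degenerate $\alpha$-stable distribution, not necessarily strictly stable; it is considered on $[0,1]$. *)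

theory Defs
  imports "HOL-Probability.Probability"
begin

section \<open>Regular variation and stable laws\<close>

definition slowly_varying :: "(real \<Rightarrow> real) \<Rightarrow> bool" where
  "slowly_varying L \<longleftrightarrow>
     L \<in> borel_measurable (restrict_space borel {0<..}) \<and>
     (\<forall>\<^sub>F x in at_top. 0 < L x) \<and>
     (\<forall>c>0. ((\<lambda>x. L (c * x) / L x) \<longlongrightarrow> 1) at_top)"

definition regularly_varying :: "real \<Rightarrow> 'a measure \<Rightarrow> ('a \<Rightarrow> real) \<Rightarrow> bool" where
  "regularly_varying \<alpha> M Z \<longleftrightarrow>
     0 < \<alpha> \<and> Z \<in> borel_measurable M \<and>
     (\<exists>L. slowly_varying L \<and> (\<forall>x>0. \<P>(\<omega> in M. \<bar>Z \<omega>\<bar> > x) = x powr (- \<alpha>) * L x)) \<and>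
     (\<exists>p. ((\<lambda>x. \<P>(\<omega> in M. Z \<omega> > x) / \<P>(\<omega> in M. \<bar>Z \<omega>\<bar> > x)) \<longlongrightarrow> p) at_top) \<and>
     (\<exists>r. ((\<lambda>x. \<P>(\<omega> in M. Z \<omega> < - x) / \<P>(\<omega> in M. \<bar>Z \<omega>\<bar> > x)) \<longlongrightarrow> r) at_top)"

text \<open>
  A law \<open>\<mu>\<close> is \<open>\<alpha>\<close>-stable if, for independent \<open>Y\<^sub>1, Y\<^sub>2 \<sim> \<mu>\<close> and all \<open>A, B > 0\<close>, the variable
  \<open>A Y\<^sub>1 + B Y\<^sub>2\<close> has the law of \<open>C Y\<^sub>1 + D\<close> for some real \<open>D\<close>, where \<open>C\<^sup>\<alpha> = A\<^sup>\<alpha> + B\<^sup>\<alpha>\<close>.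
  Strict stability would be the case \<open>D = 0\<close>. Point masses are excluded.
\<close>

definition nondegenerate_stable :: "real \<Rightarrow> real measure \<Rightarrow> bool" where
  "nondegenerate_stable \<alpha> \<mu> \<longleftrightarrow>
     prob_space \<mu> \<and> sets \<mu> = sets borel \<and> (\<forall>c. \<mu> \<noteq> return borel c) \<and>
     (\<forall>A>0. \<forall>B>0. \<exists>D.
        distr (\<mu> \<Otimes>\<^sub>M \<mu>) borel (\<lambda>(y1, y2). A * y1 + B * y2) =
        distr \<mu> borel (\<lambda>y. (A powr \<alpha> + B powr \<alpha>) powr (1 / \<alpha>) * y + D))"


section \<open>The space $D[0,1]$ with the Skorohod $M_2$ metric\<close>

text \<open>
  At an endpoint of an interval \<open>S\<close> one of the two filters is trivial, so there the corresponding
  one-sided condition is void.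
\<close>

definition cadlag_on :: "real set \<Rightarrow> (real \<Rightarrow> real) \<Rightarrow> bool" where
  "cadlag_on S f \<longleftrightarrow>
     (\<forall>t\<in>S. (f \<longlongrightarrow> f t) (at t within S \<inter> {t<..}) \<and>
            (\<exists>l. (f \<longlongrightarrow> l) (at t within S \<inter> {..<t})))"

typedef D01 = "{x. cadlag_on {0..1} x \<and> x \<in> extensional {0..1}}"
proof
  show "restrict (\<lambda>_. 0) {0..1} \<in> {x. cadlag_on {0..1} x \<and> x \<in> extensional {0..1}}"
    by (auto simp: cadlag_on_def intro!: exI[of _ 0] tendsto_eventually eventually_at_filter[THEN iffD2])
qed

text \<open>Meaningful only for \<open>f\<close> that are cadlag on \<open>[0,1]\<close>.\<close>

definition to_D01 :: "(real \<Rightarrow> real) \<Rightarrow> D01" where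
  "to_D01 f = Abs_D01 (restrict f {0..1})"

definition left_limit :: "(real \<Rightarrow> real) \<Rightarrow> real \<Rightarrow> real" where
  "left_limit x t = (if t = 0 then x 0 else Lim (at_left t) x)"

definition completed_graph :: "(real \<Rightarrow> real) \<Rightarrow> (real \<times> real) set" where
  "completed_graph x =
     {(t, z). t \<in> {0..1} \<and> (\<exists>w\<in>{0..1}. z = w * left_limit x t + (1 - w) * x t)}"

definition max_dist :: "real \<times> real \<Rightarrow> real \<times> real \<Rightarrow> real" where
  "max_dist a b = max \<bar>fst a - fst b\<bar> \<bar>snd a - snd b\<bar>"

definition dist_M2 :: "(real \<Rightarrow> real) \<Rightarrow> (real \<Rightarrow> real) \<Rightarrow> real" where
  "dist_M2 x y =
     max (SUP a\<in>completed_graph x. INF b\<in>completed_graph y. max_dist a b)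
         (SUP a\<in>completed_graph y. INF b\<in>completed_graph x. max_dist a b)"

lemma max_dist_nonneg: "0 \<le> max_dist a b"
  by (simp add: max_dist_def)

lemma max_dist_sym: "max_dist a b = max_dist b a"
  by (simp add: max_dist_def abs_minus_commute)

lemma max_dist_triangle: "max_dist a c \<le> max_dist a b + max_dist b c"
  by (auto simp: max_dist_def)

lemma cadlag_on_cong:
  assumes "cadlag_on S f" "\<And>t. t \<in> S \<Longrightarrow> f t = g t"
  shows "cadlag_on S g"
proof -
  have "(g \<longlongrightarrow> l) (at t within S \<inter> T)" if "(f \<longlongrightarrow> l) (at t within S \<inter> T)" for l t T
    by (rule Lim_transform_within[OF that, of 1]) (use assms(2) in auto)
  then show ?thesis
    using assms unfolding cadlag_on_def by metis
qed

lemma cadlag_on_at_right: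
  assumes "cadlag_on {0..1} x" "0 \<le> t" "t < 1"
  shows "(x \<longlongrightarrow> x t) (at_right t)"
proof -
  have "at t within {0..1} \<inter> {t<..} = at_right t"
    by (rule at_within_nhd[of _ "{..<1}"]) (use assms in auto)
  then show ?thesis using assms unfolding cadlag_on_def by force
qed

lemma cadlag_on_at_left:
  assumes "cadlag_on {0..1} x" "0 < t" "t \<le> 1"
  shows "(x \<longlongrightarrow> left_limit x t) (at_left t)"
proof -
  have "at t within {0..1} \<inter> {..<t} = at_left t"
    by (rule at_within_nhd[of _ "{0<..}"]) (use assms in auto)
  moreover have "t \<in> {0..1}" using assms by simp
  ultimately obtain l where "(x \<longlongrightarrow> l) (at_left t)"
    using assms(1) unfolding cadlag_on_def by metis
  moreover from this have "Lim (at_left t) x = l"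
    by (intro tendsto_Lim) auto
  ultimately show ?thesis using assms by (simp add: left_limit_def)
qed

lemma cadlag_on_bounded:
  assumes "cadlag_on {0..1} x"
  obtains K where "\<And>t. t \<in> {0..1} \<Longrightarrow> \<bar>x t\<bar> \<le> K"
proof -
  have loc: "\<exists>e>0. \<exists>K. \<forall>s\<in>{0..1}. \<bar>s - t\<bar> < e \<longrightarrow> \<bar>x s\<bar> \<le> K" if t: "t \<in> {0..1}" for t
  proof -
    obtain e1 K1 where 1: "e1 > 0" "\<And>s. s \<in> {0..1} \<Longrightarrow> t < s \<Longrightarrow> s < t + e1 \<Longrightarrow> \<bar>x s\<bar> \<le> K1"
    proof (cases "t < 1")
      case True
      have "\<forall>\<^sub>F s in at_right t. dist (x s) (x t) < 1"
        using cadlag_on_at_right[OF assms] True t tendstoD[of x "x t" "at_right t" 1] by simp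
      then obtain b where "b > t" "\<And>s. s > t \<Longrightarrow> s < b \<Longrightarrow> dist (x s) (x t) < 1"
        unfolding eventually_at_right_field by blast
      then show ?thesis
        by (intro that[of "b - t" "\<bar>x t\<bar> + 1"]) (force simp: dist_real_def)+
    next
      case False
      then show ?thesis using t by (intro that[of 1 0]) auto
    qed
    obtain e2 K2 where 2: "e2 > 0" "\<And>s. s \<in> {0..1} \<Longrightarrow> s < t \<Longrightarrow> s > t - e2 \<Longrightarrow> \<bar>x s\<bar> \<le> K2"
    proof (cases "0 < t")
      case True
      have "\<forall>\<^sub>F s in at_left t. dist (x s) (left_limit x t) < 1"
        using cadlag_on_at_left[OF assms] True t tendstoD[of x _ "at_left t" 1] by simp
      then obtain b where "b < t" "\<And>s. s > b \<Longrightarrow> s < t \<Longrightarrow> dist (x s) (left_limit x t) < 1"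
        unfolding eventually_at_left_field by blast
      then show ?thesis
        by (intro that[of "t - b" "\<bar>left_limit x t\<bar> + 1"]) (force simp: dist_real_def)+
    next
      case False
      then show ?thesis using t by (intro that[of 1 0]) auto
    qed
    show ?thesis
    proof (intro exI conjI ballI impI)
      show "0 < min e1 e2" using 1 2 by simp
      fix s assume s: "s \<in> {0..1}" "\<bar>s - t\<bar> < min e1 e2"
      consider "s = t" | "s < t" | "s > t" by linarith
      then show "\<bar>x s\<bar> \<le> max \<bar>x t\<bar> (max K1 K2)"
      proof cases
        case 1 then show ?thesis by simp
      next
        case 2 then show ?thesis using \<open>\<And>s. _ \<Longrightarrow> _ \<Longrightarrow> _ \<Longrightarrow> \<bar>x s\<bar> \<le> K2\<close>[of s] s by auto
      next
        case 3 then show ?thesis using \<open>\<And>s. _ \<Longrightarrow> _ \<Longrightarrow> _ \<Longrightarrow> \<bar>x s\<bar> \<le> K1\<close>[of s] s by auto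
      qed
    qed
  qed
  define P where "P p q \<longleftrightarrow> (\<exists>K. \<forall>s\<in>{0..1}. p \<le> s \<and> s \<le> q \<longrightarrow> \<bar>x s\<bar> \<le> K)" for p q
  have "P 0 1"
  proof (rule Bolzano)
    fix a b c assume "P a b" "P b c"
    then obtain K1 K2 where K: "\<forall>s\<in>{0..1}. a \<le> s \<and> s \<le> b \<longrightarrow> \<bar>x s\<bar> \<le> K1"
      "\<forall>s\<in>{0..1}. b \<le> s \<and> s \<le> c \<longrightarrow> \<bar>x s\<bar> \<le> K2" unfolding P_def by blast
    then have "\<bar>x s\<bar> \<le> max K1 K2" if "s \<in> {0..1}" "a \<le> s" "s \<le> c" for s
      using that by (cases "s \<le> b") (auto simp: le_max_iff_disj)
    then show "P a c" unfolding P_def by blast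
  next
    fix t :: real assume "0 \<le> t" "t \<le> 1"
    then obtain e K where e: "e > 0" and K: "\<forall>s\<in>{0..1}. \<bar>s - t\<bar> < e \<longrightarrow> \<bar>x s\<bar> \<le> K"
      using loc[of t] by auto
    have "P p q" if "p \<le> t" "t \<le> q" "q - p < e" for p q
      unfolding P_def using that K by (intro exI[of _ K]) auto
    with e show "\<exists>d>0. \<forall>a b. a \<le> t \<and> t \<le> b \<and> b - a < d \<longrightarrow> P a b" by blast
  qed simp
  then show ?thesis using that unfolding P_def by (metis atLeastAtMost_iff)
qed

lemma completed_graph_nonempty: "completed_graph x \<noteq> {}"
proof -
  have "(0, x 0) \<in> completed_graph x"
    by (auto simp: completed_graph_def left_limit_def intro!: bexI[of _ 0])
  then show ?thesis by blast
qed

lemma graph_in_completed_graph: "t \<in> {0..1} \<Longrightarrow> (t, x t) \<in> completed_graph x"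
  by (auto simp: completed_graph_def intro!: bexI[of _ 0])

lemma convex_comb_close:
  fixes l r c e :: real
  assumes "\<bar>l - c\<bar> \<le> e" "\<bar>r - c\<bar> \<le> e" "w \<in> {0..1}"
  shows "\<bar>w * l + (1 - w) * r - c\<bar> \<le> e"
proof -
  have "w * l + (1 - w) * r - c = w * (l - c) + (1 - w) * (r - c)" by (simp add: algebra_simps)
  also have "\<bar>\<dots>\<bar> \<le> w * \<bar>l - c\<bar> + (1 - w) * \<bar>r - c\<bar>"
    using assms(3) by (simp add: abs_triangle_ineq[THEN order_trans] abs_mult)
  also have "\<dots> \<le> w * e + (1 - w) * e"
    using assms by (intro add_mono mult_left_mono) auto
  finally show ?thesis by (simp add: algebra_simps)
qed

lemma completed_graph_close:
  assumes x: "cadlag_on {0..1} x" and z: "(u, z) \<in> completed_graph x"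
    and close: "\<And>s. s \<in> {0..1} \<Longrightarrow> p < s \<Longrightarrow> s < q \<Longrightarrow> \<bar>x s - c\<bar> \<le> e" and u: "p < u" "u < q"
  shows "\<bar>z - c\<bar> \<le> e"
proof -
  obtain w where w: "w \<in> {0..1}" "z = w * left_limit x u + (1 - w) * x u" and u01: "u \<in> {0..1}"
    using z by (auto simp: completed_graph_def)
  have "\<bar>left_limit x u - c\<bar> \<le> e"
  proof (cases "u = 0")
    case True
    then show ?thesis using close[of u] u01 u by (simp add: left_limit_def)
  next
    case False
    have "((\<lambda>s. \<bar>x s - c\<bar>) \<longlongrightarrow> \<bar>left_limit x u - c\<bar>) (at_left u)"
      by (intro tendsto_intros cadlag_on_at_left[OF x]) (use False u01 in auto)
    moreover have "\<forall>\<^sub>F s in at_left u. \<bar>x s - c\<bar> \<le> e"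
      using eventually_at_left_real[of "max 0 p" u] False u u01
      by (auto elim!: eventually_mono intro!: close)
    ultimately show ?thesis by (rule tendsto_upperbound) auto
  qed
  then show ?thesis using convex_comb_close[of "left_limit x u" c e "x u" w] close[of u] u u01 w by simp
qed

lemma completed_graph_bounded:
  assumes "cadlag_on {0..1} x" "cadlag_on {0..1} y"
  obtains K where "\<And>a b. a \<in> completed_graph x \<Longrightarrow> b \<in> completed_graph y \<Longrightarrow> max_dist a b \<le> K"
proof -
  obtain K1 K2 where K1: "\<And>t. t \<in> {0..1} \<Longrightarrow> \<bar>x t\<bar> \<le> K1" and K2: "\<And>t. t \<in> {0..1} \<Longrightarrow> \<bar>y t\<bar> \<le> K2"
    using cadlag_on_bounded assms by metis
  have 1: "u \<in> {0..1} \<and> \<bar>z\<bar> \<le> K1" if "(u, z) \<in> completed_graph x" for u z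
    using completed_graph_close[OF assms(1) that, of "- 1" 2 0 K1] K1 that by (auto simp: completed_graph_def)
  have 2: "u \<in> {0..1} \<and> \<bar>z\<bar> \<le> K2" if "(u, z) \<in> completed_graph y" for u z
    using completed_graph_close[OF assms(2) that, of "- 1" 2 0 K2] K2 that by (auto simp: completed_graph_def)
  show ?thesis
  proof (rule that[of "1 + K1 + K2"])
    fix a b assume "a \<in> completed_graph x" "b \<in> completed_graph y"
    then show "max_dist a b \<le> 1 + K1 + K2"
      using 1[of "fst a" "snd a"] 2[of "fst b" "snd b"] by (auto simp: max_dist_def)
  qed
qed

lemma excess_le:
  assumes "A \<noteq> {}" "\<And>a. a \<in> A \<Longrightarrow> \<exists>b\<in>B. max_dist a b \<le> r"
  shows "(SUP a\<in>A. INF b\<in>B. max_dist a b) \<le> r"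
proof (rule cSUP_least[OF assms(1)])
  fix a assume "a \<in> A"
  then obtain b where "b \<in> B" "max_dist a b \<le> r" using assms by blast
  then show "(INF b\<in>B. max_dist a b) \<le> r"
    by (intro cINF_lower2[where x = b]) (auto intro!: bdd_belowI[of _ 0] simp: max_dist_nonneg)
qed

lemma excess_less:
  assumes "(SUP a\<in>A. INF b\<in>B. max_dist a b) < r" "a \<in> A" "B \<noteq> {}"
    and K: "\<And>a b. a \<in> A \<Longrightarrow> b \<in> B \<Longrightarrow> max_dist a b \<le> K"
  shows "\<exists>b\<in>B. max_dist a b < r"
proof -
  have bb: "bdd_below (max_dist a ` B)" for a
    by (auto intro!: bdd_belowI[of _ 0] simp: max_dist_nonneg)
  have "(INF b\<in>B. max_dist a b) \<le> K" if "a \<in> A" for a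
  proof -
    obtain b where "b \<in> B" using assms by blast
    then show ?thesis using K[OF that] bb by (intro cINF_lower2[where x = b]) auto
  qed
  then have "bdd_above ((\<lambda>a. INF b\<in>B. max_dist a b) ` A)" by (auto intro!: bdd_aboveI[of _ K])
  then have "(INF b\<in>B. max_dist a b) < r"
    using assms cSUP_upper[of a A "\<lambda>a. INF b\<in>B. max_dist a b"] by (meson le_less_trans)
  then show ?thesis using cINF_less_iff[OF assms(3) bb] by blast
qed

lemma dist_M2_sym: "dist_M2 x y = dist_M2 y x"
  by (simp add: dist_M2_def max.commute)

lemma dist_M2_le:
  assumes "\<And>a. a \<in> completed_graph x \<Longrightarrow> \<exists>b\<in>completed_graph y. max_dist a b \<le> r"
    and "\<And>a. a \<in> completed_graph y \<Longrightarrow> \<exists>b\<in>completed_graph x. max_dist a b \<le> r"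
  shows "dist_M2 x y \<le> r"
  unfolding dist_M2_def using assms
  by (simp add: excess_le[OF completed_graph_nonempty])

lemma dist_M2_less:
  assumes "cadlag_on {0..1} x" "cadlag_on {0..1} y" "dist_M2 x y < r" "a \<in> completed_graph x"
  shows "\<exists>b\<in>completed_graph y. max_dist a b < r"
proof -
  obtain K where "\<And>a b. a \<in> completed_graph x \<Longrightarrow> b \<in> completed_graph y \<Longrightarrow> max_dist a b \<le> K"
    using completed_graph_bounded assms by metis
  then show ?thesis
    using assms by (intro excess_less[OF _ _ completed_graph_nonempty]) (auto simp: dist_M2_def)
qed

lemma dist_M2_triangle:
  assumes "cadlag_on {0..1} x" "cadlag_on {0..1} y" "cadlag_on {0..1} z"
  shows "dist_M2 x z \<le> dist_M2 x y + dist_M2 y z"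
proof (rule field_le_epsilon)
  fix e :: real assume e: "0 < e"
  have *: "\<exists>b\<in>completed_graph z. max_dist a b \<le> dist_M2 x y + dist_M2 y z + e"
    if c: "cadlag_on {0..1} x" "cadlag_on {0..1} y" "cadlag_on {0..1} z" and a: "a \<in> completed_graph x"
    for a x y z
  proof -
    obtain b where b: "b \<in> completed_graph y" "max_dist a b < dist_M2 x y + e / 2"
      using dist_M2_less[OF c(1,2) _ a, of "dist_M2 x y + e / 2"] e by auto
    obtain d where d: "d \<in> completed_graph z" "max_dist b d < dist_M2 y z + e / 2"
      using dist_M2_less[OF c(2,3) _ b(1), of "dist_M2 y z + e / 2"] e by auto
    show ?thesis using max_dist_triangle[of a d b] b d by (intro bexI[of _ d]) auto
  qed
  show "dist_M2 x z \<le> dist_M2 x y + dist_M2 y z + e"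
    by (rule dist_M2_le)
       (use *[OF assms] *[OF assms(3,2,1)] in \<open>auto simp: dist_M2_sym[of z] dist_M2_sym[of y x] add_ac\<close>)
qed

lemma dist_M2_zero_eq_interior:
  assumes x: "cadlag_on {0..1} x" and y: "cadlag_on {0..1} y" and 0: "dist_M2 x y = 0"
    and t: "0 \<le> t" "t < 1"
  shows "x t = y t"
proof (rule ccontr)
  assume "x t \<noteq> y t"
  define e where "e = \<bar>x t - y t\<bar> / 4"
  have e: "e > 0" using \<open>x t \<noteq> y t\<close> by (simp add: e_def)
  have "\<forall>\<^sub>F s in at_right t. dist (x s) (x t) < e \<and> dist (y s) (y t) < e \<and> s < 1"
    using tendstoD[OF cadlag_on_at_right[OF x t] e] tendstoD[OF cadlag_on_at_right[OF y t] e]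
      eventually_at_right_real[OF t(2)]
    by eventually_elim simp
  then obtain b where b: "b > t"
    "\<And>s. s > t \<Longrightarrow> s < b \<Longrightarrow> dist (x s) (x t) < e \<and> dist (y s) (y t) < e \<and> s < 1"
    unfolding eventually_at_right_field by blast
  define s where "s = (t + b) / 2"
  have s: "t < s" "s < b" using b by (auto simp: s_def)
  have s01: "s \<in> {0..1}" using s b(2)[of s] t by auto
  obtain u z where uz: "(u, z) \<in> completed_graph y" "max_dist (s, x s) (u, z) < min e (b - s)"
    using dist_M2_less[OF x y _ graph_in_completed_graph[OF s01], of "min e (b - s)"] 0 e s by auto
  then have u: "\<bar>s - u\<bar> < b - s" and z: "\<bar>x s - z\<bar> < e" by (auto simp: max_dist_def)
  have "\<bar>z - y t\<bar> \<le> e"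
  proof (rule completed_graph_close[OF y uz(1)])
    show "\<bar>y s - y t\<bar> \<le> e" if "t < s" "s < b" for s
      using b(2)[OF that] by (simp add: dist_real_def)
    show "t < u" "u < b" using u by (auto simp: s_def abs_less_iff field_simps)
  qed
  moreover have "\<bar>x s - x t\<bar> < e" using b(2)[OF s] by (simp add: dist_real_def)
  moreover have "\<bar>x t - y t\<bar> = 4 * e" by (simp add: e_def)
  ultimately show False using z e by linarith
qed

lemma dist_M2_zero_endpoint:
  assumes x: "cadlag_on {0..1} x" and y: "cadlag_on {0..1} y" and 0: "dist_M2 x y = 0"
  shows "x 1 \<in> closed_segment (left_limit y 1) (y 1)"
proof (rule ccontr)
  let ?S = "closed_segment (left_limit y 1) (y 1)"
  assume "x 1 \<notin> ?S"
  then have "infdist (x 1) ?S \<noteq> 0" using in_closed_iff_infdist_zero[of ?S "x 1"] by simp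
  then have pos: "infdist (x 1) ?S > 0" using infdist_nonneg[of "x 1" ?S] by linarith
  define e where "e = infdist (x 1) ?S / 2"
  have e: "e > 0" using pos by (simp add: e_def)
  have far: "\<bar>x 1 - z\<bar> \<ge> 2 * e" if "z \<in> ?S" for z
    using infdist_le[OF that, of "x 1"] by (simp add: e_def dist_real_def)
  have "\<forall>\<^sub>F s in at_left 1. dist (y s) (left_limit y 1) < e"
    using tendstoD[OF cadlag_on_at_left[OF y, of 1] e] by simp
  then obtain b where b: "b < 1" "\<And>s. s > b \<Longrightarrow> s < 1 \<Longrightarrow> dist (y s) (left_limit y 1) < e"
    unfolding eventually_at_left_field by blast
  obtain u z where uz: "(u, z) \<in> completed_graph y" "max_dist (1, x 1) (u, z) < min e (1 - b)"
    using dist_M2_less[OF x y _ graph_in_completed_graph[of 1], of "min e (1 - b)"] 0 e b by auto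
  then have u: "\<bar>1 - u\<bar> < 1 - b" and z: "\<bar>x 1 - z\<bar> < e" and u1: "u \<le> 1"
    by (auto simp: max_dist_def completed_graph_def)
  show False
  proof (cases "u = 1")
    case True
    then obtain w where "w \<in> {0..1}" "z = w * left_limit y 1 + (1 - w) * y 1"
      using uz(1) by (auto simp: completed_graph_def)
    then have "z \<in> ?S"
      by (auto simp: in_segment intro!: exI[of _ "1 - w"])
    then show ?thesis using far[of z] z e by linarith
  next
    case False
    have "\<bar>z - left_limit y 1\<bar> \<le> e"
      by (rule completed_graph_close[OF y uz(1), of b 1])
         (use b u u1 False in \<open>auto simp: dist_real_def less_imp_le\<close>)
    then show ?thesis using far[of "left_limit y 1"] z by auto
  qed
qed

lemma dist_M2_zero_iff:
  assumes x: "cadlag_on {0..1} x" and y: "cadlag_on {0..1} y"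
  shows "dist_M2 x y = 0 \<longleftrightarrow> (\<forall>t\<in>{0..1}. x t = y t)"
proof
  assume 0: "dist_M2 x y = 0"
  have int: "x t = y t" if "0 \<le> t" "t < 1" for t
    using dist_M2_zero_eq_interior[OF x y 0 that] .
  have "\<forall>\<^sub>F s in at_left 1. x s = y s"
    using eventually_at_left_real[of 0 "1::real"] int by (auto elim!: eventually_mono)
  then have "(y \<longlongrightarrow> left_limit x 1) (at_left 1)"
    using tendsto_cong[of x y] cadlag_on_at_left[OF x, of 1] by auto
  then have ll: "left_limit x 1 = left_limit y 1"
    using cadlag_on_at_left[OF y, of 1] tendsto_unique[of "at_left (1::real)"] by auto
  have "x 1 \<in> closed_segment (left_limit y 1) (y 1)" "y 1 \<in> closed_segment (left_limit y 1) (x 1)"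
    using dist_M2_zero_endpoint[OF x y 0] dist_M2_zero_endpoint[OF y x] 0 ll dist_M2_sym by auto
  then have "x 1 = y 1"
    by (auto simp: closed_segment_eq_real_ivl split: if_splits)
  then show "\<forall>t\<in>{0..1}. x t = y t" using int by (metis atLeastAtMost_iff less_eq_real_def)
next
  assume eq: "\<forall>t\<in>{0..1}. x t = y t"
  have ll: "left_limit x t = left_limit y t" if t: "0 \<le> t" "t \<le> 1" for t
  proof (cases "t = 0")
    case False
    have "\<forall>\<^sub>F s in at_left t. x s = y s"
      using eventually_at_left_real[of 0 t] eq t False by (auto elim!: eventually_mono)
    then have "(y \<longlongrightarrow> left_limit x t) (at_left t)"
      using tendsto_cong[of x y] cadlag_on_at_left[OF x, of t] False t by auto
    then show ?thesis
      using cadlag_on_at_left[OF y, of t] tendsto_unique[of "at_left t"] False t by auto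
  qed (use eq in \<open>auto simp: left_limit_def\<close>)
  have "completed_graph x = completed_graph y"
    using eq ll by (auto simp: completed_graph_def)
  then have "dist_M2 x y \<le> 0"
    by (intro dist_M2_le) (auto intro!: bexI simp: max_dist_def)
  moreover have "dist_M2 x y \<ge> 0"
  proof (rule ccontr)
    assume "\<not> 0 \<le> dist_M2 x y"
    then show False
      using dist_M2_less[OF x y, of 0 "(0, x 0)"] graph_in_completed_graph[of 0 x] max_dist_nonneg
      by (auto simp: not_le) (meson not_le)
  qed
  ultimately show "dist_M2 x y = 0" by simp
qed

text \<open>The topology of \<open>D01\<close>, and with it its Borel sigma-algebra, is the \<open>M\<^sub>2\<close> topology.\<close>

instantiation D01 :: metric_space
begin

definition dist_D01 :: "D01 \<Rightarrow> D01 \<Rightarrow> real" where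
  "dist_D01 x y = dist_M2 (Rep_D01 x) (Rep_D01 y)"

definition uniformity_D01 :: "(D01 \<times> D01) filter" where
  "uniformity_D01 = (INF e\<in>{0<..}. principal {(x, y). dist x y < e})"

definition open_D01 :: "D01 set \<Rightarrow> bool" where
  "open_D01 U \<longleftrightarrow> (\<forall>x\<in>U. \<forall>\<^sub>F (x', y) in uniformity. x' = x \<longrightarrow> y \<in> U)"

instance
proof
  fix x y z :: D01
  have c: "cadlag_on {0..1} (Rep_D01 w)" "Rep_D01 w \<in> extensional {0..1}" for w
    using Rep_D01[of w] by auto
  have "(\<forall>t\<in>{0..1}. Rep_D01 x t = Rep_D01 y t) \<longleftrightarrow> Rep_D01 x = Rep_D01 y"
    using extensionalityI[OF c(2) c(2), of x y] by metis
  then show "dist x y = 0 \<longleftrightarrow> x = y"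
    by (simp only: dist_D01_def dist_M2_zero_iff[OF c(1) c(1)] Rep_D01_inject)
  show "dist x y \<le> dist x z + dist y z"
    using dist_M2_triangle[of "Rep_D01 x" "Rep_D01 z" "Rep_D01 y", OF c(1) c(1) c(1)]
    by (simp add: dist_D01_def dist_M2_sym[of "Rep_D01 y" "Rep_D01 z"])
qed (rule uniformity_D01_def open_D01_def)+

end

lemma Rep_to_D01:
  assumes "cadlag_on {0..1} f"
  shows "Rep_D01 (to_D01 f) = restrict f {0..1}"
  unfolding to_D01_def
  by (rule Abs_D01_inverse) (auto intro: cadlag_on_cong[OF assms])


section \<open>Convergence in distribution and L\'evy processes\<close>

text \<open>
  The random elements may live on different probability spaces. Measurability with respect to
  the Borel sigma-algebra of the target is part of the notion.
\<close>

definition converges_in_distribution ::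
  "'a measure \<Rightarrow> (nat \<Rightarrow> 'a \<Rightarrow> 's::topological_space) \<Rightarrow> 'b measure \<Rightarrow> ('b \<Rightarrow> 's) \<Rightarrow> bool" where
  "converges_in_distribution M X N Y \<longleftrightarrow>
     (\<forall>n. X n \<in> M \<rightarrow>\<^sub>M borel) \<and> Y \<in> N \<rightarrow>\<^sub>M borel \<and>
     (\<forall>f :: 's \<Rightarrow> real. continuous_on UNIV f \<and> bounded (range f) \<longrightarrow>
        (\<lambda>n. \<integral>x. f x \<partial>distr M borel (X n)) \<longlonglongrightarrow> (\<integral>y. f y \<partial>distr N borel Y))"

text \<open>The time set is \<open>[0,\<infinity>)\<close>; values at negative times are irrelevant.\<close>

definition levy_process :: "'b measure \<Rightarrow> (real \<Rightarrow> 'b \<Rightarrow> real) \<Rightarrow> bool" where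
  "levy_process N V \<longleftrightarrow>
     prob_space N \<and>
     (\<forall>t\<ge>0. V t \<in> borel_measurable N) \<and>
     (\<forall>\<omega>\<in>space N. V 0 \<omega> = 0) \<and>
     (\<forall>\<omega>\<in>space N. cadlag_on {0..} (\<lambda>t. V t \<omega>)) \<and>
     (\<forall>(k::nat) t. 0 \<le> t 0 \<and> (\<forall>i<k. t i \<le> t (Suc i)) \<longrightarrow>
        prob_space.indep_vars N (\<lambda>_. borel) (\<lambda>i \<omega>. V (t (Suc i)) \<omega> - V (t i) \<omega>) {..<k}) \<and>
     (\<forall>s\<ge>0. \<forall>t\<ge>s. distr N borel (\<lambda>\<omega>. V t \<omega> - V s \<omega>) = distr N borel (V (t - s)))"

definition stable_levy_process :: "real \<Rightarrow> 'b measure \<Rightarrow> (real \<Rightarrow> 'b \<Rightarrow> real) \<Rightarrow> bool" where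
  "stable_levy_process \<alpha> N V \<longleftrightarrow>
     levy_process N V \<and> nondegenerate_stable \<alpha> (distr N borel (V 1))"

lemma cadlag_on_scaled_levy_path:
  assumes "levy_process N V" "\<omega> \<in> space N"
  shows "cadlag_on {0..1} (\<lambda>t. c * V t \<omega>)"
  unfolding cadlag_on_def
proof (intro ballI)
  fix t :: real assume t: "t \<in> {0..1}"
  have "cadlag_on {0..} (\<lambda>t. V t \<omega>)" using assms by (simp add: levy_process_def)
  with t obtain l where *: "((\<lambda>t. V t \<omega>) \<longlongrightarrow> V t \<omega>) (at t within {0..} \<inter> {t<..})"
      "((\<lambda>t. V t \<omega>) \<longlongrightarrow> l) (at t within {0..} \<inter> {..<t})"
    unfolding cadlag_on_def by (metis atLeastAtMost_iff atLeast_iff)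
  show "((\<lambda>t. c * V t \<omega>) \<longlongrightarrow> c * V t \<omega>) (at t within {0..1} \<inter> {t<..}) \<and>
        (\<exists>l. ((\<lambda>t. c * V t \<omega>) \<longlongrightarrow> l) (at t within {0..1} \<inter> {..<t}))"
    by (intro conjI exI[of _ "c * l"] tendsto_mult tendsto_const tendsto_within_subset[OF *(1)]
          tendsto_within_subset[OF *(2)]) auto
qed


section \<open>Linear processes and their normalized partial sums\<close>

definition linear_process :: "(nat \<Rightarrow> real) \<Rightarrow> (int \<Rightarrow> 'a \<Rightarrow> real) \<Rightarrow> int \<Rightarrow> 'a \<Rightarrow> real" where
  "linear_process \<phi> Z t \<omega> = (\<Sum>i. \<phi> i * Z (t - int i) \<omega>)"

definition partial_sum_process ::
  "(nat \<Rightarrow> real) \<Rightarrow> (nat \<Rightarrow> real) \<Rightarrow> (int \<Rightarrow> 'a \<Rightarrow> real) \<Rightarrow> nat \<Rightarrow> 'a \<Rightarrow> real \<Rightarrow> real" where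
  "partial_sum_process a b X n \<omega> t =
     1 / a n * ((\<Sum>i = 1..\<lfloor>real n * t\<rfloor>. X i \<omega>) - of_int \<lfloor>real n * t\<rfloor> * b n)"

lemma cadlag_on_floor: "cadlag_on S (\<lambda>t. g \<lfloor>real n * t\<rfloor>)"
proof (cases "n = 0")
  case True
  then show ?thesis by (auto simp: cadlag_on_def intro!: exI[of _ "g 0"])
next
  case False
  then have n: "real n > 0" by simp
  have R: "\<forall>\<^sub>F s in at_right t. \<lfloor>real n * s\<rfloor> = \<lfloor>real n * t\<rfloor>" for t
  proof -
    have "t * real n < of_int \<lfloor>real n * t\<rfloor> + 1" by (simp add: mult.commute)
    then have "t < (of_int \<lfloor>real n * t\<rfloor> + 1) / real n" using n by (simp only: pos_less_divide_eq)
    then show ?thesis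
    proof (rule eventually_at_rightI[rotated])
      fix s assume s: "s \<in> {t<..<(of_int \<lfloor>real n * t\<rfloor> + 1) / real n}"
      then have "real n * t \<le> real n * s" "s * real n < of_int \<lfloor>real n * t\<rfloor> + 1"
        using n by (simp_all only: greaterThanLessThan_iff pos_less_divide_eq mult_le_cancel_left_pos) auto
      then show "\<lfloor>real n * s\<rfloor> = \<lfloor>real n * t\<rfloor>"
        by (simp only: mult.commute[of s]) linarith
    qed
  qed
  have L: "\<forall>\<^sub>F s in at_left t. \<lfloor>real n * s\<rfloor> = \<lceil>real n * t\<rceil> - 1" for t
  proof -
    have "of_int \<lceil>real n * t\<rceil> - 1 < t * real n" by (simp add: mult.commute) linarith
    then have "(of_int \<lceil>real n * t\<rceil> - 1) / real n < t" using n by (simp only: pos_divide_less_eq)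
    then show ?thesis
    proof (rule eventually_at_leftI[rotated])
      fix s assume s: "s \<in> {(of_int \<lceil>real n * t\<rceil> - 1) / real n<..<t}"
      then have "real n * s < real n * t" "of_int \<lceil>real n * t\<rceil> - 1 < s * real n"
        using n by (simp_all only: greaterThanLessThan_iff pos_divide_less_eq mult_less_cancel_left_pos)
      then show "\<lfloor>real n * s\<rfloor> = \<lceil>real n * t\<rceil> - 1"
        by (simp only: mult.commute[of s]) linarith
    qed
  qed
  show ?thesis
    unfolding cadlag_on_def
  proof (intro ballI conjI exI)
    fix t
    show "((\<lambda>t. g \<lfloor>real n * t\<rfloor>) \<longlongrightarrow> g \<lfloor>real n * t\<rfloor>) (at t within S \<inter> {t<..})"
      by (rule tendsto_within_subset[of _ _ _ "{t<..}"])
         (use R[of t] in \<open>auto intro!: tendsto_eventually elim!: eventually_mono\<close>)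
    show "((\<lambda>t. g \<lfloor>real n * t\<rfloor>) \<longlongrightarrow> g (\<lceil>real n * t\<rceil> - 1)) (at t within S \<inter> {..<t})"
      by (rule tendsto_within_subset[of _ _ _ "{..<t}"])
         (use L[of t] in \<open>auto intro!: tendsto_eventually elim!: eventually_mono\<close>)
  qed
qed

lemma cadlag_on_partial_sum_process: "cadlag_on S (partial_sum_process a b X n \<omega>)"
  unfolding partial_sum_process_def
  using cadlag_on_floor[where g = "\<lambda>k. 1 / a n * ((\<Sum>i = 1..k. X i \<omega>) - of_int k * b n)"] .

end

theory Submission
  imports Defs "HOL-Probability.Probability"
begin

text \<open>
  Let \<open>T\<close> be the two-sided random walk whose steps are the centred \<open>Z\<^sub>i\<close>. Then
  \<open>a\<^sub>n V\<^sub>n(k/n) = \<Sum>\<^sub>j \<phi>\<^sub>j (T\<^sub>k\<^sub>-\<^sub>j - T\<^sub>-\<^sub>j)\<close>: a large step \<open>Z\<^sub>i\<close> of \<open>T\<close> reaches the process \<open>V\<^sub>n\<close>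
  spread over time, in the portions \<open>\<phi>\<^sub>0 Z\<^sub>i\<close>, \<open>\<phi>\<^sub>1 Z\<^sub>i\<close>, \<open>...\<close>, and in total as \<open>\<Phi> Z\<^sub>i\<close>. Because the partial sums of
  \<open>\<phi>\<close> lie between \<open>0\<close> and \<open>\<Phi>\<close>, while the step is being absorbed the process stays between its values
  before and after it. It may oscillate there, but the completed graph of a path with one jump
  contains the whole vertical segment, so \<open>M\<^sub>2\<close> does not see the oscillation, and \<open>V\<^sub>n\<close> is close to
  \<open>\<Phi> T / a\<^sub>n\<close>.

  To make this quantitative, \<open>[0,1]\<close> is cut into \<open>m\<close> blocks and \<open>V\<^sub>n\<close> is compared with the step function
  through the values of \<open>\<Phi> T / a\<^sub>n\<close> at the ends of the blocks (\<open>step_approximation\<close>). The coefficients of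
  index at least \<open>q\<close> contribute little, uniformly in time: the maximum of \<open>\<bar>T\<bar> / a\<^sub>n\<close> over windows of
  length \<open>n\<close> has bounded moments of order \<open>\<delta>\<close>, and \<open>\<Sum>\<^sub>j \<bar>\<phi>\<^sub>j\<bar>\<^sup>\<delta>\<close> converges (\<open>tail_event\<close>). Within one block
  the walk has at most one large jump, except with a probability quadratic in the probability of a large
  maximum, so that even after summation over the blocks the exceptional probability is of order \<open>1/m\<close> (\<open>single_jump_probability\<close>). On the remaining event the process is trapped
  between the values of \<open>\<Phi> T / a\<^sub>n\<close> at the two ends of each block (\<open>block_bound\<close>), and this is exactly
  what \<open>dist_M2_step_path_le\<close> turns into closeness in \<open>M\<^sub>2\<close>.

  For fixed \<open>m\<close> the increments of \<open>T / a\<^sub>n\<close> over the blocks are independent, and their characteristic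
  functions converge to \<open>exp (\<psi>(\<theta>) / m)\<close>. Here \<open>\<psi>\<close> is the integral of the compensated exponential against
  the limit of \<open>n P(Z / a\<^sub>n \<in> \<cdot>)\<close>, a measure that is represented as the image of Lebesgue measure under
  an explicit function \<open>jump\<close> (\<open>vague_convergence\<close>, \<open>char_increment_limit\<close>).

  A process with independent increments and exponent \<open>\<psi>\<close> is built from Poisson points in the cells
  \<open>[k, k+1] \<times> shell i\<close>, with dyadic shells of \<open>y\<close>-values; Kolmogorov's inequality and Borel--Cantelli make the sum
  over the shells converge uniformly (\<open>W_uniformly_summable\<close>), so its paths are cadlag. Independence and
  stationarity of the increments are read off their joint characteristic functions, and stability
  from \<open>\<psi>(A \<theta>) = A\<^sup>\<alpha> \<psi>(\<theta>)\<close>.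

  Finally, sampling a cadlag path at the points \<open>k/m\<close> gives step functions that converge to it in \<open>M\<^sub>2\<close>
  as \<open>m\<close> grows (\<open>step_path_sample_tendsto\<close>), and since bounded Lipschitz functionals determine weak
  convergence, letting first \<open>n\<close> and then \<open>m\<close> tend to infinity proves the theorem.
\<close>

section \<open>Geometry of the M2 metric\<close>

text \<open>A cadlag path cannot get from \<open>x s\<close> to \<open>x t\<close> without its completed graph meeting every level
  in between: at the supremum of the times at which the path is below the level, either the path
  or its jump segment meets it. The case of a downward passage follows by reflection.\<close>

lemma completed_graph_ivt:
 assumes x: "cadlag_on {0..1} x" and st: "0 <= s" "s <= t" "t <= 1"
  and z: "z \<in> closed_segment (x s) (x t)"
 shows "\<exists>u\<in>{s..t}. (u, z) \<in> completed_graph x"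
proof -
 have main: "\<exists>u\<in>{s..t}. (u, z) \<in> completed_graph (\<lambda>t. c * x t) "
  if c: "c = 1 \<or> c = -1" and z: "c * x s <= z" "z <= c * x t" for c z
 proof -
  let ?y = "\<lambda>t. c * x t"
  have y: "cadlag_on {0..1} ?y"
   using x unfolding cadlag_on_def by (blast intro: tendsto_mult_left)
  define A where "A = {v\<in>{s..t}. ?y v <= z}"
  define u where "u = Sup A"
  have sA: "s \<in> A" using z st by (auto simp: A_def)
  have bdd: "bdd_above A" by (auto simp: A_def intro: bdd_aboveI[of _ t])
  have su: "s <= u" unfolding u_def using sA bdd by (rule cSup_upper)
  have ut: "u <= t" unfolding u_def by (rule cSup_least) (use sA in \<open>auto simp: A_def\<close>)
  have out: "?y v > z" if "u < v" "v <= t" for v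
   using cSup_upper[of v A, OF _ bdd] that su by (force simp: A_def u_def)
  have u01: "u \<in> {0..1}" using su ut st by auto
  show ?thesis
  proof (cases "?y u <= z")
   case True
   have "?y u = z"
   proof (cases "u = t")
    case False
    then have ut': "u < t" using ut by simp
    have "(?y \<longlongrightarrow> ?y u) (at_right u)"
     by (rule cadlag_on_at_right[OF y]) (use ut' st su in auto)
    moreover have "\<forall>\<^sub>F v in at_right u. z <= ?y v"
     using eventually_at_right_real[OF ut'] by eventually_elim (use out in \<open>auto intro: less_imp_le\<close>)
    ultimately have "z <= ?y u" by (intro tendsto_lowerbound) auto
    with True show ?thesis by simp
   qed (use True z in auto)
   then show ?thesis
    using graph_in_completed_graph[OF u01, of ?y] su ut by auto
  next
   case False
   then have "u \<noteq> s" using z by auto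
   then have su': "s < u" using su by simp
   have u0: "0 < u" using su' st by auto
   have l: "(?y \<longlongrightarrow> left_limit ?y u) (at_left u)"
    by (rule cadlag_on_at_left[OF y]) (use u01 u0 in auto)
   have "left_limit ?y u <= z"
   proof (rule ccontr)
    assume "\<not> left_limit ?y u <= z"
    then have "\<forall>\<^sub>F v in at_left u. z < ?y v"
     by (intro order_tendstoD(1)[OF l]) auto
    then obtain b where b: "b < u" "\<And>v. b < v ==> v < u ==> z < ?y v"
     unfolding eventually_at_left_field by blast
    obtain v where v: "v \<in> A" "max b s < v"
     using b(1) su' less_cSup_iff[of A "max b s"] sA bdd unfolding u_def by (metis empty_iff max_less_iff_conj)
    have "v <= u" unfolding u_def using v bdd by (intro cSup_upper)
    moreover have "v \<noteq> u" using v False by (auto simp: A_def)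
    ultimately show False using b(2)[of v] v by (auto simp: A_def)
   qed
   then have "z \<in> closed_segment (?y u) (left_limit ?y u)"
    using False by (auto simp: closed_segment_eq_real_ivl)
   then obtain w where "0 <= w" "w <= 1" "z = (1 - w) * ?y u + w * left_limit ?y u"
    by (auto simp: in_segment)
   then have "(u, z) \<in> completed_graph ?y"
    using u01 by (auto simp: completed_graph_def intro!: bexI[of _ w])
   then show ?thesis using su ut by auto
  qed
 qed
 show ?thesis
 proof (cases "x s <= x t")
  case True
  then show ?thesis using main[of 1 z] z by (auto simp: closed_segment_eq_real_ivl)
 next
  case False
  then obtain u where u: "u \<in> {s..t}" "(u, -z) \<in> completed_graph (\<lambda>t. - x t)"
   using main[of "-1" "-z"] z by (auto simp: closed_segment_eq_real_ivl)
  then have u01: "u \<in> {0..1}" using st by auto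
  have "left_limit (\<lambda>t. - x t) u = - left_limit x u"
  proof (cases "u = 0")
   case False
   have "((\<lambda>t. - x t) \<longlongrightarrow> - left_limit x u) (at_left u)"
    by (intro tendsto_intros cadlag_on_at_left[OF x]) (use False u01 in auto)
   then show ?thesis using False by (auto simp: left_limit_def intro!: tendsto_Lim)
  qed (auto simp: left_limit_def)
  then obtain w where "w \<in> {0..1}" "- z = w * - left_limit x u + (1 - w) * - x u"
   using u(2) unfolding completed_graph_def by auto
  then have "z = w * left_limit x u + (1 - w) * x u" by linarith
  then have "(u, z) \<in> completed_graph x"
   using u01 \<open>w \<in> {0..1}\<close> unfolding completed_graph_def by blast
  then show ?thesis using u by blast
 qed
qed

definition step_path :: "nat => (nat => real) => real => real" where
 "step_path m y t = y (nat \<lfloor>real m * t\<rfloor>)"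

lemma cadlag_step_path: "cadlag_on S (step_path m y)"
 unfolding step_path_def using cadlag_on_floor[of S "\<lambda>k. y (nat k)" m] by simp

lemma step_path_eq:
 assumes "m > 0" "real k / real m <= t" "t < real (Suc k) / real m"
 shows "step_path m y t = y k"
proof -
 have "real k <= t * real m" "t * real m < real (Suc k)"
  using assms by (simp_all only: pos_divide_le_eq pos_less_divide_eq of_nat_0_less_iff)
 then have "\<lfloor>real m * t\<rfloor> = int k"
  by (simp add: floor_eq_iff mult.commute)
 then show ?thesis by (simp add: step_path_def)
qed

lemma step_path_node: "m > 0 ==> step_path m y (real k / real m) = y k"
 by (rule step_path_eq) (auto simp: divide_simps)

lemma left_limit_step_path:
 assumes "m > 0" "real k / real m < t" "t <= real (Suc k) / real m"
 shows "left_limit (step_path m y) t = y k"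
proof -
 have "0 <= real k / real m" by simp
 then have "t > 0" using assms by linarith
 have "\<forall>\<^sub>F s in at_left t. step_path m y s = y k"
  using eventually_at_left_real[OF assms(2)]
  by eventually_elim (rule step_path_eq, use assms in auto)
 then have "((step_path m y) \<longlongrightarrow> y k) (at_left t)"
  by (rule tendsto_eventually)
 then show ?thesis using \<open>t > 0\<close> by (auto simp: left_limit_def intro!: tendsto_Lim)
qed

lemma unit_interval_block:
 assumes m: "m > 0" and u: "u \<in> {0..1}"
 obtains "u = 0" | k where "k < m" "real k / real m < u" "u <= real (Suc k) / real m"
proof (cases "u = 0")
 case False
 then have u0: "0 < u" "u <= 1" using u by auto
 define k where "k = nat (\<lceil>u * real m\<rceil> - 1)"
 have "0 < u * real m" using u0 m by simp
 then have c: "\<lceil>u * real m\<rceil> \<ge> 1" by linarith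
 have "u * real m <= real m" using u0 m by simp
 then have "\<lceil>u * real m\<rceil> <= int m" by (simp add: ceiling_le_iff)
 then have km: "k < m" using c unfolding k_def by linarith
 have rk: "real k = of_int \<lceil>u * real m\<rceil> - 1" using c by (simp add: k_def)
 have "real k < u * real m" "u * real m <= real (Suc k)" using rk by linarith+
 then have "real k / real m < u" "u <= real (Suc k) / real m"
  using m by (simp_all only: pos_divide_less_eq pos_le_divide_eq of_nat_0_less_iff)
 then show ?thesis using km that(2) by blast
qed (use that in auto)

lemma completed_graph_step_pathD:
 assumes m: "m > 0" and uz: "(u, z) \<in> completed_graph (step_path m y)"
 shows "\<exists>k<m. u \<in> {real k / real m..real (Suc k) / real m} \<and> z \<in> closed_segment (y k) (y (Suc k))"
proof -
 obtain w where w: "w \<in> {0..1}" "z = w * left_limit (step_path m y) u + (1 - w) * step_path m y u"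
  and u: "u \<in> {0..1}" using uz by (auto simp: completed_graph_def)
 show ?thesis
 proof (rule unit_interval_block[OF m u])
  assume "u = 0"
  then have "step_path m y u = y 0" "left_limit (step_path m y) u = y 0"
   by (simp_all add: step_path_def left_limit_def)
  then have "z = y 0" using w by (simp add: algebra_simps)
  then show ?thesis using m \<open>u = 0\<close> by (intro exI[of _ 0]) auto
 next
  fix k assume k: "k < m" "real k / real m < u" "u <= real (Suc k) / real m"
  have L: "left_limit (step_path m y) u = y k" using left_limit_step_path[OF m k(2,3)] .
  have "z \<in> closed_segment (y k) (y (Suc k))"
  proof (cases "u = real (Suc k) / real m")
   case True
   then have "step_path m y u = y (Suc k)" using step_path_node[OF m, of y "Suc k"] by simp
   then show ?thesis using w L by (auto simp: in_segment intro!: exI[of _ "1 - w"])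
  next
   case False
   then have "step_path m y u = y k" by (intro step_path_eq[OF m]) (use k in auto)
   then have "z = y k" using w L by (simp add: algebra_simps)
   then show ?thesis by simp
  qed
  then show ?thesis using k by auto
 qed
qed

lemma completed_graph_step_pathI:
 assumes m: "m > 0" and k: "k < m" and z: "z \<in> closed_segment (y k) (y (Suc k))"
 shows "(real (Suc k) / real m, z) \<in> completed_graph (step_path m y)"
proof -
 have "left_limit (step_path m y) (real (Suc k) / real m) = y k"
  by (rule left_limit_step_path[OF m]) (use m in \<open>auto simp: divide_simps\<close>)
 moreover have "step_path m y (real (Suc k) / real m) = y (Suc k)"
  by (rule step_path_node[OF m])
 moreover obtain v where "0 <= v" "v <= 1" "z = (1 - v) * y k + v * y (Suc k)"
  using z by (auto simp: in_segment)
 moreover have "real (Suc k) / real m \<in> {0..1}" using k m by (auto simp: divide_simps)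
 ultimately show ?thesis
  unfolding completed_graph_def by (auto intro!: bexI[of _ "1 - v"])
qed

lemma clip_close:
 fixes l h z e :: real
 assumes "l <= h" "0 <= e" "l - e <= z" "z <= h + e"
 shows "\<bar>z - max l (min z h)\<bar> <= e"
 using assms by (auto simp: max_def min_def)

text \<open>The hypotheses only ask that, on each block, \<open>x\<close> stays between the two node values up to \<open>e\<close>, in
  any order and with any oscillation. One half of the distance clips the heights of \<open>x\<close> to the
  jump segment at the end of the block; the other half finds the points of that segment on the
  completed graph of \<open>x\<close> by the intermediate value property.\<close>

lemma dist_M2_step_path_le:
 assumes x: "cadlag_on {0..1} x" and m: "m > 0"
  and nodes: "\<And>k. k <= m ==> \<bar>x (real k / real m) - y k\<bar> <= e"
  and block: "\<And>k t. k < m ==> real k / real m <= t ==> t <= real (Suc k) / real m ==>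
    min (y k) (y (Suc k)) - e <= x t \<and> x t <= max (y k) (y (Suc k)) + e"
 shows "dist_M2 x (step_path m y) <= max (1 / real m) e"
proof (rule dist_M2_le)
 fix a assume "a \<in> completed_graph x"
 then obtain u z where a: "a = (u, z)" and uz: "(u, z) \<in> completed_graph x" by (cases a) auto
 obtain w where w: "w \<in> {0..1}" "z = w * left_limit x u + (1 - w) * x u" and u: "u \<in> {0..1}"
  using uz by (auto simp: completed_graph_def)
 have "\<exists>k<m. u \<in> {real k / real m..real (Suc k) / real m} \<and>
   z \<in> {min (y k) (y (Suc k)) - e..max (y k) (y (Suc k)) + e}"
 proof (rule unit_interval_block[OF m u])
  assume "u = 0"
  then have "z = x 0" using w by (simp add: left_limit_def algebra_simps)
  then show ?thesis using m block[of 0 0] \<open>u = 0\<close> by (intro exI[of _ 0]) auto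
 next
  fix k assume k: "k < m" "real k / real m < u" "u <= real (Suc k) / real m"
  let ?l = "min (y k) (y (Suc k)) - e" and ?h = "max (y k) (y (Suc k)) + e"
  have "0 <= real k / real m" by simp
  then have u0: "u > 0" using k by linarith
  have lim: "(x \<longlongrightarrow> left_limit x u) (at_left u)"
   by (rule cadlag_on_at_left[OF x]) (use u u0 in auto)
  have ev: "\<forall>\<^sub>F s in at_left u. ?l <= x s \<and> x s <= ?h"
   using eventually_at_left_real[OF k(2)]
   by eventually_elim (rule block, use k in auto)
  have L: "?l <= left_limit x u" "left_limit x u <= ?h"
   using ev by (auto intro!: tendsto_lowerbound[OF lim] tendsto_upperbound[OF lim] elim!: eventually_mono)
  have R: "?l <= x u" "x u <= ?h" using block[of k u] k by auto
  have "z \<in> closed_segment (x u) (left_limit x u)"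
   using w by (auto simp: in_segment intro!: exI[of _ w])
  then have "z \<in> {?l..?h}" using L R by (auto simp: closed_segment_eq_real_ivl split: if_splits)
  then show ?thesis using k by (intro exI[of _ k]) auto
 qed
 then obtain k where k: "k < m" "u \<in> {real k / real m..real (Suc k) / real m}"
  "z \<in> {min (y k) (y (Suc k)) - e..max (y k) (y (Suc k)) + e}" by blast
 define z' where "z' = max (min (y k) (y (Suc k))) (min z (max (y k) (y (Suc k))))"
 have e0: "0 <= e" using nodes[of 0] by simp
 have z': "z' \<in> closed_segment (y k) (y (Suc k))"
  by (auto simp: z'_def closed_segment_eq_real_ivl)
 have z'e: "\<bar>z - z'\<bar> <= e"
  unfolding z'_def by (rule clip_close) (use k(3) e0 in auto)
 have "real (Suc k) / real m - real k / real m = 1 / real m" by (simp add: divide_simps)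
 then have "\<bar>u - real (Suc k) / real m\<bar> <= 1 / real m" using k(2) by auto
 then show "\<exists>b\<in>completed_graph (step_path m y). max_dist a b <= max (1 / real m) e"
  using z'e by (intro bexI[OF _ completed_graph_step_pathI[OF m k(1) z']])
   (auto simp: a max_dist_def)
next
 fix a assume "a \<in> completed_graph (step_path m y)"
 then obtain u z where a: "a = (u, z)" and uz: "(u, z) \<in> completed_graph (step_path m y)" by (cases a) auto
 obtain k where k: "k < m" "u \<in> {real k / real m..real (Suc k) / real m}"
  "z \<in> closed_segment (y k) (y (Suc k))" using completed_graph_step_pathD[OF m uz] by blast
 let ?s = "real k / real m" and ?t = "real (Suc k) / real m"
 define z' where "z' = max (min (x ?s) (x ?t)) (min z (max (x ?s) (x ?t)))"
 have z'seg: "z' \<in> closed_segment (x ?s) (x ?t)"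
  by (auto simp: z'_def closed_segment_eq_real_ivl)
 have near: "\<bar>x ?s - y k\<bar> <= e" "\<bar>x ?t - y (Suc k)\<bar> <= e" using nodes[of k] nodes[of "Suc k"] k(1) by auto
 have "min (y k) (y (Suc k)) <= z" "z <= max (y k) (y (Suc k))"
  using k(3) by (auto simp: closed_segment_eq_real_ivl split: if_splits)
 then have z'e: "\<bar>z - z'\<bar> <= e"
  unfolding z'_def using near by (intro clip_close) linarith+
 have "?s <= ?t" "?t <= 1" using k m by (auto simp: divide_simps)
 then obtain u' where u': "u' \<in> {?s..?t}" "(u', z') \<in> completed_graph x"
  using completed_graph_ivt[OF x _ _ _ z'seg] by auto
 have "?t - ?s = 1 / real m" by (simp add: divide_simps)
 then have "\<bar>u - u'\<bar> <= 1 / real m" using k(2) u'(1) by auto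
 then show "\<exists>b\<in>completed_graph x. max_dist a b <= max (1 / real m) e"
  using z'e by (intro bexI[OF _ u'(2)]) (auto simp: a max_dist_def)
qed

lemma cadlag_two_sided:
 assumes x: "cadlag_on {0..1} x" and s: "s \<in> {0..1}" and e: "e > 0"
 shows "\<exists>d>0. (\<forall>u\<in>{0..1}. \<forall>v\<in>{0..1}. s - d < u --> u < s --> s - d < v --> v < s --> \<bar>x u - x v\<bar> <= e) \<and>
  (\<forall>u\<in>{0..1}. \<forall>v\<in>{0..1}. s <= u --> u < s + d --> s <= v --> v < s + d --> \<bar>x u - x v\<bar> <= e)"
proof -
 obtain d1 where d1: "d1 > 0"
  "\<And>u v. [|u \<in> {0..1}; v \<in> {0..1}; s - d1 < u; u < s; s - d1 < v; v < s|] ==> \<bar>x u - x v\<bar> <= e"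
 proof (cases "s = 0")
  case True
  then show ?thesis using that[of 1] by auto
 next
  case False
  then have "(x \<longlongrightarrow> left_limit x s) (at_left s)"
   using s by (intro cadlag_on_at_left[OF x]) auto
  then have "\<forall>\<^sub>F u in at_left s. dist (x u) (left_limit x s) < e / 2"
   using e by (intro tendstoD) auto
  then obtain b where b: "b < s" "\<And>u. b < u ==> u < s ==> dist (x u) (left_limit x s) < e / 2"
   unfolding eventually_at_left_field by blast
  have *: "\<bar>x u - x v\<bar> <= e" if "b < u" "u < s" "b < v" "v < s" for u v
   using b(2)[OF that(1,2)] b(2)[OF that(3,4)] unfolding dist_real_def by linarith
  show ?thesis by (rule that[of "s - b"]) (use b * in auto)
 qed
 obtain d2 where d2: "d2 > 0"
  "\<And>u v. [|u \<in> {0..1}; v \<in> {0..1}; s <= u; u < s + d2; s <= v; v < s + d2|] ==> \<bar>x u - x v\<bar> <= e"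
 proof (cases "s = 1")
  case True
  then show ?thesis using that[of 1] e by auto
 next
  case False
  then have "(x \<longlongrightarrow> x s) (at_right s)"
   using s by (intro cadlag_on_at_right[OF x]) auto
  then have "\<forall>\<^sub>F u in at_right s. dist (x u) (x s) < e / 2"
   using e by (intro tendstoD) auto
  then obtain b where b: "b > s" "\<And>u. s < u ==> u < b ==> dist (x u) (x s) < e / 2"
   unfolding eventually_at_right_field by blast
  have b': "dist (x u) (x s) < e / 2" if "s <= u" "u < b" for u
   using b(2)[of u] that e by (cases "u = s") auto
  have *: "\<bar>x u - x v\<bar> <= e" if "s <= u" "u < b" "s <= v" "v < b" for u v
   using b'[OF that(1,2)] b'[OF that(3,4)] unfolding dist_real_def by linarith
  show ?thesis by (rule that[of "b - s"]) (use b * in auto)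
 qed
 show ?thesis
  by (rule exI[of _ "min d1 d2"]) (use d1 d2 in auto)
qed

text \<open>By compactness, every sufficiently short interval \<open>[p, q]\<close> contains at most one jump of size above
  \<open>e\<close>; points to its left are close to \<open>x p\<close>, the others to \<open>x q\<close>.\<close>

lemma cadlag_blocks:
 assumes x: "cadlag_on {0..1} x" and e: "e > 0"
 obtains d where "d > 0"
  "\<And>p q t. [|0 <= p; p <= t; t <= q; q <= 1; q - p < d|] ==> \<bar>x t - x p\<bar> <= e \<or> \<bar>x t - x q\<bar> <= e"
proof -
 from bchoice[OF ballI[OF cadlag_two_sided[OF x _ e]]]
 obtain d where dd: "\<forall>s\<in>{0..1}. d s > 0 \<and>
  (\<forall>u\<in>{0..1}. \<forall>v\<in>{0..1}. s - d s < u --> u < s --> s - d s < v --> v < s --> \<bar>x u - x v\<bar> <= e) \<and>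
  (\<forall>u\<in>{0..1}. \<forall>v\<in>{0..1}. s <= u --> u < s + d s --> s <= v --> v < s + d s --> \<bar>x u - x v\<bar> <= e)" ..
 have d1: "d s > 0" if "s \<in> {0..1}" for s using bspec[OF dd that] by (rule conjunct1)
 define C where "C = (\<lambda>s. ball s (d s)) ` {0..1::real}"
 have cover: "{0..1} \<subseteq> \<Union>C"
 proof
  fix s :: real assume "s \<in> {0..1}"
  then have "s \<in> ball s (d s)" using d1 by simp
  then show "s \<in> \<Union>C" using \<open>s \<in> {0..1}\<close> unfolding C_def by blast
 qed
 have "C \<noteq> {}" unfolding C_def by auto
 obtain r where r: "0 < r" "\<And>T. T \<subseteq> {0..1} ==> diameter T < r ==> \<exists>B\<in>C. T \<subseteq> B"
  by (rule Lebesgue_number_lemma[OF _ \<open>C \<noteq> {}\<close> cover]) (auto simp: C_def)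
 show ?thesis
 proof (rule that[OF r(1)])
  fix p q t :: real assume pq: "0 <= p" "p <= t" "t <= q" "q <= 1" "q - p < r"
  have "diameter {p..q} < r" using pq by (simp add: diameter_closed_interval)
  then obtain s where s: "s \<in> {0..1}" "{p..q} \<subseteq> ball s (d s)"
   using r(2)[of "{p..q}"] pq unfolding C_def by auto
  note conjunct2[OF bspec[OF dd s(1)]]
  then have d: "\<And>u v. [|u \<in> {0..1}; v \<in> {0..1}; s - d s < u; u < s; s - d s < v; v < s|] ==> \<bar>x u - x v\<bar> <= e"
   "\<And>u v. [|u \<in> {0..1}; v \<in> {0..1}; s <= u; u < s + d s; s <= v; v < s + d s|] ==> \<bar>x u - x v\<bar> <= e"
   by blast+
  have b: "s - d s < v" "v < s + d s" "v \<in> {0..1}" if "v \<in> {p..q}" for v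
   using subsetD[OF s(2) that] pq that by (auto simp: dist_real_def)
  have mem: "p \<in> {p..q}" "q \<in> {p..q}" "t \<in> {p..q}" using pq by auto
  show "\<bar>x t - x p\<bar> <= e \<or> \<bar>x t - x q\<bar> <= e"
  proof (cases "t < s")
   case True
   then show ?thesis using d(1)[of t p] b[OF mem(1)] b[OF mem(3)] pq by auto
  next
   case False
   then show ?thesis using d(2)[of t q] b[OF mem(2)] b[OF mem(3)] pq by auto
  qed
 qed
qed

lemma dist_to_D01:
 assumes "cadlag_on {0..1} f" "cadlag_on {0..1} g"
 shows "dist (to_D01 f) (to_D01 g) = dist_M2 f g"
proof -
 have r: "cadlag_on {0..1} (restrict h {0..1})" "dist_M2 h (restrict h {0..1}) = 0"
  "dist_M2 (restrict h {0..1}) h = 0"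
  if "cadlag_on {0..1} h" for h
 proof -
  show c: "cadlag_on {0..1} (restrict h {0..1})" by (rule cadlag_on_cong[OF that]) auto
  show "dist_M2 h (restrict h {0..1}) = 0" "dist_M2 (restrict h {0..1}) h = 0"
   using dist_M2_zero_iff[OF that c] dist_M2_zero_iff[OF c that] by auto
 qed
 have "dist_M2 (restrict f {0..1}) (restrict g {0..1}) = dist_M2 f g"
  using dist_M2_triangle[OF r(1)[OF assms(1)] assms(1) r(1)[OF assms(2)]]
   dist_M2_triangle[OF assms(1) assms(2) r(1)[OF assms(2)]]
   dist_M2_triangle[OF assms(1) r(1)[OF assms(1)] assms(2)]
   dist_M2_triangle[OF r(1)[OF assms(1)] r(1)[OF assms(2)] assms(2)]
   r(2,3)[OF assms(1)] r(2,3)[OF assms(2)] by linarith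
 then show ?thesis by (simp add: dist_D01_def Rep_to_D01 assms)
qed

lemma dist_M2_step_path_sample_le:
 assumes x: "cadlag_on {0..1} x" and m: "m > 0" and e: "e > 0"
  and close: "\<And>p q t. [|0 <= p; p <= t; t <= q; q <= 1; q - p <= 1 / real m|] ==>
   \<bar>x t - x p\<bar> <= e \<or> \<bar>x t - x q\<bar> <= e"
 shows "dist_M2 x (step_path m (\<lambda>k. x (real k / real m))) <= max (1 / real m) e"
proof (rule dist_M2_step_path_le[OF x m])
 fix k t assume k: "k < m" "real k / real m <= t" "t <= real (Suc k) / real m"
 have "real (Suc k) / real m <= 1" using k m by (auto simp: divide_simps)
 moreover have "real (Suc k) / real m - real k / real m <= 1 / real m" by (simp add: divide_simps)
 ultimately show "min (x (real k / real m)) (x (real (Suc k) / real m)) - e <= x t \<and>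
   x t <= max (x (real k / real m)) (x (real (Suc k) / real m)) + e"
  using close[of "real k / real m" t "real (Suc k) / real m"] k by (auto simp: min_def max_def abs_le_iff)
qed (use e in auto)

text \<open>This has no counterpart for the uniform distance: at a jump time that is not a sampling point
  the step function jumps a little later than the path.\<close>

lemma step_path_sample_tendsto:
 assumes x: "cadlag_on {0..1} x"
 shows "(\<lambda>m. to_D01 (step_path (Suc m) (\<lambda>k. x (real k / real (Suc m))))) \<longlonglongrightarrow> to_D01 x"
proof (rule metric_LIMSEQ_I)
 fix r :: real assume r: "r > 0"
 then have r2: "r / 2 > 0" by simp
 obtain d where d: "d > 0"
  "\<And>p q t. [|0 <= p; p <= t; t <= q; q <= 1; q - p < d|] ==> \<bar>x t - x p\<bar> <= r / 2 \<or> \<bar>x t - x q\<bar> <= r / 2"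
  by (rule cadlag_blocks[OF x r2]) blast
 obtain M where M: "1 / real (Suc M) < min d r"
  using r d(1) reals_Archimedean[of "min d r"] by (auto simp: inverse_eq_divide)
 show "\<exists>M. \<forall>m\<ge>M. dist (to_D01 (step_path (Suc m) (\<lambda>k. x (real k / real (Suc m))))) (to_D01 x) < r"
 proof (intro exI allI impI)
  fix m assume "M <= m"
  then have "1 / real (Suc m) <= 1 / real (Suc M)" by (simp add: divide_simps)
  with M have m: "1 / real (Suc m) < d" "1 / real (Suc m) < r" by linarith+
  have "dist_M2 x (step_path (Suc m) (\<lambda>k. x (real k / real (Suc m)))) <= max (1 / real (Suc m)) (r / 2)"
  proof (rule dist_M2_step_path_sample_le[OF x _ r2])
   fix p q t :: real
   assume "0 <= p" "p <= t" "t <= q" "q <= 1" "q - p <= 1 / real (Suc m)"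
   then show "\<bar>x t - x p\<bar> <= r / 2 \<or> \<bar>x t - x q\<bar> <= r / 2"
    using m(1) by (intro d(2)) linarith+
  qed simp
  also have "... < r" using m r by simp
  finally show "dist (to_D01 (step_path (Suc m) (\<lambda>k. x (real k / real (Suc m))))) (to_D01 x) < r"
   by (simp only: dist_to_D01[OF cadlag_step_path x] dist_M2_sym)
 qed
qed

lemma dist_M2_uniform_le:
 assumes x: "cadlag_on {0..1} x" and y: "cadlag_on {0..1} y"
  and e: "\<And>t. t \<in> {0..1} ==> \<bar>x t - y t\<bar> <= e"
 shows "dist_M2 x y <= e"
proof -
 have *: "\<exists>b\<in>completed_graph y. max_dist a b <= e"
  if x: "cadlag_on {0..1} x" and y: "cadlag_on {0..1} y"
  and e: "\<And>t. t \<in> {0..1} ==> \<bar>x t - y t\<bar> <= e" and a: "a \<in> completed_graph x" for x y a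
 proof -
  obtain u w where u: "u \<in> {0..1}" "w \<in> {0..1}" "a = (u, w * left_limit x u + (1 - w) * x u)"
   using a by (auto simp: completed_graph_def)
  have "\<bar>left_limit x u - left_limit y u\<bar> <= e"
  proof (cases "u = 0")
   case True
   then show ?thesis using e[of 0] by (simp add: left_limit_def)
  next
   case False
   then have u0: "0 < u" "u <= 1" using u by auto
   have lim: "((\<lambda>s. \<bar>x s - y s\<bar>) \<longlongrightarrow> \<bar>left_limit x u - left_limit y u\<bar>) (at_left u)"
    by (intro tendsto_intros cadlag_on_at_left x y u0)
   show ?thesis
    by (rule tendsto_upperbound[OF lim])
     (use eventually_at_left_real[OF u0(1)] u0 in \<open>auto intro!: e elim!: eventually_mono\<close>)
  qed
  then have "\<bar>w * (left_limit x u - left_limit y u) + (1 - w) * (x u - y u)\<bar> <= e"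
   using convex_comb_close[of "left_limit x u - left_limit y u" 0 e "x u - y u" w] e[OF u(1)] u(2) by simp
  then have "max_dist a (u, w * left_limit y u + (1 - w) * y u) <= e"
   by (simp add: u max_dist_def algebra_simps)
  moreover have "(u, w * left_limit y u + (1 - w) * y u) \<in> completed_graph y"
   using u by (auto simp: completed_graph_def)
  ultimately show ?thesis by blast
 qed
 show ?thesis
  by (rule dist_M2_le) (use *[OF x y e] *[OF y x] e in \<open>auto simp: abs_minus_commute\<close>)
qed

lemma continuous_step_path: "continuous_on UNIV (\<lambda>y. to_D01 (step_path m y))"
 unfolding continuous_on_def
proof (intro ballI)
 fix y :: "nat => real"
 have fin: "finite {..m}" by simp
 show "((\<lambda>y. to_D01 (step_path m y)) \<longlongrightarrow> to_D01 (step_path m y)) (at y within UNIV)"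
 proof (rule tendstoI)
  fix e :: real assume e: "e > 0"
  have coord: "((\<lambda>y'. y' k) \<longlongrightarrow> y k) (at y)" for k
   using continuous_on_product_coordinates[of k] by (auto simp: continuous_on_def)
  have "\<forall>\<^sub>F y' in at y. \<forall>k\<in>{..m}. dist (y' k) (y k) < e / 2"
   using e by (intro eventually_ball_finite ballI tendstoD[OF coord]) auto
  then show "\<forall>\<^sub>F y' in at y. dist (to_D01 (step_path m y')) (to_D01 (step_path m y)) < e"
  proof eventually_elim
   case (elim y')
   have "dist_M2 (step_path m y') (step_path m y) <= e / 2"
   proof (rule dist_M2_uniform_le[OF cadlag_step_path cadlag_step_path])
    fix t :: real assume t: "t \<in> {0..1}"
    then have "real m * t <= real m" "0 <= real m * t" by (auto intro: mult_left_le)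
    then have "nat \<lfloor>real m * t\<rfloor> <= m" by linarith
    then show "\<bar>step_path m y' t - step_path m y t\<bar> <= e / 2"
     using elim by (auto simp: step_path_def dist_real_def intro: less_imp_le)
   qed
   then show ?case using e by (simp add: dist_to_D01 cadlag_step_path)
  qed
 qed
qed

lemma measurable_step_path:
 assumes "\<And>k. (\<lambda>w. y k w) \<in> borel_measurable M"
 shows "(\<lambda>w. to_D01 (step_path m (\<lambda>k. y k w))) \<in> M \<rightarrow>\<^sub>M borel"
proof -
 have "(\<lambda>w k. y k w) \<in> M \<rightarrow>\<^sub>M borel"
  using assms by (rule measurable_coordinatewise_then_product)
 then show ?thesis
  using borel_measurable_continuous_onI[OF continuous_step_path, of m]
  by (rule measurable_compose)
qed

text \<open>Measurability of a random path reduces to that of its coordinates, because in \<open>M\<^sub>2\<close> the path is a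
  limit of step functions, which are continuous images of finitely many coordinates.\<close>

lemma measurable_to_D01:
 assumes "\<And>w. w \<in> space M ==> cadlag_on {0..1} (X w)"
  and "\<And>t. t \<in> {0..1} ==> (\<lambda>w. X w t) \<in> borel_measurable M"
 shows "(\<lambda>w. to_D01 (X w)) \<in> M \<rightarrow>\<^sub>M borel"
proof (rule borel_measurable_LIMSEQ_metric)
 fix m
 let ?t = "\<lambda>k. min 1 (real k / real (Suc m))"
 have eq: "to_D01 (step_path (Suc m) (\<lambda>k. X w (real k / real (Suc m)))) =
   to_D01 (step_path (Suc m) (\<lambda>k. X w (?t k)))" for w
 proof -
  have "step_path (Suc m) (\<lambda>k. X w (real k / real (Suc m))) t = step_path (Suc m) (\<lambda>k. X w (?t k)) t"
   if "t \<in> {0..1}" for t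
  proof -
   have "real (Suc m) * t <= real (Suc m)" "0 <= real (Suc m) * t"
    using that by (auto intro: mult_left_le)
   then have "nat \<lfloor>real (Suc m) * t\<rfloor> <= Suc m" by linarith
   then show ?thesis unfolding step_path_def by (subst min_absorb2) (auto simp del: of_nat_Suc)
  qed
  then have "restrict (step_path (Suc m) (\<lambda>k. X w (real k / real (Suc m)))) {0..1} =
    restrict (step_path (Suc m) (\<lambda>k. X w (?t k))) {0..1}" by (rule restrict_ext)
  then show ?thesis by (simp only: to_D01_def)
 qed
 show "(\<lambda>w. to_D01 (step_path (Suc m) (\<lambda>k. X w (real k / real (Suc m))))) \<in> M \<rightarrow>\<^sub>M borel"
  unfolding eq by (rule measurable_step_path) (rule assms(2), auto)
next
 fix w assume "w \<in> space M"
 then show "(\<lambda>m. to_D01 (step_path (Suc m) (\<lambda>k. X w (real k / real (Suc m))))) \<longlonglongrightarrow> to_D01 (X w)"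
  by (intro step_path_sample_tendsto assms(1))
qed

section \<open>Convergence in distribution\<close>

text \<open>The largest \<open>k\<close>-Lipschitz function below \<open>f\<close>. For bounded continuous \<open>f\<close> these functions increase
  to \<open>f\<close> with \<open>k\<close>, which reduces weak convergence to Lipschitz test functions.\<close>

definition lipschitz_minorant :: "('s::metric_space => real) => nat => 's => real" where
 "lipschitz_minorant f k x = (INF y. f y + real k * dist x y)"

lemma lipschitz_minorant:
 fixes f :: "'s::metric_space => real"
 assumes B: "\<And>x. \<bar>f x\<bar> <= B"
 shows lipschitz_minorant_le: "lipschitz_minorant f k x <= f x"
  and lipschitz_minorant_abs_le: "\<bar>lipschitz_minorant f k x\<bar> <= B"
  and lipschitz_minorant_lipschitz: "\<bar>lipschitz_minorant f k x - lipschitz_minorant f k y\<bar> <= real k * dist x y"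
proof -
 have ge: "- B <= f y + real k * dist x y" for x y
 proof -
  have "0 <= real k * dist x y" by simp
  then show ?thesis using B[of y] by linarith
 qed
 then have bdd: "bdd_below (range (\<lambda>y. f y + real k * dist x y))" for x
  by (auto intro!: bdd_belowI[of _ "-B"])
 show le: "lipschitz_minorant f k x <= f x" for x
  unfolding lipschitz_minorant_def using cINF_lower[OF bdd, of x x] by simp
 have "- B <= lipschitz_minorant f k x" for x
  unfolding lipschitz_minorant_def by (rule cINF_greatest) (auto intro: ge)
 then show "\<bar>lipschitz_minorant f k x\<bar> <= B"
  using le[of x] B[of x] by (smt (verit))
 have "lipschitz_minorant f k x <= lipschitz_minorant f k y + real k * dist x y" for x y
 proof -
  have "lipschitz_minorant f k x - real k * dist x y <= f z + real k * dist y z" for z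
  proof -
   have "lipschitz_minorant f k x <= f z + real k * dist x z"
    unfolding lipschitz_minorant_def by (rule cINF_lower[OF bdd]) simp
   also have "... <= f z + real k * (dist x y + dist y z)"
    by (intro add_left_mono mult_left_mono dist_triangle) auto
   finally show ?thesis by (simp add: algebra_simps)
  qed
  then have "lipschitz_minorant f k x - real k * dist x y <= lipschitz_minorant f k y"
   unfolding lipschitz_minorant_def[of f k y] by (intro cINF_greatest) auto
  then show ?thesis by simp
 qed
 from this[of x y] this[of y x] show "\<bar>lipschitz_minorant f k x - lipschitz_minorant f k y\<bar> <= real k * dist x y"
  by (simp add: dist_commute abs_le_iff)
qed

lemma lipschitz_minorant_tendsto:
 fixes f :: "'s::metric_space => real"
 assumes B: "\<And>x. \<bar>f x\<bar> <= B" and cont: "continuous_on UNIV f"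
 shows "(\<lambda>k. lipschitz_minorant f k x) \<longlonglongrightarrow> f x"
proof (rule LIMSEQ_I)
 fix r :: real assume r: "r > 0"
 have "isCont f x" using cont by (simp add: continuous_on_eq_continuous_at)
 then obtain d where d: "d > 0" "\<And>y. dist y x < d ==> dist (f y) (f x) < r / 2"
  using r unfolding continuous_at_eps_delta by (metis half_gt_zero)
 obtain K :: nat where K: "2 * B / d < real K" using reals_Archimedean2 by blast
 show "\<exists>no. \<forall>n\<ge>no. norm (lipschitz_minorant f n x - f x) < r"
 proof (intro exI allI impI)
  fix k assume "K <= k"
  then have "2 * B < real k * d" using K d(1) by (simp add: divide_less_eq) (smt (verit) mult_right_mono of_nat_le_iff)
  then have k: "f x <= B + (real k * d - 2 * B)" using B[of x] by linarith
  have "f x - r / 2 <= f y + real k * dist x y" for y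
  proof (cases "dist x y < d")
   case True
   then have "dist (f y) (f x) < r / 2" using d(2)[of y] by (simp add: dist_commute)
   moreover have "0 <= real k * dist x y" by simp
   ultimately show ?thesis unfolding dist_real_def by linarith
  next
   case False
   then have "real k * d <= real k * dist x y" by (intro mult_left_mono) auto
   then show ?thesis using B[of y] k r by linarith
  qed
  then have "f x - r / 2 <= lipschitz_minorant f k x"
   unfolding lipschitz_minorant_def by (intro cINF_greatest) auto
  then show "norm (lipschitz_minorant f k x - f x) < r"
   using lipschitz_minorant_le[of f B k x, OF B] r by auto
 qed
qed

lemma lipschitz_imp_borel:
 fixes f :: "'s::metric_space => real"
 assumes "\<And>x y. \<bar>f x - f y\<bar> <= K * dist x y"
 shows "f \<in> borel_measurable borel"
proof -
 have "continuous_on UNIV f"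
 proof (rule continuous_on_iff[THEN iffD2], intro ballI allI impI)
  fix x :: 's and e :: real assume e: "e > 0"
  have K: "K <= \<bar>K\<bar> + 1" by simp
  have "dist (f y) (f x) < e" if "dist y x < e / (\<bar>K\<bar> + 1)" for y
  proof -
   have "dist (f y) (f x) <= (\<bar>K\<bar> + 1) * dist y x"
    using assms[of y x] mult_right_mono[OF K, of "dist y x"] by (simp add: dist_real_def)
   also have "... < (\<bar>K\<bar> + 1) * (e / (\<bar>K\<bar> + 1))" using that by (intro mult_strict_left_mono) auto
   finally show ?thesis by simp
  qed
  then show "\<exists>d>0. \<forall>y\<in>UNIV. dist y x < d --> dist (f y) (f x) < e"
   using e by (intro exI[of _ "e / (\<bar>K\<bar> + 1)"]) auto
 qed
 then show ?thesis by (rule borel_measurable_continuous_onI)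
qed

lemma converges_in_distributionI_lipschitz:
 fixes X :: "nat => 'a => 's::metric_space"
 assumes M: "prob_space M" and N: "prob_space N"
  and X: "\<And>n. X n \<in> M \<rightarrow>\<^sub>M borel" and Y: "Y \<in> N \<rightarrow>\<^sub>M borel"
  and lip: "\<And>(f::'s => real) K B. (\<And>x y. \<bar>f x - f y\<bar> <= K * dist x y) ==> (\<And>x. \<bar>f x\<bar> <= B) ==> 0 <= K ==>
    (\<lambda>n. \<integral>w. f (X n w) \<partial>M) \<longlonglongrightarrow> (\<integral>w. f (Y w) \<partial>N)"
 shows "converges_in_distribution M X N Y"
proof -
 interpret M: prob_space M by fact
 interpret N: prob_space N by fact
 have lower: "\<forall>\<^sub>F n in sequentially. (\<integral>w. f (Y w) \<partial>N) - e < (\<integral>w. f (X n w) \<partial>M)"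
  if f: "continuous_on UNIV f" and B: "\<And>x. \<bar>f x\<bar> <= B" and e: "e > 0" for f :: "'s => real" and B e
 proof -
  let ?g = "lipschitz_minorant f"
  have gm: "?g k \<in> borel_measurable borel" for k
   by (rule lipschitz_imp_borel) (rule lipschitz_minorant_lipschitz[of f B, OF B])
  have fm: "f \<in> borel_measurable borel" using f by (rule borel_measurable_continuous_onI)
  have gY: "(\<lambda>w. ?g k (Y w)) \<in> borel_measurable N" for k using Y gm by (rule measurable_compose)
  have gX: "(\<lambda>w. ?g k (X n w)) \<in> borel_measurable M" for k n using X gm by (rule measurable_compose)
  have fX: "(\<lambda>w. f (X n w)) \<in> borel_measurable M" for n using X fm by (rule measurable_compose)
  have fY: "(\<lambda>w. f (Y w)) \<in> borel_measurable N" using Y fm by (rule measurable_compose)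
  have "(\<lambda>k. \<integral>w. ?g k (Y w) \<partial>N) \<longlonglongrightarrow> (\<integral>w. f (Y w) \<partial>N)"
   by (rule integral_dominated_convergence[where w = "\<lambda>_. B"])
    (use gY fY lipschitz_minorant_tendsto[OF B f] lipschitz_minorant_abs_le[of f B, OF B] in auto)
  then have "\<forall>\<^sub>F k in sequentially. (\<integral>w. f (Y w) \<partial>N) - e / 2 < (\<integral>w. ?g k (Y w) \<partial>N)"
   by (rule order_tendstoD) (use e in auto)
  then obtain k where k: "(\<integral>w. f (Y w) \<partial>N) - e / 2 < (\<integral>w. ?g k (Y w) \<partial>N)"
   by (auto simp: eventually_sequentially)
  have "(\<lambda>n. \<integral>w. ?g k (X n w) \<partial>M) \<longlonglongrightarrow> (\<integral>w. ?g k (Y w) \<partial>N)"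
   by (rule lip[OF lipschitz_minorant_lipschitz[of f B, OF B] lipschitz_minorant_abs_le[of f B, OF B]]) simp
  then have "\<forall>\<^sub>F n in sequentially. (\<integral>w. ?g k (Y w) \<partial>N) - e / 2 < (\<integral>w. ?g k (X n w) \<partial>M)"
   by (rule order_tendstoD) (use e in auto)
  then show ?thesis
  proof eventually_elim
   case (elim n)
   have "(\<integral>w. ?g k (X n w) \<partial>M) <= (\<integral>w. f (X n w) \<partial>M)"
    by (rule integral_mono)
     (auto intro!: M.integrable_const_bound[where B = B] gX fX AE_I2 lipschitz_minorant_abs_le[of f B, OF B] B lipschitz_minorant_le[of f B, OF B])
   then show ?case using k elim by linarith
  qed
 qed
 show ?thesis
  unfolding converges_in_distribution_def
 proof (intro conjI allI impI X Y)
  fix f :: "'s => real" assume f: "continuous_on UNIV f \<and> bounded (range f)"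
  then obtain B where B: "\<And>x. \<bar>f x\<bar> <= B" unfolding bounded_iff by auto
  have fm: "f \<in> borel_measurable borel" using f by (intro borel_measurable_continuous_onI) auto
  have "(\<lambda>n. \<integral>w. f (X n w) \<partial>M) \<longlonglongrightarrow> (\<integral>w. f (Y w) \<partial>N)"
  proof (rule order_tendstoI)
   fix y assume "y < (\<integral>w. f (Y w) \<partial>N)"
   then show "\<forall>\<^sub>F n in sequentially. y < (\<integral>w. f (X n w) \<partial>M)"
    using lower[of f B "(\<integral>w. f (Y w) \<partial>N) - y"] f B by simp
  next
   fix y assume y: "(\<integral>w. f (Y w) \<partial>N) < y"
   have "continuous_on UNIV (\<lambda>x. - f x)" using f by (intro continuous_intros) auto
   then show "\<forall>\<^sub>F n in sequentially. (\<integral>w. f (X n w) \<partial>M) < y"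
    using lower[of "\<lambda>x. - f x" B "y - (\<integral>w. f (Y w) \<partial>N)"] B y by simp
  qed
  then show "(\<lambda>n. \<integral>x. f x \<partial>distr M borel (X n)) \<longlonglongrightarrow> (\<integral>y. f y \<partial>distr N borel Y)"
   by (simp add: integral_distr X Y fm)
 qed
qed

section \<open>Maximal inequalities for sums of independent variables\<close>

text \<open>The partial sums leave \<open>[-x, x]\<close> for the first time at \<open>k\<close>. Being a condition on the first \<open>k\<close>
  variables only, it is independent of the later ones.\<close>

definition first_passage :: "real => nat => (nat => real) => bool" where
 "first_passage x k y \<longleftrightarrow> x < \<bar>\<Sum>i<k. y i\<bar> \<and> (\<forall>j\<in>{..<k}. \<bar>\<Sum>i<j. y i\<bar> <= x)"

text \<open>Up to errors \<open>x\<close>, the path stays at its initial value \<open>0\<close> before some time and at its final value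
  from then on.\<close>

definition single_jump :: "nat => real => (nat => real) => bool" where
 "single_jump N x y \<longleftrightarrow> (\<exists>t. \<forall>k\<le>N. (k < t --> \<bar>y k\<bar> <= x) \<and> (t <= k --> \<bar>y N - y k\<bar> <= x))"

context prob_space
begin

lemma indep_past_future:
 fixes \<xi> :: "nat => 'a => real" and F G :: "(nat => real) => real"
 assumes "indep_vars (\<lambda>_. borel) \<xi> {..<N}" "t <= N"
  and "F \<in> borel_measurable (PiM {..<t} (\<lambda>_. borel))" "G \<in> borel_measurable (PiM {t..<N} (\<lambda>_. borel))"
 shows "indep_var borel (\<lambda>w. F (\<lambda>i\<in>{..<t}. \<xi> i w)) borel (\<lambda>w. G (\<lambda>i\<in>{t..<N}. \<xi> i w))"
proof -
 have "indep_var (PiM {..<t} (\<lambda>_. borel)) (\<lambda>w. \<lambda>i\<in>{..<t}. \<xi> i w)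
   (PiM {t..<N} (\<lambda>_. borel)) (\<lambda>w. \<lambda>i\<in>{t..<N}. \<xi> i w)"
  by (rule indep_var_restrict[OF assms(1)]) (use assms(2) in auto)
 from indep_var_compose[OF this assms(3,4)] show ?thesis by (simp add: comp_def)
qed

lemma borel_measurable_PiM_sum:
 "A \<subseteq> I ==> (\<lambda>y. \<Sum>i\<in>A. y i :: real) \<in> borel_measurable (PiM I (\<lambda>_. borel))"
 by (intro borel_measurable_sum measurable_component_singleton) auto

lemma expectation_past_mult_future:
 fixes \<xi> :: "nat => 'a => real"
 assumes ind: "indep_vars (\<lambda>_. borel) \<xi> {..<N}" and t: "t <= N"
  and sq: "\<And>i. i < N ==> integrable M (\<lambda>w. (\<xi> i w)\<^sup>2)"
  and mean: "\<And>i. i < N ==> expectation (\<xi> i) = 0"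
  and F: "F \<in> borel_measurable (PiM {..<t} (\<lambda>_. borel))"
  and intF: "integrable M (\<lambda>w. F (\<lambda>i\<in>{..<t}. \<xi> i w))"
  and A: "A \<subseteq> {t..<N}"
 shows "integrable M (\<lambda>w. F (\<lambda>i\<in>{..<t}. \<xi> i w) * (\<Sum>i\<in>A. \<xi> i w))"
  and "expectation (\<lambda>w. F (\<lambda>i\<in>{..<t}. \<xi> i w) * (\<Sum>i\<in>A. \<xi> i w)) = 0"
proof -
 have rv: "random_variable borel (\<xi> i)" if "i < N" for i
  using ind that by (auto simp: indep_vars_def)
 have int: "integrable M (\<xi> i)" if "i < N" for i
  using sq[OF that] rv[OF that] by (rule square_integrable_imp_integrable[rotated])
 have iv: "indep_var borel (\<lambda>w. F (\<lambda>i\<in>{..<t}. \<xi> i w)) borel (\<lambda>w. \<Sum>i\<in>A. (\<lambda>i\<in>{t..<N}. \<xi> i w) i)"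
  by (rule indep_past_future[OF ind t F borel_measurable_PiM_sum[OF A]])
 have eq: "(\<lambda>w. \<Sum>i\<in>A. (\<lambda>i\<in>{t..<N}. \<xi> i w) i) = (\<lambda>w. \<Sum>i\<in>A. \<xi> i w)"
  using A by (intro ext sum.cong) auto
 have intG: "integrable M (\<lambda>w. \<Sum>i\<in>A. \<xi> i w)" using A by (intro Bochner_Integration.integrable_sum int) auto
 note iv' = iv[unfolded eq]
 show "integrable M (\<lambda>w. F (\<lambda>i\<in>{..<t}. \<xi> i w) * (\<Sum>i\<in>A. \<xi> i w))"
  by (rule indep_var_integrable[OF iv' intF intG])
 have "expectation (\<lambda>w. \<Sum>i\<in>A. \<xi> i w) = 0"
  using A by (subst Bochner_Integration.integral_sum) (auto intro!: int sum.neutral mean)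
 then show "expectation (\<lambda>w. F (\<lambda>i\<in>{..<t}. \<xi> i w) * (\<Sum>i\<in>A. \<xi> i w)) = 0"
  using indep_var_lebesgue_integral[OF iv' intF intG] by simp
qed

lemma square_integrable_sum:
 fixes \<xi> :: "nat => 'a => real"
 assumes "\<And>i. i \<in> A ==> random_variable borel (\<xi> i)" "\<And>i. i \<in> A ==> integrable M (\<lambda>w. (\<xi> i w)\<^sup>2)"
 shows "integrable M (\<lambda>w. (\<Sum>i\<in>A. \<xi> i w)\<^sup>2)"
proof (rule Bochner_Integration.integrable_bound)
 show "integrable M (\<lambda>w. real (card A) * (\<Sum>i\<in>A. (\<xi> i w)\<^sup>2))"
  using assms by (intro integrable_mult_right Bochner_Integration.integrable_sum) auto
 show "(\<lambda>w. (\<Sum>i\<in>A. \<xi> i w)\<^sup>2) \<in> borel_measurable M"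
  using assms(1) by (intro borel_measurable_power borel_measurable_sum) auto
 have "(\<Sum>i\<in>A. \<xi> i w)\<^sup>2 <= real (card A) * (\<Sum>i\<in>A. (\<xi> i w)\<^sup>2)" for w
  using Cauchy_Schwarz_ineq_sum[of "\<lambda>_. 1" "\<lambda>i. \<xi> i w" A] by simp
 then show "AE w in M. norm ((\<Sum>i\<in>A. \<xi> i w)\<^sup>2) <= norm (real (card A) * (\<Sum>i\<in>A. (\<xi> i w)\<^sup>2))"
  by (intro AE_I2) (auto intro!: order_trans[OF _ abs_ge_self])
qed

lemma expectation_square_sum:
 fixes \<xi> :: "nat => 'a => real"
 assumes ind: "indep_vars (\<lambda>_. borel) \<xi> {..<N}"
  and sq: "\<And>i. i < N ==> integrable M (\<lambda>w. (\<xi> i w)\<^sup>2)"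
  and mean: "\<And>i. i < N ==> expectation (\<xi> i) = 0"
 shows "expectation (\<lambda>w. (\<Sum>i<N. \<xi> i w)\<^sup>2) = (\<Sum>i<N. expectation (\<lambda>w. (\<xi> i w)\<^sup>2))"
proof -
 have rv: "random_variable borel (\<xi> i)" if "i < N" for i
  using ind that by (auto simp: indep_vars_def)
 have "k <= N ==> expectation (\<lambda>w. (\<Sum>i<k. \<xi> i w)\<^sup>2) = (\<Sum>i<k. expectation (\<lambda>w. (\<xi> i w)\<^sup>2))" for k
 proof (induction k)
  case (Suc k)
  then have k: "k <= N" "k < N" by auto
  have F: "(\<lambda>y. \<Sum>i<k. y i :: real) \<in> borel_measurable (PiM {..<k} (\<lambda>_. borel))"
   by (rule borel_measurable_PiM_sum) simp
  have eq: "(\<Sum>i<k. (\<lambda>i\<in>{..<k}. \<xi> i w) i) = (\<Sum>i<k. \<xi> i w)" for w by (intro sum.cong) auto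
  have i1: "integrable M (\<lambda>w. (\<Sum>i<k. \<xi> i w)\<^sup>2)"
   using k by (intro square_integrable_sum rv sq) auto
  have i1': "integrable M (\<lambda>w. (\<Sum>i<k. \<xi> i w))"
   by (rule square_integrable_imp_integrable[OF _ i1]) (use k in \<open>auto intro!: borel_measurable_sum rv\<close>)
  note cross = expectation_past_mult_future[OF ind k(1) sq mean F, where A = "{k}", unfolded eq]
  have cr: "integrable M (\<lambda>w. (\<Sum>i<k. \<xi> i w) * \<xi> k w)" "expectation (\<lambda>w. (\<Sum>i<k. \<xi> i w) * \<xi> k w) = 0"
   using cross i1' k by auto
  have "expectation (\<lambda>w. (\<Sum>i<Suc k. \<xi> i w)\<^sup>2)
    = expectation (\<lambda>w. (\<Sum>i<k. \<xi> i w)\<^sup>2 + (\<xi> k w)\<^sup>2 + 2 * ((\<Sum>i<k. \<xi> i w) * \<xi> k w))"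
   by (simp add: power2_sum mult.assoc)
  also have "... = expectation (\<lambda>w. (\<Sum>i<k. \<xi> i w)\<^sup>2) + expectation (\<lambda>w. (\<xi> k w)\<^sup>2)"
   using i1 sq[OF k(2)] cr by simp
  finally show ?case using Suc by simp
 qed simp
 then show ?thesis by simp
qed

lemma first_passage_restrict: "first_passage x k (\<lambda>i\<in>{..<k}. y i) = first_passage x k y"
proof -
 have "(\<Sum>i<j. (\<lambda>i\<in>{..<k}. y i) i) = (\<Sum>i<j. y i)" if "j <= k" for j using that by (intro sum.cong) auto
 then show ?thesis unfolding first_passage_def by simp
qed

lemma first_passage_measurable:
 assumes "k <= N" shows "Measurable.pred (PiM {..<N} (\<lambda>_. borel)) (first_passage x k)"
proof -
 have m: "(\<lambda>y. \<bar>\<Sum>i<j. y i :: real\<bar>) \<in> borel_measurable (PiM {..<N} (\<lambda>_. borel))" if "j <= k" for j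
  using that assms by (intro borel_measurable_abs borel_measurable_PiM_sum) auto
 show ?thesis
  unfolding first_passage_def[abs_def] not_less[symmetric]
  by (intro pred_intros_logic pred_intros_finite borel_measurable_pred_less m) auto
qed

lemma first_passage_event:
 assumes ind: "indep_vars (\<lambda>_. borel) \<xi> {..<N}" and k: "k <= N"
 shows "{w\<in>space M. first_passage x k (\<lambda>i. \<xi> i w)} \<in> events"
proof -
 have "(\<lambda>w. \<lambda>i\<in>{..<k}. \<xi> i w) \<in> M \<rightarrow>\<^sub>M PiM {..<k} (\<lambda>_. borel)"
  using ind k by (intro measurable_restrict) (auto simp: indep_vars_def)
 from measurable_compose[OF this first_passage_measurable[OF order_refl, where x = x]]
 have "Measurable.pred M (\<lambda>w. first_passage x k (\<lambda>i. \<xi> i w))" by (simp only: first_passage_restrict)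
 then show ?thesis by (simp add: pred_def)
qed

lemma disjoint_first_passage: "disjoint_family_on (\<lambda>k. {w\<in>space M. first_passage x k (\<lambda>i. \<xi> i w)}) I"
 unfolding disjoint_family_on_def first_passage_def by (auto, metis lessThan_iff linorder_neqE_nat not_le)

lemma UN_first_passage:
 "(\<Union>k\<in>{..N}. {w\<in>space M. first_passage x k (\<lambda>i. \<xi> i w)}) = {w\<in>space M. \<exists>k\<le>N. x < \<bar>\<Sum>i<k. \<xi> i w\<bar>}"
proof (intro set_eqI iffI)
 fix w assume "w \<in> {w\<in>space M. \<exists>k\<le>N. x < \<bar>\<Sum>i<k. \<xi> i w\<bar>}"
 then obtain k where k: "k <= N" "x < \<bar>\<Sum>i<k. \<xi> i w\<bar>" "w \<in> space M" by auto
 then obtain t where t: "x < \<bar>\<Sum>i<t. \<xi> i w\<bar>" "\<forall>j<t. \<not> x < \<bar>\<Sum>i<j. \<xi> i w\<bar>"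
  using exists_least_iff[of "\<lambda>k. x < \<bar>\<Sum>i<k. \<xi> i w\<bar>"] by auto
 then have "t <= k" using k(2) not_le by blast
 then show "w \<in> (\<Union>k\<in>{..N}. {w\<in>space M. first_passage x k (\<lambda>i. \<xi> i w)})"
  using k t by (auto simp: first_passage_def not_less intro!: bexI[of _ t])
qed (auto simp: first_passage_def)

lemma sum_split_at: "k <= N ==> (\<Sum>i<N. f i) = (\<Sum>i<k. f i) + (\<Sum>i\<in>{k..<N}. f i)" for f :: "nat => real"
 using sum.atLeastLessThan_concat[of 0 k N f] by (simp add: lessThan_atLeast0)

text \<open>On the event that the passage happens at time \<open>k\<close>, the remaining sum is independent of the past
  and centred, so the mean of the squared total sum over that event is at least \<open>x\<^sup>2\<close> times its
  probability.\<close>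

lemma kolmogorov_maximal_inequality:
 fixes \<xi> :: "nat => 'a => real"
 assumes ind: "indep_vars (\<lambda>_. borel) \<xi> {..<N}"
  and sq: "\<And>i. i < N ==> integrable M (\<lambda>w. (\<xi> i w)\<^sup>2)"
  and mean: "\<And>i. i < N ==> expectation (\<xi> i) = 0"
  and x: "x > 0"
 shows "\<P>(w in M. \<exists>k\<le>N. x < \<bar>\<Sum>i<k. \<xi> i w\<bar>) <= (\<Sum>i<N. expectation (\<lambda>w. (\<xi> i w)\<^sup>2)) / x\<^sup>2"
proof -
 define S where "S k w = (\<Sum>i<k. \<xi> i w)" for k w
 define A where "A k = {w\<in>space M. first_passage x k (\<lambda>i. \<xi> i w)}" for k
 have rv: "random_variable borel (\<xi> i)" if "i < N" for i
  using ind that by (auto simp: indep_vars_def)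
 have S_rv: "S k \<in> borel_measurable M" if "k <= N" for k
  unfolding S_def[abs_def] using that by (intro borel_measurable_sum rv) auto
 have A_sets: "A k \<in> events" if "k <= N" for k unfolding A_def by (rule first_passage_event[OF ind that])
 have int_S: "integrable M (\<lambda>w. (S k w)\<^sup>2)" if "k <= N" for k
  unfolding S_def using that by (intro square_integrable_sum rv sq) auto
 have int_AS: "integrable M (\<lambda>w. indicator (A k) w * (S N w)\<^sup>2)" if "k <= N" for k
  using integrable_real_mult_indicator[OF A_sets[OF that] int_S[OF order_refl]] by (simp add: mult.commute)
 have lower: "x\<^sup>2 * prob (A k) <= expectation (\<lambda>w. indicator (A k) w * (S N w)\<^sup>2)" if k: "k <= N" for k
 proof -
  define F where "F y = (if first_passage x k y then \<Sum>i<k. y i else 0)" for y :: "nat => real"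
  define R where "R w = indicator (A k) w * S k w * (\<Sum>i\<in>{k..<N}. \<xi> i w)" for w
  have F: "F \<in> borel_measurable (PiM {..<k} (\<lambda>_. borel))"
   unfolding F_def[abs_def] by (intro measurable_If borel_measurable_PiM_sum) (auto intro: first_passage_measurable[unfolded pred_def])
  have Feq: "F (\<lambda>i\<in>{..<k}. \<xi> i w) = indicator (A k) w * S k w" if "w \<in> space M" for w
   using that by (simp add: F_def A_def S_def first_passage_restrict indicator_def)
  have "integrable M (\<lambda>w. indicator (A k) w * S k w)"
   using A_sets[OF k] S_rv[OF k] int_S[OF k]
   by (intro integrable_real_mult_indicator[where f = "S k", simplified mult.commute])
     (auto intro: square_integrable_imp_integrable)
  then have intF: "integrable M (\<lambda>w. F (\<lambda>i\<in>{..<k}. \<xi> i w))"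
   by (subst Bochner_Integration.integrable_cong[OF refl Feq]) auto
  have RF: "R w = F (\<lambda>i\<in>{..<k}. \<xi> i w) * (\<Sum>i\<in>{k..<N}. \<xi> i w)" if "w \<in> space M" for w
   unfolding R_def Feq[OF that] ..
  note cross = expectation_past_mult_future[OF ind k sq mean F intF order_refl]
  have R: "integrable M R"
   by (rule Bochner_Integration.integrable_cong[THEN iffD2, OF refl RF cross(1)])
  have R0: "expectation R = 0"
   by (rule trans[OF Bochner_Integration.integral_cong[OF refl RF] cross(2)])
  have iA: "integrable M (\<lambda>w. x\<^sup>2 * indicator (A k) w :: real)"
   using A_sets[OF k] by (intro integrable_mult_right integrable_real_indicator) (auto simp: emeasure_eq_measure)
  have "x\<^sup>2 * prob (A k) = expectation (\<lambda>w. x\<^sup>2 * indicator (A k) w + 2 * R w)"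
   using R R0 iA A_sets[OF k] by simp
  also have "... <= expectation (\<lambda>w. indicator (A k) w * (S N w)\<^sup>2)"
  proof (rule integral_mono[OF _ int_AS[OF k]])
   show "integrable M (\<lambda>w. x\<^sup>2 * indicator (A k) w + 2 * R w)"
    by (intro Bochner_Integration.integrable_add iA integrable_mult_right R)
   show "x\<^sup>2 * indicator (A k) w + 2 * R w <= indicator (A k) w * (S N w)\<^sup>2" for w
   proof (cases "w \<in> A k")
    case True
    then have "\<bar>x\<bar> <= \<bar>S k w\<bar>" using x by (simp add: A_def S_def first_passage_def)
    then have "x\<^sup>2 <= (S k w)\<^sup>2 + (\<Sum>i\<in>{k..<N}. \<xi> i w)\<^sup>2" by (simp add: abs_le_square_iff add_increasing2)
    then show ?thesis using True by (simp add: R_def S_def sum_split_at[OF k] power2_sum)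
   qed (simp add: R_def)
  qed
  finally show ?thesis .
 qed
 have disj: "disjoint_family_on A {..N}" unfolding A_def by (rule disjoint_first_passage)
 have "x\<^sup>2 * \<P>(w in M. \<exists>k\<le>N. x < \<bar>S k w\<bar>) = (\<Sum>k\<le>N. x\<^sup>2 * prob (A k))"
  unfolding S_def UN_first_passage[symmetric] A_def[symmetric] using A_sets disj
  by (subst finite_measure_finite_Union) (auto simp: sum_distrib_left)
 also have "... <= (\<Sum>k\<le>N. expectation (\<lambda>w. indicator (A k) w * (S N w)\<^sup>2))"
  by (intro sum_mono lower) simp
 also have "... = expectation (\<lambda>w. \<Sum>k\<le>N. indicator (A k) w * (S N w)\<^sup>2)"
  using int_AS by (subst Bochner_Integration.integral_sum) auto
 also have "... <= expectation (\<lambda>w. (S N w)\<^sup>2)"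
 proof (rule integral_mono)
  show "integrable M (\<lambda>w. \<Sum>k\<le>N. indicator (A k) w * (S N w)\<^sup>2)"
   using int_AS by (intro Bochner_Integration.integrable_sum) auto
  fix w
  have "(\<Sum>k\<le>N. indicator (A k) w :: real) = indicator (\<Union>k\<in>{..N}. A k) w"
   using disj by (subst indicator_UN_disjoint) auto
  also have "... <= 1" by simp
  finally have "(\<Sum>k\<le>N. indicator (A k) w) * (S N w)\<^sup>2 <= 1 * (S N w)\<^sup>2"
   by (intro mult_right_mono) auto
  then show "(\<Sum>k\<le>N. indicator (A k) w * (S N w)\<^sup>2) <= (S N w)\<^sup>2" by (simp add: sum_distrib_right)
 qed (simp add: int_S)
 also have "... = (\<Sum>i<N. expectation (\<lambda>w. (\<xi> i w)\<^sup>2))"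
  unfolding S_def by (rule expectation_square_sum[OF ind sq mean])
 finally show ?thesis using x by (simp add: S_def field_simps)
qed

text \<open>If the candidate for the jump is the first passage time \<open>t\<close>, then failure means a second large
  move after \<open>t\<close>, and this is independent of what happened up to \<open>t\<close>. Hence the product.\<close>

lemma single_jump_probability:
 fixes \<xi> :: "nat => 'a => real"
 assumes ind: "indep_vars (\<lambda>_. borel) \<xi> {..<N}"
 defines "S \<equiv> (\<lambda>k w. \<Sum>i<k. \<xi> i w)"
 shows "\<P>(w in M. \<not> single_jump N x (\<lambda>k. S k w))
  <= \<P>(w in M. \<exists>k\<le>N. x < \<bar>S k w\<bar>) * \<P>(w in M. \<exists>k\<le>N. x < \<bar>S N w - S k w\<bar>)"
proof -
 have S_rv: "S k \<in> borel_measurable M" if "k <= N" for k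
  unfolding S_def using that ind by (intro borel_measurable_sum) (auto simp: indep_vars_def)
 define A where "A t = {w\<in>space M. first_passage x t (\<lambda>i. \<xi> i w)}" for t
 define B where "B t = {w\<in>space M. \<exists>k\<in>{t..N}. x < \<bar>S N w - S k w\<bar>}" for t
 have A_sets: "A t \<in> events" if "t <= N" for t unfolding A_def by (rule first_passage_event[OF ind that])
 have B_sets: "B t \<in> events" for t
  unfolding B_def by (intro sets.sets_Collect_finite_Ex) (auto intro!: borel_measurable_less borel_measurable_abs borel_measurable_diff S_rv)
 have disj: "disjoint_family_on A {..N}" unfolding A_def by (rule disjoint_first_passage)
 have UA: "(\<Union>t\<in>{..N}. A t) = {w\<in>space M. \<exists>k\<le>N. x < \<bar>S k w\<bar>}"
  unfolding A_def S_def by (rule UN_first_passage)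
 have AB: "prob (A t \<inter> B t) = prob (A t) * prob (B t)" if t: "t <= N" for t
 proof -
  define F :: "(nat => real) => real" where "F y = (if first_passage x t y then 1 else 0)" for y
  define G :: "(nat => real) => real" where
   "G y = (if \<exists>k\<in>{t..N}. x < \<bar>\<Sum>i\<in>{k..<N}. y i\<bar> then 1 else 0)" for y
  have F: "F \<in> borel_measurable (PiM {..<t} (\<lambda>_. borel))"
   unfolding F_def[abs_def] by (intro measurable_If) (auto intro: first_passage_measurable[unfolded pred_def])
  have m: "(\<lambda>y. \<Sum>i\<in>{k..<N}. y i :: real) \<in> borel_measurable (PiM {t..<N} (\<lambda>_. borel))" if "k \<in> {t..N}" for k
   by (rule borel_measurable_PiM_sum) (use that in auto)
  have G: "G \<in> borel_measurable (PiM {t..<N} (\<lambda>_. borel))"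
   unfolding G_def[abs_def]
   by (intro measurable_If pred_intros_finite borel_measurable_pred_less borel_measurable_abs m) auto
  have "(\<Sum>i\<in>{k..<N}. (\<lambda>i\<in>{t..<N}. \<xi> i w) i) = S N w - S k w" if "k \<in> {t..N}" for k w
  proof -
   have "(\<Sum>i\<in>{k..<N}. (\<lambda>i\<in>{t..<N}. \<xi> i w) i) = (\<Sum>i\<in>{k..<N}. \<xi> i w)"
    using that by (intro sum.cong) auto
   then show ?thesis using that sum_split_at[of k N "\<lambda>i. \<xi> i w"] by (simp add: S_def)
  qed
  then have G_iff: "G (\<lambda>i\<in>{t..<N}. \<xi> i w) \<in> {1} \<longleftrightarrow> w \<in> B t" if "w \<in> space M" for w
   using that by (simp add: G_def B_def)
  have F_iff: "F (\<lambda>i\<in>{..<t}. \<xi> i w) \<in> {1} \<longleftrightarrow> w \<in> A t" if "w \<in> space M" for w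
   using that by (simp add: F_def A_def first_passage_restrict)
  have "\<P>(w in M. F (\<lambda>i\<in>{..<t}. \<xi> i w) \<in> {1} \<and> G (\<lambda>i\<in>{t..<N}. \<xi> i w) \<in> {1}) =
    \<P>(w in M. F (\<lambda>i\<in>{..<t}. \<xi> i w) \<in> {1}) * \<P>(w in M. G (\<lambda>i\<in>{t..<N}. \<xi> i w) \<in> {1})"
   by (rule prob_indep_random_variable[OF indep_past_future[OF ind t F G]]) auto
  also have "{w\<in>space M. F (\<lambda>i\<in>{..<t}. \<xi> i w) \<in> {1} \<and> G (\<lambda>i\<in>{t..<N}. \<xi> i w) \<in> {1}} = A t \<inter> B t"
   using F_iff G_iff by (auto simp: A_def)
  also have "{w\<in>space M. F (\<lambda>i\<in>{..<t}. \<xi> i w) \<in> {1}} = A t" using F_iff by (auto simp: A_def)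
  also have "{w\<in>space M. G (\<lambda>i\<in>{t..<N}. \<xi> i w) \<in> {1}} = B t" using G_iff by (auto simp: B_def)
  finally show ?thesis .
 qed
 have "{w\<in>space M. \<not> single_jump N x (\<lambda>k. S k w)} \<subseteq> (\<Union>t\<in>{..N}. A t \<inter> B t)"
 proof
  fix w assume "w \<in> {w\<in>space M. \<not> single_jump N x (\<lambda>k. S k w)}"
  then have w: "w \<in> space M" and nt: "\<And>t. \<exists>k\<le>N. (k < t \<and> x < \<bar>S k w\<bar>) \<or> (t <= k \<and> x < \<bar>S N w - S k w\<bar>)"
   by (auto simp: single_jump_def not_le)
  have "w \<in> (\<Union>t\<in>{..N}. A t)" unfolding UA using nt[of "Suc N"] w by auto
  then obtain t where t: "t <= N" "w \<in> A t" by auto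
  then have "\<forall>j<t. \<bar>S j w\<bar> <= x" by (auto simp: A_def S_def first_passage_def)
  moreover obtain k where "k <= N" "(k < t \<and> x < \<bar>S k w\<bar>) \<or> (t <= k \<and> x < \<bar>S N w - S k w\<bar>)" using nt[of t] by blast
  ultimately have "w \<in> B t" using w by (auto simp: B_def not_less[symmetric])
  then show "w \<in> (\<Union>t\<in>{..N}. A t \<inter> B t)" using t by auto
 qed
 then have "\<P>(w in M. \<not> single_jump N x (\<lambda>k. S k w)) <= prob (\<Union>t\<in>{..N}. A t \<inter> B t)"
  using A_sets B_sets by (intro finite_measure_mono sets.finite_UN) auto
 also have "... = (\<Sum>t\<le>N. prob (A t \<inter> B t))"
  using A_sets B_sets disj
  by (intro finite_measure_finite_Union) (auto simp: disjoint_family_on_def, blast)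
 also have "... = (\<Sum>t\<le>N. prob (A t) * prob (B t))" using AB by simp
 also have "... <= (\<Sum>t\<le>N. prob (A t) * prob (B 0))"
  using B_sets by (intro sum_mono mult_left_mono finite_measure_mono) (auto simp: B_def)
 also have "... = prob (\<Union>t\<in>{..N}. A t) * prob (B 0)"
  using A_sets disj by (subst finite_measure_finite_Union) (auto simp: sum_distrib_right)
 finally show ?thesis unfolding UA B_def by (simp add: Bex_def)
qed

end

section \<open>Regular variation\<close>

lemma dyadic_bracket:
 assumes "1 <= (t::real)"
 obtains k :: nat where "2 ^ k <= t" "t < 2 ^ Suc k"
proof -
 define k where "k = nat \<lfloor>log 2 t\<rfloor>"
 have "0 <= log 2 t" using assms by simp
 then have "real k <= log 2 t" "log 2 t < real (Suc k)" unfolding k_def by linarith+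
 then have "2 powr real k <= t" "t < 2 powr real (Suc k)"
  using assms by (simp_all add: le_log_iff log_less_iff del: of_nat_Suc)
 then show ?thesis using that[of k] by (simp add: powr_realpow del: of_nat_Suc)
qed

lemma recip_powr: "0 < x ==> (1 / x) powr s = x powr - s" for x s :: real
 by (simp add: powr_divide powr_minus_divide)

lemma half_powr: "0 <= x ==> (x / 2) powr s = 2 powr (- s) * x powr s" for x s :: real
 by (simp add: powr_divide powr_minus_divide)

text \<open>The shape of Potter's bounds: the power \<open>- \<alpha>\<close> worsened by \<open>e\<close>, for large and for small arguments.\<close>

abbreviation power_max :: "real => real => real => real" where
 "power_max \<alpha> e x \<equiv> max (x powr (- \<alpha> - e)) (x powr (- \<alpha> + e))"

locale regular_tail =
 fixes H :: "real => real" and \<alpha> :: real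
 assumes index_pos: "\<alpha> > 0"
  and H_pos: "\<And>x. H x > 0" and H_le_1: "\<And>x. H x <= 1"
  and H_antimono: "\<And>x y. x <= y ==> H y <= H x"
  and H_regular: "\<And>c. c > 0 ==> ((\<lambda>x. H (c * x) / H x) \<longlongrightarrow> c powr (- \<alpha>)) at_top"
begin

text \<open>Regular variation at the ratio \<open>2\<close> bounds the decay over one doubling, and iteration along a
  dyadic bracket of \<open>y / x\<close> gives a power bound for arbitrary ratios.\<close>

lemma potter:
 assumes e: "0 < e" "e < \<alpha>"
 obtains x0 where "x0 > 0"
  "\<And>x y. [|x0 <= x; x <= y|] ==> H y <= 2 powr (\<alpha> - e) * (y / x) powr (- \<alpha> + e) * H x"
  "\<And>x y. [|x0 <= x; x <= y|] ==> H x <= 2 powr (\<alpha> + e) * (y / x) powr (\<alpha> + e) * H y"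
proof -
 have "2 powr (- \<alpha>) < (2::real) powr (- \<alpha> + e)" "2 powr (- \<alpha> - e) < (2::real) powr (- \<alpha>)"
  using e by simp_all
 then have "\<forall>\<^sub>F x in at_top. H (2 * x) / H x < 2 powr (- \<alpha> + e) \<and> 2 powr (- \<alpha> - e) < H (2 * x) / H x"
  using order_tendstoD[OF H_regular[of 2]] by (intro eventually_conj) auto
 then obtain b where b: "\<And>x. x \<ge> b ==> H (2 * x) / H x < 2 powr (- \<alpha> + e) \<and> 2 powr (- \<alpha> - e) < H (2 * x) / H x"
  unfolding eventually_at_top_linorder by blast
 define x0 where "x0 = max b 1"
 have up: "H (2 * x) <= 2 powr (- \<alpha> + e) * H x" if "x0 <= x" for x
  using b[of x] H_pos[of x] that by (auto simp: x0_def pos_divide_less_eq)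
 have lo: "H x <= 2 powr (\<alpha> + e) * H (2 * x)" if "x0 <= x" for x
 proof -
  have "2 powr (- \<alpha> - e) * H x <= H (2 * x)"
   using b[of x] H_pos[of x] that by (auto simp: x0_def pos_less_divide_eq)
  then have "2 powr (\<alpha> + e) * (2 powr (- \<alpha> - e) * H x) <= 2 powr (\<alpha> + e) * H (2 * x)"
   by (intro mult_left_mono) auto
  then show ?thesis by (simp add: mult.assoc[symmetric] powr_add[symmetric])
 qed
 have ge: "x0 <= 2 ^ k * x" if "x0 <= x" for k x
 proof -
  have "1 * x <= 2 ^ k * x" using that by (intro mult_right_mono) (auto simp: x0_def)
  then show ?thesis using that by simp
 qed
 have up_k: "H (2 ^ k * x) <= (2 ^ k) powr (- \<alpha> + e) * H x" if x: "x0 <= x" for k x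
 proof (induction k)
  case (Suc k)
  have "H (2 ^ Suc k * x) <= 2 powr (- \<alpha> + e) * H (2 ^ k * x)"
   using up[OF ge[OF x, of k]] by (simp add: mult.assoc)
  also have "... <= 2 powr (- \<alpha> + e) * ((2 ^ k) powr (- \<alpha> + e) * H x)"
   by (intro mult_left_mono Suc) auto
  finally show ?case by (simp add: powr_mult mult.assoc)
 qed simp
 have lo_k: "H x <= (2 ^ k) powr (\<alpha> + e) * H (2 ^ k * x)" if x: "x0 <= x" for k x
 proof (induction k)
  case (Suc k)
  note Suc
  also have "(2 ^ k) powr (\<alpha> + e) * H (2 ^ k * x) <= (2 ^ k) powr (\<alpha> + e) * (2 powr (\<alpha> + e) * H (2 * (2 ^ k * x)))"
   by (intro mult_left_mono lo ge x) auto
  finally show ?case by (simp add: powr_mult mult_ac)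
 qed simp
 show ?thesis
 proof (rule that[of x0])
  show "x0 > 0" by (simp add: x0_def)
  fix x y assume xy: "x0 <= x" "x <= y"
  have x: "x > 0" using xy by (simp add: x0_def)
  have "1 <= y / x" using xy x by simp
  then obtain k where k: "2 ^ k <= y / x" "y / x < 2 ^ Suc k" using dyadic_bracket by blast
  have k': "2 ^ k * x <= y" "y <= 2 ^ Suc k * x" using k x by (simp_all add: field_simps)
  have yx: "y / x > 0" using \<open>1 <= y / x\<close> by linarith
  have "H y <= H (2 ^ k * x)" by (rule H_antimono[OF k'(1)])
  also have "... <= (2 ^ k) powr (- \<alpha> + e) * H x" by (rule up_k[OF xy(1)])
  also have "... <= (y / x / 2) powr (- \<alpha> + e) * H x"
   using k e yx less_imp_le[OF H_pos[of x]] by (intro mult_right_mono powr_mono2') auto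
  also have "(y / x / 2) powr (- \<alpha> + e) = 2 powr (\<alpha> - e) * (y / x) powr (- \<alpha> + e)"
   using half_powr[of "y / x" "- \<alpha> + e"] yx by (simp add: add.commute)
  finally show "H y <= 2 powr (\<alpha> - e) * (y / x) powr (- \<alpha> + e) * H x" .
  have "H x <= (2 ^ Suc k) powr (\<alpha> + e) * H (2 ^ Suc k * x)" by (rule lo_k[OF xy(1)])
  also have "... <= (2 * (y / x)) powr (\<alpha> + e) * H y"
   using k k' e H_pos by (intro mult_mono powr_mono2 H_antimono) (auto intro: less_imp_le)
  also have "(2 * (y / x)) powr (\<alpha> + e) = 2 powr (\<alpha> + e) * (y / x) powr (\<alpha> + e)"
   using yx powr_mult[of 2 "y / x" "\<alpha> + e"] by simp
  finally show "H x <= 2 powr (\<alpha> + e) * (y / x) powr (\<alpha> + e) * H y" .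
 qed
qed

end

locale normalized_tail = regular_tail +
 fixes a :: "nat => real"
 assumes a_pos: "\<And>n. n \<ge> 1 ==> a n > 0"
  and a_norm: "(\<lambda>n. real n * H (a n)) \<longlonglongrightarrow> 1"
begin

text \<open>As \<open>H\<close> is positive everywhere, \<open>n H(a n)\<close> can only stay bounded if \<open>a n\<close> leaves every bounded set.\<close>

lemma a_at_top: "filterlim a at_top sequentially"
proof (rule filterlim_at_top[THEN iffD2], rule allI)
 fix K
 have "filterlim (\<lambda>n. real n * H K) at_top sequentially"
  by (rule filterlim_at_top_mult_tendsto_pos[OF tendsto_const H_pos filterlim_real_sequentially])
 then have "\<forall>\<^sub>F n in sequentially. real n * H K > 2"
  by (simp add: filterlim_at_top_dense)
 moreover have "\<forall>\<^sub>F n in sequentially. real n * H (a n) < 2"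
  using order_tendstoD(2)[OF a_norm, of 2] by simp
 ultimately show "\<forall>\<^sub>F n in sequentially. K <= a n"
 proof eventually_elim
  case (elim n)
  show ?case
  proof (rule ccontr)
   assume "\<not> K <= a n"
   then have "real n * H K <= real n * H (a n)" by (intro mult_left_mono H_antimono) auto
   then show False using elim by linarith
  qed
 qed
qed

lemma tail_limit:
 assumes x: "x > 0"
 shows "(\<lambda>n. real n * H (a n * x)) \<longlonglongrightarrow> x powr (- \<alpha>)"
proof -
 have "(\<lambda>n. H (x * a n) / H (a n)) \<longlonglongrightarrow> x powr (- \<alpha>)"
  by (rule filterlim_compose[OF H_regular[OF x] a_at_top])
 from tendsto_mult[OF a_norm this] show ?thesis
  by (simp add: mult.commute less_imp_neq[OF H_pos, symmetric])
qed

text \<open>The integrable majorant for all limits below. Potter's bounds cover the arguments \<open>a n * x\<close> beyond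
  a fixed threshold; below it, \<open>H\<close> is at most one and a power of \<open>x\<close> compensates the factor \<open>n\<close>.\<close>

lemma tail_bound:
 assumes e: "0 < e" "e < \<alpha>"
 obtains K where "K > 0"
  "\<forall>\<^sub>F n in sequentially. \<forall>x>0. real n * H (a n * x) <= K * power_max \<alpha> e x"
proof -
 obtain x0 where x0: "x0 > 0"
  and up: "\<And>x y. [|x0 <= x; x <= y|] ==> H y <= 2 powr (\<alpha> - e) * (y / x) powr (- \<alpha> + e) * H x"
  and lo: "\<And>x y. [|x0 <= x; x <= y|] ==> H x <= 2 powr (\<alpha> + e) * (y / x) powr (\<alpha> + e) * H y"
  by (rule potter[OF e]) blast
 define K where "K = 2 powr (\<alpha> + e) * 2 / H x0"
 have Kpos: "K > 0" using H_pos[of x0] by (simp add: K_def)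
 have K1: "2 powr (\<alpha> + e) * 2 <= K"
  unfolding K_def using H_pos[of x0] H_le_1[of x0] by (simp add: pos_le_divide_eq)
 have "\<forall>\<^sub>F n in sequentially. real n * H (a n) < 2" "\<forall>\<^sub>F n in sequentially. x0 <= a n"
  using order_tendstoD(2)[OF a_norm, of 2] a_at_top by (auto simp: filterlim_at_top)
 then have "\<forall>\<^sub>F n in sequentially. \<forall>x>0. real n * H (a n * x) <= K * power_max \<alpha> e x"
 proof eventually_elim
  case (elim n)
  show ?case
  proof (intro allI impI)
   fix x :: real assume x: "x > 0"
   have an: "a n > 0" using elim x0 by linarith
   have two: "(2::real) powr (\<alpha> - e) <= 2 powr (\<alpha> + e)" using e by (intro powr_mono) auto
   have nH: "0 <= real n * H (a n)" using less_imp_le[OF H_pos] by simp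
   show "real n * H (a n * x) <= K * power_max \<alpha> e x"
   proof (cases "x \<ge> 1")
    case True
    have "H (a n * x) <= 2 powr (\<alpha> - e) * (a n * x / a n) powr (- \<alpha> + e) * H (a n)"
     by (rule up) (use elim True an in auto)
    then have "real n * H (a n * x) <= real n * (2 powr (\<alpha> - e) * x powr (- \<alpha> + e) * H (a n))"
     using an by (intro mult_left_mono) auto
    also have "... = 2 powr (\<alpha> - e) * (real n * H (a n)) * x powr (- \<alpha> + e)" by (simp add: mult_ac)
    also have "... <= 2 powr (\<alpha> + e) * 2 * x powr (- \<alpha> + e)"
     using elim nH two by (intro mult_right_mono mult_mono) auto
    also have "... <= K * power_max \<alpha> e x"
     using K1 Kpos by (intro mult_mono) auto
    finally show ?thesis .
   next
    case False
    show ?thesis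
    proof (cases "x0 <= a n * x")
     case True
     have "H (a n * x) <= 2 powr (\<alpha> + e) * (a n / (a n * x)) powr (\<alpha> + e) * H (a n)"
      by (rule lo[OF True]) (use an False in auto)
     also have "a n / (a n * x) = 1 / x" using an x by (simp add: field_simps)
     also have "(1 / x) powr (\<alpha> + e) = x powr (- \<alpha> - e)"
      using recip_powr[OF x, of "\<alpha> + e"] by simp
     finally have "real n * H (a n * x) <= real n * (2 powr (\<alpha> + e) * x powr (- \<alpha> - e) * H (a n))"
      by (intro mult_left_mono) auto
     also have "... = 2 powr (\<alpha> + e) * (real n * H (a n)) * x powr (- \<alpha> - e)" by (simp add: mult_ac)
     also have "... <= 2 powr (\<alpha> + e) * 2 * x powr (- \<alpha> - e)"
      using elim nH by (intro mult_right_mono mult_mono) auto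
     also have "... <= K * power_max \<alpha> e x"
      using K1 Kpos by (intro mult_mono) auto
     finally show ?thesis .
    next
     case False': False
     have "H x0 <= 2 powr (\<alpha> + e) * (a n / x0) powr (\<alpha> + e) * H (a n)"
      by (rule lo) (use elim in auto)
     also have "... <= 2 powr (\<alpha> + e) * (1 / x) powr (\<alpha> + e) * H (a n)"
      using False' x x0 e an less_imp_le[OF H_pos]
      by (intro mult_right_mono mult_left_mono powr_mono2) (auto simp: field_simps)
     also have "(1 / x) powr (\<alpha> + e) = x powr (- \<alpha> - e)"
      using recip_powr[OF x, of "\<alpha> + e"] by simp
     finally have "real n * H x0 <= real n * (2 powr (\<alpha> + e) * x powr (- \<alpha> - e) * H (a n))"
      by (intro mult_left_mono) auto
     also have "... = 2 powr (\<alpha> + e) * (real n * H (a n)) * x powr (- \<alpha> - e)" by (simp add: mult_ac)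
     also have "... <= 2 powr (\<alpha> + e) * 2 * x powr (- \<alpha> - e)"
      using elim nH by (intro mult_right_mono mult_mono) auto
     finally have "real n <= K * x powr (- \<alpha> - e)"
      using H_pos[of x0] by (simp add: K_def field_simps)
     moreover have "real n * H (a n * x) <= real n * 1"
      by (intro mult_left_mono H_le_1) auto
     moreover have "K * x powr (- \<alpha> - e) <= K * power_max \<alpha> e x"
      using Kpos by (intro mult_left_mono) auto
     ultimately show ?thesis by linarith
    qed
   qed
  qed
 qed
 with Kpos show ?thesis using that by blast
qed

text \<open>As \<open>\<alpha> < 2\<close>, the normalization grows faster than the square root; the drift correction in the
  characteristic functions is quadratic in \<open>1 / a n\<close> and therefore vanishes.\<close>

lemma n_over_a_square:
 assumes "\<alpha> < 2"
 shows "(\<lambda>n. real n / (a n)\<^sup>2) \<longlonglongrightarrow> 0"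
proof -
 define e where "e = min (\<alpha> / 2) ((2 - \<alpha>) / 2)"
 have e1: "e <= \<alpha> / 2" and e2: "e <= (2 - \<alpha>) / 2"
  unfolding e_def by (rule min.cobounded1, rule min.cobounded2)
 have "0 < e" using assms index_pos by (simp add: e_def)
 moreover have "e < \<alpha>" using e1 index_pos by linarith
 moreover have "\<alpha> + e < 2" using e2 assms by (simp add: field_simps)
 ultimately have e: "0 < e" "e < \<alpha>" "\<alpha> + e < 2" by auto
 obtain K where K: "K > 0"
  "\<forall>\<^sub>F n in sequentially. \<forall>x>0. real n * H (a n * x) <= K * power_max \<alpha> e x"
  using tail_bound[OF e(1,2)] by blast
 have "\<forall>\<^sub>F n in sequentially. 1 <= a n" using a_at_top by (auto simp: filterlim_at_top)
 with K(2) have bound: "\<forall>\<^sub>F n in sequentially. real n / (a n)\<^sup>2 <= K / H 1 * a n powr (\<alpha> + e - 2)"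
 proof eventually_elim
  case (elim n)
  then have an: "a n > 0" "1 <= a n" by auto
  have "real n * H (a n * (1 / a n)) <= K * max ((1 / a n) powr (- \<alpha> - e)) ((1 / a n) powr (- \<alpha> + e))"
   using elim(1)[rule_format, of "1 / a n"] an by simp
  also have "(1 / a n) powr (- \<alpha> - e) = a n powr (\<alpha> + e)"
   using recip_powr[OF an(1), of "- \<alpha> - e"] by (simp add: add.commute)
  also have "(1 / a n) powr (- \<alpha> + e) = a n powr (\<alpha> - e)"
   using recip_powr[OF an(1), of "- \<alpha> + e"] by simp
  also have "max (a n powr (\<alpha> + e)) (a n powr (\<alpha> - e)) = a n powr (\<alpha> + e)"
   using an e by (intro max_absorb1 powr_mono) auto
  finally have "real n * H 1 <= K * a n powr (\<alpha> + e)" using an by simp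
  then have "real n <= K / H 1 * a n powr (\<alpha> + e)" using H_pos[of 1] by (simp add: field_simps)
  then have "real n / (a n)\<^sup>2 <= K / H 1 * a n powr (\<alpha> + e) / (a n)\<^sup>2" by (intro divide_right_mono) auto
  also have "... = K / H 1 * a n powr (\<alpha> + e - 2)"
   using an by (simp add: powr_diff powr_numeral)
  finally show ?case .
 qed
 have "((\<lambda>x::real. x powr (\<alpha> + e - 2)) \<longlongrightarrow> 0) at_top"
  using e tendsto_neg_powr[of "\<alpha> + e - 2" "\<lambda>x. x" at_top] by (simp add: filterlim_ident)
 then have "(\<lambda>n. K / H 1 * a n powr (\<alpha> + e - 2)) \<longlonglongrightarrow> K / H 1 * 0"
  by (intro tendsto_mult_left filterlim_compose[OF _ a_at_top])
 then have z: "(\<lambda>n. K / H 1 * a n powr (\<alpha> + e - 2)) \<longlonglongrightarrow> 0" by simp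
 show ?thesis
  by (rule tendsto_sandwich[OF _ bound tendsto_const z]) (auto intro!: always_eventually)
qed

end

section \<open>Vague convergence of the rescaled law\<close>

lemma powr_less_iff:
 fixes x y s :: real
 assumes "0 < s" "0 <= x" "0 <= y"
 shows "x powr s < y powr s \<longleftrightarrow> x < y"
 using powr_less_mono2[of s x y] powr_mono2[of s y x] assms by linarith

lemma midpoint_between:
 fixes L x :: real
 assumes "0 <= L" "L < x"
 shows "0 < (x + L) / 2 \<and> (x + L) / 2 < x \<and> L < (x + L) / 2"
 using assms by auto

lemma integrable_powr_at_0:
 assumes "s > (-1::real)"
 shows "integrable lborel (\<lambda>y. indicator {0<..1} y * y powr s)"
proof -
 have "((\<lambda>x. x powr s) has_integral (1 powr (s+1) / (s+1))) {0..1}"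
  by (rule has_integral_powr_from_0) (use assms in auto)
 then have "(\<lambda>x. x powr s) integrable_on {0..1}" by (auto simp: integrable_on_def)
 then have "(\<lambda>x. x powr s) absolutely_integrable_on {0..1}"
  by (intro nonnegative_absolutely_integrable_1) auto
 then have "integrable lebesgue (\<lambda>y. indicator {0..1} y *\<^sub>R y powr s)"
  by (simp add: set_integrable_def)
 then have "integrable lborel (\<lambda>y. indicator {0..1} y *\<^sub>R y powr s)"
  by (subst (asm) integrable_completion) auto
 moreover have "(\<lambda>y::real. indicator {0..1} y *\<^sub>R y powr s) = (\<lambda>y. indicator {0<..1} y * y powr s)"
  by (auto simp: indicator_def fun_eq_iff)
 ultimately show ?thesis by simp
qed

lemma integrable_powr_at_top:
 assumes "s < (-1::real)"
 shows "integrable lborel (\<lambda>y. indicator {1..} y * y powr s)"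
proof -
 have "((\<lambda>x. x powr s) has_integral (-(1 powr (s+1)) / (s+1))) {1..}"
  by (rule has_integral_powr_to_inf) (use assms in auto)
 then have "(\<lambda>x. x powr s) integrable_on {1..}" by (auto simp: integrable_on_def)
 then have "(\<lambda>x. x powr s) absolutely_integrable_on {1..}"
  by (intro nonnegative_absolutely_integrable_1) auto
 then have "integrable lebesgue (\<lambda>y. indicator {1..} y *\<^sub>R y powr s)"
  by (simp add: set_integrable_def)
 then show ?thesis
  by (subst (asm) integrable_completion) auto
qed

text \<open>The law of the quantile function under Lebesgue measure on \<open>(0,1)\<close> is \<open>\<mu>\<close>. With the substitution
  \<open>u = 1 - y / n\<close>, integrals against \<open>n\<close> copies of the rescaled law become Lebesgue integrals over \<open>(0, n)\<close>,
  so that vague convergence turns into dominated convergence.\<close>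

definition quantile :: "real measure => real => real" where
 "quantile \<mu> u = Inf {x. u <= cdf \<mu> x}"

lemma quantile_le_iff:
 assumes "real_distribution \<mu>" "0 < u" "u < 1"
 shows "quantile \<mu> u <= x \<longleftrightarrow> u <= cdf \<mu> x"
proof -
 interpret real_distribution \<mu> by fact
 interpret cdf_distribution \<mu> ..
 show ?thesis unfolding quantile_def by (rule pseudoinverse[OF assms(2,3), symmetric])
qed

lemma integral_quantile:
 fixes f :: "real => 'b::{banach, second_countable_topology}"
 assumes "real_distribution \<mu>" and f: "f \<in> borel_measurable borel"
 shows "(\<lambda>u. indicator {0<..<1} u *\<^sub>R f (quantile \<mu> u)) \<in> borel_measurable lborel"
  and "(\<integral>x. f x \<partial>\<mu>) = (\<integral>u. indicator {0<..<1} u *\<^sub>R f (quantile \<mu> u) \<partial>lborel)"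
  and "integrable \<mu> f \<longleftrightarrow> integrable lborel (\<lambda>u. indicator {0<..<1} u *\<^sub>R f (quantile \<mu> u))"
proof -
 interpret real_distribution \<mu> by fact
 interpret cdf_distribution \<mu> ..
 let ?R = "restrict_space lborel {0<..<1::real}"
 have "sets ?R = sets (restrict_space borel {0<..<1::real})" by (rule sets_restrict_space_cong) simp
 from measurable_cong_sets[OF this refl] have m: "quantile \<mu> \<in> borel_measurable ?R"
  using measurable_CI unfolding quantile_def[abs_def] by blast
 have fm: "(\<lambda>u. f (quantile \<mu> u)) \<in> borel_measurable ?R" by (rule measurable_compose[OF m f])
 then show "(\<lambda>u. indicator {0<..<1} u *\<^sub>R f (quantile \<mu> u)) \<in> borel_measurable lborel"
  by (subst (asm) borel_measurable_restrict_space_iff) auto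
 have "integrable \<mu> f \<longleftrightarrow> integrable (distr ?R borel (quantile \<mu>)) f"
  using distr_I_eq_M by (simp add: quantile_def[abs_def])
 also have "... \<longleftrightarrow> integrable ?R (\<lambda>u. f (quantile \<mu> u))" by (rule integrable_distr_eq[OF m f])
 also have "... \<longleftrightarrow> integrable lborel (\<lambda>u. indicator {0<..<1} u *\<^sub>R f (quantile \<mu> u))"
  by (subst integrable_restrict_space) (auto simp: set_integrable_def)
 finally show "integrable \<mu> f \<longleftrightarrow> integrable lborel (\<lambda>u. indicator {0<..<1} u *\<^sub>R f (quantile \<mu> u))" .
 have "(\<integral>x. f x \<partial>\<mu>) = (\<integral>x. f x \<partial>distr ?R borel (quantile \<mu>))"
  using distr_I_eq_M by (simp add: quantile_def[abs_def])
 also have "... = (\<integral>u. f (quantile \<mu> u) \<partial>?R)"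
  using m f by (subst integral_distr) auto
 also have "... = (\<integral>u. indicator {0<..<1} u *\<^sub>R f (quantile \<mu> u) \<partial>lborel)"
  by (subst integral_restrict_space) (auto simp: set_lebesgue_integral_def)
 finally show "(\<integral>x. f x \<partial>\<mu>) = (\<integral>u. indicator {0<..<1} u *\<^sub>R f (quantile \<mu> u) \<partial>lborel)" .
qed

text \<open>The integrands \<open>Q n\<close> converge pointwise because the tail limit, inverted, is the limit of the
  quantiles; the tail bound, inverted, bounds the quantiles by \<open>D\<close> and thus \<open>Q n\<close> by \<open>W\<close>.\<close>

lemma one_sided_vague_convergence:
 fixes g :: "real => 'b::{banach, second_countable_topology}" and a :: "nat => real"
 assumes \<mu>: "real_distribution \<mu>" and supp: "\<And>x. x < 0 ==> cdf \<mu> x = 0"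
  and a: "\<And>n. n \<ge> 1 ==> a n > 0" and \<alpha>: "\<alpha> > 0" and e: "0 < e" "e < \<alpha>" and K: "K > 0" and q: "q \<ge> 0"
  and bound: "\<forall>\<^sub>F n in sequentially. \<forall>x>0. real n * (1 - cdf \<mu> (a n * x)) <= K * power_max \<alpha> e x"
  and lim: "\<And>x. x > 0 ==> (\<lambda>n. real n * (1 - cdf \<mu> (a n * x))) \<longlonglongrightarrow> q * x powr (- \<alpha>)"
  and g: "continuous_on UNIV g" and gb: "\<And>x. x \<ge> 0 ==> norm (g x) <= G * min (x powr b1) (x powr b2)"
  and b: "\<alpha> + e < b1" "0 < b2" "b2 < \<alpha> - e"
 shows "(\<lambda>n. real n *\<^sub>R (\<integral>x. g (x / a n) \<partial>\<mu>)) \<longlonglongrightarrow> (\<integral>y. indicator {0<..} y *\<^sub>R g ((q / y) powr (1 / \<alpha>)) \<partial>lborel)"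
  and "integrable lborel (\<lambda>y. indicator {0<..} y *\<^sub>R g ((q / y) powr (1 / \<alpha>)))"
  and "\<forall>\<^sub>F n in sequentially. integrable \<mu> (\<lambda>x. g (x / a n))"
proof -
 interpret \<mu>: real_distribution \<mu> by fact
 define Q where "Q n y = (indicator {0<..<real n} y *\<^sub>R g (quantile \<mu> (1 - y / real n) / a n) :: 'b)" for n y
 define D where "D y = max ((y / K) powr (- 1 / (\<alpha> + e))) ((y / K) powr (- 1 / (\<alpha> - e)))" for y
 define W where "W z = G * (indicator {0<..1} z * z powr (- b2 / (\<alpha> - e)) + indicator {1..} z * z powr (- b1 / (\<alpha> + e)))" for z :: real
 have gm: "g \<in> borel_measurable borel" using g by (rule borel_measurable_continuous_onI)
 have G0: "G \<ge> 0" using order_trans[OF norm_ge_zero gb[of 1]] by simp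
 have Qm: "Q n \<in> borel_measurable lborel" and Qint: "real n *\<^sub>R (\<integral>x. g (x / a n) \<partial>\<mu>) = (\<integral>y. Q n y \<partial>lborel)"
  and Qiff: "integrable \<mu> (\<lambda>x. g (x / a n)) \<longleftrightarrow> integrable lborel (Q n)"
  if n: "n \<ge> 1" for n
 proof -
  let ?f = "\<lambda>u. indicator {0<..<1} u *\<^sub>R g (quantile \<mu> u / a n)"
  have gma: "(\<lambda>x. g (x / a n)) \<in> borel_measurable borel"
   by (rule measurable_compose[OF _ gm]) auto
  have eq: "?f (1 + (- 1 / real n) * y) = Q n y" for y
   using n by (auto simp: Q_def indicator_def field_simps)
  have fm: "?f \<in> borel_measurable borel" using integral_quantile(1)[OF \<mu> gma] by simp
  have "(\<lambda>y. ?f (1 + (- 1 / real n) * y)) \<in> borel_measurable borel"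
   by (rule measurable_compose[OF _ fm]) auto
  then show "Q n \<in> borel_measurable lborel" unfolding eq by simp
  have "(\<integral>x. g (x / a n) \<partial>\<mu>) = (\<integral>u. ?f u \<partial>lborel)" by (rule integral_quantile(2)[OF \<mu> gma])
  also have "... = \<bar>- 1 / real n\<bar> *\<^sub>R (\<integral>y. ?f (1 + (- 1 / real n) * y) \<partial>lborel)"
   by (rule lborel_integral_real_affine) (use n in auto)
  also have "... = \<bar>- 1 / real n\<bar> *\<^sub>R (\<integral>y. Q n y \<partial>lborel)" unfolding eq ..
  finally show "real n *\<^sub>R (\<integral>x. g (x / a n) \<partial>\<mu>) = (\<integral>y. Q n y \<partial>lborel)"
   using n by simp
  have "integrable lborel ?f \<longleftrightarrow> integrable lborel (\<lambda>y. ?f (1 + (- 1 / real n) * y))"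
   by (rule lborel_integrable_real_affine_iff[symmetric]) (use n in auto)
  then show "integrable \<mu> (\<lambda>x. g (x / a n)) \<longleftrightarrow> integrable lborel (Q n)"
   unfolding eq using integral_quantile(3)[OF \<mu> gma] by simp
 qed
 have qn0: "quantile \<mu> u \<ge> 0" if "0 < u" "u < 1" for u
 proof (rule ccontr)
  assume "\<not> 0 <= quantile \<mu> u"
  then have "cdf \<mu> (quantile \<mu> u) = 0" using supp by simp
  then show False using quantile_le_iff[OF \<mu> that, of "quantile \<mu> u"] that by simp
 qed
 have qle: "quantile \<mu> (1 - y / real n) / a n <= x \<longleftrightarrow> real n * (1 - cdf \<mu> (a n * x)) <= y"
  if "n \<ge> 1" "0 < y" "y < real n" for n x y
 proof -
  have "quantile \<mu> (1 - y / real n) / a n <= x \<longleftrightarrow> quantile \<mu> (1 - y / real n) <= a n * x"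
   using a[OF that(1)] by (simp add: divide_le_eq mult.commute)
  also have "... \<longleftrightarrow> 1 - y / real n <= cdf \<mu> (a n * x)"
   by (rule quantile_le_iff[OF \<mu>]) (use that in auto)
  also have "... \<longleftrightarrow> real n * (1 - cdf \<mu> (a n * x)) <= y" using that by (simp add: field_simps)
  finally show ?thesis .
 qed
 have ptw: "(\<lambda>n. Q n y) \<longlonglongrightarrow> indicator {0<..} y *\<^sub>R g ((q / y) powr (1 / \<alpha>))" for y
 proof (cases "y > 0")
  case False
  then show ?thesis by (simp add: Q_def)
 next
  case y: True
  let ?L = "(q / y) powr (1 / \<alpha>)"
  have big: "\<forall>\<^sub>F n in sequentially. y < real n \<and> n \<ge> 1"
   by (intro eventually_conj eventually_ge_at_top filterlim_real_sequentially[unfolded filterlim_at_top_dense, rule_format])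
  have cmp: "x powr (- \<alpha>) * q < y \<longleftrightarrow> ?L < x" "y < x powr (- \<alpha>) * q \<longleftrightarrow> x < ?L" if x: "x > 0" for x
  proof -
   have xx: "(x powr \<alpha>) powr (1 / \<alpha>) = x" using \<alpha> x by (simp add: powr_powr)
   have "x powr (- \<alpha>) * q < y \<longleftrightarrow> q / y < x powr \<alpha>"
    using x y by (simp add: powr_minus field_simps)
   also have "... \<longleftrightarrow> ?L < (x powr \<alpha>) powr (1 / \<alpha>)"
    by (rule powr_less_iff[symmetric]) (use q y \<alpha> in auto)
   finally show "x powr (- \<alpha>) * q < y \<longleftrightarrow> ?L < x" using xx by simp
   have "y < x powr (- \<alpha>) * q \<longleftrightarrow> x powr \<alpha> < q / y"
    using x y by (simp add: powr_minus field_simps)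
   also have "... \<longleftrightarrow> (x powr \<alpha>) powr (1 / \<alpha>) < ?L"
    by (rule powr_less_iff[symmetric]) (use q y \<alpha> in auto)
   finally show "y < x powr (- \<alpha>) * q \<longleftrightarrow> x < ?L" using xx by simp
  qed
  have lJ: "(\<lambda>n. quantile \<mu> (1 - y / real n) / a n) \<longlonglongrightarrow> ?L"
  proof (rule order_tendstoI)
   fix x assume x: "x < ?L"
   show "\<forall>\<^sub>F n in sequentially. x < quantile \<mu> (1 - y / real n) / a n"
   proof (cases "x < 0")
    case True
    show ?thesis using big
    proof eventually_elim
     case (elim n)
     then have "0 <= quantile \<mu> (1 - y / real n)" using y by (intro qn0) auto
     then have "0 <= quantile \<mu> (1 - y / real n) / a n" using a[of n] elim by simp
     then show ?case using True by linarith
    qed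
   next
    case False
    define x' where "x' = (x + ?L) / 2"
    have x': "x' > 0" "x < x'" "x' < ?L" using x False by (auto simp: x'_def)
    then have "y < q * x' powr (- \<alpha>)" using cmp(2)[of x'] by (simp add: mult.commute)
    then have "\<forall>\<^sub>F n in sequentially. y < real n * (1 - cdf \<mu> (a n * x'))"
     by (rule order_tendstoD(1)[OF lim[OF x'(1)]])
    with big show ?thesis
    proof eventually_elim
     case (elim n)
     then have "x' < quantile \<mu> (1 - y / real n) / a n"
      using qle[of n y x'] y by (simp add: not_le[symmetric])
     then show ?case using x' by linarith
    qed
   qed
  next
   fix x assume x: "?L < x"
   have L0: "0 <= ?L" by simp
   define x' where "x' = (x + ?L) / 2"
   have x': "x' > 0" "x' < x" "?L < x'"
    using midpoint_between[OF L0 x] by (auto simp: x'_def)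
   then have "q * x' powr (- \<alpha>) < y" using cmp(1)[of x'] by (simp add: mult.commute)
   then have "\<forall>\<^sub>F n in sequentially. real n * (1 - cdf \<mu> (a n * x')) < y"
    by (rule order_tendstoD(2)[OF lim[OF x'(1)]])
   with big show "\<forall>\<^sub>F n in sequentially. quantile \<mu> (1 - y / real n) / a n < x"
   proof eventually_elim
    case (elim n)
    then have "quantile \<mu> (1 - y / real n) / a n <= x'" using qle[of n y x'] y by simp
    then show ?case using x' by linarith
   qed
  qed
  have "isCont g ?L" using g by (simp add: continuous_on_eq_continuous_at)
  from isCont_tendsto_compose[OF this lJ]
  have "(\<lambda>n. g (quantile \<mu> (1 - y / real n) / a n)) \<longlonglongrightarrow> g ?L" .
  moreover have "\<forall>\<^sub>F n in sequentially. g (quantile \<mu> (1 - y / real n) / a n) = Q n y"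
   using big by eventually_elim (use y in \<open>auto simp: Q_def\<close>)
  ultimately have "(\<lambda>n. Q n y) \<longlonglongrightarrow> g ?L" by (rule Lim_transform_eventually)
  then show ?thesis using y by simp
 qed
 \<comment> \<open>\<open>D y\<close> inverts the tail bound: at the level \<open>D y\<close> the bound has already fallen to \<open>y\<close>.\<close>
 have D_tail: "K * power_max \<alpha> e (D y) <= y" and D_pos: "D y > 0" if y: "y > 0" for y
 proof -
  have z: "y / K > 0" using y K by simp
  have P1: "(y / K) powr 1 = y / K" using z by (intro powr_one less_imp_le)
  show Dp: "D y > 0" unfolding D_def using y K by (simp add: less_max_iff_disj)
  have "D y powr (- \<alpha> - e) <= ((y / K) powr (- 1 / (\<alpha> + e))) powr (- \<alpha> - e)"
   unfolding D_def using z e \<alpha> by (intro powr_mono2') auto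
  also have "... = (y / K) powr 1"
   unfolding powr_powr using e \<alpha> by (intro arg_cong2[where f = "(powr)"] refl) (simp add: field_simps)
  finally have 1: "D y powr (- \<alpha> - e) <= y / K" unfolding P1 .
  have "D y powr (- \<alpha> + e) <= ((y / K) powr (- 1 / (\<alpha> - e))) powr (- \<alpha> + e)"
   unfolding D_def using z e \<alpha> by (intro powr_mono2') auto
  also have "... = (y / K) powr 1"
   unfolding powr_powr using e \<alpha> by (intro arg_cong2[where f = "(powr)"] refl) (simp add: field_simps)
  finally have 2: "D y powr (- \<alpha> + e) <= y / K" unfolding P1 .
  show "K * power_max \<alpha> e (D y) <= y"
   using 1 2 K by (simp add: pos_le_divide_eq mult.commute)
 qed
 have D_W: "G * min (D y powr b1) (D y powr b2) <= W (y / K)" if y: "y > 0" for y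
 proof -
  have z: "y / K > 0" using y K by simp
  have "min (D y powr b1) (D y powr b2) <= indicator {0<..1} (y / K) * (y / K) powr (- b2 / (\<alpha> - e)) + indicator {1..} (y / K) * (y / K) powr (- b1 / (\<alpha> + e))"
  proof (cases "y / K <= 1")
   case True
   have "D y = (y / K) powr (- 1 / (\<alpha> - e))"
    unfolding D_def using True z e \<alpha> by (intro max_absorb2 powr_mono') (auto simp: field_simps)
   then have "D y powr b2 = (y / K) powr (- b2 / (\<alpha> - e))" by (simp add: powr_powr)
   moreover have "0 <= indicator {1..} (y / K) * (y / K) powr (- b1 / (\<alpha> + e))" by simp
   ultimately show ?thesis using True z by (simp add: min_le_iff_disj indicator_def)
  next
   case False
   have "D y = (y / K) powr (- 1 / (\<alpha> + e))"
    unfolding D_def using False z e \<alpha> by (intro max_absorb1 powr_mono) (auto simp: field_simps)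
   then have "D y powr b1 = (y / K) powr (- b1 / (\<alpha> + e))" by (simp add: powr_powr)
   then show ?thesis using False z by (simp add: min_le_iff_disj indicator_def)
  qed
  then show ?thesis unfolding W_def using G0 by (intro mult_left_mono) auto
 qed
 have W_int: "integrable lborel (\<lambda>y. W (y / K))"
 proof -
  have "integrable lborel W"
   unfolding W_def using b e \<alpha>
   by (intro integrable_mult_right Bochner_Integration.integrable_add integrable_powr_at_0 integrable_powr_at_top)
     (auto simp: field_simps)
  from lborel_integrable_real_affine[OF this, of "1 / K" 0] show ?thesis using K by simp
 qed
 have W0: "W z \<ge> 0" for z using G0 by (simp add: W_def)
 obtain n0 where n0: "\<And>n x. n \<ge> n0 ==> x > 0 ==> real n * (1 - cdf \<mu> (a n * x)) <= K * power_max \<alpha> e x"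
  using bound unfolding eventually_sequentially by blast
 have dom: "norm (Q n y) <= W (y / K)" if n: "n \<ge> max 1 n0" for n y
 proof (cases "0 < y \<and> y < real n")
  case False
  then show ?thesis using W0 by (auto simp: Q_def)
 next
  case True
  let ?J = "quantile \<mu> (1 - y / real n) / a n"
  have J: "?J <= D y" using qle[of n y "D y"] n0[of n "D y"] D_tail[of y] D_pos[of y] True n by auto
  have J0: "0 <= ?J" using qn0[of "1 - y / real n"] a[of n] n True by simp
  have "norm (Q n y) = norm (g ?J)" using True by (simp add: Q_def)
  also have "... <= G * min (?J powr b1) (?J powr b2)" by (rule gb[OF J0])
  also have "... <= G * min (D y powr b1) (D y powr b2)"
   using J J0 G0 b e \<alpha> by (intro mult_left_mono min.mono powr_mono2) auto
  also have "... <= W (y / K)" by (rule D_W) (use True in simp)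
  finally show ?thesis .
 qed
 define N where "N = max 1 n0"
 have limN: "(\<lambda>n. Q (n + N) y) \<longlonglongrightarrow> indicator {0<..} y *\<^sub>R g ((q / y) powr (1 / \<alpha>))" for y
  by (rule LIMSEQ_ignore_initial_segment[OF ptw])
 have Lm: "(\<lambda>y. indicator {0<..} y *\<^sub>R g ((q / y) powr (1 / \<alpha>))) \<in> borel_measurable lborel"
  by (intro borel_measurable_scaleR measurable_compose[OF _ gm]) auto
 have QmN: "Q (n + N) \<in> borel_measurable lborel" for n by (rule Qm) (simp add: N_def)
 have domN: "AE y in lborel. norm (Q (n + N) y) <= W (y / K)" for n
  by (intro AE_I2 dom) (simp add: N_def)
 note dc = integral_dominated_convergence[OF Lm QmN W_int AE_I2[OF limN] domN]
  integrable_dominated_convergence[OF Lm QmN W_int AE_I2[OF limN] domN]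
 show "integrable lborel (\<lambda>y. indicator {0<..} y *\<^sub>R g ((q / y) powr (1 / \<alpha>)))"
  using dc(2) .
 have "integrable \<mu> (\<lambda>x. g (x / a n))" if n: "n \<ge> N" for n
 proof -
  have "integrable lborel (Q n)"
   by (rule Bochner_Integration.integrable_bound[OF W_int Qm])
    (use n dom[of n] W0 in \<open>auto simp: N_def\<close>)
  then show ?thesis using Qiff[of n] n by (simp add: N_def)
 qed
 then show "\<forall>\<^sub>F n in sequentially. integrable \<mu> (\<lambda>x. g (x / a n))"
  unfolding eventually_sequentially by blast
 have "(\<lambda>n. \<integral>y. Q (n + N) y \<partial>lborel) = (\<lambda>n. real (n + N) *\<^sub>R (\<integral>x. g (x / a (n + N)) \<partial>\<mu>))"
  by (intro ext Qint[symmetric]) (simp add: N_def)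
 from dc(1)[unfolded this]
 show "(\<lambda>n. real n *\<^sub>R (\<integral>x. g (x / a n) \<partial>\<mu>)) \<longlonglongrightarrow> (\<integral>y. indicator {0<..} y *\<^sub>R g ((q / y) powr (1 / \<alpha>)) \<partial>lborel)"
  by (rule LIMSEQ_offset)
qed

text \<open>A bound of this form, with \<open>b2 < \<alpha> < b1\<close>, is what makes a function integrable against a measure
  with tails of order \<open>\<alpha>\<close> both at the origin and at infinity.\<close>

abbreviation power_min :: "real => real => real => real" where
 "power_min b1 b2 x \<equiv> min (\<bar>x\<bar> powr b1) (\<bar>x\<bar> powr b2)"

text \<open>The image of Lebesgue measure under this function is the L\'evy measure of the limit: it gives
  mass \<open>p x\<^sup>-\<^sup>\<alpha>\<close> to \<open>(x, \<infinity>)\<close> and \<open>r x\<^sup>-\<^sup>\<alpha>\<close> to \<open>(- \<infinity>, - x)\<close>.\<close>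

definition jump :: "real => real => real => real => real" where
 "jump \<alpha> p r y = (if 0 < y then (p / y) powr (1 / \<alpha>) else - ((r / (- y)) powr (1 / \<alpha>)))"

lemma measurable_jump[measurable]: "jump \<alpha> p r \<in> borel_measurable borel"
 unfolding jump_def[abs_def] by measurable

text \<open>The law \<open>\<mu>\<close> of the innovations: regularly varying tails with balance \<open>p\<close>, \<open>r\<close> and normalization \<open>a\<close>.\<close>

locale stable_domain = real_distribution \<mu> for \<mu> :: "real measure" +
 fixes \<alpha> p r :: real and a :: "nat => real"
 assumes alpha: "0 < \<alpha>" "\<alpha> < 2"
  and tail_pos: "\<And>x. 0 < measure \<mu> {y. x < \<bar>y\<bar>}"
  and tail_regular: "\<And>c. c > 0 ==> ((\<lambda>x. measure \<mu> {y. c * x < \<bar>y\<bar>} / measure \<mu> {y. x < \<bar>y\<bar>}) \<longlongrightarrow> c powr (- \<alpha>)) at_top"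
  and right_tail: "((\<lambda>x. measure \<mu> {x<..} / measure \<mu> {y. x < \<bar>y\<bar>}) \<longlongrightarrow> p) at_top"
  and left_tail: "((\<lambda>x. measure \<mu> {..<- x} / measure \<mu> {y. x < \<bar>y\<bar>}) \<longlongrightarrow> r) at_top"
  and a_pos': "\<And>n. n \<ge> 1 ==> a n > 0"
  and a_norm': "(\<lambda>n. real n * measure \<mu> {y. a n < \<bar>y\<bar>}) \<longlonglongrightarrow> 1"
  and symmetric: "\<alpha> = 1 ==> distr \<mu> borel uminus = \<mu>"
begin

abbreviation "J \<equiv> jump \<alpha> p r"

sublocale normalized_tail "\<lambda>x. measure \<mu> {y. x < \<bar>y\<bar>}" \<alpha> a
proof
 show "measure \<mu> {z. y < \<bar>z\<bar>} <= measure \<mu> {z. x < \<bar>z\<bar>}" if "x <= y" for x y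
  using that by (intro finite_measure_mono) auto
qed (use alpha tail_pos tail_regular a_pos' a_norm' in auto)

lemma tail_split:
 assumes "x \<ge> 0"
 shows "measure \<mu> {y. x < \<bar>y\<bar>} = measure \<mu> {x<..} + measure \<mu> {..<- x}"
proof -
 have "{y. x < \<bar>y\<bar>} = {x<..} \<union> {..<- x}" using assms by auto
 moreover have "measure \<mu> ({x<..} \<union> {..<- x}) = measure \<mu> {x<..} + measure \<mu> {..<- x}"
  by (rule finite_measure_Union) (use assms in auto)
 ultimately show ?thesis by simp
qed

lemma p_plus_r: "p + r = 1"
proof -
 have "((\<lambda>x. measure \<mu> {x<..} / measure \<mu> {y. x < \<bar>y\<bar>} + measure \<mu> {..<- x} / measure \<mu> {y. x < \<bar>y\<bar>}) \<longlongrightarrow> p + r) at_top"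
  by (intro tendsto_add right_tail left_tail)
 moreover have "\<forall>\<^sub>F x in at_top. measure \<mu> {x<..} / measure \<mu> {y. x < \<bar>y\<bar>} + measure \<mu> {..<- x} / measure \<mu> {y. x < \<bar>y\<bar>} = 1"
  using eventually_ge_at_top[of 0]
 proof eventually_elim
  case (elim x)
  then show ?case using tail_split[OF elim] tail_pos[of x] by (simp add: add_divide_distrib[symmetric])
 qed
 ultimately have "((\<lambda>x::real. 1) \<longlongrightarrow> p + r) at_top"
  by (rule Lim_transform_eventually)
 then show ?thesis using tendsto_unique[OF _ tendsto_const] by (metis trivial_limit_at_top_linorder)
qed

lemma p_nonneg: "0 <= p"
 by (rule tendsto_lowerbound[OF right_tail]) auto

lemma r_nonneg: "0 <= r"
 by (rule tendsto_lowerbound[OF left_tail]) auto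

lemma p_eq_r: assumes "\<alpha> = 1" shows "p = r"
proof -
 have "measure \<mu> {x<..} = measure \<mu> {..<- x}" for x
 proof -
  have "measure \<mu> {x<..} = measure (distr \<mu> borel uminus) {x<..}" using symmetric[OF assms] by simp
  also have "... = measure \<mu> (uminus -` {x<..} \<inter> space \<mu>)" by (rule measure_distr) auto
  also have "uminus -` {x<..} \<inter> space \<mu> = {..<- x}" by auto
  finally show ?thesis .
 qed
 then show ?thesis using tendsto_unique[OF _ right_tail] left_tail by auto
qed

lemma right_tail_limit:
 assumes x: "x > 0"
 shows "(\<lambda>n. real n * measure \<mu> {a n * x<..}) \<longlonglongrightarrow> p * x powr (- \<alpha>)"
proof -
 have ax: "filterlim (\<lambda>n. a n * x) at_top sequentially"
  by (rule filterlim_at_top_mult_tendsto_pos[OF tendsto_const x a_at_top])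
 show ?thesis
  using tendsto_mult[OF filterlim_compose[OF right_tail ax] tail_limit[OF x]]
  by (simp add: mult.commute less_imp_neq[OF tail_pos, symmetric])
qed

lemma left_tail_limit:
 assumes x: "x > 0"
 shows "(\<lambda>n. real n * measure \<mu> {..<- (a n * x)}) \<longlonglongrightarrow> r * x powr (- \<alpha>)"
proof -
 have ax: "filterlim (\<lambda>n. a n * x) at_top sequentially"
  by (rule filterlim_at_top_mult_tendsto_pos[OF tendsto_const x a_at_top])
 show ?thesis
  using tendsto_mult[OF filterlim_compose[OF left_tail ax] tail_limit[OF x]]
  by (simp add: mult.commute less_imp_neq[OF tail_pos, symmetric])
qed

text \<open>The positive and the negative part of the variable are handled by the one-sided result, and the
  two contributions recombine because \<open>g 0 = 0\<close>.\<close>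

lemma vague_convergence:
 fixes g :: "real => 'b::{banach, second_countable_topology}"
 assumes g: "continuous_on UNIV g" and gb: "\<And>x. norm (g x) <= G * power_min b1 b2 x"
  and b: "\<alpha> < b1" "0 < b2" "b2 < \<alpha>"
 shows "(\<lambda>n. real n *\<^sub>R (\<integral>x. g (x / a n) \<partial>\<mu>)) \<longlonglongrightarrow> (\<integral>y. g (J y) \<partial>lborel)"
  and "integrable lborel (\<lambda>y. g (J y))"
  and "\<forall>\<^sub>F n in sequentially. integrable \<mu> (\<lambda>x. g (x / a n))"
proof -
 define m where "m = min (b1 - \<alpha>) (\<alpha> - b2)"
 have "m <= b1 - \<alpha>" "m <= \<alpha> - b2" "0 < m" using b by (simp_all add: m_def)
 moreover define e where "e = m / 2"
 ultimately have e: "0 < e" "\<alpha> + e < b1" "b2 < \<alpha> - e" "e < \<alpha>"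
  using b by (auto simp: e_def field_simps)
 obtain K where K: "K > 0" and bound:
  "\<forall>\<^sub>F n in sequentially. \<forall>x>0. real n * measure \<mu> {y. a n * x < \<bar>y\<bar>} <= K * power_max \<alpha> e x"
  using tail_bound[OF e(1,4)] by blast
 have gm[measurable]: "g \<in> borel_measurable borel" using g by (rule borel_measurable_continuous_onI)
 have g0: "g 0 = 0" using gb[of 0] b by simp
 have one: "(\<lambda>n. real n *\<^sub>R (\<integral>x. h (T x / a n) \<partial>\<mu>)) \<longlonglongrightarrow> (\<integral>y. indicator {0<..} y *\<^sub>R h ((q / y) powr (1 / \<alpha>)) \<partial>lborel) \<and>
   integrable lborel (\<lambda>y. indicator {0<..} y *\<^sub>R h ((q / y) powr (1 / \<alpha>))) \<and>
   (\<forall>\<^sub>F n in sequentially. integrable \<mu> (\<lambda>x. h (T x / a n)))"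
  if h: "continuous_on UNIV h" and hb: "\<And>x. x \<ge> 0 ==> norm (h x) <= G * min (x powr b1) (x powr b2)"
   and T: "T \<in> borel_measurable borel" "\<And>x. T x \<ge> 0" and q: "q \<ge> 0"
   and sub: "\<And>x t. 0 <= t ==> t < T x ==> t < \<bar>x\<bar>"
   and lim: "\<And>x. x > 0 ==> (\<lambda>n. real n * measure \<mu> {y. a n * x < T y}) \<longlonglongrightarrow> q * x powr (- \<alpha>)"
  for h :: "real => 'b" and T :: "real => real" and q
 proof -
  let ?\<nu> = "distr \<mu> borel T"
  have Tm[measurable]: "T \<in> borel_measurable \<mu>" using T(1) by simp
  have \<nu>: "real_distribution ?\<nu>" by (rule real_distribution_distr) simp
  have cdf: "cdf ?\<nu> t = 1 - measure \<mu> {y. t < T y}" for t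
  proof -
   have "cdf ?\<nu> t = measure \<mu> {y. T y <= t}"
    unfolding cdf_def by (subst measure_distr) (auto intro!: arg_cong[where f = "measure \<mu>"])
   also have "... = 1 - measure \<mu> {y. t < T y}"
    using prob_compl[of "{y. t < T y}"] T(1) by (simp add: Compl_eq_Diff_UNIV[symmetric] Collect_neg_eq[symmetric] not_less)
   finally show ?thesis .
  qed
  have supp: "cdf ?\<nu> x = 0" if "x < 0" for x
  proof -
   have "T y > x" for y using that T(2)[of y] by linarith
   then show ?thesis using prob_space by (simp add: cdf)
  qed
  have bound': "\<forall>\<^sub>F n in sequentially. \<forall>x>0. real n * (1 - cdf ?\<nu> (a n * x)) <= K * power_max \<alpha> e x"
   using bound eventually_ge_at_top[of 1]
  proof eventually_elim
   case (elim n)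
   show ?case
   proof (intro allI impI)
    fix x :: real assume x: "x > 0"
    have "measure \<mu> {y. a n * x < T y} <= measure \<mu> {y. a n * x < \<bar>y\<bar>}"
     using sub a_pos[OF elim(2)] x by (intro finite_measure_mono) auto
    then have "real n * (1 - cdf ?\<nu> (a n * x)) <= real n * measure \<mu> {y. a n * x < \<bar>y\<bar>}"
     by (simp add: cdf mult_left_mono)
    also have "... <= K * power_max \<alpha> e x" using elim(1) x by blast
    finally show "real n * (1 - cdf ?\<nu> (a n * x)) <= K * power_max \<alpha> e x" .
   qed
  qed
  have lim': "(\<lambda>n. real n * (1 - cdf ?\<nu> (a n * x))) \<longlonglongrightarrow> q * x powr (- \<alpha>)" if "x > 0" for x
   using lim[OF that] by (simp add: cdf)
  have hm: "h \<in> borel_measurable borel" using h by (rule borel_measurable_continuous_onI)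
  have hTm: "(\<lambda>x. h (x / a n)) \<in> borel_measurable borel" for n
   by (rule measurable_compose[OF _ hm]) simp
  note * = one_sided_vague_convergence[OF \<nu> supp a_pos alpha(1) e(1,4) K q bound' lim' h hb e(2) b(2) e(3)]
  have "(\<lambda>n. real n *\<^sub>R (\<integral>x. h (T x / a n) \<partial>\<mu>)) = (\<lambda>n. real n *\<^sub>R (\<integral>x. h (x / a n) \<partial>?\<nu>))"
   by (intro ext) (simp add: integral_distr hTm)
  moreover have "integrable \<mu> (\<lambda>x. h (T x / a n)) \<longleftrightarrow> integrable ?\<nu> (\<lambda>x. h (x / a n))" for n
   by (simp add: integrable_distr_eq hTm)
  ultimately show ?thesis using * by simp
 qed
 have P: "(\<lambda>n. real n *\<^sub>R (\<integral>x. g (max x 0 / a n) \<partial>\<mu>)) \<longlonglongrightarrow> (\<integral>y. indicator {0<..} y *\<^sub>R g ((p / y) powr (1 / \<alpha>)) \<partial>lborel) \<and>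
   integrable lborel (\<lambda>y. indicator {0<..} y *\<^sub>R g ((p / y) powr (1 / \<alpha>))) \<and>
   (\<forall>\<^sub>F n in sequentially. integrable \<mu> (\<lambda>x. g (max x 0 / a n)))"
 proof (rule one[of g "\<lambda>x. max x 0" p, OF g])
  show "norm (g x) <= G * min (x powr b1) (x powr b2)" if "x \<ge> 0" for x using gb[of x] that by simp
  fix x :: real assume x: "x > 0"
  have "\<forall>\<^sub>F n in sequentially. real n * measure \<mu> {a n * x<..} = real n * measure \<mu> {y. a n * x < max y 0}"
   using eventually_ge_at_top[of 1]
  proof eventually_elim
   case (elim n)
   then have "a n * x > 0" using a_pos x by simp
   then have "{y. a n * x < max y 0} = {a n * x<..}" by auto
   then show ?case by simp
  qed
  then show "(\<lambda>n. real n * measure \<mu> {y. a n * x < max y 0}) \<longlonglongrightarrow> p * x powr (- \<alpha>)"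
   using right_tail_limit[OF x] by (rule Lim_transform_eventually[rotated])
 qed (use p_nonneg in auto)
 have R: "(\<lambda>n. real n *\<^sub>R (\<integral>x. g (- (max (- x) 0 / a n)) \<partial>\<mu>)) \<longlonglongrightarrow> (\<integral>y. indicator {0<..} y *\<^sub>R g (- ((r / y) powr (1 / \<alpha>))) \<partial>lborel) \<and>
   integrable lborel (\<lambda>y. indicator {0<..} y *\<^sub>R g (- ((r / y) powr (1 / \<alpha>)))) \<and>
   (\<forall>\<^sub>F n in sequentially. integrable \<mu> (\<lambda>x. g (- (max (- x) 0 / a n))))"
 proof (rule one[of "\<lambda>x. g (- x)" "\<lambda>x. max (- x) 0" r])
  show "continuous_on UNIV (\<lambda>x. g (- x))"
   by (rule continuous_on_compose2[OF g]) (auto intro!: continuous_intros)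
  show "norm (g (- x)) <= G * min (x powr b1) (x powr b2)" if "x \<ge> 0" for x using gb[of "- x"] that by simp
  fix x :: real assume x: "x > 0"
  have "\<forall>\<^sub>F n in sequentially. real n * measure \<mu> {..<- (a n * x)} = real n * measure \<mu> {y. a n * x < max (- y) 0}"
   using eventually_ge_at_top[of 1]
  proof eventually_elim
   case (elim n)
   then have "a n * x > 0" using a_pos x by simp
   then have "{y. a n * x < max (- y) 0} = {..<- (a n * x)}" by auto
   then show ?case by simp
  qed
  then show "(\<lambda>n. real n * measure \<mu> {y. a n * x < max (- y) 0}) \<longlonglongrightarrow> r * x powr (- \<alpha>)"
   using left_tail_limit[OF x] by (rule Lim_transform_eventually[rotated])
 qed (use r_nonneg in auto)
 have split: "g (x / a n) = g (max x 0 / a n) + g (- (max (- x) 0 / a n))" for x n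
  using g0 by (cases "x \<ge> 0") auto
 have ev: "\<forall>\<^sub>F n in sequentially. integrable \<mu> (\<lambda>x. g (max x 0 / a n)) \<and> integrable \<mu> (\<lambda>x. g (- (max (- x) 0 / a n)))"
  using P R by (auto intro: eventually_conj)
 show "\<forall>\<^sub>F n in sequentially. integrable \<mu> (\<lambda>x. g (x / a n))"
  using ev by eventually_elim (subst split, auto)
 let ?gp = "\<lambda>y. indicator {0<..} y *\<^sub>R g ((p / y) powr (1 / \<alpha>))"
 let ?gr = "\<lambda>y. indicator {0<..} y *\<^sub>R g (- ((r / y) powr (1 / \<alpha>)))"
 have J: "g (J y) = ?gp y + ?gr (0 + (- 1) * y)" for y
  using g0 alpha by (cases "y = 0") (auto simp: jump_def indicator_def)
 have ir: "integrable lborel (\<lambda>y. ?gr (0 + (- 1) * y))"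
  using R by (intro lborel_integrable_real_affine) auto
 show "integrable lborel (\<lambda>y. g (J y))"
  unfolding J using P ir by (intro Bochner_Integration.integrable_add) auto
 have "(\<integral>y. g (J y) \<partial>lborel) = (\<integral>y. ?gp y \<partial>lborel) + (\<integral>y. ?gr (0 + (- 1) * y) \<partial>lborel)"
  unfolding J using P ir by (intro Bochner_Integration.integral_add) auto
 also have "(\<integral>y. ?gr (0 + (- 1) * y) \<partial>lborel) = (\<integral>y. ?gr y \<partial>lborel)"
  using lborel_integral_real_affine[of "- 1" ?gr 0] by simp
 finally have eq: "(\<integral>y. g (J y) \<partial>lborel) = (\<integral>y. ?gp y \<partial>lborel) + (\<integral>y. ?gr y \<partial>lborel)" .
 have "(\<lambda>n. real n *\<^sub>R (\<integral>x. g (max x 0 / a n) \<partial>\<mu>) + real n *\<^sub>R (\<integral>x. g (- (max (- x) 0 / a n)) \<partial>\<mu>))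
   \<longlonglongrightarrow> (\<integral>y. g (J y) \<partial>lborel)"
  unfolding eq using P R by (intro tendsto_add) auto
 moreover have "\<forall>\<^sub>F n in sequentially. real n *\<^sub>R (\<integral>x. g (max x 0 / a n) \<partial>\<mu>) + real n *\<^sub>R (\<integral>x. g (- (max (- x) 0 / a n)) \<partial>\<mu>)
   = real n *\<^sub>R (\<integral>x. g (x / a n) \<partial>\<mu>)"
  using ev
 proof eventually_elim
  case (elim n)
  then have "(\<integral>x. g (x / a n) \<partial>\<mu>) = (\<integral>x. g (max x 0 / a n) \<partial>\<mu>) + (\<integral>x. g (- (max (- x) 0 / a n)) \<partial>\<mu>)"
   by (subst Bochner_Integration.integral_add[symmetric]) (auto simp: split[symmetric])
  then show ?case by (simp add: scaleR_add_right)
 qed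
 ultimately show "(\<lambda>n. real n *\<^sub>R (\<integral>x. g (x / a n) \<partial>\<mu>)) \<longlonglongrightarrow> (\<integral>y. g (J y) \<partial>lborel)"
  by (rule Lim_transform_eventually)
qed

lemma moment_bound:
 assumes b: "\<alpha> < b1" "0 < b2" "b2 < \<alpha>"
 obtains C where "C > 0" "\<forall>\<^sub>F n in sequentially. real n * (\<integral>x. power_min b1 b2 (x / a n) \<partial>\<mu>) <= C"
  "\<forall>\<^sub>F n in sequentially. integrable \<mu> (\<lambda>x. power_min b1 b2 (x / a n))"
proof -
 let ?g = "\<lambda>x::real. power_min b1 b2 x"
 have c: "continuous_on UNIV ?g"
  using b alpha by (intro continuous_intros continuous_on_powr') auto
 note v = vague_convergence[OF c, of 1 b1 b2, OF _ b]
 let ?I = "\<integral>y. ?g (J y) \<partial>lborel"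
 have "(\<lambda>n. real n * (\<integral>x. ?g (x / a n) \<partial>\<mu>)) \<longlonglongrightarrow> ?I" using v(1) by simp
 then have "\<forall>\<^sub>F n in sequentially. real n * (\<integral>x. ?g (x / a n) \<partial>\<mu>) < ?I + 1"
  by (rule order_tendstoD) simp
 then have ev: "\<forall>\<^sub>F n in sequentially. real n * (\<integral>x. ?g (x / a n) \<partial>\<mu>) <= ?I + 1"
  by (rule eventually_mono) simp
 have "0 <= ?I" by (rule Bochner_Integration.integral_nonneg) simp
 then have "0 < ?I + 1" by linarith
 then show ?thesis using ev by (rule that) (rule v(3), simp)
qed

lemma absolute_moment:
 assumes "0 < b" "b < \<alpha>"
 shows "integrable \<mu> (\<lambda>x. \<bar>x\<bar> powr b)"
proof -
 obtain n where n: "n \<ge> 1" "integrable \<mu> (\<lambda>x. power_min (\<alpha> + 1) b (x / a n))"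
  using moment_bound[of "\<alpha> + 1" b] assms eventually_happens'[OF _ eventually_conj[OF _ eventually_ge_at_top[of 1]]]
  by (smt (verit, best) sequentially_bot)
 have an: "a n > 0" by (rule a_pos[OF n(1)])
 have "integrable \<mu> (\<lambda>x. a n powr b * (1 + power_min (\<alpha> + 1) b (x / a n)))"
  using n by simp
 then show ?thesis
 proof (rule Bochner_Integration.integrable_bound)
  have *: "t powr b <= 1 + min (t powr (\<alpha> + 1)) (t powr b)" if "t \<ge> 0" for t :: real
  proof (cases "t <= 1")
   case True
   then have "t powr b <= 1" using that assms by (intro powr_le1) auto
   moreover have "0 <= min (t powr (\<alpha> + 1)) (t powr b)" by simp
   ultimately show ?thesis by linarith
  next
   case False
   then have "t powr b <= t powr (\<alpha> + 1)" using assms by (intro powr_mono) auto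
   then show ?thesis by simp
  qed
  have "\<bar>x\<bar> powr b = a n powr b * \<bar>x / a n\<bar> powr b" for x
   using an by (simp add: powr_divide)
  then show "AE x in \<mu>. norm (\<bar>x\<bar> powr b) <= norm (a n powr b * (1 + power_min (\<alpha> + 1) b (x / a n)))"
   using *[of "\<bar>_ / a n\<bar>"] by (intro AE_I2) (simp add: abs_mult mult_left_mono)
 qed simp
qed

end

section \<open>The characteristic exponent\<close>

lemma power_tendsto_exp:
 fixes c :: "nat => complex" and z :: complex and k :: "nat => nat"
 assumes c: "\<And>n. norm (c n) <= 1" and lim: "(\<lambda>n. of_nat n * (c n - 1)) \<longlonglongrightarrow> z"
  and k: "(\<lambda>n. real (k n) / real n) \<longlonglongrightarrow> t"
 shows "(\<lambda>n. c n ^ k n) \<longlonglongrightarrow> exp (of_real t * z)"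
proof -
 define d where "d n = c n - 1" for n
 have kd: "(\<lambda>n. of_nat (k n) * d n) \<longlonglongrightarrow> of_real t * z"
 proof -
  have "(\<lambda>n. of_real (real (k n) / real n) * (of_nat n * d n)) \<longlonglongrightarrow> of_real t * z"
   unfolding d_def by (intro tendsto_mult tendsto_of_real k lim)
  moreover have "\<forall>\<^sub>F n in sequentially. of_real (real (k n) / real n) * (of_nat n * d n) = of_nat (k n) * d n"
   using eventually_gt_at_top[of 0] by eventually_elim simp
  ultimately show ?thesis by (rule Lim_transform_eventually)
 qed
 have d0: "d \<longlonglongrightarrow> 0"
 proof -
  have "(\<lambda>n. of_real (1 / real n) * (of_nat n * d n)) \<longlonglongrightarrow> of_real 0 * z"
   unfolding d_def by (intro tendsto_mult tendsto_of_real lim lim_1_over_n)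
  moreover have "\<forall>\<^sub>F n in sequentially. of_real (1 / real n) * (of_nat n * d n) = d n"
   using eventually_gt_at_top[of 0] by eventually_elim simp
  ultimately have "d \<longlonglongrightarrow> of_real 0 * z" by (rule Lim_transform_eventually)
  then show ?thesis by simp
 qed
 have err: "(\<lambda>n. real (k n) * norm (c n - exp (d n))) \<longlonglongrightarrow> 0"
 proof (rule LIMSEQ_I)
  fix e :: real assume e: "e > 0"
  define B where "B = norm (of_real t * z) + 1"
  have B: "B > 0" unfolding B_def by (simp add: add_nonneg_pos)
  have "(exp has_derivative (*) (1::complex)) (at 0)"
   using DERIV_exp[of "0::complex"] by (simp add: has_field_derivative_def)
  then obtain r where r: "r > 0" "\<And>y. norm y < r ==> norm (exp y - 1 - y) <= e / (2 * B) * norm (y :: complex)"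
   using e B unfolding has_derivative_at_alt by (auto dest!: spec[of _ "e / (2 * B)"])
  have "\<forall>\<^sub>F n in sequentially. norm (d n) < r"
   using tendstoD[OF d0 r(1)] by simp
  moreover have "\<forall>\<^sub>F n in sequentially. norm (of_nat (k n) * d n) < B"
   by (rule order_tendstoD(2)[OF tendsto_norm[OF kd]]) (simp add: B_def)
  ultimately have "\<forall>\<^sub>F n in sequentially. norm (real (k n) * norm (c n - exp (d n)) - 0) < e"
  proof eventually_elim
   case (elim n)
   have "c n - exp (d n) = - (exp (d n) - 1 - d n)" by (simp add: d_def)
   then have "norm (c n - exp (d n)) <= e / (2 * B) * norm (d n)" using r(2)[OF elim(1)] by (simp only: norm_minus_cancel)
   then have "real (k n) * norm (c n - exp (d n)) <= real (k n) * (e / (2 * B) * norm (d n))"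
    by (intro mult_left_mono) auto
   also have "... = e / (2 * B) * norm (of_nat (k n) * d n)" by (simp add: norm_mult)
   also have "... <= e / (2 * B) * B" using elim e B by (intro mult_left_mono) auto
   also have "... < e" using e B by simp
   finally show ?case by simp
  qed
  then show "\<exists>no. \<forall>n\<ge>no. norm (real (k n) * norm (c n - exp (d n)) - 0) < e"
   by (simp add: eventually_sequentially)
 qed
 have "(\<lambda>n. c n ^ k n - exp (d n) ^ k n) \<longlonglongrightarrow> 0"
 proof (rule tendsto_norm_zero_cancel, rule tendsto_sandwich[OF _ _ tendsto_const err])
  show "\<forall>\<^sub>F n in sequentially. norm (c n ^ k n - exp (d n) ^ k n) <= real (k n) * norm (c n - exp (d n))"
  proof (intro always_eventually allI norm_power_diff c)
   fix n
   have "Re (d n) <= 0" using abs_Re_le_cmod[of "c n"] c[of n] by (simp add: d_def)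
   then show "norm (exp (d n)) <= 1" by (simp add: norm_exp_eq_Re)
  qed
 qed auto
 moreover have "(\<lambda>n. exp (d n) ^ k n) \<longlonglongrightarrow> exp (of_real t * z)"
  using tendsto_exp[OF kd] by (simp add: exp_of_nat_mult)
 ultimately have "(\<lambda>n. (c n ^ k n - exp (d n) ^ k n) + exp (d n) ^ k n) \<longlonglongrightarrow> 0 + exp (of_real t * z)"
  by (rule tendsto_add)
 then show ?thesis by simp
qed

text \<open>Chosen such that the compensated exponential is of order above \<open>\<alpha>\<close> at the origin and below \<open>\<alpha>\<close> at
  infinity. The integral of the compensator is a centring for \<open>\<alpha> > 1\<close>; that of the sine vanishes by
  symmetry.\<close>

definition compensator :: "real => real => real => real" where
 "compensator \<alpha> \<theta> x = (if \<alpha> < 1 then 0 else if \<alpha> = 1 then sin (\<theta> * x) else \<theta> * x)"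

definition compensated_iexp :: "real => real => real => complex" where
 "compensated_iexp \<alpha> \<theta> x = iexp (\<theta> * x) - 1 - \<i> * of_real (compensator \<alpha> \<theta> x)"

lemma continuous_compensator: "continuous_on UNIV (compensator \<alpha> \<theta>)"
 unfolding compensator_def[abs_def] by (cases "\<alpha> < 1"; cases "\<alpha> = 1") (auto intro!: continuous_intros)

lemma continuous_compensated_iexp: "continuous_on UNIV (compensated_iexp \<alpha> \<theta>)"
 unfolding compensated_iexp_def[abs_def]
 by (intro continuous_intros continuous_compensator)

lemma measurable_compensated_iexp[measurable]: "compensated_iexp \<alpha> \<theta> \<in> borel_measurable borel"
 by (intro borel_measurable_continuous_onI continuous_compensated_iexp)

lemma compensated_iexp_scale: "compensated_iexp \<alpha> (c * \<theta>) x = compensated_iexp \<alpha> \<theta> (c * x)"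
 by (simp add: compensated_iexp_def compensator_def mult_ac)

lemma compensated_iexp_bound:
 assumes \<alpha>: "0 < \<alpha>" "\<alpha> < 2"
 obtains b1 b2 where "0 < b2" "b2 < \<alpha>" "\<alpha> < b1"
  "\<And>\<theta>. \<exists>G. \<forall>x. norm (compensated_iexp \<alpha> \<theta> x) <= G * power_min b1 b2 x"
proof -
 have minI: "\<exists>G. \<forall>x. norm (f x) <= G * power_min b1 b2 x"
  if "\<And>x. norm (f x) <= A * \<bar>x\<bar> powr b1" "\<And>x. norm (f x) <= B * \<bar>x\<bar> powr b2" "0 <= A" "0 <= B"
  for f :: "real => complex" and A B b1 b2
 proof (intro exI allI)
  fix x
  have "norm (f x) <= (A + B) * \<bar>x\<bar> powr b1" "norm (f x) <= (A + B) * \<bar>x\<bar> powr b2"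
   by (rule order_trans[OF that(1)], use that in \<open>auto intro!: mult_right_mono\<close>)
     (rule order_trans[OF that(2)], use that in \<open>auto intro!: mult_right_mono\<close>)
  then show "norm (f x) <= (A + B) * power_min b1 b2 x"
   by (simp add: min_def)
 qed
 consider "\<alpha> < 1" | "\<alpha> = 1" | "\<alpha> > 1" by linarith
 then show ?thesis
 proof cases
  case 1
  have "\<exists>G. \<forall>x. norm (compensated_iexp \<alpha> \<theta> x) <= G * min (\<bar>x\<bar> powr 1) (\<bar>x\<bar> powr (\<alpha> / 2))" for \<theta>
  proof (rule minI)
   fix x :: real
   have a1: "norm (compensated_iexp \<alpha> \<theta> x) <= \<bar>\<theta> * x\<bar>"
    using iexp_approx1[of "\<theta> * x" 0] 1 by (simp add: compensated_iexp_def compensator_def)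
   have a2: "norm (compensated_iexp \<alpha> \<theta> x) <= 2"
    using iexp_approx2[of "\<theta> * x" 0] 1 by (simp add: compensated_iexp_def compensator_def)
   show "norm (compensated_iexp \<alpha> \<theta> x) <= \<bar>\<theta>\<bar> * \<bar>x\<bar> powr 1" using a1 by (simp add: abs_mult)
   show "norm (compensated_iexp \<alpha> \<theta> x) <= (\<bar>\<theta>\<bar> + 2) * \<bar>x\<bar> powr (\<alpha> / 2)"
   proof (cases "\<bar>x\<bar> <= 1")
    case True
    then have "\<bar>x\<bar> powr 1 <= \<bar>x\<bar> powr (\<alpha> / 2)" using 1 by (intro powr_mono') auto
    then have "\<bar>\<theta>\<bar> * \<bar>x\<bar> <= (\<bar>\<theta>\<bar> + 2) * \<bar>x\<bar> powr (\<alpha> / 2)" by (intro mult_mono) auto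
    then show ?thesis using a1 by (simp add: abs_mult)
   next
    case False
    then have "1 <= \<bar>x\<bar> powr (\<alpha> / 2)" using \<alpha> by (intro ge_one_powr_ge_zero) auto
    then have "2 * 1 <= (\<bar>\<theta>\<bar> + 2) * \<bar>x\<bar> powr (\<alpha> / 2)" by (intro mult_mono) auto
    then show ?thesis using a2 by simp
   qed
  qed auto
  then show ?thesis using 1 \<alpha> by (intro that[of "\<alpha> / 2" 1]) auto
 next
  case 2
  have "\<exists>G. \<forall>x. norm (compensated_iexp \<alpha> \<theta> x) <= G * min (\<bar>x\<bar> powr 2) (\<bar>x\<bar> powr (1 / 2))" for \<theta>
  proof (rule minI)
   fix x :: real
   have eq: "compensated_iexp \<alpha> \<theta> x = of_real (Re (iexp (\<theta> * x) - (\<Sum>k\<le>1. (\<i> * (\<theta> * x))^k / fact k)))"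
    using 2 by (simp add: compensated_iexp_def compensator_def complex_eq_iff Re_exp Im_exp)
   have a1: "norm (compensated_iexp \<alpha> \<theta> x) <= \<bar>\<theta> * x\<bar>\<^sup>2 / 2"
    unfolding eq norm_of_real
    by (rule order_trans[OF abs_Re_le_cmod]) (use iexp_approx1[of "\<theta> * x" 1] in \<open>simp add: power2_eq_square\<close>)
   have eq': "compensated_iexp \<alpha> \<theta> x = of_real (cos (\<theta> * x) - 1)"
    using 2 by (simp add: compensated_iexp_def compensator_def complex_eq_iff Re_exp Im_exp)
   have a2: "norm (compensated_iexp \<alpha> \<theta> x) <= 2"
    unfolding eq' norm_of_real using cos_ge_minus_one[of "\<theta> * x"] cos_le_one[of "\<theta> * x"] by linarith
   show "norm (compensated_iexp \<alpha> \<theta> x) <= (\<theta>\<^sup>2 / 2) * \<bar>x\<bar> powr 2"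
    using a1 by (simp add: power_mult_distrib)
   show "norm (compensated_iexp \<alpha> \<theta> x) <= (\<theta>\<^sup>2 + 2) * \<bar>x\<bar> powr (1 / 2)"
   proof (cases "\<bar>x\<bar> <= 1")
    case True
    then have "\<bar>x\<bar> powr 2 <= \<bar>x\<bar> powr (1 / 2)" by (intro powr_mono') auto
    then have "(\<theta>\<^sup>2 / 2) * \<bar>x\<bar> powr 2 <= (\<theta>\<^sup>2 + 2) * \<bar>x\<bar> powr (1 / 2)" by (intro mult_mono) auto
    then show ?thesis using a1 by (simp add: power_mult_distrib)
   next
    case False
    then have "1 <= \<bar>x\<bar> powr (1 / 2)" by (intro ge_one_powr_ge_zero) auto
    then have "2 * 1 <= (\<theta>\<^sup>2 + 2) * \<bar>x\<bar> powr (1 / 2)" by (intro mult_mono) auto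
    then show ?thesis using a2 by simp
   qed
  qed auto
  then show ?thesis using 2 by (intro that[of "1 / 2" 2]) auto
 next
  case 3
  have "\<exists>G. \<forall>x. norm (compensated_iexp \<alpha> \<theta> x) <= G * power_min 2 1 x" for \<theta>
  proof (rule minI)
   fix x :: real
   have eq: "compensated_iexp \<alpha> \<theta> x = iexp (\<theta> * x) - (\<Sum>k\<le>1. (\<i> * (\<theta> * x))^k / fact k)"
    using 3 by (simp add: compensated_iexp_def compensator_def)
   show "norm (compensated_iexp \<alpha> \<theta> x) <= (\<theta>\<^sup>2 / 2) * \<bar>x\<bar> powr 2"
    unfolding eq using iexp_approx1[of "\<theta> * x" 1] by (simp add: power2_eq_square mult_ac)
   show "norm (compensated_iexp \<alpha> \<theta> x) <= (2 * \<bar>\<theta>\<bar>) * \<bar>x\<bar> powr 1"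
    unfolding eq using iexp_approx2[of "\<theta> * x" 1] by (simp add: abs_mult mult_ac)
  qed auto
  then show ?thesis using 3 \<alpha> by (intro that[of 1 2]) auto
 qed
qed

context stable_domain
begin

definition "centre = (if \<alpha> <= 1 then 0 else \<integral>x. x \<partial>\<mu>)"

text \<open>The exponent of the limit process.\<close>

definition "psi \<theta> = (\<integral>y. compensated_iexp \<alpha> \<theta> (J y) \<partial>lborel)"

lemma integrable_compensated_jump: "integrable lborel (\<lambda>y. compensated_iexp \<alpha> \<theta> (J y))"
proof -
 obtain b1 b2 where b: "0 < b2" "b2 < \<alpha>" "\<alpha> < b1"
  "\<And>\<theta>. \<exists>G. \<forall>x. norm (compensated_iexp \<alpha> \<theta> x) <= G * power_min b1 b2 x"
  using compensated_iexp_bound[OF alpha] by metis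
 from b(4)[of \<theta>] obtain G where G: "\<And>x. norm (compensated_iexp \<alpha> \<theta> x) <= G * power_min b1 b2 x" by blast
 show ?thesis by (rule vague_convergence(2)[OF continuous_compensated_iexp G b(3,1,2)])
qed

lemma integrable_identity: assumes "1 < \<alpha>" shows "integrable \<mu> (\<lambda>x. x)"
proof -
 have "integrable \<mu> (\<lambda>x. \<bar>x\<bar> powr 1)" by (rule absolute_moment) (use assms in auto)
 then have "integrable \<mu> (\<lambda>x. \<bar>x\<bar>)" by simp
 then show ?thesis by (subst (asm) integrable_abs_iff) auto
qed

lemma odd_integral_zero:
 fixes f :: "real => real"
 assumes "\<alpha> = 1" "\<And>x. f (- x) = - f x" and [measurable]: "f \<in> borel_measurable borel"
 shows "(\<integral>x. f x \<partial>\<mu>) = 0"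
proof -
 have "(\<integral>x. f x \<partial>\<mu>) = (\<integral>x. f x \<partial>distr \<mu> borel uminus)" by (simp add: symmetric[OF assms(1)])
 also have "... = - (\<integral>x. f x \<partial>\<mu>)" by (subst integral_distr) (auto simp: assms(2))
 finally show ?thesis by simp
qed

lemma compensator_mean:
 assumes "n \<ge> 1"
 shows "integrable \<mu> (\<lambda>x. compensator \<alpha> \<theta> (x / a n))"
  and "(\<integral>x. compensator \<alpha> \<theta> (x / a n) \<partial>\<mu>) = \<theta> * centre / a n"
proof -
 show "integrable \<mu> (\<lambda>x. compensator \<alpha> \<theta> (x / a n))"
 proof (cases "\<alpha> = 1")
  case True
  then show ?thesis by (simp add: compensator_def) (rule integrable_const_bound[of _ 1], auto)
 next
  case False
  then show ?thesis using integrable_identity by (cases "\<alpha> < 1") (auto simp: compensator_def)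
 qed
 show "(\<integral>x. compensator \<alpha> \<theta> (x / a n) \<partial>\<mu>) = \<theta> * centre / a n"
 proof (cases "\<alpha> = 1")
  case True
  have "(\<integral>x. sin (\<theta> * (x / a n)) \<partial>\<mu>) = 0" by (rule odd_integral_zero[OF True]) auto
  moreover have "centre = 0" using True unfolding centre_def by simp
  ultimately show ?thesis using True unfolding compensator_def by simp
 next
  case False
  then show ?thesis unfolding compensator_def centre_def by (cases "\<alpha> < 1") auto
 qed
qed

lemma char_increment_limit:
 "(\<lambda>n. of_nat n * ((\<integral>x. iexp (\<theta> * ((x - centre) / a n)) \<partial>\<mu>) - 1)) \<longlonglongrightarrow> psi \<theta>"
proof -
 obtain b1 b2 where b: "0 < b2" "b2 < \<alpha>" "\<alpha> < b1"
  "\<And>\<theta>. \<exists>G. \<forall>x. norm (compensated_iexp \<alpha> \<theta> x) <= G * power_min b1 b2 x"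
  using compensated_iexp_bound[OF alpha] by metis
 from b(4)[of \<theta>] obtain G where G: "\<And>x. norm (compensated_iexp \<alpha> \<theta> x) <= G * power_min b1 b2 x" by blast
 define w where "w n = real n *\<^sub>R (\<integral>x. compensated_iexp \<alpha> \<theta> (x / a n) \<partial>\<mu>)" for n
 have w: "w \<longlonglongrightarrow> psi \<theta>"
  unfolding w_def[abs_def] psi_def by (rule vague_convergence(1)[OF continuous_compensated_iexp G b(3,1,2)])
 define y where "y n = \<theta> * centre / a n" for n
 have int: "integrable \<mu> (\<lambda>x. iexp (\<theta> * (x / a n)))" for n by (rule integrable_iexp) auto
 have eq: "(\<integral>x. iexp (\<theta> * ((x - centre) / a n)) \<partial>\<mu>) = iexp (- y n) * (1 + \<i> * y n + w n / of_nat n)" if n: "n \<ge> 1" for n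
 proof -
  have "iexp (\<theta> * ((x - centre) / a n)) = iexp (- y n) * iexp (\<theta> * (x / a n))" for x
   by (simp add: y_def exp_add[symmetric] algebra_simps diff_divide_distrib)
  then have "(\<integral>x. iexp (\<theta> * ((x - centre) / a n)) \<partial>\<mu>) = iexp (- y n) * (\<integral>x. iexp (\<theta> * (x / a n)) \<partial>\<mu>)"
   by simp
  also have "(\<integral>x. iexp (\<theta> * (x / a n)) \<partial>\<mu>) = (\<integral>x. 1 + \<i> * of_real (compensator \<alpha> \<theta> (x / a n)) + compensated_iexp \<alpha> \<theta> (x / a n) \<partial>\<mu>)"
   by (simp add: compensated_iexp_def)
  also have "... = 1 + \<i> * y n + (\<integral>x. compensated_iexp \<alpha> \<theta> (x / a n) \<partial>\<mu>)"
  proof -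
   have i1: "integrable \<mu> (\<lambda>x. \<i> * complex_of_real (compensator \<alpha> \<theta> (x / a n)))"
    using compensator_mean(1)[OF n] by simp
   have i2: "integrable \<mu> (\<lambda>x. compensated_iexp \<alpha> \<theta> (x / a n))"
    unfolding compensated_iexp_def using int i1 by simp
   show ?thesis using i1 i2 compensator_mean(2)[OF n, of \<theta>] prob_space
    by (simp add: y_def del: space_eq_univ)
  qed
  also have "(\<integral>x. compensated_iexp \<alpha> \<theta> (x / a n) \<partial>\<mu>) = w n / of_nat n"
   using n by (simp add: w_def scaleR_conv_of_real)
  finally show ?thesis .
 qed
 have y0: "y \<longlonglongrightarrow> 0"
  unfolding y_def[abs_def] by (rule real_tendsto_divide_at_top[OF tendsto_const a_at_top])
 have "(\<lambda>n. of_nat n * (iexp (- y n) * (1 + \<i> * y n) - 1)) \<longlonglongrightarrow> 0"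
 proof (rule tendsto_norm_zero_cancel, rule tendsto_sandwich[OF _ _ tendsto_const])
  show "\<forall>\<^sub>F n in sequentially. norm (of_nat n * (iexp (- y n) * (1 + \<i> * y n) - 1)) <= (\<theta> * centre)\<^sup>2 / 2 * (real n / (a n)\<^sup>2)"
  proof (intro always_eventually allI)
   fix n
   have "iexp (- y n) * (1 + \<i> * y n) - 1 = - (iexp (- y n) * (iexp (y n) - (\<Sum>k\<le>1. (\<i> * y n)^k / fact k)))"
    by (simp add: algebra_simps flip: exp_add)
   then have "norm (iexp (- y n) * (1 + \<i> * y n) - 1) = norm (iexp (y n) - (\<Sum>k\<le>1. (\<i> * y n)^k / fact k))"
    by (simp only: norm_minus_cancel norm_mult norm_exp_i_times mult_1)
   also have "... <= \<bar>y n\<bar>\<^sup>2 / 2" using iexp_approx1[of "y n" 1] by (simp add: power2_eq_square)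
   finally have "real n * norm (iexp (- y n) * (1 + \<i> * y n) - 1) <= real n * (\<bar>y n\<bar>\<^sup>2 / 2)"
    by (intro mult_left_mono) auto
   then show "norm (of_nat n * (iexp (- y n) * (1 + \<i> * y n) - 1)) <= (\<theta> * centre)\<^sup>2 / 2 * (real n / (a n)\<^sup>2)"
    by (simp only: norm_mult norm_of_nat) (simp add: y_def power_divide mult_ac)
  qed
  have "(\<lambda>n. (\<theta> * centre)\<^sup>2 / 2 * (real n / (a n)\<^sup>2)) \<longlonglongrightarrow> (\<theta> * centre)\<^sup>2 / 2 * 0"
   by (intro tendsto_mult_left n_over_a_square alpha)
  then show "(\<lambda>n. (\<theta> * centre)\<^sup>2 / 2 * (real n / (a n)\<^sup>2)) \<longlonglongrightarrow> 0" by simp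
 qed auto
 moreover have "(\<lambda>n. iexp (- y n) * w n) \<longlonglongrightarrow> iexp (- 0) * psi \<theta>"
  by (intro tendsto_mult w tendsto_exp tendsto_of_real tendsto_minus y0 tendsto_const)
 ultimately have "(\<lambda>n. of_nat n * (iexp (- y n) * (1 + \<i> * y n) - 1) + iexp (- y n) * w n) \<longlonglongrightarrow> 0 + iexp (- 0) * psi \<theta>"
  by (rule tendsto_add)
 then have l: "(\<lambda>n. of_nat n * (iexp (- y n) * (1 + \<i> * y n) - 1) + iexp (- y n) * w n) \<longlonglongrightarrow> psi \<theta>" by simp
 show ?thesis
 proof (rule Lim_transform_eventually[OF l])
  show "\<forall>\<^sub>F n in sequentially. of_nat n * (iexp (- y n) * (1 + \<i> * y n) - 1) + iexp (- y n) * w n =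
    of_nat n * ((\<integral>x. iexp (\<theta> * ((x - centre) / a n)) \<partial>\<mu>) - 1)"
   using eventually_ge_at_top[of 1] by eventually_elim (simp only: eq, simp add: algebra_simps)
 qed
qed

end

context stable_domain
begin

section \<open>Truncation of the innovations\<close>

definition small_part :: "nat => real => real" where
 "small_part n x = (if \<bar>x\<bar> <= a n then x / a n else 0)"

definition large_part :: "nat => real => real" where
 "large_part n x = (if \<bar>x\<bar> <= a n then 0 else \<bar>x\<bar> / a n)"

abbreviation "bias n \<equiv> \<bar>(\<integral>x. small_part n x \<partial>\<mu>) - centre / a n\<bar>"

lemma measurable_small_part[measurable]: "small_part n \<in> borel_measurable borel"
 unfolding small_part_def[abs_def] by measurable

lemma measurable_large_part[measurable]: "large_part n \<in> borel_measurable borel"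
 unfolding large_part_def[abs_def] by measurable

lemma small_part_abs_le: "n \<ge> 1 ==> \<bar>small_part n x\<bar> <= 1"
 using a_pos[of n] by (auto simp: small_part_def)

lemma integrable_small_part: "n \<ge> 1 ==> integrable \<mu> (small_part n)"
 by (intro integrable_const_bound[of _ 1]) (auto simp: small_part_abs_le)

lemma parts_decompose: "n \<ge> 1 ==> \<bar>x / a n - small_part n x\<bar> = large_part n x"
 using a_pos[of n] by (auto simp: small_part_def large_part_def)

text \<open>The steps up to size \<open>a n\<close> are controlled by variances, the larger ones by moments of an order
  below \<open>\<alpha>\<close>. The last bound says that truncation moves the centre of \<open>n\<close> steps by a bounded multiple of
  \<open>a n\<close> only, the truncated mean being small for \<open>\<alpha> < 1\<close>, zero for \<open>\<alpha> = 1\<close>, and close to the mean for \<open>\<alpha> > 1\<close>.\<close>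

lemma truncation_bounds:
 assumes \<delta>: "0 < \<delta>" "\<delta> < \<alpha>"
 obtains C where "C > 0"
  "\<forall>\<^sub>F n in sequentially. real n * measure \<mu> {x. a n < \<bar>x\<bar>} <= C"
  "\<forall>\<^sub>F n in sequentially. real n * (\<integral>x. (small_part n x)\<^sup>2 \<partial>\<mu>) <= C"
  "\<forall>\<^sub>F n in sequentially. integrable \<mu> (\<lambda>x. large_part n x powr \<delta>) \<and> real n * (\<integral>x. large_part n x powr \<delta> \<partial>\<mu>) <= C"
  "\<forall>\<^sub>F n in sequentially. real n * bias n <= C"
proof -
 have an: "\<forall>\<^sub>F n in sequentially. n \<ge> 1 \<and> a n > 0"
  using eventually_ge_at_top[of 1] by eventually_elim (use a_pos in auto)
 define C1 :: real where "C1 = 2"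
 have "\<forall>\<^sub>F n in sequentially. real n * measure \<mu> {x. a n < \<bar>x\<bar>} < 2"
  by (rule order_tendstoD(2)[OF a_norm]) simp
 then have 1: "\<forall>\<^sub>F n in sequentially. real n * measure \<mu> {x. a n < \<bar>x\<bar>} <= C1"
  by eventually_elim (simp add: C1_def)
 obtain C2 where C2: "C2 > 0"
  and c2: "\<forall>\<^sub>F n in sequentially. real n * (\<integral>x. power_min 2 \<delta> (x / a n) \<partial>\<mu>) <= C2"
  and i2: "\<forall>\<^sub>F n in sequentially. integrable \<mu> (\<lambda>x. power_min 2 \<delta> (x / a n))"
  using moment_bound[OF alpha(2) \<delta>] by blast
 have d2: "\<delta> <= 2" using \<delta> alpha by simp
 have cmp: "(small_part n x)\<^sup>2 <= power_min 2 \<delta> (x / a n)"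
  "large_part n x powr \<delta> <= power_min 2 \<delta> (x / a n)" if n: "a n > 0" for n x
 proof -
  show "(small_part n x)\<^sup>2 <= power_min 2 \<delta> (x / a n)"
  proof (cases "\<bar>x\<bar> <= a n")
   case True
   then have "\<bar>x / a n\<bar> <= 1" using n by simp
   then have "\<bar>x / a n\<bar> powr 2 <= \<bar>x / a n\<bar> powr \<delta>" using d2 by (intro powr_mono') auto
   then show ?thesis using True n by (simp add: small_part_def power_divide)
  qed (simp add: small_part_def)
  show "large_part n x powr \<delta> <= power_min 2 \<delta> (x / a n)"
  proof (cases "\<bar>x\<bar> <= a n")
   case False
   then have "1 <= \<bar>x / a n\<bar>" using n by simp
   then have "\<bar>x / a n\<bar> powr \<delta> <= \<bar>x / a n\<bar> powr 2" using d2 by (intro powr_mono) auto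
   then show ?thesis using False n by (simp add: large_part_def)
  qed (simp add: large_part_def)
 qed
 have 2: "\<forall>\<^sub>F n in sequentially. real n * (\<integral>x. (small_part n x)\<^sup>2 \<partial>\<mu>) <= C2"
  using c2 i2 an
 proof eventually_elim
  case (elim n)
  have "(\<integral>x. (small_part n x)\<^sup>2 \<partial>\<mu>) <= (\<integral>x. power_min 2 \<delta> (x / a n) \<partial>\<mu>)"
   using elim cmp(1) by (intro integral_mono_AE') auto
  then have "real n * (\<integral>x. (small_part n x)\<^sup>2 \<partial>\<mu>) <= real n * (\<integral>x. power_min 2 \<delta> (x / a n) \<partial>\<mu>)"
   by (intro mult_left_mono) auto
  then show ?case using elim by linarith
 qed
 have 3: "\<forall>\<^sub>F n in sequentially. integrable \<mu> (\<lambda>x. large_part n x powr \<delta>) \<and> real n * (\<integral>x. large_part n x powr \<delta> \<partial>\<mu>) <= C2"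
  using c2 i2 an
 proof eventually_elim
  case (elim n)
  have "(\<integral>x. large_part n x powr \<delta> \<partial>\<mu>) <= (\<integral>x. power_min 2 \<delta> (x / a n) \<partial>\<mu>)"
   using elim cmp(2) by (intro integral_mono_AE') auto
  then have "real n * (\<integral>x. large_part n x powr \<delta> \<partial>\<mu>) <= real n * (\<integral>x. power_min 2 \<delta> (x / a n) \<partial>\<mu>)"
   by (intro mult_left_mono) auto
  moreover have "integrable \<mu> (\<lambda>x. large_part n x powr \<delta>)"
   by (rule Bochner_Integration.integrable_bound[OF elim(2)]) (use elim cmp(2) in auto)
  ultimately show ?case using elim by linarith
 qed
 obtain C4 where C4: "C4 > 0" "\<forall>\<^sub>F n in sequentially. real n * bias n <= C4"
 proof -
  consider "\<alpha> < 1" | "\<alpha> = 1" | "\<alpha> > 1" by linarith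
  then show ?thesis
  proof cases
   case 1
   obtain C where C: "C > 0"
    and c: "\<forall>\<^sub>F n in sequentially. real n * (\<integral>x. power_min 1 \<delta> (x / a n) \<partial>\<mu>) <= C"
    and i: "\<forall>\<^sub>F n in sequentially. integrable \<mu> (\<lambda>x. power_min 1 \<delta> (x / a n))"
    using moment_bound[OF 1 \<delta>] by blast
   have "\<forall>\<^sub>F n in sequentially. real n * bias n <= C"
    using c i an
   proof eventually_elim
    case (elim n)
    have le: "\<bar>small_part n x\<bar> <= power_min 1 \<delta> (x / a n)" for x
    proof (cases "\<bar>x\<bar> <= a n")
     case True
     then have "\<bar>x / a n\<bar> <= 1" using elim by simp
     then have "\<bar>x / a n\<bar> powr 1 <= \<bar>x / a n\<bar> powr \<delta>" using \<delta> 1 by (intro powr_mono') auto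
     then show ?thesis using True elim by (simp add: small_part_def)
    qed (simp add: small_part_def)
    have "\<bar>\<integral>x. small_part n x \<partial>\<mu>\<bar> <= (\<integral>x. \<bar>small_part n x\<bar> \<partial>\<mu>)" by (rule integral_abs_bound)
    also have "... <= (\<integral>x. power_min 1 \<delta> (x / a n) \<partial>\<mu>)"
     using elim le by (intro integral_mono_AE') auto
    finally have "real n * \<bar>\<integral>x. small_part n x \<partial>\<mu>\<bar> <= real n * (\<integral>x. power_min 1 \<delta> (x / a n) \<partial>\<mu>)"
     by (intro mult_left_mono) auto
    also note elim(1)
    finally have "real n * \<bar>\<integral>x. small_part n x \<partial>\<mu>\<bar> <= C" .
    moreover have "centre = 0" using 1 unfolding centre_def by simp
    ultimately show ?case by simp
   qed
   then show ?thesis using C that by blast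
  next
   case 2
   have "centre = 0" using 2 unfolding centre_def by simp
   moreover have "(\<integral>x. small_part n x \<partial>\<mu>) = 0" for n
    by (rule odd_integral_zero[OF 2]) (auto simp: small_part_def)
   ultimately show ?thesis by (intro that[of 1]) auto
  next
   case 3
   obtain C where C: "C > 0"
    and c: "\<forall>\<^sub>F n in sequentially. real n * (\<integral>x. power_min 2 1 (x / a n) \<partial>\<mu>) <= C"
    and i: "\<forall>\<^sub>F n in sequentially. integrable \<mu> (\<lambda>x. power_min 2 1 (x / a n))"
    using moment_bound[OF alpha(2) zero_less_one 3] by blast
   have "\<forall>\<^sub>F n in sequentially. real n * bias n <= C"
    using c i an
   proof eventually_elim
    case (elim n)
    have le: "\<bar>small_part n x - x / a n\<bar> <= power_min 2 1 (x / a n)" for x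
    proof (cases "\<bar>x\<bar> <= a n")
     case False
     then have "1 <= \<bar>x / a n\<bar>" using elim by simp
     then have "\<bar>x / a n\<bar> powr 1 <= \<bar>x / a n\<bar> powr 2" by (intro powr_mono) auto
     then show ?thesis using False elim by (simp add: small_part_def)
    qed (simp add: small_part_def)
    have "centre / a n = (\<integral>x. x / a n \<partial>\<mu>)" using 3 unfolding centre_def by simp
    then have "(\<integral>x. small_part n x \<partial>\<mu>) - centre / a n = (\<integral>x. small_part n x - x / a n \<partial>\<mu>)"
     using integrable_small_part integrable_identity[OF 3] elim by simp
    then have "bias n <= (\<integral>x. \<bar>small_part n x - x / a n\<bar> \<partial>\<mu>)" by simp
    also have "... <= (\<integral>x. power_min 2 1 (x / a n) \<partial>\<mu>)"
     using elim le by (intro integral_mono_AE') auto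
    finally have "real n * bias n <= real n * (\<integral>x. power_min 2 1 (x / a n) \<partial>\<mu>)"
     by (intro mult_left_mono) auto
    also note elim(1)
    finally show ?case .
   qed
   then show ?thesis using C that by blast
  qed
 qed
 define C where "C = max C1 (max C2 C4)"
 have le: "C1 <= C" "C2 <= C" "C4 <= C" by (auto simp: C_def)
 show ?thesis
 proof (rule that[of C])
  show "C > 0" using le C2 by linarith
  show "\<forall>\<^sub>F n in sequentially. real n * measure \<mu> {x. a n < \<bar>x\<bar>} <= C" using 1 le by (auto elim: eventually_mono)
  show "\<forall>\<^sub>F n in sequentially. real n * (\<integral>x. (small_part n x)\<^sup>2 \<partial>\<mu>) <= C" using 2 le by (auto elim: eventually_mono)
  show "\<forall>\<^sub>F n in sequentially. integrable \<mu> (\<lambda>x. large_part n x powr \<delta>) \<and> real n * (\<integral>x. large_part n x powr \<delta> \<partial>\<mu>) <= C"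
   using 3 le by (auto elim: eventually_mono)
  show "\<forall>\<^sub>F n in sequentially. real n * bias n <= C" using C4 le by (auto elim: eventually_mono)
 qed
qed

end

section \<open>Sums of i.i.d. variables\<close>

lemma (in prob_space) indep_vars_reindex:
 assumes X: "indep_vars (\<lambda>_. N) X (f ` I)" and f: "inj_on f I"
 shows "indep_vars (\<lambda>_. N) (\<lambda>i. X (f i)) I"
 unfolding indep_vars_def
proof (intro conjI ballI)
 fix i assume "i \<in> I" then show "random_variable N (X (f i))"
  using X by (auto simp: indep_vars_def)
next
 have is': "indep_sets (\<lambda>i. sigma_sets (space M) {X i -` A \<inter> space M |A. A \<in> sets N}) (f ` I)"
  using X by (simp add: indep_vars_def)
 show "indep_sets (\<lambda>i. sigma_sets (space M) {X (f i) -` A \<inter> space M |A. A \<in> sets N}) I"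
 proof (rule indep_setsI)
  fix i assume "i \<in> I"
  then show "sigma_sets (space M) {X (f i) -` A \<inter> space M |A. A \<in> sets N} \<subseteq> events"
   using is' by (auto simp: indep_sets_def)
 next
  fix A J assume J: "J \<noteq> {}" "J \<subseteq> I" "finite J"
   and A: "\<forall>j\<in>J. A j \<in> sigma_sets (space M) {X (f j) -` A \<inter> space M |A. A \<in> sets N}"
  have inj: "inj_on f J" using f J(2) by (rule inj_on_subset)
  let ?A = "\<lambda>k. A (inv_into J f k)"
  have inv: "inv_into J f (f j) = j" if "j \<in> J" for j using inj that by simp
  have "prob (\<Inter>k\<in>f ` J. ?A k) = (\<Prod>k\<in>f ` J. prob (?A k))"
   by (rule indep_setsD[OF is']) (use J A inv in auto)
  moreover have "(\<Inter>k\<in>f ` J. ?A k) = (\<Inter>j\<in>J. A j)" using inv by auto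
  moreover have "(\<Prod>k\<in>f ` J. prob (?A k)) = (\<Prod>j\<in>J. prob (A j))"
   using inv by (subst prod.reindex[OF inj]) auto
  ultimately show "prob (\<Inter>j\<in>J. A j) = (\<Prod>j\<in>J. prob (A j))" by simp
 qed
qed

lemma summable_inverse_squares: "summable (\<lambda>k. 1 / (real (Suc k))\<^sup>2)"
 using inverse_power_summable[of 2, where 'a = real] by (subst summable_Suc_iff) (simp add: inverse_eq_divide)

lemma (in prob_space) nn_integral_le_weak_square_tail:
 fixes f :: "'a => real"
 assumes f[measurable]: "f \<in> borel_measurable M" and C: "C \<ge> 0"
  and tail: "\<And>x. x \<ge> 1 ==> \<P>(w in M. x < f w) <= C / x\<^sup>2"
 shows "(\<integral>\<^sup>+w. ennreal (f w) \<partial>M) <= ennreal (1 + C * (\<Sum>k. 1 / (real (Suc k))\<^sup>2))"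
proof -
 note sm = summable_inverse_squares
 have bd: "ennreal (f w) <= 1 + (\<Sum>k. indicator {w\<in>space M. real (Suc k) < f w} w)" if w: "w \<in> space M" for w
 proof (cases "f w <= 1")
  case True
  then have "ennreal (f w) <= 1" using ennreal_leI[OF True] by simp
  then show ?thesis by (rule order_trans) simp
 next
  case False
  define K where "K = nat (\<lceil>f w\<rceil> - 1)"
  have K: "f w <= 1 + real K" "real K < f w" using False unfolding K_def by linarith+
  have "ennreal (real K) = (\<Sum>k<K. 1)" by (simp add: ennreal_of_nat_eq_real_of_nat)
  also have "... = (\<Sum>k<K. indicator {w\<in>space M. real (Suc k) < f w} w)"
   using w K by (intro sum.cong) (auto simp: indicator_def)
  also have "... <= (\<Sum>k. indicator {w\<in>space M. real (Suc k) < f w} w)"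
   by (rule sum_le_suminf) auto
  finally have "1 + ennreal (real K) <= 1 + (\<Sum>k. indicator {w\<in>space M. real (Suc k) < f w} w)"
   by (rule add_left_mono)
  moreover have "ennreal (f w) <= 1 + ennreal (real K)"
   using ennreal_leI[OF K(1)] by (simp add: ennreal_plus)
  ultimately show ?thesis by (rule order_trans[rotated])
 qed
 have "(\<integral>\<^sup>+w. ennreal (f w) \<partial>M) <= (\<integral>\<^sup>+w. 1 + (\<Sum>k. indicator {w\<in>space M. real (Suc k) < f w} w) \<partial>M)"
  by (intro nn_integral_mono bd)
 also have "... = 1 + (\<Sum>k. emeasure M {w\<in>space M. real (Suc k) < f w})"
  by (simp add: nn_integral_add nn_integral_suminf emeasure_space_1)
 also have "... <= 1 + (\<Sum>k. ennreal (C * (1 / (real (Suc k))\<^sup>2)))"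
  using tail by (intro add_left_mono suminf_le) (auto simp: emeasure_eq_measure intro!: ennreal_leI)
 also have "(\<Sum>k. ennreal (C * (1 / (real (Suc k))\<^sup>2))) = ennreal (C * (\<Sum>k. 1 / (real (Suc k))\<^sup>2))"
  by (subst suminf_ennreal2[OF _ summable_mult[OF sm]]) (use C in simp, simp only: suminf_mult[OF sm])
 also have "1 + ennreal (C * (\<Sum>k. 1 / (real (Suc k))\<^sup>2)) = ennreal (1 + C * (\<Sum>k. 1 / (real (Suc k))\<^sup>2))"
  using C sm by (subst ennreal_plus) (auto intro!: mult_nonneg_nonneg suminf_nonneg)
 finally show ?thesis .
qed

lemma powr_add_le:
 fixes x y d :: real
 assumes "0 <= x" "0 <= y" "0 < d" "d <= 1"
 shows "(x + y) powr d <= x powr d + y powr d"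
proof (cases "x + y = 0")
 case True
 then show ?thesis by simp
next
 case False
 then have s: "x + y > 0" using assms by linarith
 have "x / (x + y) <= (x / (x + y)) powr d" "y / (x + y) <= (y / (x + y)) powr d"
  using powr_mono'[of d 1 "x / (x + y)"] powr_mono'[of d 1 "y / (x + y)"] assms s by auto
 then have "x / (x + y) + y / (x + y) <= (x / (x + y)) powr d + (y / (x + y)) powr d" by linarith
 moreover have "x / (x + y) + y / (x + y) = 1" using s by (simp add: add_divide_distrib[symmetric])
 ultimately have "(x + y) powr d * 1 <= (x + y) powr d * ((x / (x + y)) powr d + (y / (x + y)) powr d)"
  by (intro mult_left_mono) auto
 also have "... = x powr d + y powr d" using s assms by (simp add: powr_divide distrib_left)
 finally show ?thesis by simp
qed

lemma powr_sum_le: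
 fixes x :: "'i => real"
 assumes "finite I" "\<And>i. i \<in> I ==> 0 <= x i" "0 < d" "d <= 1"
 shows "(\<Sum>i\<in>I. x i) powr d <= (\<Sum>i\<in>I. x i powr d)"
 using assms(1,2)
proof (induction I rule: finite_induct)
 case (insert i I)
 have "(\<Sum>i\<in>insert i I. x i) powr d <= x i powr d + (\<Sum>i\<in>I. x i) powr d"
  using insert assms by (simp add: powr_add_le sum_nonneg)
 then show ?case using insert by simp
qed simp

locale iid_domain = prob_space M + D: stable_domain \<mu> \<alpha> p r a
 for M :: "'a measure" and \<mu> \<alpha> p r a +
 fixes Z :: "int => 'a => real"
 assumes indep: "indep_vars (\<lambda>_. borel) Z UNIV" and law: "\<And>i. distr M borel (Z i) = \<mu>"
begin

lemma Z_rv[measurable]: "Z i \<in> borel_measurable M"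
 using indep by (auto simp: indep_vars_def)

lemma indep_window:
 assumes [measurable]: "h \<in> borel_measurable borel"
 shows "indep_vars (\<lambda>_. borel) (\<lambda>i w. h (Z (k0 + 1 + int i) w) :: real) {..<N}"
proof -
 have "indep_vars (\<lambda>_. borel) (\<lambda>i. Z (k0 + 1 + int i)) {..<N}"
  by (rule indep_vars_reindex) (auto intro: indep_vars_subset[OF indep] simp: inj_on_def)
 then show ?thesis by (rule indep_vars_compose2) auto
qed

lemma integral_Z:
 fixes h :: "real => 'b::{banach, second_countable_topology}"
 assumes "h \<in> borel_measurable borel"
 shows "(\<integral>w. h (Z i w) \<partial>M) = (\<integral>x. h x \<partial>\<mu>)" "integrable M (\<lambda>w. h (Z i w)) \<longleftrightarrow> integrable \<mu> h"
 using assms integral_distr[of "Z i" M borel h] integrable_distr_eq[of "Z i" M borel h] by (auto simp: law)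

definition walk :: "int => nat => 'a => real" where
 "walk k0 k w = (\<Sum>i<k. Z (k0 + 1 + int i) w - D.centre)"

lemma walk_rv[measurable]: "walk k0 k \<in> borel_measurable M"
 unfolding walk_def[abs_def] by measurable

lemma walk_0[simp]: "walk k0 0 w = 0" by (simp add: walk_def)

lemma walk_add: "walk k0 (k + l) w = walk k0 k w + walk (k0 + int k) l w"
proof -
 have "(\<Sum>i<k + l. Z (k0 + 1 + int i) w - D.centre) =
   (\<Sum>i<k. Z (k0 + 1 + int i) w - D.centre) + (\<Sum>i\<in>{k..<k + l}. Z (k0 + 1 + int i) w - D.centre)"
  by (simp add: lessThan_atLeast0 sum.atLeastLessThan_concat)
 also have "(\<Sum>i\<in>{k..<k + l}. Z (k0 + 1 + int i) w - D.centre) = (\<Sum>i<l. Z (k0 + 1 + int (i + k)) w - D.centre)"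
  using sum.shift_bounds_nat_ivl[of "\<lambda>i. Z (k0 + 1 + int i) w - D.centre" 0 k l] by (simp add: lessThan_atLeast0 add.commute)
 finally show ?thesis by (simp add: walk_def algebra_simps)
qed

definition small_walk :: "nat => int => nat => 'a => real" where
 "small_walk n k0 k w = (\<Sum>i<k. D.small_part n (Z (k0 + 1 + int i) w) - (\<integral>x. D.small_part n x \<partial>\<mu>))"

definition large_walk :: "nat => int => nat => 'a => real" where
 "large_walk n k0 k w = (\<Sum>i<k. D.large_part n (Z (k0 + 1 + int i) w))"

lemma small_walk_rv[measurable]: "small_walk n k0 k \<in> borel_measurable M"
 unfolding small_walk_def[abs_def] by measurable

lemma large_walk_rv[measurable]: "large_walk n k0 k \<in> borel_measurable M"
 unfolding large_walk_def[abs_def] by measurable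

lemma large_part_nonneg: "n \<ge> 1 ==> 0 <= D.large_part n x"
 using D.a_pos[of n] by (simp add: D.large_part_def)

lemma walk_decompose:
 assumes n: "n \<ge> 1"
 shows "\<bar>walk k0 k w\<bar> / a n <= \<bar>small_walk n k0 k w\<bar> + large_walk n k0 k w +
  real k * D.bias n"
proof -
 let ?m = "\<integral>x. D.small_part n x \<partial>\<mu>"
 let ?z = "\<lambda>i. Z (k0 + 1 + int i) w"
 have an: "a n > 0" by (rule D.a_pos[OF n])
 have "walk k0 k w / a n = (\<Sum>i<k. (D.small_part n (?z i) - ?m) + (?z i / a n - D.small_part n (?z i)) + (?m - D.centre / a n))"
  unfolding walk_def sum_divide_distrib by (intro sum.cong) (auto simp: diff_divide_distrib)
 also have "... = small_walk n k0 k w + (\<Sum>i<k. ?z i / a n - D.small_part n (?z i)) + real k * (?m - D.centre / a n)"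
  unfolding small_walk_def by (simp only: sum.distrib sum_constant card_lessThan)
 finally have "\<bar>walk k0 k w / a n\<bar> <= \<bar>small_walk n k0 k w\<bar> + \<bar>\<Sum>i<k. ?z i / a n - D.small_part n (?z i)\<bar> + \<bar>real k * (?m - D.centre / a n)\<bar>"
  by linarith
 also have "\<bar>\<Sum>i<k. ?z i / a n - D.small_part n (?z i)\<bar> <= large_walk n k0 k w"
  unfolding large_walk_def D.parts_decompose[OF n, symmetric] by (rule sum_abs)
 finally show ?thesis using an by (simp add: abs_mult)
qed

lemma small_walk_maximal:
 assumes n: "n \<ge> 1" and C: "real n * (\<integral>x. (D.small_part n x)\<^sup>2 \<partial>\<mu>) <= C" and x: "x > 0"
 shows "\<P>(w in M. \<exists>k\<le>N. x < \<bar>small_walk n k0 k w\<bar>) <= real N * C / (real n * x\<^sup>2)"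
proof -
 define m where "m = (\<integral>x. D.small_part n x \<partial>\<mu>)"
 define \<xi> where "\<xi> i w = D.small_part n (Z (k0 + 1 + int i) w) - m" for i w
 have ind: "indep_vars (\<lambda>_. borel) \<xi> {..<N}"
  unfolding \<xi>_def by (rule indep_window[where h = "\<lambda>x. D.small_part n x - m"]) measurable
 have i0: "integrable \<mu> (\<lambda>x. (D.small_part n x)\<^sup>2)"
  using D.small_part_abs_le[OF n] by (intro D.integrable_const_bound[of _ 1]) (auto simp: abs_square_le_1)
 have i1: "integrable \<mu> (\<lambda>x. (D.small_part n x - m)\<^sup>2)"
  using i0 D.integrable_small_part[OF n] by (simp add: power2_diff)
 have sq: "integrable M (\<lambda>w. (\<xi> i w)\<^sup>2)" for i
  unfolding \<xi>_def using integral_Z(2)[of "\<lambda>x. (D.small_part n x - m)\<^sup>2"] i1 by simp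
 have mean: "expectation (\<xi> i) = 0" for i
  unfolding \<xi>_def using integral_Z(1)[of "\<lambda>x. D.small_part n x - m"] D.integrable_small_part[OF n] D.prob_space
  by (simp add: m_def)
 have e2: "expectation (\<lambda>w. (\<xi> i w)\<^sup>2) <= C / real n" for i
 proof -
  have "expectation (\<lambda>w. (\<xi> i w)\<^sup>2) = (\<integral>x. (D.small_part n x - m)\<^sup>2 \<partial>\<mu>)"
   unfolding \<xi>_def by (rule integral_Z(1)) measurable
  also have "... = (\<integral>x. (D.small_part n x)\<^sup>2 \<partial>\<mu>) - m\<^sup>2"
  proof -
   have "(\<integral>x. (D.small_part n x - m)\<^sup>2 \<partial>\<mu>) = (\<integral>x. ((D.small_part n x)\<^sup>2 + m\<^sup>2) - (2 * m) * D.small_part n x \<partial>\<mu>)"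
    by (simp add: power2_diff mult_ac)
   also have "... = (\<integral>x. (D.small_part n x)\<^sup>2 \<partial>\<mu>) + m\<^sup>2 - 2 * m * (\<integral>x. D.small_part n x \<partial>\<mu>)"
    using i0 D.integrable_small_part[OF n] D.prob_space by simp
   finally show ?thesis by (simp add: m_def[symmetric] power2_eq_square)
  qed
  also have "... <= (\<integral>x. (D.small_part n x)\<^sup>2 \<partial>\<mu>)" by simp
  also have "... <= C / real n" using C n by (simp add: field_simps)
  finally show ?thesis .
 qed
 have "\<P>(w in M. \<exists>k\<le>N. x < \<bar>small_walk n k0 k w\<bar>) <= (\<Sum>i<N. expectation (\<lambda>w. (\<xi> i w)\<^sup>2)) / x\<^sup>2"
  using kolmogorov_maximal_inequality[OF ind sq mean x] by (simp add: small_walk_def \<xi>_def m_def)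
 also have "... <= (\<Sum>i<N. C / real n) / x\<^sup>2" by (intro divide_right_mono sum_mono e2) auto
 finally show ?thesis by simp
qed

lemma large_walk_zero:
 assumes n: "n \<ge> 1" and C: "real n * measure \<mu> {x. a n < \<bar>x\<bar>} <= C"
 shows "\<P>(w in M. large_walk n k0 N w \<noteq> 0) <= real N * C / real n"
proof -
 have "\<P>(w in M. large_walk n k0 N w \<noteq> 0) <= prob (\<Union>i\<in>{..<N}. {w\<in>space M. a n < \<bar>Z (k0 + 1 + int i) w\<bar>})"
 proof (rule finite_measure_mono)
  show "{w\<in>space M. large_walk n k0 N w \<noteq> 0} \<subseteq> (\<Union>i\<in>{..<N}. {w\<in>space M. a n < \<bar>Z (k0 + 1 + int i) w\<bar>})"
  proof
   fix w assume w: "w \<in> {w\<in>space M. large_walk n k0 N w \<noteq> 0}"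
   then obtain i where "i < N" "D.large_part n (Z (k0 + 1 + int i) w) \<noteq> 0"
    unfolding large_walk_def by (auto elim!: sum.not_neutral_contains_not_neutral)
   then have "a n < \<bar>Z (k0 + 1 + int i) w\<bar>" by (simp add: D.large_part_def not_le split: if_splits)
   then show "w \<in> (\<Union>i\<in>{..<N}. {w\<in>space M. a n < \<bar>Z (k0 + 1 + int i) w\<bar>})" using w \<open>i < N\<close> by auto
  qed
 qed auto
 also have "... <= (\<Sum>i<N. prob {w\<in>space M. a n < \<bar>Z (k0 + 1 + int i) w\<bar>})"
  by (rule finite_measure_subadditive_finite) auto
 also have "... <= (\<Sum>i<N. C / real n)"
 proof (rule sum_mono)
  fix i
  have "prob {w\<in>space M. a n < \<bar>Z (k0 + 1 + int i) w\<bar>} = measure (distr M borel (Z (k0 + 1 + int i))) {x. a n < \<bar>x\<bar>}"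
   by (subst measure_distr) (auto intro!: arg_cong[where f = prob])
  also have "... = measure \<mu> {x. a n < \<bar>x\<bar>}" by (simp add: law)
  also have "... <= C / real n" using C n by (simp add: field_simps)
  finally show "prob {w\<in>space M. a n < \<bar>Z (k0 + 1 + int i) w\<bar>} <= C / real n" .
 qed
 finally show ?thesis by simp
qed

lemma large_walk_mono: "n \<ge> 1 ==> k <= N ==> large_walk n k0 k w <= large_walk n k0 N w"
 unfolding large_walk_def by (intro sum_mono2) (auto simp: large_part_nonneg)

lemma large_walk_nonneg: "n \<ge> 1 ==> 0 <= large_walk n k0 k w"
 unfolding large_walk_def by (intro sum_nonneg) (auto simp: large_part_nonneg)

text \<open>Large maxima come from a large truncated walk, which Kolmogorov's inequality makes unlikely, or
  from the presence of a step above \<open>a n\<close>. The probability is proportional to the length of the window;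
  this linearity is what makes its square summable over the blocks.\<close>

lemma walk_maximal:
 obtains C where "C > 0" "\<forall>\<^sub>F n in sequentially. \<forall>N k0 x. 0 < x --> real N * C / real n <= x / 2 -->
  \<P>(w in M. \<exists>k\<le>N. x * a n < \<bar>walk k0 k w\<bar>) <= real N / real n * (C * (1 + 4 / x\<^sup>2))"
proof -
 have half: "0 < \<alpha> / 2" "\<alpha> / 2 < \<alpha>" using D.alpha by auto
 obtain C where C: "C > 0"
  and c1: "\<forall>\<^sub>F n in sequentially. real n * measure \<mu> {x. a n < \<bar>x\<bar>} <= C"
  and c2: "\<forall>\<^sub>F n in sequentially. real n * (\<integral>x. (D.small_part n x)\<^sup>2 \<partial>\<mu>) <= C"
  and c4: "\<forall>\<^sub>F n in sequentially. real n * D.bias n <= C"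
  using D.truncation_bounds[OF half] by blast
 have "\<forall>\<^sub>F n in sequentially. \<forall>N k0 x. 0 < x --> real N * C / real n <= x / 2 -->
  \<P>(w in M. \<exists>k\<le>N. x * a n < \<bar>walk k0 k w\<bar>) <= real N / real n * (C * (1 + 4 / x\<^sup>2))"
  using c1 c2 c4 eventually_ge_at_top[of 1]
 proof eventually_elim
  case (elim n)
  show ?case
  proof (intro allI impI)
   fix N k0 and x :: real assume x: "0 < x" "real N * C / real n <= x / 2"
   have an: "a n > 0" by (rule D.a_pos[OF elim(4)])
   let ?A = "{w\<in>space M. \<exists>k\<le>N. x / 2 < \<bar>small_walk n k0 k w\<bar>}" and ?B = "{w\<in>space M. large_walk n k0 N w \<noteq> 0}"
   have "{w\<in>space M. \<exists>k\<le>N. x * a n < \<bar>walk k0 k w\<bar>} \<subseteq> ?A \<union> ?B"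
   proof
    fix w assume "w \<in> {w\<in>space M. \<exists>k\<le>N. x * a n < \<bar>walk k0 k w\<bar>}"
    then obtain k where w: "w \<in> space M" and k: "k <= N" "x * a n < \<bar>walk k0 k w\<bar>" by auto
    have "w \<in> ?A" if z: "large_walk n k0 N w = 0"
    proof -
     have lz: "large_walk n k0 k w <= 0" using large_walk_mono[OF elim(4) k(1), of k0 w] z by simp
     have "D.bias n <= C / real n" using elim by (simp add: field_simps)
     then have "real k * D.bias n <= real N * (C / real n)"
      using k C by (intro mult_mono) auto
     then have dr: "real k * D.bias n <= x / 2" using x(2) unfolding times_divide_eq_right by (rule order_trans)
     have "x < \<bar>walk k0 k w\<bar> / a n" using k(2) an by (simp add: pos_less_divide_eq)
     then have "x / 2 < \<bar>small_walk n k0 k w\<bar>" using walk_decompose[OF elim(4), of k0 k w] lz dr by linarith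
     then show ?thesis using w k by auto
    qed
    then show "w \<in> ?A \<union> ?B" using w by auto
   qed
   then have "\<P>(w in M. \<exists>k\<le>N. x * a n < \<bar>walk k0 k w\<bar>) <= prob (?A \<union> ?B)"
    by (intro finite_measure_mono) auto
   also have "... <= prob ?A + prob ?B" by (intro measure_Un_le) auto
   also have "... <= real N * C / (real n * (x / 2)\<^sup>2) + real N * C / real n"
    by (intro add_mono small_walk_maximal large_walk_zero) (use elim x in auto)
   also have "... = real N / real n * (C * (1 + 4 / x\<^sup>2))"
    using x(1) elim(4) by (simp add: divide_simps) (simp add: algebra_simps power2_eq_square)
   finally show "\<P>(w in M. \<exists>k\<le>N. x * a n < \<bar>walk k0 k w\<bar>) <= real N / real n * (C * (1 + 4 / x\<^sup>2))" .
  qed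
 qed
 with C show ?thesis using that by blast
qed

definition walk_max :: "nat => int => 'a => real" where
 "walk_max n k0 w = Max ((\<lambda>k. \<bar>walk k0 k w\<bar>) ` {..n}) / a n"

lemma walk_max_rv[measurable]: "walk_max n k0 \<in> borel_measurable M"
 unfolding walk_max_def[abs_def] by (intro borel_measurable_divide borel_measurable_Max) auto

lemma walk_le_walk_max: "n \<ge> 1 ==> k <= n ==> \<bar>walk k0 k w\<bar> / a n <= walk_max n k0 w"
 unfolding walk_max_def using D.a_pos[of n] by (intro divide_right_mono Max_ge) auto

lemma walk_max_nonneg: "n \<ge> 1 ==> 0 <= walk_max n k0 w"
 using walk_le_walk_max[of n 0 k0 w] by simp

text \<open>The truncated walk has a weak second moment, hence a mean, and for the large steps the
  subadditivity of \<open>x \<mapsto> x\<^sup>\<delta>\<close> replaces the maximum by a sum of \<open>n\<close> moments of order \<open>1 / n\<close>.\<close>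

lemma walk_max_moment:
 assumes \<delta>: "0 < \<delta>" "\<delta> < \<alpha>" "\<delta> <= 1"
 obtains C where "C > 0" "\<forall>\<^sub>F n in sequentially. \<forall>k0. (\<integral>\<^sup>+w. ennreal (walk_max n k0 w powr \<delta>) \<partial>M) <= ennreal C"
proof -
 obtain C where C: "C > 0"
  and c2: "\<forall>\<^sub>F n in sequentially. real n * (\<integral>x. (D.small_part n x)\<^sup>2 \<partial>\<mu>) <= C"
  and c3: "\<forall>\<^sub>F n in sequentially. integrable \<mu> (\<lambda>x. D.large_part n x powr \<delta>) \<and> real n * (\<integral>x. D.large_part n x powr \<delta> \<partial>\<mu>) <= C"
  and c4: "\<forall>\<^sub>F n in sequentially. real n * D.bias n <= C"
  using D.truncation_bounds[OF \<delta>(1,2)] by blast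
 let ?s = "\<Sum>k. 1 / (real (Suc k))\<^sup>2"
 have s0: "0 <= ?s"
  by (rule suminf_nonneg[OF summable_inverse_squares]) simp
 define K where "K = (1 + (1 + C * ?s)) + C + C powr \<delta>"
 have K: "K > 0" using C s0 by (simp add: K_def add_pos_nonneg)
 have "\<forall>\<^sub>F n in sequentially. \<forall>k0. (\<integral>\<^sup>+w. ennreal (walk_max n k0 w powr \<delta>) \<partial>M) <= ennreal K"
  using c2 c3 c4 eventually_ge_at_top[of 1]
 proof eventually_elim
  case (elim n)
  show ?case
  proof
   fix k0
   define A where "A w = Max ((\<lambda>k. \<bar>small_walk n k0 k w\<bar>) ` {..n})" for w
   have A_rv[measurable]: "A \<in> borel_measurable M"
    unfolding A_def[abs_def] by (intro borel_measurable_Max) auto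
   have A_ge: "\<bar>small_walk n k0 k w\<bar> <= A w" if "k <= n" for k w
    unfolding A_def using that by (intro Max_ge) auto
   have A0: "0 <= A w" for w using A_ge[of 0 w] by linarith
   have lp[measurable]: "(\<lambda>x. D.large_part n x powr \<delta>) \<in> borel_measurable borel" by measurable
   have ptw: "walk_max n k0 w powr \<delta> <= (1 + A w) + (\<Sum>i<n. D.large_part n (Z (k0 + 1 + int i) w) powr \<delta>) + C powr \<delta>" for w
   proof -
    have "\<bar>walk k0 k w\<bar> / a n <= A w + large_walk n k0 n w + C" if k: "k <= n" for k
    proof -
     have "real k * D.bias n <= real n * D.bias n"
      using k by (intro mult_right_mono) auto
     then show ?thesis
      using walk_decompose[OF elim(4), of k0 k w] A_ge[OF k, of w] large_walk_mono[OF elim(4) k, of k0 w] elim(3) by linarith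
    qed
    then have "walk_max n k0 w <= A w + large_walk n k0 n w + C"
     unfolding walk_max_def using D.a_pos[OF elim(4)] by (simp add: pos_divide_le_eq)
    then have "walk_max n k0 w powr \<delta> <= (A w + large_walk n k0 n w + C) powr \<delta>"
     using walk_max_nonneg[OF elim(4)] \<delta> by (intro powr_mono2) auto
    also have "... <= (A w + large_walk n k0 n w) powr \<delta> + C powr \<delta>"
     using A0[of w] large_walk_nonneg[OF elim(4), of k0 n w] C \<delta> by (intro powr_add_le) auto
    also have "(A w + large_walk n k0 n w) powr \<delta> <= A w powr \<delta> + large_walk n k0 n w powr \<delta>"
     using A0[of w] large_walk_nonneg[OF elim(4), of k0 n w] \<delta> by (intro powr_add_le) auto
    also have "large_walk n k0 n w powr \<delta> <= (\<Sum>i<n. D.large_part n (Z (k0 + 1 + int i) w) powr \<delta>)"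
     unfolding large_walk_def using large_part_nonneg[OF elim(4)] \<delta> by (intro powr_sum_le) auto
    also have "A w powr \<delta> <= 1 + A w"
    proof (cases "A w <= 1")
     case True
     then have "A w powr \<delta> <= 1" using A0 \<delta> by (intro powr_le1) auto
     then show ?thesis using A0[of w] by linarith
    next
     case False
     then have "A w powr \<delta> <= A w powr 1" using \<delta> by (intro powr_mono) auto
     then show ?thesis using False by simp
    qed
    finally show ?thesis by simp
   qed
   have "(\<integral>\<^sup>+w. ennreal (walk_max n k0 w powr \<delta>) \<partial>M)
     <= (\<integral>\<^sup>+w. (1 + ennreal (A w)) + (\<Sum>i<n. ennreal (D.large_part n (Z (k0 + 1 + int i) w) powr \<delta>)) + ennreal (C powr \<delta>) \<partial>M)"
    using ennreal_leI[OF ptw] A0 by (intro nn_integral_mono) (simp add: ennreal_plus sum_nonneg)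
   also have "... = (1 + (\<integral>\<^sup>+w. ennreal (A w) \<partial>M)) + (\<Sum>i<n. \<integral>\<^sup>+w. ennreal (D.large_part n (Z (k0 + 1 + int i) w) powr \<delta>) \<partial>M) + ennreal (C powr \<delta>)"
    by (simp add: nn_integral_add nn_integral_sum emeasure_space_1 del: sum_ennreal)
   also have "(\<Sum>i<n. \<integral>\<^sup>+w. ennreal (D.large_part n (Z (k0 + 1 + int i) w) powr \<delta>) \<partial>M) <= ennreal C"
   proof -
    have "(\<integral>\<^sup>+w. ennreal (D.large_part n (Z i w) powr \<delta>) \<partial>M) = ennreal (\<integral>x. D.large_part n x powr \<delta> \<partial>\<mu>)" for i
     using integral_Z[OF lp, of i] elim(2) by (subst nn_integral_eq_integral) auto
    then have "(\<Sum>i<n. \<integral>\<^sup>+w. ennreal (D.large_part n (Z (k0 + 1 + int i) w) powr \<delta>) \<partial>M) = ennreal (real n * (\<integral>x. D.large_part n x powr \<delta> \<partial>\<mu>))"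
     by (simp add: ennreal_mult ennreal_of_nat_eq_real_of_nat)
    also have "... <= ennreal C" using elim(2) by (intro ennreal_leI) auto
    finally show ?thesis .
   qed
   also have "(\<integral>\<^sup>+w. ennreal (A w) \<partial>M) <= ennreal (1 + C * ?s)"
   proof (rule nn_integral_le_weak_square_tail[OF A_rv])
    fix x :: real assume x: "x \<ge> 1"
    have "{w\<in>space M. x < A w} = {w\<in>space M. \<exists>k\<le>n. x < \<bar>small_walk n k0 k w\<bar>}"
     unfolding A_def by (subst Max_gr_iff) auto
    then show "\<P>(w in M. x < A w) <= C / x\<^sup>2"
     using small_walk_maximal[OF elim(4) elim(1), of x n k0] x elim(4) by simp
   qed (use C in auto)
   also have "(1 + ennreal (1 + C * ?s)) + ennreal C + ennreal (C powr \<delta>) = ennreal K"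
   proof -
    have "(1 + ennreal x) + ennreal y + ennreal z = ennreal ((1 + x) + y + z)" if "0 <= x" "0 <= y" "0 <= z" for x y z
     using that by (simp add: ennreal_plus)
    then show ?thesis using C s0 unfolding K_def by simp
   qed
   finally show "(\<integral>\<^sup>+w. ennreal (walk_max n k0 w powr \<delta>) \<partial>M) <= ennreal K"
    by (simp add: add_mono)
  qed
 qed
 with K show ?thesis using that by blast
qed

end

section \<open>Linear processes\<close>

text \<open>As \<open>\<delta> \<le> 1\<close>, the \<open>\<delta>\<close>-th power of the sum is at most the sum of the \<open>\<delta>\<close>-th powers.\<close>

lemma summable_of_summable_powr:
 fixes c :: "nat => real"
 assumes c: "\<And>j. 0 <= c j" and d: "0 < d" "d <= 1" and e: "e > 0"
  and s: "summable (\<lambda>j. c j powr d)" "(\<Sum>j. c j powr d) <= e powr d"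
 shows "summable c" "(\<Sum>j. c j) <= e"
proof -
 have le1: "c j <= e" for j
 proof -
  have "c j powr d <= (\<Sum>j. c j powr d)"
   using sum_le_suminf[OF s(1), of "{j}"] by simp
  then have "c j powr d <= e powr d" using s(2) by linarith
  then show ?thesis using powr_less_iff[of d e "c j"] c[of j] d e by (simp add: not_less[symmetric])
 qed
 have cj: "c j <= e * (c j / e) powr d" for j
 proof -
  have "(c j / e) powr 1 <= (c j / e) powr d"
   using le1[of j] c[of j] d e by (intro powr_mono') auto
  then have "e * (c j / e) <= e * (c j / e) powr d" using c[of j] e by (intro mult_left_mono) auto
  then show ?thesis using e by simp
 qed
 have eq: "e * (c j / e) powr d = e / e powr d * c j powr d" for j
  using c[of j] e by (simp add: powr_divide)
 have s': "summable (\<lambda>j. e / e powr d * c j powr d)" by (intro summable_mult s)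
 show sc: "summable c"
  by (rule summable_comparison_test'[OF s', of 0]) (use cj c eq in auto)
 have "(\<Sum>j. c j) <= (\<Sum>j. e / e powr d * c j powr d)"
  by (rule suminf_le[OF _ sc s']) (use cj eq in auto)
 also have "... = e / e powr d * (\<Sum>j. c j powr d)" by (rule suminf_mult[OF s(1)])
 also have "... <= e / e powr d * e powr d" using e by (intro mult_left_mono s) auto
 also have "... = e" using e by simp
 finally show "(\<Sum>j. c j) <= e" .
qed

text \<open>The core of the argument. In the block \<open>[k0, k1]\<close>, extended to the left by the memory \<open>q\<close>, the walk
  \<open>T\<close> has a single jump, at time \<open>\<tau>\<close>. The terms with \<open>k - j\<close> past \<open>\<tau>\<close> see the new value and the others
  the old one, so that the moving average is close to a combination of the two, with weights
  given by a partial sum of the coefficients; \<open>ratio\<close> makes it a convex combination. Each of the three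
  approximations \<open>jump\<close>, \<open>short\<close> and \<open>zero\<close> costs \<open>\<eta>\<close>.\<close>

lemma block_bound:
 fixes T :: "int => real" and c :: "nat => real" and q :: nat
 assumes jump: "\<And>k. k0 - int q <= k ==> k <= k1 ==>
   (k < \<tau> --> \<bar>T k - T (k0 - int q)\<bar> <= \<eta>) \<and> (\<tau> <= k --> \<bar>T k1 - T k\<bar> <= \<eta>)"
  and short: "\<And>j. j <= q ==> \<bar>T (k0 - int j) - T k0\<bar> <= \<eta>"
  and zero: "\<And>j. j <= q ==> \<bar>T (- int j)\<bar> <= \<eta>"
  and ratio: "\<And>s. s <= q ==> 0 <= (\<Sum>j\<le>s. c j) / \<Phi> \<and> (\<Sum>j\<le>s. c j) / \<Phi> <= 1"
  and total: "(\<Sum>j\<le>q. c j) = \<Phi>" and \<Phi>: "\<Phi> \<noteq> 0" and k: "k0 <= k" "k <= k1"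
 defines "U \<equiv> \<Sum>j\<le>q. c j * (T (k - int j) - T (- int j))" and "F \<equiv> \<Sum>j\<le>q. \<bar>c j\<bar>"
 shows "min (\<Phi> * T k0) (\<Phi> * T k1) - 3 * \<eta> * F <= U \<and> U <= max (\<Phi> * T k0) (\<Phi> * T k1) + 3 * \<eta> * F"
proof -
 define v where "v j = (if \<tau> <= k - int j then T k1 else T k0)" for j :: nat
 have near: "\<bar>T (k - int j) - T (- int j) - v j\<bar> <= 3 * \<eta>" if j: "j <= q" for j
 proof -
  have r: "k0 - int q <= k - int j" "k - int j <= k1" using k j by auto
  have "\<bar>T (k - int j) - v j\<bar> <= 2 * \<eta>"
  proof (cases "\<tau> <= k - int j")
   case True
   then show ?thesis using jump[OF r] zero[OF j] by (simp add: v_def)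
  next
   case False
   then show ?thesis using jump[OF r] short[of q] by (simp add: v_def)
  qed
  then show ?thesis using zero[OF j] by linarith
 qed
 have "U - (\<Sum>j\<le>q. c j * v j) = (\<Sum>j\<le>q. c j * (T (k - int j) - T (- int j) - v j))"
  unfolding U_def by (simp add: sum_subtractf[symmetric] algebra_simps)
 also have "\<bar>...\<bar> <= (\<Sum>j\<le>q. \<bar>c j\<bar> * (3 * \<eta>))"
  by (rule order_trans[OF sum_abs], rule sum_mono) (use near in \<open>auto simp: abs_mult intro!: mult_left_mono\<close>)
 also have "... = 3 * \<eta> * F" unfolding F_def by (subst sum_distrib_right[symmetric]) (rule mult.commute)
 finally have err: "\<bar>U - (\<Sum>j\<le>q. c j * v j)\<bar> <= 3 * \<eta> * F" .
 have "(\<Sum>j\<le>q. c j * v j) \<in> closed_segment (\<Phi> * T k0) (\<Phi> * T k1)"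
 proof (cases "k < \<tau>")
  case True
  then have "(\<Sum>j\<le>q. c j * v j) = (\<Sum>j\<le>q. c j * T k0)" by (intro sum.cong) (auto simp: v_def)
  then have "(\<Sum>j\<le>q. c j * v j) = \<Phi> * T k0" by (simp add: total sum_distrib_right[symmetric])
  then show ?thesis by simp
 next
  case False
  define s where "s = min q (nat (k - \<tau>))"
  have s: "s <= q" "\<And>j. j <= q ==> \<tau> <= k - int j \<longleftrightarrow> j <= s" using False by (auto simp: s_def)
  define w where "w = (\<Sum>j\<le>s. c j) / \<Phi>"
  have w: "0 <= w" "w <= 1" using ratio[OF s(1)] by (auto simp: w_def)
  have c1: "(\<Sum>j\<le>s. c j) = \<Phi> * w" using \<Phi> by (simp add: w_def)
  have split: "(\<Sum>j\<le>q. f j) = (\<Sum>j\<le>s. f j) + (\<Sum>j\<in>{s<..q}. f j)" for f :: "nat => real"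
  proof -
   have "{..q} = {..s} \<union> {s<..q}" using s(1) by auto
   then show ?thesis by (simp add: sum.union_disjoint ivl_disj_int)
  qed
  have c2: "(\<Sum>j\<in>{s<..q}. c j) = \<Phi> - \<Phi> * w" using split[of c] total c1 by simp
  have "(\<Sum>j\<le>q. c j * v j) = (\<Sum>j\<le>s. c j * v j) + (\<Sum>j\<in>{s<..q}. c j * v j)" by (rule split)
  also have "(\<Sum>j\<le>s. c j * v j) = (\<Sum>j\<le>s. c j * T k1)"
   using s by (intro sum.cong) (auto simp: v_def)
  also have "(\<Sum>j\<in>{s<..q}. c j * v j) = (\<Sum>j\<in>{s<..q}. c j * T k0)"
   using s by (intro sum.cong) (auto simp: v_def)
  also have "(\<Sum>j\<le>s. c j * T k1) + (\<Sum>j\<in>{s<..q}. c j * T k0) = (1 - w) * (\<Phi> * T k0) + w * (\<Phi> * T k1)"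
   unfolding sum_distrib_right[symmetric] c1 c2 by (simp add: algebra_simps)
  finally show ?thesis using w by (auto simp: in_segment intro!: exI[of _ w])
 qed
 then have "min (\<Phi> * T k0) (\<Phi> * T k1) <= (\<Sum>j\<le>q. c j * v j)" "(\<Sum>j\<le>q. c j * v j) <= max (\<Phi> * T k0) (\<Phi> * T k1)"
  by (auto simp: closed_segment_eq_real_ivl split: if_splits)
 then show ?thesis using err by linarith
qed

context iid_domain
begin

text \<open>The random walk indexed by all integers and vanishing at \<open>0\<close>.\<close>

definition T :: "'a => int => real" where
 "T w k = (if 0 <= k then walk 0 (nat k) w else - walk k (nat (- k)) w)"

lemma T_0[simp]: "T w 0 = 0" by (simp add: T_def)

lemma T_rv[measurable]: "(\<lambda>w. T w k) \<in> borel_measurable M"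
 unfolding T_def by (cases "0 <= k") auto

lemma T_step: "T w (k + 1) = T w k + (Z (k + 1) w - D.centre)"
proof (cases "0 <= k")
 case True
 then have "nat (k + 1) = nat k + 1" by simp
 then show ?thesis using walk_add[of 0 "nat k" 1 w] True by (simp add: T_def walk_def)
next
 case False
 then have n: "nat (- k) = 1 + nat (- (k + 1))" by simp
 have w: "walk k (nat (- k)) w = walk k 1 w + walk (k + 1) (nat (- (k + 1))) w"
  unfolding n using walk_add[of k 1 "nat (- (k + 1))" w] by simp
 show ?thesis
 proof (cases "k = -1")
  case True
  then show ?thesis by (simp add: T_def walk_def)
 next
  case False': False
  then show ?thesis using False w by (simp add: T_def walk_def)
 qed
qed

lemma walk_eq_T: "walk k0 l w = T w (k0 + int l) - T w k0"
proof (induction l)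
 case (Suc l)
 have "walk k0 (Suc l) w = walk k0 l w + (Z (k0 + int l + 1) w - D.centre)"
  by (simp add: walk_def algebra_simps)
 also have "... = T w (k0 + int l + 1) - T w k0" using Suc by (simp add: T_step)
 finally show ?case by (simp add: algebra_simps)
qed simp

end

locale linear_domain = iid_domain M \<mu> \<alpha> p r a Z
 for M :: "'a measure" and \<mu> \<alpha> p r a Z +
 fixes \<phi> :: "nat => real" and \<Phi> \<delta> :: real
 assumes \<delta>: "0 < \<delta>" "\<delta> < 1" "\<delta> < \<alpha>" and \<phi>_powr: "summable (\<lambda>i. \<bar>\<phi> i\<bar> powr \<delta>)"
  and \<Phi>_eq: "\<Phi> = (\<Sum>i. \<phi> i)" and \<Phi>_nz: "\<Phi> \<noteq> 0"
  and \<phi>_ratio: "\<And>s. 0 <= (\<Sum>i=0..s. \<phi> i) / \<Phi> \<and> (\<Sum>i=0..s. \<phi> i) / \<Phi> <= 1"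
begin

lemma summable_powr_imp_summable:
 fixes c :: "nat => real"
 assumes "\<And>j. 0 <= c j" "summable (\<lambda>j. c j powr \<delta>)"
 shows "summable c"
proof -
 define S where "S = (\<Sum>j. c j powr \<delta>) + 1"
 have S: "S > 0" unfolding S_def using assms suminf_nonneg[OF assms(2)] by (simp add: add_nonneg_pos)
 show ?thesis
  by (rule summable_of_summable_powr(1)[OF assms(1) \<delta>(1) _ _ assms(2), of "S powr (1 / \<delta>)"])
   (use S \<delta> in \<open>auto simp: powr_powr S_def\<close>)
qed

lemma summable_abs_\<phi>: "summable (\<lambda>i. \<bar>\<phi> i\<bar>)"
 by (rule summable_powr_imp_summable[OF _ \<phi>_powr]) simp

lemma summable_\<phi>: "summable \<phi>"
 using summable_abs_\<phi> by (rule summable_rabs_cancel)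

text \<open>The \<open>\<delta>\<close>-th powers of the terms have summable means.\<close>

lemma AE_summable: "AE w in M. summable (\<lambda>i. \<bar>\<phi> i * Z (t - int i) w\<bar>)"
proof -
 let ?m = "\<integral>x. \<bar>x\<bar> powr \<delta> \<partial>\<mu>"
 have im: "integrable \<mu> (\<lambda>x. \<bar>x\<bar> powr \<delta>)" using D.absolute_moment \<delta> by auto
 have e: "(\<integral>\<^sup>+w. ennreal (\<bar>\<phi> i * Z (t - int i) w\<bar> powr \<delta>) \<partial>M) = ennreal (\<bar>\<phi> i\<bar> powr \<delta> * ?m)" for i
 proof -
  have "integrable M (\<lambda>w. \<bar>\<phi> i * Z (t - int i) w\<bar> powr \<delta>)"
   using integral_Z(2)[of "\<lambda>x. \<bar>x\<bar> powr \<delta>" "t - int i"] im by (simp add: abs_mult powr_mult)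
  moreover have "(\<integral>w. \<bar>\<phi> i * Z (t - int i) w\<bar> powr \<delta> \<partial>M) = \<bar>\<phi> i\<bar> powr \<delta> * ?m"
   using integral_Z(1)[of "\<lambda>x. \<bar>x\<bar> powr \<delta>" "t - int i"] by (simp add: abs_mult powr_mult)
  ultimately show ?thesis by (subst nn_integral_eq_integral) auto
 qed
 have "(\<integral>\<^sup>+w. (\<Sum>i. ennreal (\<bar>\<phi> i * Z (t - int i) w\<bar> powr \<delta>)) \<partial>M) = (\<Sum>i. ennreal (\<bar>\<phi> i\<bar> powr \<delta> * ?m))"
  by (subst nn_integral_suminf) (auto simp: e)
 also have "... = ennreal (\<Sum>i. \<bar>\<phi> i\<bar> powr \<delta> * ?m)"
  by (intro suminf_ennreal2 summable_mult2 \<phi>_powr) auto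
 finally have fin: "(\<integral>\<^sup>+w. (\<Sum>i. ennreal (\<bar>\<phi> i * Z (t - int i) w\<bar> powr \<delta>)) \<partial>M) \<noteq> \<infinity>" by simp
 have "AE w in M. (\<Sum>i. ennreal (\<bar>\<phi> i * Z (t - int i) w\<bar> powr \<delta>)) \<noteq> \<infinity>"
  by (rule nn_integral_PInf_AE[OF _ fin]) measurable
 then show ?thesis
 proof eventually_elim
  case (elim w)
  then have "summable (\<lambda>i. \<bar>\<phi> i * Z (t - int i) w\<bar> powr \<delta>)"
   by (intro summable_suminf_not_top) auto
  then show ?case by (rule summable_powr_imp_summable[rotated]) (rule abs_ge_zero)
 qed
qed

lemma linear_process_walk:
 assumes s: "\<And>t. summable (\<lambda>i. \<bar>\<phi> i * Z (t - int i) w\<bar>)"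
 shows "(\<lambda>j. \<phi> j * walk (- int j) k w) sums
  ((\<Sum>i = 1..int k. linear_process \<phi> Z i w) - real k * (\<Phi> * D.centre))"
proof -
 have s1: "(\<lambda>j. \<phi> j * Z (i - int j) w) sums linear_process \<phi> Z i w" for i
  unfolding linear_process_def using summable_rabs_cancel[OF s[of i]] by (rule summable_sums)
 have s2: "(\<lambda>j. \<phi> j * D.centre) sums (\<Phi> * D.centre)"
  unfolding \<Phi>_eq using summable_\<phi> by (intro sums_mult2 summable_sums)
 have "(\<lambda>j. \<Sum>i\<in>{1..int k}. \<phi> j * Z (i - int j) w - \<phi> j * D.centre) sums
   (\<Sum>i\<in>{1..int k}. linear_process \<phi> Z i w - \<Phi> * D.centre)"
  by (intro sums_sum sums_diff s1 s2)
 moreover have "(\<Sum>i\<in>{1..int k}. \<phi> j * Z (i - int j) w - \<phi> j * D.centre) = \<phi> j * walk (- int j) k w" for j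
 proof -
  have "(\<Sum>i\<in>{1..int k}. f i) = (\<Sum>i<k. f (1 + int i))" for f :: "int => real"
   by (rule sum.reindex_bij_witness[of _ "\<lambda>i. 1 + int i" "\<lambda>i. nat (i - 1)"]) auto
  then show ?thesis by (simp add: walk_def sum_distrib_left algebra_simps)
 qed
 moreover have "(\<Sum>i\<in>{1..int k}. linear_process \<phi> Z i w - \<Phi> * D.centre) =
   (\<Sum>i = 1..int k. linear_process \<phi> Z i w) - real k * (\<Phi> * D.centre)"
  by (simp add: sum_subtractf)
 ultimately show ?thesis by simp
qed

text \<open>What replacing the lag \<open>j + q\<close> by the lag \<open>q\<close> changes in the contribution of the coefficient
  \<open>\<phi> (j + q)\<close>.\<close>

abbreviation "tail_term q k w j \<equiv> \<phi> (j + q) * (walk (- int (j + q)) k w - walk (- int q) k w)"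
abbreviation "tail_small e q n k w \<equiv> \<bar>\<Sum>j. tail_term q k w j\<bar> <= e * a n \<and> summable (tail_term q k w)"

text \<open>Markov's inequality for the \<open>\<delta>\<close>-th moment of the sum of \<open>\<bar>\<phi> (j + q)\<bar>\<close> times the maxima of the walk
  over the windows that the two lags use.\<close>

lemma tail_event:
 obtains C where "C > 0" "\<forall>\<^sub>F n in sequentially. \<forall>q e. e > 0 -->
  (\<exists>E\<in>events. prob E <= C * (\<Sum>j. \<bar>\<phi> (j + q)\<bar> powr \<delta>) / e powr \<delta> \<and>
   (\<forall>w\<in>space M - E. \<forall>k\<le>n. tail_small e q n k w))"
proof -
 have \<delta>1: "\<delta> <= 1" using \<delta> by simp
 obtain C where C: "C > 0" and cm: "\<forall>\<^sub>F n in sequentially. \<forall>k0. (\<integral>\<^sup>+w. ennreal (walk_max n k0 w powr \<delta>) \<partial>M) <= ennreal C"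
  using walk_max_moment[OF \<delta>(1,3) \<delta>1] by blast
 have "\<forall>\<^sub>F n in sequentially. \<forall>q e. e > 0 -->
  (\<exists>E\<in>events. prob E <= (2 * C) * (\<Sum>j. \<bar>\<phi> (j + q)\<bar> powr \<delta>) / e powr \<delta> \<and>
   (\<forall>w\<in>space M - E. \<forall>k\<le>n. tail_small e q n k w))"
  using cm eventually_ge_at_top[of 1]
 proof eventually_elim
  case (elim n)
  have an: "a n > 0" by (rule D.a_pos[OF elim(2)])
  show ?case
  proof (intro allI impI)
   fix q and e :: real assume e: "e > 0"
   define c where "c j w = \<bar>\<phi> (j + q)\<bar> * (walk_max n (- int (j + q)) w + walk_max n (- int q) w)" for j w
   have c_rv[measurable]: "c j \<in> borel_measurable M" for j unfolding c_def[abs_def] by measurable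
   have c0: "0 <= c j w" for j w using walk_max_nonneg[OF elim(2)] by (simp add: c_def)
   define Dn where "Dn w = (\<Sum>j. ennreal (c j w powr \<delta>))" for w
   have Dn_rv[measurable]: "Dn \<in> borel_measurable M" unfolding Dn_def[abs_def] by measurable
   define S where "S = (\<Sum>j. \<bar>\<phi> (j + q)\<bar> powr \<delta>)"
   have sS: "summable (\<lambda>j. \<bar>\<phi> (j + q)\<bar> powr \<delta>)" using \<phi>_powr by (subst summable_iff_shift)
   have S0: "0 <= S" unfolding S_def by (rule suminf_nonneg[OF sS]) simp
   have ec: "(\<integral>\<^sup>+w. ennreal (c j w powr \<delta>) \<partial>M) <= ennreal (2 * C * \<bar>\<phi> (j + q)\<bar> powr \<delta>)" for j
   proof -
    let ?W = "\<lambda>i w. walk_max n (- int i) w powr \<delta>"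
    have "c j w powr \<delta> <= \<bar>\<phi> (j + q)\<bar> powr \<delta> * (?W (j + q) w + ?W q w)" for w
     unfolding c_def using walk_max_nonneg[OF elim(2)] \<delta>
     by (simp add: powr_mult mult_left_mono powr_add_le)
    then have "(\<integral>\<^sup>+w. ennreal (c j w powr \<delta>) \<partial>M) <= (\<integral>\<^sup>+w. ennreal (\<bar>\<phi> (j + q)\<bar> powr \<delta>) * (ennreal (?W (j + q) w) + ennreal (?W q w)) \<partial>M)"
     by (intro nn_integral_mono) (simp add: ennreal_mult[symmetric] ennreal_plus[symmetric] ennreal_leI del: ennreal_plus)
    also have "... = ennreal (\<bar>\<phi> (j + q)\<bar> powr \<delta>) * ((\<integral>\<^sup>+w. ennreal (?W (j + q) w) \<partial>M) + (\<integral>\<^sup>+w. ennreal (?W q w) \<partial>M))"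
     by (simp add: nn_integral_cmult nn_integral_add)
    also have "... <= ennreal (\<bar>\<phi> (j + q)\<bar> powr \<delta>) * (ennreal C + ennreal C)"
     using elim(1) by (intro mult_left_mono add_mono) auto
    also have "... = ennreal (2 * C * \<bar>\<phi> (j + q)\<bar> powr \<delta>)"
     using C by (simp add: ennreal_mult[symmetric] ennreal_plus[symmetric] mult_ac del: ennreal_plus)
    finally show ?thesis .
   qed
   have "(\<integral>\<^sup>+w. Dn w \<partial>M) = (\<Sum>j. \<integral>\<^sup>+w. ennreal (c j w powr \<delta>) \<partial>M)"
    unfolding Dn_def by (rule nn_integral_suminf) measurable
   also have "... <= (\<Sum>j. ennreal (2 * C * \<bar>\<phi> (j + q)\<bar> powr \<delta>))" by (intro suminf_le ec) auto
   also have "... = ennreal (\<Sum>j. 2 * C * \<bar>\<phi> (j + q)\<bar> powr \<delta>)"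
    using C by (intro suminf_ennreal2 summable_mult sS) auto
   also have "(\<Sum>j. 2 * C * \<bar>\<phi> (j + q)\<bar> powr \<delta>) = 2 * C * S" unfolding S_def by (rule suminf_mult[OF sS])
   finally have ED: "(\<integral>\<^sup>+w. Dn w \<partial>M) <= ennreal (2 * C * S)" .
   define E where "E = {w\<in>space M. 1 <= ennreal (1 / e powr \<delta>) * Dn w}"
   have E: "E \<in> events" unfolding E_def by measurable
   have "emeasure M E <= ennreal (1 / e powr \<delta>) * (\<integral>\<^sup>+w. Dn w * indicator (space M) w \<partial>M)"
    using nn_integral_Markov_inequality[of Dn "space M" M "ennreal (1 / e powr \<delta>)"] by (simp add: E_def)
   also have "(\<integral>\<^sup>+w. Dn w * indicator (space M) w \<partial>M) = (\<integral>\<^sup>+w. Dn w \<partial>M)"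
    by (intro nn_integral_cong) auto
   also have "ennreal (1 / e powr \<delta>) * ... <= ennreal (1 / e powr \<delta>) * ennreal (2 * C * S)"
    by (intro mult_left_mono ED) auto
   also have "... = ennreal ((2 * C) * S / e powr \<delta>)" using C S0 by (simp add: ennreal_mult[symmetric])
   finally have "prob E <= (2 * C) * S / e powr \<delta>" using C S0 by (simp add: emeasure_eq_measure)
   moreover have "tail_small e q n k w"
    if w: "w \<in> space M - E" and k: "k <= n" for w k
   proof -
    have lt: "ennreal (1 / e powr \<delta>) * Dn w < 1" using w by (auto simp: E_def not_le)
    have D_lt: "Dn w < ennreal (e powr \<delta>)"
    proof (rule ccontr)
     assume "\<not> Dn w < ennreal (e powr \<delta>)"
     then have "ennreal (1 / e powr \<delta>) * ennreal (e powr \<delta>) <= ennreal (1 / e powr \<delta>) * Dn w"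
      by (intro mult_left_mono) auto
     then show False using lt e by (simp add: ennreal_mult[symmetric])
    qed
    then have "Dn w \<noteq> top" by auto
    then have sm: "summable (\<lambda>j. c j w powr \<delta>)"
     unfolding Dn_def by (intro summable_suminf_not_top) auto
    have "ennreal (\<Sum>j. c j w powr \<delta>) = Dn w"
     unfolding Dn_def by (rule suminf_ennreal2[symmetric, OF _ sm]) simp
    then have le: "(\<Sum>j. c j w powr \<delta>) <= e powr \<delta>"
     using D_lt by (metis ennreal_le_iff less_imp_le powr_ge_zero)
    have sc: "summable (\<lambda>j. c j w)" and cs: "(\<Sum>j. c j w) <= e"
     using summable_of_summable_powr[OF c0 \<delta>(1) \<delta>1 e sm le] by auto
    have trm: "norm (tail_term q k w j) <= a n * c j w" for j
    proof -
     have "\<bar>walk (- int (j + q)) k w - walk (- int q) k w\<bar> <= a n * (walk_max n (- int (j + q)) w + walk_max n (- int q) w)"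
      using walk_le_walk_max[OF elim(2) k, of "- int (j + q)" w] walk_le_walk_max[OF elim(2) k, of "- int q" w] an
      by (simp add: pos_divide_le_eq distrib_left mult.commute)
     then have "\<bar>\<phi> (j + q)\<bar> * \<bar>walk (- int (j + q)) k w - walk (- int q) k w\<bar> <= \<bar>\<phi> (j + q)\<bar> * (a n * (walk_max n (- int (j + q)) w + walk_max n (- int q) w))"
      by (intro mult_left_mono) auto
     then show ?thesis by (simp add: c_def abs_mult mult_ac)
    qed
    have sac: "summable (\<lambda>j. a n * c j w)" using sc by (rule summable_mult)
    have sn: "summable (\<lambda>j. norm (tail_term q k w j))"
     by (rule summable_comparison_test'[OF sac, of 0]) (use trm in auto)
    have "\<bar>\<Sum>j. tail_term q k w j\<bar>
      <= (\<Sum>j. norm (tail_term q k w j))"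
     using summable_norm[OF sn] by simp
    also have "... <= (\<Sum>j. a n * c j w)" by (intro suminf_le trm sn sac)
    also have "... = a n * (\<Sum>j. c j w)" by (rule suminf_mult[OF sc])
    also have "... <= e * a n" using cs an by (simp add: mult.commute)
    finally show ?thesis using summable_norm_cancel[OF sn] by simp
   qed
   ultimately show "\<exists>E\<in>events. prob E <= (2 * C) * (\<Sum>j. \<bar>\<phi> (j + q)\<bar> powr \<delta>) / e powr \<delta> \<and>
    (\<forall>w\<in>space M - E. \<forall>k\<le>n. tail_small e q n k w)"
    using E unfolding S_def by blast
  qed
 qed
 then show ?thesis using C by (intro that[of "2 * C"]) auto
qed

end

context linear_domain
begin

section \<open>Approximation by the skeleton\<close>

definition V :: "nat => 'a => real => real" where
 "V n w = partial_sum_process a (\<lambda>_. \<Phi> * D.centre) (linear_process \<phi> Z) n w"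

lemma cadlag_V: "cadlag_on S (V n w)"
 unfolding V_def by (rule cadlag_on_partial_sum_process)

definition skeleton :: "nat => nat => 'a => nat => real" where
 "skeleton n m w k = \<Phi> * (T w (int (n * k div m)) / a n)"

text \<open>The coefficients from \<open>q\<close> on are collected at lag \<open>q\<close>, instead of being dropped: this preserves
  the total \<open>\<Phi>\<close>, and the partial sums remain between \<open>0\<close> and \<open>\<Phi>\<close>.\<close>

definition folded :: "nat => nat => real" where
 "folded q j = (if j < q then \<phi> j else \<Sum>i. \<phi> (i + q))"

lemma folded_total: "(\<Sum>j\<le>q. folded q j) = \<Phi>"
proof -
 have "(\<Sum>j\<le>q. folded q j) = (\<Sum>j<q. folded q j) + folded q q"
  by (simp add: lessThan_Suc_atMost[symmetric])
 also have "... = (\<Sum>j<q. \<phi> j) + (\<Sum>i. \<phi> (i + q))" by (simp add: folded_def)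
 also have "... = \<Phi>" unfolding \<Phi>_eq using suminf_split_initial_segment[OF summable_\<phi>, of q] by simp
 finally show ?thesis .
qed

lemma folded_ratio: assumes "s <= q" shows "0 <= (\<Sum>j\<le>s. folded q j) / \<Phi> \<and> (\<Sum>j\<le>s. folded q j) / \<Phi> <= 1"
proof (cases "s = q")
 case True
 then show ?thesis using folded_total \<Phi>_nz by simp
next
 case False
 then have "(\<Sum>j\<le>s. folded q j) = (\<Sum>i=0..s. \<phi> i)"
  using assms by (simp add: folded_def atLeast0AtMost)
 then show ?thesis using \<phi>_ratio[of s] by simp
qed

lemma V_decompose:
 assumes s: "\<And>t. summable (\<lambda>i. \<bar>\<phi> i * Z (t - int i) w\<bar>)"
  and R: "\<bar>\<Sum>j. tail_term q k w j\<bar> <= e * a n"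
   "summable (tail_term q k w)"
  and n: "n \<ge> 1" and k: "\<lfloor>real n * t\<rfloor> = int k"
 shows "\<bar>V n w t - (\<Sum>j\<le>q. folded q j * (T w (int k - int j) / a n - T w (- int j) / a n))\<bar> <= e"
proof -
 have an: "a n > 0" by (rule D.a_pos[OF n])
 define R' where "R' = (\<Sum>j. tail_term q k w j)"
 let ?W = "\<lambda>j. walk (- int j) k w"
 have sW: "(\<lambda>j. \<phi> j * ?W j) sums ((\<Sum>i = 1..int k. linear_process \<phi> Z i w) - real k * (\<Phi> * D.centre))"
  by (rule linear_process_walk[OF s])
 have sW': "summable (\<lambda>j. \<phi> j * ?W j)" using sW by (rule sums_summable)
 have sq: "summable (\<lambda>j. \<phi> (j + q))" using summable_\<phi> by (subst summable_iff_shift)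
 have sq': "summable (\<lambda>j. \<phi> (j + q) * ?W (j + q))"
  using sW' by (rule summable_ignore_initial_segment)
 have "V n w t * a n = (\<Sum>i = 1..int k. linear_process \<phi> Z i w) - real k * (\<Phi> * D.centre)"
  using an by (simp add: V_def partial_sum_process_def k)
 also have "... = (\<Sum>j. \<phi> j * ?W j)" using sW by (rule sums_unique)
 also have "... = (\<Sum>j. \<phi> (j + q) * ?W (j + q)) + (\<Sum>j<q. \<phi> j * ?W j)"
  by (rule suminf_split_initial_segment[OF sW'])
 also have "(\<Sum>j. \<phi> (j + q) * ?W (j + q)) = R' + folded q q * ?W q"
 proof -
  have "R' = (\<Sum>j. \<phi> (j + q) * ?W (j + q)) - (\<Sum>j. \<phi> (j + q) * ?W q)"
   unfolding R'_def using suminf_diff[OF sq' summable_mult2[OF sq, of "?W q"]] by (simp add: right_diff_distrib)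
  also have "(\<Sum>j. \<phi> (j + q) * ?W q) = folded q q * ?W q"
   using suminf_mult2[OF sq, of "?W q"] by (simp add: folded_def)
  finally show ?thesis by simp
 qed
 also have "R' + folded q q * ?W q + (\<Sum>j<q. \<phi> j * ?W j) = R' + (\<Sum>j\<le>q. folded q j * ?W j)"
  by (simp add: lessThan_Suc_atMost[symmetric] folded_def)
 finally have "V n w t * a n = R' + (\<Sum>j\<le>q. folded q j * ?W j)" .
 then have "V n w t = (R' + (\<Sum>j\<le>q. folded q j * ?W j)) / a n" using an by (simp add: field_simps)
 also have "... = R' / a n + (\<Sum>j\<le>q. folded q j * (T w (int k - int j) / a n - T w (- int j) / a n))"
  by (simp add: add_divide_distrib sum_divide_distrib walk_eq_T diff_divide_distrib[symmetric])
 finally have "V n w t - (\<Sum>j\<le>q. folded q j * (T w (int k - int j) / a n - T w (- int j) / a n)) = R' / a n" by simp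
 moreover have "\<bar>R' / a n\<bar> <= e" using R(1) an by (simp add: R'_def pos_divide_le_eq)
 ultimately show ?thesis by simp
qed

lemma floor_block:
 assumes m: "m > 0" and t: "real k / real m <= t" "t <= real (Suc k) / real m"
 shows "int (n * k div m) <= \<lfloor>real n * t\<rfloor>" "\<lfloor>real n * t\<rfloor> <= int (n * Suc k div m)"
proof -
 have fl: "\<lfloor>real n * (real j / real m)\<rfloor> = int (n * j div m)" for j
  using floor_divide_of_nat_eq[of "n * j" m, where 'a = real] by simp
 have "real n * (real k / real m) <= real n * t" "real n * t <= real n * (real (Suc k) / real m)"
  using t by (intro mult_left_mono; simp)+
 then have "\<lfloor>real n * (real k / real m)\<rfloor> <= \<lfloor>real n * t\<rfloor>" "\<lfloor>real n * t\<rfloor> <= \<lfloor>real n * (real (Suc k) / real m)\<rfloor>"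
  by (intro floor_mono; simp)+
 then show "int (n * k div m) <= \<lfloor>real n * t\<rfloor>" "\<lfloor>real n * t\<rfloor> <= int (n * Suc k div m)"
  unfolding fl .
qed

lemma dist_V_skeleton:
 assumes s: "\<And>t. summable (\<lambda>i. \<bar>\<phi> i * Z (t - int i) w\<bar>)" and n: "n \<ge> 1" and m: "m > 0"
  and tail: "\<And>k. k <= n ==> tail_small e q n k w"
  and short: "\<And>k j. k <= m ==> j <= q ==> \<bar>T w (int (n * k div m) - int j) - T w (int (n * k div m))\<bar> <= \<eta> * a n"
  and jump: "\<And>k. k < m ==> \<exists>\<tau>. \<forall>l\<in>{int (n * k div m) - int q..int (n * Suc k div m)}.
    (l < \<tau> --> \<bar>T w l - T w (int (n * k div m) - int q)\<bar> <= \<eta> * a n) \<and>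
    (\<tau> <= l --> \<bar>T w (int (n * Suc k div m)) - T w l\<bar> <= \<eta> * a n)"
 defines "F \<equiv> \<Sum>j\<le>q. \<bar>folded q j\<bar>"
 shows "dist_M2 (V n w) (step_path m (skeleton n m w)) <= max (1 / real m) (3 * \<eta> * F + e)"
proof (rule dist_M2_step_path_le[OF cadlag_V m])
 have an: "a n > 0" by (rule D.a_pos[OF n])
 have dv: "\<bar>x / a n - y / a n\<bar> <= \<eta> \<longleftrightarrow> \<bar>x - y\<bar> <= \<eta> * a n" for x y
 proof -
  have "\<bar>x / a n - y / a n\<bar> = \<bar>x - y\<bar> / a n" using an by (simp add: diff_divide_distrib[symmetric])
  then show ?thesis using an by (simp add: pos_divide_le_eq)
 qed
 have zero: "\<bar>T w (- int j) / a n\<bar> <= \<eta>" if "j <= q" for j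
  using short[of 0 j] that dv[of "T w (- int j)" 0] by simp
 have F0: "0 <= F" unfolding F_def by (rule sum_nonneg) simp
 have \<eta>0: "0 <= \<eta>" using zero[of 0] by simp
 {
  fix k assume k: "k <= m"
  let ?k0 = "n * k div m"
  have le: "?k0 <= n" using k m by (metis div_le_mono div_mult_self_is_m mult_le_mono2)
  have fl: "\<lfloor>real n * (real k / real m)\<rfloor> = int ?k0"
   using floor_divide_of_nat_eq[of "n * k" m, where 'a = real] by simp
  let ?U = "\<Sum>j\<le>q. folded q j * (T w (int ?k0 - int j) / a n - T w (- int j) / a n)"
  have 1: "\<bar>V n w (real k / real m) - ?U\<bar> <= e"
   using tail[OF le] by (intro V_decompose[OF s _ _ n fl]) auto
  have sk: "skeleton n m w k = (\<Sum>j\<le>q. folded q j * (T w (int ?k0) / a n))"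
   unfolding skeleton_def sum_distrib_right[symmetric] folded_total ..
  have "?U - skeleton n m w k = (\<Sum>j\<le>q. folded q j * (T w (int ?k0 - int j) / a n - T w (- int j) / a n - T w (int ?k0) / a n))"
   unfolding sk by (simp only: sum_subtractf[symmetric] right_diff_distrib)
  also have "\<bar>...\<bar> <= (\<Sum>j\<le>q. \<bar>folded q j\<bar> * (2 * \<eta>))"
  proof (rule order_trans[OF sum_abs], rule sum_mono)
   fix j assume j: "j \<in> {..q}"
   have "\<bar>T w (int ?k0 - int j) / a n - T w (int ?k0) / a n\<bar> <= \<eta>"
    unfolding dv using short[OF k] j by simp
   then have "\<bar>T w (int ?k0 - int j) / a n - T w (- int j) / a n - T w (int ?k0) / a n\<bar> <= 2 * \<eta>"
    using zero[OF j[unfolded atMost_iff]] by linarith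
   then show "\<bar>folded q j * (T w (int ?k0 - int j) / a n - T w (- int j) / a n - T w (int ?k0) / a n)\<bar> <= \<bar>folded q j\<bar> * (2 * \<eta>)"
    unfolding abs_mult by (intro mult_left_mono) auto
  qed
  also have "... = F * (2 * \<eta>)" unfolding F_def by (rule sum_distrib_right[symmetric])
  also have "... <= 3 * \<eta> * F"
  proof -
   have "0 <= \<eta> * F" using F0 \<eta>0 by simp
   then show ?thesis by (simp add: mult.commute mult.left_commute)
  qed
  finally show "\<bar>V n w (real k / real m) - skeleton n m w k\<bar> <= 3 * \<eta> * F + e" using 1 by linarith
 }
 {
  fix k t assume k: "k < m" and t: "real k / real m <= t" "t <= real (Suc k) / real m"
  let ?k0 = "n * k div m" and ?k1 = "n * Suc k div m"
  have k1n: "?k1 <= n" using k m by (metis Suc_leI div_le_mono div_mult_self_is_m mult_le_mono2)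
  note fb = floor_block[OF m t, of n]
  define l where "l = nat \<lfloor>real n * t\<rfloor>"
  have "0 <= \<lfloor>real n * t\<rfloor>" using fb(1) by (rule order_trans[rotated]) simp
  then have l: "\<lfloor>real n * t\<rfloor> = int l" unfolding l_def by (rule nat_0_le[symmetric])
  have ln: "l <= n" using fb(2) k1n l by linarith
  let ?U = "\<Sum>j\<le>q. folded q j * (T w (int l - int j) / a n - T w (- int j) / a n)"
  have 1: "\<bar>V n w t - ?U\<bar> <= e"
   using tail[OF ln] by (intro V_decompose[OF s _ _ n l]) auto
  from jump[OF k] obtain \<tau> where \<tau>': "\<forall>l\<in>{int ?k0 - int q..int ?k1}.
    (l < \<tau> --> \<bar>T w l - T w (int ?k0 - int q)\<bar> <= \<eta> * a n) \<and> (\<tau> <= l --> \<bar>T w (int ?k1) - T w l\<bar> <= \<eta> * a n)" ..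
  have \<tau>: "(l < \<tau> --> \<bar>T w l - T w (int ?k0 - int q)\<bar> <= \<eta> * a n) \<and> (\<tau> <= l --> \<bar>T w (int ?k1) - T w l\<bar> <= \<eta> * a n)"
   if "int ?k0 - int q <= l" "l <= int ?k1" for l
   by (rule bspec[OF \<tau>']) (use that in \<open>simp only: atLeastAtMost_iff simp_thms\<close>)
  have 2: "min (\<Phi> * (T w (int ?k0) / a n)) (\<Phi> * (T w (int ?k1) / a n)) - 3 * \<eta> * F <= ?U \<and>
   ?U <= max (\<Phi> * (T w (int ?k0) / a n)) (\<Phi> * (T w (int ?k1) / a n)) + 3 * \<eta> * F"
   unfolding F_def
  proof (rule block_bound[where T = "\<lambda>k. T w k / a n" and \<tau> = \<tau>])
   show "(k < \<tau> --> \<bar>T w k / a n - T w (int ?k0 - int q) / a n\<bar> <= \<eta>) \<and> (\<tau> <= k --> \<bar>T w (int ?k1) / a n - T w k / a n\<bar> <= \<eta>)"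
    if "int ?k0 - int q <= k" "k <= int ?k1" for k
    unfolding dv using \<tau>[OF that] .
   show "\<bar>T w (int ?k0 - int j) / a n - T w (int ?k0) / a n\<bar> <= \<eta>" if "j <= q" for j
    unfolding dv using short[of k j] k that by simp
   show "\<bar>T w (- int j) / a n\<bar> <= \<eta>" if "j <= q" for j by (rule zero[OF that])
   show "int ?k0 <= int l" "int l <= int ?k1" using fb l by auto
  qed (use folded_ratio folded_total \<Phi>_nz in auto)
  then show "min (skeleton n m w k) (skeleton n m w (Suc k)) - (3 * \<eta> * F + e) <= V n w t \<and>
    V n w t <= max (skeleton n m w k) (skeleton n m w (Suc k)) + (3 * \<eta> * F + e)"
   unfolding skeleton_def using 1 by linarith
 }
qed

end

context iid_domain
begin

text \<open>Both factors of the product bound concern increments of the walk, and if none of its values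
  exceeds \<open>x / 2\<close>, no increment exceeds \<open>x\<close>.\<close>

lemma block_failure:
 assumes x: "x > 0"
 shows "{w\<in>space M. \<not> single_jump N x (\<lambda>l. walk e0 l w)} \<in> events"
  and "\<P>(w in M. \<not> single_jump N x (\<lambda>l. walk e0 l w))
   <= (\<P>(w in M. \<exists>l\<le>N. x / 2 < \<bar>walk e0 l w\<bar>))\<^sup>2"
proof -
 show "{w\<in>space M. \<not> single_jump N x (\<lambda>l. walk e0 l w)} \<in> events"
  unfolding single_jump_def by measurable
 have ind: "indep_vars (\<lambda>_. borel) (\<lambda>i w. Z (e0 + 1 + int i) w - D.centre) {..<N}"
  by (rule indep_window) measurable
 have "\<P>(w in M. \<not> single_jump N x (\<lambda>l. walk e0 l w))
   <= \<P>(w in M. \<exists>l\<le>N. x < \<bar>walk e0 l w\<bar>) * \<P>(w in M. \<exists>l\<le>N. x < \<bar>walk e0 N w - walk e0 l w\<bar>)"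
  using single_jump_probability[OF ind, of x] by (simp add: walk_def)
 also have "... <= \<P>(w in M. \<exists>l\<le>N. x / 2 < \<bar>walk e0 l w\<bar>) * \<P>(w in M. \<exists>l\<le>N. x / 2 < \<bar>walk e0 l w\<bar>)"
 proof (intro mult_mono finite_measure_mono)
  show "{w\<in>space M. \<exists>l\<le>N. x < \<bar>walk e0 l w\<bar>} \<subseteq> {w\<in>space M. \<exists>l\<le>N. x / 2 < \<bar>walk e0 l w\<bar>}"
  proof
   fix w assume "w \<in> {w\<in>space M. \<exists>l\<le>N. x < \<bar>walk e0 l w\<bar>}"
   then obtain l where "w \<in> space M" "l <= N" "x < \<bar>walk e0 l w\<bar>" by auto
   moreover from this x have "x / 2 < \<bar>walk e0 l w\<bar>" by linarith
   ultimately show "w \<in> {w\<in>space M. \<exists>l\<le>N. x / 2 < \<bar>walk e0 l w\<bar>}" by blast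
  qed
  show "{w\<in>space M. \<exists>l\<le>N. x < \<bar>walk e0 N w - walk e0 l w\<bar>} \<subseteq> {w\<in>space M. \<exists>l\<le>N. x / 2 < \<bar>walk e0 l w\<bar>}"
  proof
   fix w assume "w \<in> {w\<in>space M. \<exists>l\<le>N. x < \<bar>walk e0 N w - walk e0 l w\<bar>}"
   then obtain l where l: "w \<in> space M" "l <= N" "x < \<bar>walk e0 N w - walk e0 l w\<bar>" by auto
   then have "x / 2 < \<bar>walk e0 N w\<bar> \<or> x / 2 < \<bar>walk e0 l w\<bar>" by linarith
   then show "w \<in> {w\<in>space M. \<exists>l\<le>N. x / 2 < \<bar>walk e0 l w\<bar>}" using l by blast
  qed
 qed auto
 finally show "\<P>(w in M. \<not> single_jump N x (\<lambda>l. walk e0 l w))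
   <= (\<P>(w in M. \<exists>l\<le>N. x / 2 < \<bar>walk e0 l w\<bar>))\<^sup>2"
  by (simp add: power2_eq_square)
qed

end

context linear_domain
begin

text \<open>The block number \<open>m\<close> may be chosen freely as long as it is large; this is needed to pass to the
  limit in \<open>n\<close> before that in \<open>m\<close>. The exceptional event collects the null set where some series
  diverges, the tail event, large moves of the walk shortly before a node, and the blocks with
  more than one jump. The lag \<open>q\<close> and the tolerance \<open>\<eta>\<close> do not depend on \<open>m\<close>.\<close>

lemma step_approximation:
 assumes e: "e > 0"
 obtains m0 where "m0 > 0" "\<And>m. m \<ge> m0 ==> \<forall>\<^sub>F n in sequentially. \<exists>E\<in>events. prob E <= e \<and>
  (\<forall>w\<in>space M - E. dist_M2 (V n w) (step_path m (skeleton n m w)) <= e)"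
proof -
 obtain C1 where C1: "C1 > 0" and tail: "\<forall>\<^sub>F n in sequentially. \<forall>q e. e > 0 -->
  (\<exists>E\<in>events. prob E <= C1 * (\<Sum>j. \<bar>\<phi> (j + q)\<bar> powr \<delta>) / e powr \<delta> \<and>
   (\<forall>w\<in>space M - E. \<forall>k\<le>n.
     tail_small e q n k w))"
  by (rule tail_event) blast
 obtain C2 where C2: "C2 > 0" and mx: "\<forall>\<^sub>F n in sequentially. \<forall>N k0 x. 0 < x --> real N * C2 / real n <= x / 2 -->
  \<P>(w in M. \<exists>k\<le>N. x * a n < \<bar>walk k0 k w\<bar>) <= real N / real n * (C2 * (1 + 4 / x\<^sup>2))"
  by (rule walk_maximal) blast
 define \<epsilon> where "\<epsilon> = e / 2"
 have \<epsilon>: "\<epsilon> > 0" using e by (simp add: \<epsilon>_def)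
 \<comment> \<open>The lag is chosen from the tail of \<open>\<Sum> \<bar>\<phi>\<bar>\<^sup>\<delta>\<close>, before the tolerance, which depends on it.\<close>
 obtain q where q: "C1 * (\<Sum>j. \<bar>\<phi> (j + q)\<bar> powr \<delta>) / \<epsilon> powr \<delta> <= e / 4"
 proof -
  define y where "y = e / 4 * \<epsilon> powr \<delta> / C1"
  have "y > 0" using e \<epsilon> C1 by (simp add: y_def)
  from suminf_exist_split[OF this \<phi>_powr]
  obtain N where N: "\<forall>n\<ge>N. norm (\<Sum>i. \<bar>\<phi> (i + n)\<bar> powr \<delta>) < y" by blast
  then have "(\<Sum>i. \<bar>\<phi> (i + N)\<bar> powr \<delta>) <= y" by (metis abs_le_D1 less_imp_le order_refl real_norm_def)
  then have "C1 * (\<Sum>j. \<bar>\<phi> (j + N)\<bar> powr \<delta>) / \<epsilon> powr \<delta> <= C1 * y / \<epsilon> powr \<delta>"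
   using C1 by (intro divide_right_mono mult_left_mono) auto
  also have "... = e / 4" using C1 \<epsilon> by (simp add: y_def)
  finally show ?thesis by (rule that)
 qed
 define F where "F = (\<Sum>j\<le>q. \<bar>folded q j\<bar>)"
 have F0: "0 <= F" unfolding F_def by (rule sum_nonneg) simp
 define \<eta> where "\<eta> = e / (6 * (F + 1))"
 have \<eta>: "\<eta> > 0" using e F0 by (simp add: \<eta>_def)
 have \<eta>F: "3 * \<eta> * F + \<epsilon> <= e"
 proof -
  have "3 * \<eta> * F <= 3 * \<eta> * (F + 1)" using \<eta> by simp
  also have "... = e / 2" using F0 by (simp add: \<eta>_def field_simps)
  finally show ?thesis by (simp add: \<epsilon>_def)
 qed
 define x where "x = \<eta> / 2"
 have x: "x > 0" using \<eta> by (simp add: x_def)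
 define G where "G = C2 * (1 + 4 / x\<^sup>2)"
 have G: "G > 0" using C2 x by (simp add: G_def add_pos_nonneg)
 \<comment> \<open>The three terms serve the mesh \<open>1 / m\<close>, the total probability of bad blocks, and the range in which the
  maximal inequality is available.\<close>
 obtain m0 :: nat where m0: "1 / e + 16 * G\<^sup>2 / e + 4 * C2 / x < real m0" using reals_Archimedean2 by blast
 have pos: "0 < 1 / e" "0 <= 16 * G\<^sup>2 / e" "0 <= 4 * C2 / x" using e x C2 by auto
 show ?thesis
 proof (rule that[of m0])
  show "m0 > 0" using m0 pos by (cases "m0 = 0") auto
  fix m assume m: "m \<ge> m0"
  then have mr: "1 / e < real m" "16 * G\<^sup>2 / e < real m" "4 * C2 / x < real m" using m0 pos by (smt (verit) of_nat_le_iff)+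
  then have m_pos: "m > 0" using pos by (cases "m = 0") auto
  have me: "1 / real m <= e" using mr(1) e m_pos by (simp add: field_simps)
  have lim0: "(\<lambda>n. c / real n) \<longlonglongrightarrow> 0" for c :: real
   by (rule real_tendsto_divide_at_top[OF tendsto_const filterlim_real_sequentially])
  have ev1: "\<forall>\<^sub>F n in sequentially. real q * C2 / real n <= x / 2"
   by (rule eventually_mono[OF order_tendstoD(2)[OF lim0[of "real q * C2"], of "x / 2"]]) (use x in simp_all)
  have ev2: "\<forall>\<^sub>F n in sequentially. real (Suc m) * real q * G / real n <= e / 4"
   by (rule eventually_mono[OF order_tendstoD(2)[OF lim0[of "real (Suc m) * real q * G"], of "e / 4"]])
    (use e in \<open>simp_all del: of_nat_Suc\<close>)
  show "\<forall>\<^sub>F n in sequentially. \<exists>E\<in>events. prob E <= e \<and>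
   (\<forall>w\<in>space M - E. dist_M2 (V n w) (step_path m (skeleton n m w)) <= e)"
   using tail mx ev1 ev2 eventually_ge_at_top[of "max 1 (m * Suc q)"]
  proof eventually_elim
   case (elim n)
   have n: "n \<ge> 1" "m * Suc q <= n" using elim(5) by auto
   have an: "a n > 0" by (rule D.a_pos[OF n(1)])
   from elim(1)[rule_format, OF \<epsilon>, of q]
   obtain E1 where E1': "E1 \<in> events" "prob E1 <= C1 * (\<Sum>j. \<bar>\<phi> (j + q)\<bar> powr \<delta>) / \<epsilon> powr \<delta>"
    and R': "\<forall>w\<in>space M - E1. \<forall>k\<le>n.
     tail_small \<epsilon> q n k w" by blast
   have E1: "E1 \<in> events" "prob E1 <= e / 4"
    using E1'(1) order_trans[OF E1'(2) q] by simp_all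
   have "AE w in M. \<forall>t. summable (\<lambda>i. \<bar>\<phi> i * Z (t - int i) w\<bar>)"
    unfolding AE_all_countable by (intro allI AE_summable)
   then obtain E0 where E0: "E0 \<in> null_sets M" "{w\<in>space M. \<not> (\<forall>t. summable (\<lambda>i. \<bar>\<phi> i * Z (t - int i) w\<bar>))} \<subseteq> E0"
    by (auto elim!: AE_E3 AE_E simp: null_sets_def)
   define node where "node k = n * k div m" for k
   define start where "start k = int (node k) - int q" for k
   define len where "len k = node (Suc k) - node k + q" for k
   have node_mono: "node k <= node (Suc k)" for k unfolding node_def by (intro div_le_mono) simp
   define S where "S k = {w\<in>space M. \<exists>l\<le>q. x * a n < \<bar>walk (start k) l w\<bar>}" for k
   define B where "B k = {w\<in>space M. \<not> single_jump (len k) (\<eta> * a n) (\<lambda>l. walk (start k) l w)}" for k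
   have S_ev: "S k \<in> events" for k unfolding S_def by measurable
   have \<eta>an: "\<eta> * a n > 0" using \<eta> an by simp
   have B_ev: "B k \<in> events" for k unfolding B_def by (rule block_failure(1)[OF \<eta>an])
   have S_pr: "prob (S k) <= real q * G / real n" for k
    using elim(2)[rule_format, OF x elim(3), of "start k"] by (simp add: S_def G_def)
   have len_le: "real (len k) / real n <= 2 / real m" for k
   proof -
    have "node (Suc k) <= node k + n div m + 1"
    proof -
     have "n * k mod m + n mod m < m + m" using m_pos by (intro add_strict_mono) auto
     then have "(n * k mod m + n mod m) div m < 2" by (intro less_mult_imp_div_less) simp
     moreover have "node (Suc k) = n * k div m + n div m + (n * k mod m + n mod m) div m"
      unfolding node_def using div_add1_eq[of "n * k" n m] by (simp add: add.commute)
     ultimately show ?thesis unfolding node_def by linarith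
    qed
    then have "len k <= n div m + Suc q" using node_mono[of k] by (simp add: len_def)
    then have "m * len k <= m * (n div m + Suc q)" by (rule mult_le_mono2)
    also have "... = m * (n div m) + m * Suc q" by (rule distrib_left)
    also have "... <= n + n" using n(2) by (intro add_mono) simp_all
    finally have "real (m * len k) <= real (2 * n)" by (subst of_nat_le_iff) simp
    then show ?thesis using m_pos n(1) by (simp add: field_simps)
   qed
   have B_pr: "prob (B k) <= 4 * G\<^sup>2 / (real m)\<^sup>2" for k
   proof -
    have "real (len k) * C2 / real n <= 2 / real m * C2"
     using mult_right_mono[OF len_le[of k], of C2] C2 by simp
    also have "... <= x / 2" using mr(3) x m_pos by (simp add: field_simps)
    finally have c: "real (len k) * C2 / real n <= x / 2" .
    have "\<P>(w in M. \<exists>l\<le>len k. x * a n < \<bar>walk (start k) l w\<bar>) <= real (len k) / real n * G"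
     using elim(2)[rule_format, OF x c, of "start k"] by (simp add: G_def)
    also have "... <= 2 / real m * G" using G by (intro mult_right_mono len_le) auto
    finally have p: "\<P>(w in M. \<exists>l\<le>len k. x * a n < \<bar>walk (start k) l w\<bar>) <= 2 / real m * G" .
    have "prob (B k) <= (\<P>(w in M. \<exists>l\<le>len k. x * a n < \<bar>walk (start k) l w\<bar>))\<^sup>2"
     using block_failure(2)[OF \<eta>an, of "len k" "start k"] by (simp add: B_def x_def)
    also have "... <= (2 / real m * G)\<^sup>2" using p by (intro power_mono) auto
    finally show ?thesis by (simp add: power2_eq_square)
   qed
   define E where "E = E0 \<union> E1 \<union> (\<Union>k\<in>{..m}. S k) \<union> (\<Union>k\<in>{..<m}. B k)"
   have E0': "E0 \<in> events" "prob E0 = 0" using E0(1) by (auto simp: measure_eq_0_null_sets)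
   have E_ev: "E \<in> events" unfolding E_def using E0' E1 S_ev B_ev by auto
   have "prob E <= prob E0 + prob E1 + prob (\<Union>k\<in>{..m}. S k) + prob (\<Union>k\<in>{..<m}. B k)"
    unfolding E_def using E0' E1 S_ev B_ev
    by (intro order_trans[OF measure_Un_le] add_mono) auto
   also have "prob (\<Union>k\<in>{..m}. S k) <= (\<Sum>k\<le>m. real q * G / real n)"
    using S_ev S_pr by (intro order_trans[OF finite_measure_subadditive_finite] sum_mono) auto
   also have "prob (\<Union>k\<in>{..<m}. B k) <= (\<Sum>k<m. 4 * G\<^sup>2 / (real m)\<^sup>2)"
    using B_ev B_pr by (intro order_trans[OF finite_measure_subadditive_finite] sum_mono) auto
   also have "(\<Sum>k\<le>m. real q * G / real n) <= e / 4" using elim(4) by (simp add: mult.assoc)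
   also have "(\<Sum>k<m. 4 * G\<^sup>2 / (real m)\<^sup>2) <= e / 4"
   proof -
    have "(\<Sum>k<m. 4 * G\<^sup>2 / (real m)\<^sup>2) = 4 * G\<^sup>2 / real m" using m_pos by (simp add: power2_eq_square)
    also have "... <= e / 4" using mr(2) e m_pos by (simp add: field_simps)
    finally show ?thesis .
   qed
   finally have prE: "prob E <= e" using E0' E1 e by simp
   have "dist_M2 (V n w) (step_path m (skeleton n m w)) <= e" if w: "w \<in> space M - E" for w
   proof -
    have s: "summable (\<lambda>i. \<bar>\<phi> i * Z (t - int i) w\<bar>)" for t using w E0(2) by (auto simp: E_def)
    have tl: "tail_small \<epsilon> q n k w" if "k <= n" for k
     by (rule R'[rule_format, OF _ that]) (use w in \<open>auto simp: E_def\<close>)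
    have sh: "\<bar>T w (int (n * k div m) - int j) - T w (int (n * k div m))\<bar> <= \<eta> * a n" if k: "k <= m" and j: "j <= q" for k j
    proof -
     have "w \<notin> S k" using w k by (auto simp: E_def)
     then have w: "\<bar>walk (start k) l w\<bar> <= x * a n" if "l <= q" for l using w that by (auto simp: S_def not_less)
     have h: "int (node k) - int j = start k + int (q - j)" "int (node k) = start k + int q"
      using j by (auto simp: start_def)
     have "T w (int (node k) - int j) - T w (int (node k)) = walk (start k) (q - j) w - walk (start k) q w"
      unfolding h(1) unfolding h(2) walk_eq_T by simp
     also have "\<bar>...\<bar> <= x * a n + x * a n" using w[of "q - j"] w[of q] by linarith
     also have "... = \<eta> * a n" by (simp add: x_def algebra_simps)
     finally show ?thesis by (simp add: node_def)
    qed
    have jp: "\<exists>\<tau>. \<forall>l\<in>{int (n * k div m) - int q..int (n * Suc k div m)}.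
     (l < \<tau> --> \<bar>T w l - T w (int (n * k div m) - int q)\<bar> <= \<eta> * a n) \<and>
     (\<tau> <= l --> \<bar>T w (int (n * Suc k div m)) - T w l\<bar> <= \<eta> * a n)" if k: "k < m" for k
    proof -
     have "w \<notin> B k" using w k by (auto simp: E_def)
     then obtain \<tau> where \<tau>: "\<forall>l\<le>len k. (l < \<tau> --> \<bar>walk (start k) l w\<bar> <= \<eta> * a n) \<and>
      (\<tau> <= l --> \<bar>walk (start k) (len k) w - walk (start k) l w\<bar> <= \<eta> * a n)"
      using w by (auto simp: B_def single_jump_def)
     have en: "start k + int (len k) = int (node (Suc k))" using node_mono[of k] by (simp add: start_def len_def)
     have "(l < start k + int \<tau> --> \<bar>T w l - T w (start k)\<bar> <= \<eta> * a n) \<and>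
      (start k + int \<tau> <= l --> \<bar>T w (int (node (Suc k))) - T w l\<bar> <= \<eta> * a n)"
      if l: "l \<in> {start k..int (node (Suc k))}" for l
     proof -
      define i where "i = nat (l - start k)"
      have i: "l = start k + int i" using l by (simp add: i_def)
      have "l <= int (node (Suc k))" using l by simp
      then have "start k + int i <= start k + int (len k)" using en i by linarith
      then have "i <= len k" by simp
      then have "(i < \<tau> --> \<bar>walk (start k) i w\<bar> <= \<eta> * a n) \<and>
       (\<tau> <= i --> \<bar>walk (start k) (len k) w - walk (start k) i w\<bar> <= \<eta> * a n)" using \<tau> by blast
      then show ?thesis unfolding walk_eq_T i by (simp add: en)
     qed
     then show ?thesis unfolding start_def node_def by blast
    qed
    have "dist_M2 (V n w) (step_path m (skeleton n m w)) <= max (1 / real m) (3 * \<eta> * F + \<epsilon>)"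
     unfolding F_def by (rule dist_V_skeleton[OF s n(1) m_pos tl sh jp])
    also have "... <= e" using me \<eta>F by simp
    finally show ?thesis .
   qed
   then show ?case using E_ev prE by blast
  qed
 qed
qed

end

section \<open>Independence from joint characteristic functions\<close>

lemma of_real_Re_mult: "of_real (Re z) * w = (z * w + cnj z * w) / 2"
 by (simp add: complex_add_cnj flip: distrib_right)

context prob_space
begin

text \<open>Shifted to be positive and normalized, \<open>W\<close> is the density of a probability measure under which
  \<open>S\<close> has the same characteristic function, hence by uniqueness the same law, as before.\<close>

lemma expectation_mult_indicator_real:
 fixes S W :: "'a => real"
 assumes S[measurable]: "random_variable borel S" and W[measurable]: "random_variable borel W"
  and B: "\<And>w. \<bar>W w\<bar> <= B"
  and char: "\<And>\<theta>. expectation (\<lambda>w. of_real (W w) * iexp (\<theta> * S w)) = of_real (expectation W) * expectation (\<lambda>w. iexp (\<theta> * S w))"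
  and A[measurable]: "A \<in> sets borel"
 shows "expectation (\<lambda>w. W w * indicator A (S w)) = expectation W * prob {w\<in>space M. S w \<in> A}"
proof -
 define b where "b = \<bar>B\<bar> + 1"
 define D where "D w = W w + 2 * b" for w
 have Wb: "\<bar>W w\<bar> <= b" for w using B[of w] by (simp add: b_def)
 have b: "b > 0" by (simp add: b_def)
 have D_lo: "b <= D w" and D_hi: "D w <= 3 * b" for w using Wb[of w] by (auto simp: D_def)
 have D_rv[measurable]: "random_variable borel D" unfolding D_def[abs_def] by measurable
 have intW: "integrable M W" by (rule integrable_const_bound[of _ b]) (use Wb in auto)
 have intD: "integrable M D" unfolding D_def[abs_def] using intW by simp
 define c where "c = expectation D"
 have c_eq: "c = expectation W + 2 * b" unfolding c_def D_def using intW by (simp add: prob_space)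
 have "b <= c" unfolding c_def using integral_mono[of M "\<lambda>_. b" D] intD D_lo by (simp add: prob_space)
 then have c: "c > 0" using b by linarith
 \<comment> \<open>The shift by \<open>2 * b\<close> keeps the density positive, and the same shift is undone at the end.\<close>
 define M' where "M' = density M (\<lambda>w. ennreal (D w / c))"
 have dens[measurable]: "(\<lambda>w. D w / c) \<in> borel_measurable M" by measurable
 have "0 <= D w" for w using D_lo[of w] b by linarith
 then have dens0: "AE w in M. 0 <= D w / c" using c by auto
 have int': "(\<integral>w. f w \<partial>M') = expectation (\<lambda>w. (D w / c) *\<^sub>R f w)"
  if "f \<in> borel_measurable M" for f :: "'a => 'b::{banach, second_countable_topology}"
  unfolding M'_def by (rule integral_density[OF that dens dens0])
 have "emeasure M' (space M') = 1"
 proof -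
  have "emeasure M' (space M') = (\<integral>\<^sup>+w. ennreal (D w / c) \<partial>M)"
   unfolding M'_def by (simp add: emeasure_density nn_integral_set_ennreal[symmetric] cong: nn_integral_cong)
  also have "... = ennreal (\<integral>w. D w / c \<partial>M)"
   using dens0 intD by (intro nn_integral_eq_integral) auto
  also have "... = 1" using c by (simp add: c_def[symmetric])
  finally show ?thesis .
 qed
 then interpret M': prob_space M' by (rule prob_spaceI)
 have sets': "sets M' = sets M" "space M' = space M" unfolding M'_def by auto
 have S'[measurable]: "S \<in> borel_measurable M'" using S by (simp add: measurable_cong_sets[OF sets'(1)])
 have "distr M' borel S = distr M borel S"
 proof (rule Levy_uniqueness)
  show "real_distribution (distr M' borel S)" by (rule M'.real_distribution_distr) simp
  show "real_distribution (distr M borel S)" by (rule real_distribution_distr) simp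
  show "char (distr M' borel S) = char (distr M borel S)"
  proof
   fix \<theta>
   have "char (distr M' borel S) \<theta> = (\<integral>w. iexp (\<theta> * S w) \<partial>M')"
    unfolding char_def by (subst integral_distr) auto
   also have "... = expectation (\<lambda>w. (D w / c) *\<^sub>R iexp (\<theta> * S w))" by (rule int') measurable
   also have "... = expectation (\<lambda>w. (of_real (W w) * iexp (\<theta> * S w) + of_real (2 * b) * iexp (\<theta> * S w)) / of_real c)"
    by (intro Bochner_Integration.integral_cong) (auto simp: D_def scaleR_conv_of_real field_simps)
   also have "... = (expectation (\<lambda>w. of_real (W w) * iexp (\<theta> * S w)) + of_real (2 * b) * expectation (\<lambda>w. iexp (\<theta> * S w))) / of_real c"
   proof -
    have i1: "integrable M (\<lambda>w. complex_of_real (W w) * iexp (\<theta> * S w))"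
     by (rule integrable_const_bound[of _ b]) (use Wb in \<open>auto simp: norm_mult\<close>)
    have i2: "integrable M (\<lambda>w. iexp (\<theta> * S w))" by (rule integrable_const_bound[of _ 1]) auto
    show ?thesis using i1 i2 by (simp add: add_divide_distrib)
   qed
   also have "... = expectation (\<lambda>w. iexp (\<theta> * S w))"
    unfolding char distrib_right[symmetric] of_real_add[symmetric] c_eq[symmetric] using c by simp
   also have "... = char (distr M borel S) \<theta>" unfolding char_def by (subst integral_distr) auto
   finally show "char (distr M' borel S) \<theta> = char (distr M borel S) \<theta>" .
  qed
 qed
 then have "measure (distr M' borel S) A = measure (distr M borel S) A" by simp
 then have eq: "measure M' (S -` A \<inter> space M) = prob {w\<in>space M. S w \<in> A}"
  by (simp add: measure_distr sets' vimage_def Int_def conj_commute)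
 have iWA: "integrable M (\<lambda>w. W w * indicator A (S w))"
  by (rule integrable_const_bound[of _ b]) (use Wb b in \<open>auto simp: abs_mult indicator_def\<close>)
 have iA: "integrable M (\<lambda>w. indicator A (S w) :: real)" by (rule integrable_const_bound[of _ 1]) auto
 have pA: "expectation (\<lambda>w. indicator A (S w)) = prob {w\<in>space M. S w \<in> A}"
 proof -
  have "expectation (\<lambda>w. indicator A (S w)) = expectation (indicator {w\<in>space M. S w \<in> A} :: _ => real)"
   by (intro Bochner_Integration.integral_cong) (auto simp: indicator_def)
  then show ?thesis by simp
 qed
 have "measure M' (S -` A \<inter> space M) = (\<integral>w. indicator (S -` A \<inter> space M) w \<partial>M')"
  by (simp add: sets')
 also have "... = expectation (\<lambda>w. (D w / c) *\<^sub>R indicator (S -` A \<inter> space M) w)" by (rule int') measurable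
 also have "... = expectation (\<lambda>w. (W w * indicator A (S w) + 2 * b * indicator A (S w)) / c)"
  by (intro Bochner_Integration.integral_cong) (auto simp: D_def indicator_def)
 also have "... = (expectation (\<lambda>w. W w * indicator A (S w)) + 2 * b * prob {w\<in>space M. S w \<in> A}) / c"
  using iWA iA by (simp add: add_divide_distrib pA)
 finally have "prob {w\<in>space M. S w \<in> A} = (expectation (\<lambda>w. W w * indicator A (S w)) + 2 * b * prob {w\<in>space M. S w \<in> A}) / c"
  unfolding eq .
 then show ?thesis using c by (simp add: c_eq field_simps)
qed

text \<open>The assumption passes to the conjugate of \<open>W\<close>, by replacing \<open>\<theta>\<close> with \<open>- \<theta>\<close>, and so to its real part;
  the imaginary part is the real part of \<open>- \<i> W\<close>.\<close>

lemma expectation_mult_indicator: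
 fixes S :: "'a => real" and W :: "'a => complex"
 assumes S[measurable]: "random_variable borel S" and W: "random_variable borel W"
  and B: "\<And>w. norm (W w) <= B"
  and char: "\<And>\<theta>. expectation (\<lambda>w. W w * iexp (\<theta> * S w)) = expectation W * expectation (\<lambda>w. iexp (\<theta> * S w))"
  and A[measurable]: "A \<in> sets borel"
 shows "expectation (\<lambda>w. W w * indicator A (S w)) = expectation W * of_real (prob {w\<in>space M. S w \<in> A})"
proof -
 have Re: "Re (expectation (\<lambda>w. U w * indicator A (S w))) = Re (expectation U) * prob {w\<in>space M. S w \<in> A}"
  if U[measurable]: "random_variable borel U" and B: "\<And>w. norm (U w) <= B"
   and char: "\<And>\<theta>. expectation (\<lambda>w. U w * iexp (\<theta> * S w)) = expectation U * expectation (\<lambda>w. iexp (\<theta> * S w))" for U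
 proof -
  have iU: "integrable M U" by (rule integrable_const_bound[of _ B]) (use B in auto)
  have iUe: "integrable M (\<lambda>w. U w * iexp (\<theta> * S w))" for \<theta>
   by (rule integrable_const_bound[of _ B]) (use B in \<open>auto simp: norm_mult\<close>)
  have iUA: "integrable M (\<lambda>w. U w * indicator A (S w))"
   by (rule Bochner_Integration.integrable_bound[OF iU]) (auto simp: norm_mult indicator_def)
  have cnj: "expectation (\<lambda>w. cnj (U w) * iexp (\<theta> * S w)) = cnj (expectation U) * expectation (\<lambda>w. iexp (\<theta> * S w))" for \<theta>
  proof -
   have "expectation (\<lambda>w. cnj (U w) * iexp (\<theta> * S w)) = expectation (\<lambda>w. cnj (U w * iexp ((- \<theta>) * S w)))"
    by (intro Bochner_Integration.integral_cong) (auto simp: exp_cnj)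
   also have "... = cnj (expectation U * expectation (\<lambda>w. iexp ((- \<theta>) * S w)))"
    by (simp only: Bochner_Integration.integral_cnj char)
   also have "... = cnj (expectation U) * expectation (\<lambda>w. cnj (iexp ((- \<theta>) * S w)))"
    by (simp only: complex_cnj_mult Bochner_Integration.integral_cnj)
   also have "(\<lambda>w. cnj (iexp ((- \<theta>) * S w))) = (\<lambda>w. iexp (\<theta> * S w))" by (auto simp: exp_cnj)
   finally show ?thesis .
  qed
  have "integrable M (\<lambda>w. cnj (U w))" using iU by simp
  note [measurable] = borel_measurable_integrable[OF this]
  have iUc: "integrable M (\<lambda>w. cnj (U w) * iexp (\<theta> * S w))" for \<theta>
   by (rule integrable_const_bound[of _ B]) (use B in \<open>auto simp: norm_mult\<close>)
  have "expectation (\<lambda>w. Re (U w) * indicator A (S w)) = expectation (\<lambda>w. Re (U w)) * prob {w\<in>space M. S w \<in> A}"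
  proof (rule expectation_mult_indicator_real[where B = B])
   show "\<bar>Re (U w)\<bar> <= B" for w using abs_Re_le_cmod[of "U w"] B[of w] by linarith
   fix \<theta>
   let ?e = "expectation (\<lambda>w. iexp (\<theta> * S w))"
   have "expectation (\<lambda>w. of_real (Re (U w)) * iexp (\<theta> * S w)) = (expectation U * ?e + cnj (expectation U) * ?e) / 2"
    by (simp only: of_real_Re_mult integral_divide_zero Bochner_Integration.integral_add[OF iUe iUc] char cnj)
   then show "expectation (\<lambda>w. of_real (Re (U w)) * iexp (\<theta> * S w)) = of_real (expectation (\<lambda>w. Re (U w))) * ?e"
    by (simp only: of_real_Re_mult[symmetric] integral_Re[OF iU])
  qed measurable
  moreover have "Re (U w * indicator A (S w)) = Re (U w) * indicator A (S w)" for w by (simp add: indicator_def)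
  ultimately show ?thesis by (simp only: integral_Re[OF iUA, symmetric] integral_Re[OF iU])
 qed
 have Im: "Re (expectation (\<lambda>w. (- \<i> * W w) * indicator A (S w))) = Re (expectation (\<lambda>w. - \<i> * W w)) * prob {w\<in>space M. S w \<in> A}"
  by (rule Re) (use W B char in \<open>simp_all add: norm_mult mult.assoc\<close>)
 show ?thesis
  using Re[OF W B char] Im by (intro complex_eqI) (simp_all add: mult.assoc)
qed

text \<open>The exponentials are exchanged for indicators one variable at a time. In each step the product of
  the other factors plays the role of \<open>W\<close> in the preceding lemma.\<close>

lemma indep_vars_of_joint_char:
 fixes X :: "nat => 'a => real"
 assumes X: "\<And>i. i < k ==> random_variable borel (X i)"
  and char: "\<And>\<theta>. expectation (\<lambda>w. \<Prod>i<k. iexp (\<theta> i * X i w)) = (\<Prod>i<k. expectation (\<lambda>w. iexp (\<theta> i * X i w)))"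
 shows "indep_vars (\<lambda>_. borel) X {..<k}"
proof -
 have step: "j <= k ==> (\<And>i. A i \<in> sets borel) ==>
  expectation (\<lambda>w. (\<Prod>i<j. indicator (A i) (X i w)) * (\<Prod>i\<in>{j..<k}. iexp (\<theta> i * X i w))) =
  (\<Prod>i<j. of_real (prob {w\<in>space M. X i w \<in> A i})) * (\<Prod>i\<in>{j..<k}. expectation (\<lambda>w. iexp (\<theta> i * X i w)))"
  for j \<theta> and A :: "nat => real set"
 proof (induction j arbitrary: \<theta>)
  case 0
  then show ?case using char[of \<theta>] by (simp add: atLeast0LessThan)
 next
  case (Suc j)
  then have j: "j < k" "j <= k" by auto
  define W where "W w = (\<Prod>i<j. indicator (A i) (X i w)) * (\<Prod>i\<in>{Suc j..<k}. iexp (\<theta> i * X i w))" for w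
  define c where "c = (\<Prod>i<j. complex_of_real (prob {w\<in>space M. X i w \<in> A i})) * (\<Prod>i\<in>{Suc j..<k}. expectation (\<lambda>w. iexp (\<theta> i * X i w)))"
  have W_rv: "random_variable borel W"
  proof -
   have "random_variable borel (\<lambda>w. indicator (A i) (X i w) :: complex)" if "i < j" for i
    using X[of i] Suc.prems that by (intro borel_measurable_indicator') auto
   moreover have "random_variable borel (\<lambda>w. iexp (\<theta> i * X i w))" if "i < k" for i
    using X[OF that] by measurable
   ultimately show ?thesis unfolding W_def[abs_def] using j
    by (intro borel_measurable_times borel_measurable_prod) auto
  qed
  have W_le: "norm (W w) <= 1" for w
  proof -
   have "norm (\<Prod>i<j. indicator (A i) (X i w) :: complex) <= 1"
    unfolding prod_norm[symmetric] by (intro prod_le_1) (auto simp: indicator_def)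
   moreover have "norm (\<Prod>i\<in>{Suc j..<k}. iexp (\<theta> i * X i w)) = 1"
    unfolding prod_norm[symmetric] by (intro prod.neutral) auto
   ultimately show ?thesis by (simp add: W_def norm_mult)
  qed
  have ch: "expectation (\<lambda>w. W w * iexp (t * X j w)) = c * expectation (\<lambda>w. iexp (t * X j w))" for t
  proof -
   have rng: "{j..<k} = insert j {Suc j..<k}" using j by auto
   have "W w * iexp (t * X j w) = (\<Prod>i<j. indicator (A i) (X i w)) * (\<Prod>i\<in>{j..<k}. iexp ((\<theta>(j := t)) i * X i w))" for w
    unfolding rng W_def by (simp add: mult_ac)
   then have "expectation (\<lambda>w. W w * iexp (t * X j w)) =
    (\<Prod>i<j. of_real (prob {w\<in>space M. X i w \<in> A i})) * (\<Prod>i\<in>{j..<k}. expectation (\<lambda>w. iexp ((\<theta>(j := t)) i * X i w)))"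
    using Suc.IH[OF j(2) Suc.prems(2), of "\<theta>(j := t)"] by simp
   also have "... = c * expectation (\<lambda>w. iexp (t * X j w))"
    unfolding rng c_def by (simp add: mult_ac)
   finally show ?thesis .
  qed
  have EW: "expectation W = c" using ch[of 0] by (simp add: prob_space)
  have "expectation (\<lambda>w. W w * indicator (A j) (X j w)) = expectation W * of_real (prob {w\<in>space M. X j w \<in> A j})"
   by (rule expectation_mult_indicator[OF X[OF j(1)] W_rv W_le]) (use ch EW Suc.prems in auto)
  also have "... = (\<Prod>i<Suc j. of_real (prob {w\<in>space M. X i w \<in> A i})) * (\<Prod>i\<in>{Suc j..<k}. expectation (\<lambda>w. iexp (\<theta> i * X i w)))"
   unfolding EW c_def prod.lessThan_Suc by (simp only: mult_ac)
  finally have fin: "expectation (\<lambda>w. W w * indicator (A j) (X j w)) = (\<Prod>i<Suc j. of_real (prob {w\<in>space M. X i w \<in> A i})) * (\<Prod>i\<in>{Suc j..<k}. expectation (\<lambda>w. iexp (\<theta> i * X i w)))" .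
  have eqW: "(\<Prod>i<Suc j. indicator (A i) (X i w)) * (\<Prod>i\<in>{Suc j..<k}. iexp (\<theta> i * X i w)) = W w * indicator (A j) (X j w)" for w
   by (simp add: W_def mult_ac)
  show ?case unfolding eqW by (rule fin)
 qed
 show ?thesis
  unfolding indep_vars_def2
 proof (intro conjI ballI)
  show "random_variable borel (X i)" if "i \<in> {..<k}" for i using X that by simp
  show "indep_sets (\<lambda>i. {X i -` A \<inter> space M |A. A \<in> sets borel}) {..<k}"
  proof (cases "k = 0")
   case True
   then show ?thesis by (simp add: indep_sets_def)
  next
   case False
   show ?thesis
   proof (rule indep_sets_finite[THEN iffD2])
    show "{X i -` A \<inter> space M |A. A \<in> sets borel} \<subseteq> events" if "i \<in> {..<k}" for i
     using X that by (auto intro: measurable_sets)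
    show "space M \<in> {X i -` A \<inter> space M |A. A \<in> sets borel}" if "i \<in> {..<k}" for i
     by (rule CollectI, rule exI[of _ UNIV]) auto
    show "\<forall>F\<in>Pi {..<k} (\<lambda>i. {X i -` A \<inter> space M |A. A \<in> sets borel}). prob (\<Inter>i\<in>{..<k}. F i) = (\<Prod>i\<in>{..<k}. prob (F i))"
    proof
     fix F assume F: "F \<in> Pi {..<k} (\<lambda>i. {X i -` A \<inter> space M |A. A \<in> sets borel})"
     have "\<forall>i\<in>{..<k}. \<exists>A. A \<in> sets borel \<and> F i = X i -` A \<inter> space M"
      using Pi_mem[OF F] by blast
     from bchoice[OF this]
     obtain A0 where A0: "\<forall>i\<in>{..<k}. A0 i \<in> sets borel \<and> F i = X i -` A0 i \<inter> space M" ..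
     define A where "A i = (if i < k then A0 i else {})" for i
     have A: "A i \<in> sets borel" "i < k ==> F i = {w\<in>space M. X i w \<in> A i}" for i using A0 by (auto simp: A_def)
     have Fm: "F i \<in> events" if "i < k" for i
      using A0 X[OF that] that by (auto intro: measurable_sets)
     have Iev: "(\<Inter>i\<in>{..<k}. F i) \<in> events" using Fm False by (intro sets.finite_INT) auto
     have "complex_of_real (prob (\<Inter>i\<in>{..<k}. F i)) = of_real (expectation (indicator (\<Inter>i\<in>{..<k}. F i)))"
      using sets.sets_into_space[OF Iev] by (simp add: Int_absorb2)
     also have "... = expectation (\<lambda>w. of_real (indicator (\<Inter>i\<in>{..<k}. F i) w))" by simp
     also have "... = expectation (\<lambda>w. \<Prod>i<k. indicator (A i) (X i w))"
     proof (rule Bochner_Integration.integral_cong[OF refl])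
      fix w assume w: "w \<in> space M"
      show "complex_of_real (indicator (\<Inter>i\<in>{..<k}. F i) w) = (\<Prod>i<k. indicator (A i) (X i w))"
      proof (cases "w \<in> (\<Inter>i\<in>{..<k}. F i)")
       case True
       then have "X i w \<in> A i" if "i < k" for i using A(2)[OF that] that by auto
       then show ?thesis using True by simp
      next
       case False
       then obtain i where "i < k" "X i w \<notin> A i" using A(2) w by auto
       then have "(\<Prod>i<k. indicator (A i) (X i w) :: complex) = 0" by (intro prod_zero) (auto intro!: bexI[of _ i])
       then show ?thesis using False by simp
      qed
     qed
     also have "... = (\<Prod>i<k. of_real (prob {w\<in>space M. X i w \<in> A i}))"
      using step[of k A "\<lambda>_. 0", OF order_refl A(1)] by simp
     also have "... = of_real (\<Prod>i\<in>{..<k}. prob (F i))" using A(2) by simp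
     finally show "prob (\<Inter>i\<in>{..<k}. F i) = (\<Prod>i\<in>{..<k}. prob (F i))" by (simp only: of_real_eq_iff)
    qed
   qed (use False in auto)
  qed
 qed
qed

end

section \<open>Compound Poisson sums\<close>

lemma poisson_sums:
 fixes l :: real
 defines "w \<equiv> \<lambda>n. l ^ n / fact n * exp (- l)"
 shows "w sums 1" "(\<lambda>n. w n * real n) sums l" "(\<lambda>n. w n * (real n - l)\<^sup>2) sums l"
proof -
 have e: "(\<lambda>n. l ^ n / fact n) sums exp l"
  using exp_converges[of l] by (simp add: divide_inverse mult.commute)
 have w0: "w sums 1"
  unfolding w_def using sums_mult2[OF e, of "exp (- l)"] by (simp add: exp_minus)
 have wS: "w (Suc n) * real (Suc n) = w n * l" for n
  unfolding w_def fact_Suc by (simp add: field_simps del: of_nat_Suc)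
 have w1: "(\<lambda>n. w n * real n) sums l"
 proof (rule sums_Suc_imp)
  show "(\<lambda>n. w (Suc n) * real (Suc n)) sums l" using sums_mult2[OF w0, of l] unfolding wS by simp
 qed simp
 have w2: "(\<lambda>n. w n * (real n * (real n - 1))) sums l\<^sup>2"
 proof (rule sums_Suc_imp)
  have w': "w (Suc n) * (real (Suc n) * (real (Suc n) - 1)) = w n * real n * l" for n
   using arg_cong[OF wS[of n], of "\<lambda>x. x * real n"] by (simp add: mult_ac)
  show "(\<lambda>n. w (Suc n) * (real (Suc n) * (real (Suc n) - 1))) sums l\<^sup>2"
   unfolding w' power2_eq_square by (rule sums_mult2[OF w1])
 qed simp
 have "(\<lambda>n. w n * (real n * (real n - 1)) + (1 - 2 * l) * (w n * real n) + l\<^sup>2 * w n) sums (l\<^sup>2 + (1 - 2 * l) * l + l\<^sup>2 * 1)"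
  by (intro sums_add sums_mult w0 w1 w2)
 moreover have "w n * (real n * (real n - 1)) + (1 - 2 * l) * (w n * real n) + l\<^sup>2 * w n = w n * (real n - l)\<^sup>2" for n
  by (simp add: power2_eq_square algebra_simps)
 ultimately show "(\<lambda>n. w n * (real n - l)\<^sup>2) sums l" by (simp add: power2_eq_square algebra_simps)
 show "w sums 1" "(\<lambda>n. w n * real n) sums l" by (fact w0 w1)+
qed

text \<open>Number and summands of a compound Poisson sum in one independent sequence: the integer part of
  \<open>Y 0\<close> is the number of terms and \<open>Y 1, Y 2, ...\<close> are the terms.\<close>

locale compound_poisson = prob_space M for M :: "'a measure" +
 fixes Y :: "nat => 'a => real" and rate :: real and \<nu> :: "real measure"
 assumes indep: "indep_vars (\<lambda>_. borel) Y UNIV"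
  and count: "\<And>n. prob {w\<in>space M. nat \<lfloor>Y 0 w\<rfloor> = n} = rate ^ n / fact n * exp (- rate)"
  and law: "\<And>l. distr M borel (Y (Suc l)) = \<nu>"
begin

lemma Y_rv[measurable]: "random_variable borel (Y i)"
 using indep by (auto simp: indep_vars_def)

abbreviation "cnt w \<equiv> nat \<lfloor>Y 0 w\<rfloor>"

definition "jump_sum w = (\<Sum>l<cnt w. Y (Suc l) w)"

lemma cnt_measurable[measurable]: "cnt \<in> M \<rightarrow>\<^sub>M count_space UNIV"
 by measurable

lemma cnt_indep:
 fixes G :: "(nat => real) => 'b::{real_normed_field, banach, second_countable_topology}"
 assumes G: "G \<in> borel_measurable (PiM {Suc 0..n} (\<lambda>_. borel))"
  and int: "integrable M (\<lambda>w. G (\<lambda>i\<in>{Suc 0..n}. Y i w))"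
 shows "integrable M (\<lambda>w. indicator {w. cnt w = n} w * G (\<lambda>i\<in>{Suc 0..n}. Y i w))"
  and "expectation (\<lambda>w. indicator {w. cnt w = n} w * G (\<lambda>i\<in>{Suc 0..n}. Y i w)) =
   of_real (rate ^ n / fact n * exp (- rate)) * expectation (\<lambda>w. G (\<lambda>i\<in>{Suc 0..n}. Y i w))"
proof -
 let ?F = "\<lambda>y::nat => real. if nat \<lfloor>y 0\<rfloor> = n then 1 else 0 :: 'b"
 have F: "?F \<in> borel_measurable (PiM {0} (\<lambda>_. borel))" by measurable
 have "indep_var (PiM {0} (\<lambda>_. borel)) (\<lambda>w. \<lambda>i\<in>{0}. Y i w) (PiM {Suc 0..n} (\<lambda>_. borel)) (\<lambda>w. \<lambda>i\<in>{Suc 0..n}. Y i w)"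
  by (rule indep_var_restrict[OF indep]) auto
 from indep_var_compose[OF this F G]
 have iv: "indep_var borel (\<lambda>w. ?F (\<lambda>i\<in>{0}. Y i w)) borel (\<lambda>w. G (\<lambda>i\<in>{Suc 0..n}. Y i w))"
  by (simp add: comp_def)
 have eq: "?F (\<lambda>i\<in>{0}. Y i w) = indicator {w. cnt w = n} w" for w by (simp add: indicator_def)
 have iF: "integrable M (\<lambda>w. ?F (\<lambda>i\<in>{0}. Y i w))"
  by (rule integrable_const_bound[of _ 1]) (use indep_var_rv1[OF iv] in auto)
 show "integrable M (\<lambda>w. indicator {w. cnt w = n} w * G (\<lambda>i\<in>{Suc 0..n}. Y i w))"
  using indep_var_integrable[OF iv iF int] unfolding eq .
 have pr: "expectation (\<lambda>w. indicator {w. cnt w = n} w :: 'b) = of_real (rate ^ n / fact n * exp (- rate))"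
 proof -
 have "expectation (\<lambda>w. indicator {w. cnt w = n} w :: 'b) = expectation (\<lambda>w. of_real (indicator {w\<in>space M. cnt w = n} w))"
  by (intro Bochner_Integration.integral_cong) (auto simp: indicator_def)
 also have "... = of_real (prob {w\<in>space M. cnt w = n})"
 proof -
  have ev: "{w\<in>space M. cnt w = n} \<in> events" by measurable
  have "integrable M (indicator {w\<in>space M. cnt w = n} :: _ => real)"
   using ev by (rule integrable_real_indicator) (simp add: emeasure_eq_measure)
  then have "expectation (\<lambda>w. of_real (indicator {w\<in>space M. cnt w = n} w) :: 'b) = of_real (expectation (indicator {w\<in>space M. cnt w = n}))"
   by (rule integral_of_real)
  then show ?thesis using sets.sets_into_space[OF ev] by (simp add: Int_absorb2)
 qed
 also have "... = of_real (rate ^ n / fact n * exp (- rate))" by (simp only: count)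
 finally show ?thesis .
 qed
 show "expectation (\<lambda>w. indicator {w. cnt w = n} w * G (\<lambda>i\<in>{Suc 0..n}. Y i w)) =
   of_real (rate ^ n / fact n * exp (- rate)) * expectation (\<lambda>w. G (\<lambda>i\<in>{Suc 0..n}. Y i w))"
  using indep_var_lebesgue_integral[OF iv iF int] unfolding eq pr .
qed

text \<open>Conditioning on the number of terms.\<close>

lemma random_index_integral:
 fixes G :: "nat => (nat => real) => 'b::{real_normed_field, banach, second_countable_topology}"
 assumes G: "\<And>n. G n \<in> borel_measurable (PiM {Suc 0..n} (\<lambda>_. borel))"
  and int: "\<And>n. integrable M (\<lambda>w. G n (\<lambda>i\<in>{Suc 0..n}. Y i w))"
  and sm: "summable (\<lambda>n. rate ^ n / fact n * exp (- rate) * expectation (\<lambda>w. norm (G n (\<lambda>i\<in>{Suc 0..n}. Y i w))))"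
 shows "integrable M (\<lambda>w. G (cnt w) (\<lambda>i\<in>{Suc 0..cnt w}. Y i w))"
  and "(\<lambda>n. of_real (rate ^ n / fact n * exp (- rate)) * expectation (\<lambda>w. G n (\<lambda>i\<in>{Suc 0..n}. Y i w))) sums
   expectation (\<lambda>w. G (cnt w) (\<lambda>i\<in>{Suc 0..cnt w}. Y i w))"
proof -
 let ?R = "\<lambda>n w. G n (\<lambda>i\<in>{Suc 0..n}. Y i w)"
 let ?f = "\<lambda>n w. indicator {w. cnt w = n} w * ?R n w"
 have one: "(\<lambda>n. ?f n w) sums ?R (cnt w) w" for w
  using sums_single[of "cnt w" "\<lambda>n. ?R n w"] by (rule back_subst[where P = "\<lambda>f. f sums _"]) (auto simp: fun_eq_iff indicator_def)
 have onen: "(\<lambda>n. norm (?f n w)) sums norm (?R (cnt w) w)" for w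
  using sums_single[of "cnt w" "\<lambda>n. norm (?R n w)"] by (rule back_subst[where P = "\<lambda>f. f sums _"]) (auto simp: fun_eq_iff indicator_def)
 have Gn: "(\<lambda>y. norm (G n y)) \<in> borel_measurable (PiM {Suc 0..n} (\<lambda>_. borel))" for n
  by (rule measurable_compose[OF G borel_measurable_norm])
 have intn: "integrable M (\<lambda>w. norm (?R n w))" for n using int by (rule integrable_norm)
 have nf: "norm (?f n w) = indicator {w. cnt w = n} w * norm (?R n w)" for n w
  by (simp add: indicator_def)
 have En: "expectation (\<lambda>w. norm (?f n w)) = rate ^ n / fact n * exp (- rate) * expectation (\<lambda>w. norm (?R n w))" for n
  unfolding nf cnt_indep(2)[OF Gn intn] by (simp only: of_real_eq_id id_apply)
 have fi: "integrable M (?f n)" for n by (rule cnt_indep(1)[OF G int])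
 have a1: "AE w in M. summable (\<lambda>n. norm (?f n w))" using onen by (intro AE_I2) (rule sums_summable)
 have a2: "summable (\<lambda>n. expectation (\<lambda>w. norm (?f n w)))" unfolding En by (rule sm)
 have su: "(\<lambda>w. \<Sum>n. ?f n w) = (\<lambda>w. ?R (cnt w) w)" using one by (intro ext) (simp add: sums_iff)
 show "integrable M (\<lambda>w. ?R (cnt w) w)"
  using integrable_suminf[OF fi a1 a2] unfolding su .
 have "(\<lambda>n. expectation (?f n)) sums expectation (\<lambda>w. \<Sum>n. ?f n w)"
  by (rule sums_integral[OF fi a1 a2])
 then show "(\<lambda>n. of_real (rate ^ n / fact n * exp (- rate)) * expectation (?R n)) sums expectation (\<lambda>w. ?R (cnt w) w)"
  unfolding su by (simp only: cnt_indep(2)[OF G int])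
qed

lemma sum_Suc_shift: "(\<Sum>i\<in>{Suc 0..n}. f i) = (\<Sum>l<n. f (Suc l))" for f :: "nat => 'b::comm_monoid_add"
 by (rule sum.reindex_bij_witness[of _ Suc "\<lambda>i. i - 1"]) auto

lemma prod_Suc_shift: "(\<Prod>i\<in>{Suc 0..n}. f i) = (\<Prod>l<n. f (Suc l))" for f :: "nat => 'b::comm_monoid_mult"
 by (rule prod.reindex_bij_witness[of _ Suc "\<lambda>i. i - 1"]) auto

lemma char_jump_sum: "expectation (\<lambda>w. iexp (jump_sum w)) = exp (of_real rate * ((\<integral>x. iexp x \<partial>\<nu>) - 1))"
proof -
 define \<phi> where "\<phi> = (\<integral>x. iexp x \<partial>\<nu>)"
 define G :: "nat => (nat => real) => complex" where "G n y = (\<Prod>i\<in>{Suc 0..n}. iexp (y i))" for n y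
 have Gm: "G n \<in> borel_measurable (PiM {Suc 0..n} (\<lambda>_. borel))" for n
  unfolding G_def[abs_def] by (intro borel_measurable_prod) measurable
 have GY: "G n (\<lambda>i\<in>{Suc 0..n}. Y i w) = (\<Prod>i\<in>{Suc 0..n}. iexp (Y i w))" for n w
  unfolding G_def by (intro prod.cong) auto
 have nG: "norm (G n (\<lambda>i\<in>{Suc 0..n}. Y i w)) = 1" for n w
  unfolding GY prod_norm[symmetric] by (intro prod.neutral) auto
 have int: "integrable M (\<lambda>w. iexp (Y i w))" for i by (rule integrable_const_bound[of _ 1]) auto
 have ind: "indep_vars (\<lambda>_. borel) (\<lambda>i w. iexp (Y i w)) {Suc 0..n}" for n
  by (rule indep_vars_compose2[OF indep_vars_subset[OF indep]]) auto
 have E1: "expectation (\<lambda>w. iexp (Y (Suc l) w)) = \<phi>" for l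
  unfolding \<phi>_def law[of l, symmetric] by (subst integral_distr) auto
 have intG: "integrable M (\<lambda>w. G n (\<lambda>i\<in>{Suc 0..n}. Y i w))" for n
  unfolding GY by (rule indep_vars_integrable[OF _ ind int]) simp
 have EG: "expectation (\<lambda>w. G n (\<lambda>i\<in>{Suc 0..n}. Y i w)) = \<phi> ^ n" for n
  unfolding GY by (subst indep_vars_lebesgue_integral[OF _ ind int]) (simp_all add: prod_Suc_shift E1)
 have sm: "summable (\<lambda>n. rate ^ n / fact n * exp (- rate) * expectation (\<lambda>w. norm (G n (\<lambda>i\<in>{Suc 0..n}. Y i w))))"
  unfolding nG using poisson_sums(1)[of rate] by (simp add: prob_space sums_iff)
 have "(\<lambda>n. of_real (rate ^ n / fact n * exp (- rate)) * \<phi> ^ n) sums expectation (\<lambda>w. G (cnt w) (\<lambda>i\<in>{Suc 0..cnt w}. Y i w))"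
  using random_index_integral(2)[of G, OF Gm intG sm] unfolding EG .
 moreover have "G (cnt w) (\<lambda>i\<in>{Suc 0..cnt w}. Y i w) = iexp (jump_sum w)" for w
  unfolding GY jump_sum_def prod_Suc_shift by (simp add: exp_sum sum_distrib_left)
 moreover have "(\<lambda>n. of_real (rate ^ n / fact n * exp (- rate)) * \<phi> ^ n) sums exp (of_real rate * (\<phi> - 1))"
 proof -
  have "(\<lambda>n. ((of_real rate * \<phi>) ^ n /\<^sub>R fact n) * of_real (exp (- rate))) sums (exp (of_real rate * \<phi>) * of_real (exp (- rate)))"
   by (intro sums_mult2 exp_converges)
  moreover have "((of_real rate * \<phi>) ^ n /\<^sub>R fact n) * of_real (exp (- rate)) = of_real (rate ^ n / fact n * exp (- rate)) * \<phi> ^ n" for n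
   by (simp add: scaleR_conv_of_real power_mult_distrib divide_inverse mult_ac)
  moreover have "exp (of_real rate * \<phi>) * of_real (exp (- rate)) = exp (of_real rate * (\<phi> - 1))"
   by (simp add: exp_of_real[symmetric] exp_add[symmetric] algebra_simps)
  ultimately show ?thesis by simp
 qed
 ultimately show ?thesis unfolding \<phi>_def using sums_unique2 by fastforce
qed

text \<open>The second moment about an arbitrary centre \<open>c\<close> follows by conditioning on the number of terms; the
  centres \<open>0\<close> and \<open>1\<close> together also yield the mean.\<close>

lemma moments_jump_sum:
 assumes b: "\<And>l w. \<bar>Y (Suc l) w\<bar> <= b"
 defines "m \<equiv> \<integral>x. x \<partial>\<nu>" and "s \<equiv> \<integral>x. x\<^sup>2 \<partial>\<nu>"
 shows "integrable M jump_sum" "expectation jump_sum = rate * m"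
  and "integrable M (\<lambda>w. (jump_sum w - rate * m)\<^sup>2)" "expectation (\<lambda>w. (jump_sum w - rate * m)\<^sup>2) = rate * s"
proof -
 have b0: "0 <= b" using b[of 0 undefined] by linarith
 let ?w = "\<lambda>n. rate ^ n / fact n * exp (- rate)"
 have w_pos: "0 <= ?w n" for n using measure_nonneg[of M "{w\<in>space M. cnt w = n}"] by (simp add: count)
 have i1: "integrable M (Y (Suc l))" for l by (rule integrable_const_bound[of _ b]) (use b in auto)
 have b2: "(Y (Suc l) w)\<^sup>2 <= b\<^sup>2" for l w
  using power_mono[OF b[of l w] abs_ge_zero, of 2] by simp
 have i2: "integrable M (\<lambda>w. (Y (Suc l) w)\<^sup>2)" for l
  by (rule integrable_const_bound[of _ "b\<^sup>2"]) (use b2 in simp_all)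
 have e1: "expectation (Y (Suc l)) = m" for l
  unfolding m_def law[of l, symmetric] by (subst integral_distr) auto
 have e2: "expectation (\<lambda>w. (Y (Suc l) w)\<^sup>2) = s" for l
  unfolding s_def law[of l, symmetric] by (subst integral_distr) auto
 let ?S = "\<lambda>n w. \<Sum>l<n. Y (Suc l) w"
 have ind: "indep_vars (\<lambda>_. borel) (\<lambda>l w. Y (Suc l) w - m) {..<n}" for n
 proof -
  have "indep_vars (\<lambda>_. borel) Y (Suc ` {..<n})" by (rule indep_vars_subset[OF indep]) simp
  then have "indep_vars (\<lambda>_. borel) (\<lambda>l. Y (Suc l)) {..<n}" by (rule indep_vars_reindex) simp
  then show ?thesis by (rule indep_vars_compose2) auto
 qed
 have i3: "integrable M (\<lambda>w. (Y (Suc l) w - m)\<^sup>2)" for l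
  using i1 i2 by (simp add: power2_diff)
 have e3: "expectation (\<lambda>w. Y (Suc l) w - m) = 0" for l using i1 e1 by (simp add: prob_space)
 have e4: "expectation (\<lambda>w. (Y (Suc l) w - m)\<^sup>2) = s - m\<^sup>2" for l
 proof -
  have "expectation (\<lambda>w. (Y (Suc l) w - m)\<^sup>2) = expectation (\<lambda>w. ((Y (Suc l) w)\<^sup>2 + m\<^sup>2) - (2 * m) * Y (Suc l) w)"
   by (simp add: power2_diff mult_ac)
  also have "... = s + m\<^sup>2 - 2 * m * m" using i1 i2 by (simp add: e1 e2 prob_space)
  finally show ?thesis by (simp add: power2_eq_square)
 qed
 have Q: "integrable M (\<lambda>w. (?S n w - c)\<^sup>2)" "expectation (\<lambda>w. (?S n w - c)\<^sup>2) = real n * (s - m\<^sup>2) + (real n * m - c)\<^sup>2" for n c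
 proof -
  let ?C = "\<lambda>w. \<Sum>l<n. Y (Suc l) w - m"
  have eq: "(?S n w - c)\<^sup>2 = (?C w)\<^sup>2 + (real n * m - c)\<^sup>2 + 2 * (real n * m - c) * ?C w" for w
  proof -
   have "?S n w - c = ?C w + (real n * m - c)" by (simp add: sum_subtractf)
   then show ?thesis by (simp only: power2_sum mult_ac)
  qed
  have iC2: "integrable M (\<lambda>w. (?C w)\<^sup>2)" by (intro square_integrable_sum i3) measurable
  have iC: "integrable M ?C" by (intro Bochner_Integration.integrable_sum Bochner_Integration.integrable_diff i1) simp
  have EC2: "expectation (\<lambda>w. (?C w)\<^sup>2) = real n * (s - m\<^sup>2)"
   by (subst expectation_square_sum[OF ind i3 e3]) (simp add: e4)
  have EC: "expectation ?C = 0"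
   by (subst Bochner_Integration.integral_sum) (auto intro!: sum.neutral e3 Bochner_Integration.integrable_diff i1)
  show "integrable M (\<lambda>w. (?S n w - c)\<^sup>2)" unfolding eq using iC2 iC by simp
  show "expectation (\<lambda>w. (?S n w - c)\<^sup>2) = real n * (s - m\<^sup>2) + (real n * m - c)\<^sup>2"
   unfolding eq using iC2 iC EC2 EC by (simp add: prob_space)
 qed
 have sq: "integrable M (\<lambda>w. (jump_sum w - c)\<^sup>2)" "expectation (\<lambda>w. (jump_sum w - c)\<^sup>2) = rate * s + (rate * m - c)\<^sup>2" for c
 proof -
  define G :: "nat => (nat => real) => real" where "G n y = ((\<Sum>i\<in>{Suc 0..n}. y i) - c)\<^sup>2" for n y
  have Gm: "G n \<in> borel_measurable (PiM {Suc 0..n} (\<lambda>_. borel))" for n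
   unfolding G_def[abs_def] by (intro borel_measurable_power borel_measurable_diff borel_measurable_sum) measurable
  have "(\<Sum>i\<in>{Suc 0..n}. (\<lambda>i\<in>{Suc 0..n}. Y i w) i) = ?S n w" for n w
   unfolding sum_Suc_shift by (intro sum.cong) auto
  then have GY: "G n (\<lambda>i\<in>{Suc 0..n}. Y i w) = (?S n w - c)\<^sup>2" for n w unfolding G_def by (simp only:)
  have lim: "(\<lambda>n. ?w n * (real n * (s - m\<^sup>2) + (real n * m - c)\<^sup>2)) sums (rate * s + (rate * m - c)\<^sup>2)"
  proof -
   have "(\<lambda>n. ?w n * real n * (s - m\<^sup>2 + 2 * m * (rate * m - c)) + ?w n * (real n - rate)\<^sup>2 * m\<^sup>2 +
     ?w n * ((rate * m - c)\<^sup>2 - 2 * rate * m * (rate * m - c))) sums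
     (rate * (s - m\<^sup>2 + 2 * m * (rate * m - c)) + rate * m\<^sup>2 + 1 * ((rate * m - c)\<^sup>2 - 2 * rate * m * (rate * m - c)))"
    by (intro sums_add sums_mult2 poisson_sums)
   moreover have "?w n * real n * (s - m\<^sup>2 + 2 * m * (rate * m - c)) + ?w n * (real n - rate)\<^sup>2 * m\<^sup>2 +
     ?w n * ((rate * m - c)\<^sup>2 - 2 * rate * m * (rate * m - c)) = ?w n * (real n * (s - m\<^sup>2) + (real n * m - c)\<^sup>2)" for n
    by (simp only: mult.assoc distrib_left[symmetric]) (simp add: power2_eq_square algebra_simps)
   moreover have "rate * (s - m\<^sup>2 + 2 * m * (rate * m - c)) + rate * m\<^sup>2 + 1 * ((rate * m - c)\<^sup>2 - 2 * rate * m * (rate * m - c)) =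
     rate * s + (rate * m - c)\<^sup>2" by (simp add: power2_eq_square algebra_simps)
   ultimately show ?thesis by (simp only:)
  qed
  have sm: "summable (\<lambda>n. ?w n * expectation (\<lambda>w. norm (G n (\<lambda>i\<in>{Suc 0..n}. Y i w))))"
   unfolding GY using lim by (simp add: Q(2) sums_iff)
  have iG: "integrable M (\<lambda>w. G n (\<lambda>i\<in>{Suc 0..n}. Y i w))" for n unfolding GY by (rule Q(1))
  note r = random_index_integral[of G, OF Gm iG sm, unfolded GY]
  show "integrable M (\<lambda>w. (jump_sum w - c)\<^sup>2)" using r(1) by (simp add: jump_sum_def)
  have "(\<lambda>n. ?w n * (real n * (s - m\<^sup>2) + (real n * m - c)\<^sup>2)) sums expectation (\<lambda>w. (jump_sum w - c)\<^sup>2)"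
   using r(2) unfolding Q(2) jump_sum_def[symmetric] by simp
  then show "expectation (\<lambda>w. (jump_sum w - c)\<^sup>2) = rate * s + (rate * m - c)\<^sup>2" using lim by (rule sums_unique2)
 qed
 show "integrable M (\<lambda>w. (jump_sum w - rate * m)\<^sup>2)" "expectation (\<lambda>w. (jump_sum w - rate * m)\<^sup>2) = rate * s"
  using sq[of "rate * m"] by simp_all
 have eq: "jump_sum w = ((jump_sum w - 0)\<^sup>2 - (jump_sum w - 1)\<^sup>2 + 1) / 2" for w
  by (simp add: power2_eq_square algebra_simps)
 show "integrable M jump_sum" by (subst eq[abs_def]) (use sq(1)[of 0] sq(1)[of 1] in simp)
 have "expectation jump_sum = expectation (\<lambda>w. ((jump_sum w - 0)\<^sup>2 - (jump_sum w - 1)\<^sup>2 + 1) / 2)"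
  by (subst eq[abs_def]) simp
 also have "... = (expectation (\<lambda>w. (jump_sum w - 0)\<^sup>2) - expectation (\<lambda>w. (jump_sum w - 1)\<^sup>2) + 1) / 2"
  using sq(1)[of 0] sq(1)[of 1] by (simp add: prob_space)
 also have "... = rate * m" unfolding sq(2) by (simp add: power2_eq_square algebra_simps)
 finally show "expectation jump_sum = rate * m" .
qed

end

section \<open>Poisson points in one cell\<close>

definition clamp01 :: "real => real" where
 "clamp01 s = max 0 (min s 1)"

text \<open>Poisson many points with uniform times in \<open>[k, k+1]\<close> and independent marks of law \<open>\<rho>\<close>; a point with
  mark \<open>y\<close> is a jump of size \<open>h y\<close>. The points sit in one independent sequence: \<open>X 0\<close> is their number and
  \<open>X (2 l + 1)\<close>, \<open>X (2 l + 2)\<close> are the time and the mark of the \<open>l\<close>-th one.\<close>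

locale poisson_cell = prob_space M for M :: "'a measure" +
 fixes X :: "nat => 'a => real" and rate :: real and \<rho> :: "real measure" and h :: "real => real" and k :: real
 assumes indep: "indep_vars (\<lambda>_. borel) X UNIV"
  and count: "\<And>n. prob {w\<in>space M. nat \<lfloor>X 0 w\<rfloor> = n} = rate ^ n / fact n * exp (- rate)"
  and time_law: "\<And>l. distr M borel (X (2 * l + 1)) = uniform_measure lborel {0..1}"
  and size_law: "\<And>l. distr M borel (X (2 * l + 2)) = \<rho>"
  and h[measurable]: "h \<in> borel_measurable borel"
begin

lemma X_rv[measurable]: "random_variable borel (X i)"
 using indep by (auto simp: indep_vars_def)

definition cell_sum :: "(real \<times> real => real) => 'a => real" where
 "cell_sum f w = (\<Sum>l<nat \<lfloor>X 0 w\<rfloor>. f (X (2 * l + 1) w, X (2 * l + 2) w))"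

lemma pair_law:
 "distr M (borel \<Otimes>\<^sub>M borel) (\<lambda>w. (X (2 * l + 1) w, X (2 * l + 2) w)) = uniform_measure lborel {0..1} \<Otimes>\<^sub>M \<rho>"
proof -
 have "indep_var (PiM {2 * l + 1} (\<lambda>_. borel)) (\<lambda>w. \<lambda>i\<in>{2 * l + 1}. X i w) (PiM {2 * l + 2} (\<lambda>_. borel)) (\<lambda>w. \<lambda>i\<in>{2 * l + 2}. X i w)"
  by (rule indep_var_restrict[OF indep]) auto
 from indep_var_compose[OF this, of "\<lambda>y. y (2 * l + 1)" borel "\<lambda>y. y (2 * l + 2)" borel]
 have "indep_var borel (X (2 * l + 1)) borel (X (2 * l + 2))"
  by (simp add: comp_def)
 then show ?thesis by (simp add: indep_var_distribution_eq time_law[symmetric, of l] size_law[symmetric, of l])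
qed

lemma indep_first_pair:
 fixes A B :: "real => 'b::{real_normed_field, banach, second_countable_topology}"
 assumes [measurable]: "A \<in> borel_measurable borel" "B \<in> borel_measurable borel"
  and "integrable M (\<lambda>w. A (X 1 w))" "integrable M (\<lambda>w. B (X 2 w))"
 shows "integrable M (\<lambda>w. A (X 1 w) * B (X 2 w))"
  and "expectation (\<lambda>w. A (X 1 w) * B (X 2 w)) = expectation (\<lambda>w. A (X 1 w)) * expectation (\<lambda>w. B (X 2 w))"
proof -
 have "indep_var (PiM {1} (\<lambda>_. borel)) (\<lambda>w. \<lambda>i\<in>{1}. X i w) (PiM {2} (\<lambda>_. borel)) (\<lambda>w. \<lambda>i\<in>{2}. X i w)"
  by (rule indep_var_restrict[OF indep]) auto
 from indep_var_compose[OF this, of "\<lambda>y. A (y 1)" borel "\<lambda>y. B (y 2)" borel]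
 have "indep_var borel (\<lambda>w. A (X 1 w)) borel (\<lambda>w. B (X 2 w))"
  by (simp add: comp_def)
 then show "integrable M (\<lambda>w. A (X 1 w) * B (X 2 w))"
  and "expectation (\<lambda>w. A (X 1 w) * B (X 2 w)) = expectation (\<lambda>w. A (X 1 w)) * expectation (\<lambda>w. B (X 2 w))"
  using assms by (auto intro: indep_var_integrable indep_var_lebesgue_integral)
qed

lemma compound_poisson_cell:
 assumes f[measurable]: "f \<in> borel_measurable (borel \<Otimes>\<^sub>M borel)"
 defines "Y \<equiv> \<lambda>i w. case i of 0 => X 0 w | Suc l => f (X (2 * l + 1) w, X (2 * l + 2) w)"
 shows "compound_poisson M Y rate (distr M borel (\<lambda>w. f (X 1 w, X 2 w)))"
proof -
 define K :: "nat => nat set" where "K i = (case i of 0 => {0} | Suc l => {2 * l + 1, 2 * l + 2})" for i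
 define F where "F i y = (case i of 0 => y 0 | Suc l => f (y (2 * l + 1), y (2 * l + 2)))" for i and y :: "nat => real"
 have dj: "disjoint_family_on K UNIV"
  unfolding disjoint_family_on_def K_def by (auto split: nat.splits; presburger)
 have "indep_vars (\<lambda>j. PiM (K j) (\<lambda>_. borel)) (\<lambda>j w. restrict (\<lambda>i. X i w) (K j)) UNIV"
  by (rule indep_vars_restrict[OF indep _ dj]) auto
 then have "indep_vars (\<lambda>_. borel) (\<lambda>i w. F i (restrict (\<lambda>i. X i w) (K i))) UNIV"
 proof (rule indep_vars_compose2)
  fix i
  show "F i \<in> borel_measurable (PiM (K i) (\<lambda>_. borel))"
  proof (cases i)
   case 0
   then show ?thesis unfolding F_def[abs_def] K_def by simp
  next
   case (Suc l)
   have "(\<lambda>y. (y (2 * l + 1), y (2 * l + 2))) \<in> PiM {2 * l + 1, 2 * l + 2} (\<lambda>_. borel) \<rightarrow>\<^sub>M borel \<Otimes>\<^sub>M borel"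
    by (intro measurable_Pair measurable_component_singleton) auto
   from measurable_compose[OF this f] show ?thesis
    unfolding F_def[abs_def] K_def Suc by simp
  qed
 qed
 moreover have "F i (restrict (\<lambda>i. X i w) (K i)) = Y i w" for i w
  by (cases i) (simp_all add: F_def K_def Y_def)
 ultimately have ind: "indep_vars (\<lambda>_. borel) Y UNIV" by simp
 have law: "distr M borel (Y (Suc l)) = distr M borel (\<lambda>w. f (X 1 w, X 2 w))" for l
 proof -
  have d: "distr M borel (\<lambda>w. f (X (2 * l + 1) w, X (2 * l + 2) w)) = distr (uniform_measure lborel {0..1} \<Otimes>\<^sub>M \<rho>) borel f" for l
  proof -
   have "distr (distr M (borel \<Otimes>\<^sub>M borel) (\<lambda>w. (X (2 * l + 1) w, X (2 * l + 2) w))) borel f = distr M borel (f \<circ> (\<lambda>w. (X (2 * l + 1) w, X (2 * l + 2) w)))"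
    by (rule distr_distr) measurable
   then show ?thesis by (simp only: pair_law comp_def)
  qed
  show ?thesis using d[of l] d[of 0] by (simp add: Y_def numeral_2_eq_2)
 qed
 show ?thesis
  by unfold_locales (use ind law count in \<open>auto simp: Y_def\<close>)
qed

lemma cell_sum_measurable[measurable]:
 assumes [measurable]: "f \<in> borel_measurable (borel \<Otimes>\<^sub>M borel)"
 shows "cell_sum f \<in> borel_measurable M"
proof -
 have "(\<lambda>w. \<Sum>l<n. f (X (2 * l + 1) w, X (2 * l + 2) w)) \<in> borel_measurable M" for n
  by measurable
 then show ?thesis
  unfolding cell_sum_def[abs_def] by (rule measurable_compose_countable) measurable
qed

lemma char_cell_sum:
 assumes f[measurable]: "f \<in> borel_measurable (borel \<Otimes>\<^sub>M borel)"
 shows "expectation (\<lambda>w. iexp (cell_sum f w)) = exp (of_real rate * expectation (\<lambda>w. iexp (f (X 1 w, X 2 w)) - 1))"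
proof -
 interpret P: compound_poisson M "\<lambda>i w. case i of 0 => X 0 w | Suc l => f (X (2 * l + 1) w, X (2 * l + 2) w)" rate "distr M borel (\<lambda>w. f (X 1 w, X 2 w))"
  by (rule compound_poisson_cell[OF f])
 have "integrable M (\<lambda>w. iexp (f (X 1 w, X 2 w)))" by (rule integrable_const_bound[of _ 1]) auto
 then show ?thesis
  using P.char_jump_sum by (simp add: P.jump_sum_def cell_sum_def[abs_def] integral_distr prob_space)
qed

lemma moments_cell_sum:
 assumes f[measurable]: "f \<in> borel_measurable (borel \<Otimes>\<^sub>M borel)" and b: "\<And>z. \<bar>f z\<bar> <= b"
 defines "m \<equiv> expectation (\<lambda>w. f (X 1 w, X 2 w))"
 shows "integrable M (cell_sum f)" "expectation (cell_sum f) = rate * m"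
  and "integrable M (\<lambda>w. (cell_sum f w - rate * m)\<^sup>2)"
  and "expectation (\<lambda>w. (cell_sum f w - rate * m)\<^sup>2) = rate * expectation (\<lambda>w. (f (X 1 w, X 2 w))\<^sup>2)"
proof -
 interpret P: compound_poisson M "\<lambda>i w. case i of 0 => X 0 w | Suc l => f (X (2 * l + 1) w, X (2 * l + 2) w)" rate "distr M borel (\<lambda>w. f (X 1 w, X 2 w))"
  by (rule compound_poisson_cell[OF f])
 have eq: "P.jump_sum = cell_sum f" by (simp add: P.jump_sum_def[abs_def] cell_sum_def[abs_def])
 have m: "(\<integral>x. x \<partial>distr M borel (\<lambda>w. f (X 1 w, X 2 w))) = m" by (simp add: m_def integral_distr)
 have s: "(\<integral>x. x\<^sup>2 \<partial>distr M borel (\<lambda>w. f (X 1 w, X 2 w))) = expectation (\<lambda>w. (f (X 1 w, X 2 w))\<^sup>2)" by (simp add: integral_distr)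
 have b': "\<bar>case Suc l of 0 => X 0 w | Suc l => f (X (2 * l + 1) w, X (2 * l + 2) w)\<bar> <= b" for l w using b by simp
 note mm = P.moments_jump_sum[of b, OF b', unfolded eq m s]
 show "integrable M (cell_sum f)" "expectation (cell_sum f) = rate * m"
  "integrable M (\<lambda>w. (cell_sum f w - rate * m)\<^sup>2)"
  "expectation (\<lambda>w. (cell_sum f w - rate * m)\<^sup>2) = rate * expectation (\<lambda>w. (f (X 1 w, X 2 w))\<^sup>2)"
  by (fact mm)+
qed

definition window :: "real => real => real => real" where
 "window s t u = (if 0 < u \<and> u <= 1 \<and> s < k + u \<and> k + u <= t then 1 else 0)"

lemma window_measurable[measurable]: "window s t \<in> borel_measurable borel"
 unfolding window_def[abs_def] by measurable

lemma expectation_window: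
 assumes "s <= t"
 shows "expectation (\<lambda>w. window s t (X 1 w)) = clamp01 (t - k) - clamp01 (s - k)"
proof -
 let ?A = "{max 0 (s - k)<..min 1 (t - k)}"
 have law1: "distr M borel (X 1) = uniform_measure lborel {0..1}" using time_law[of 0] by simp
 have "expectation (\<lambda>w. window s t (X 1 w)) = (\<integral>u. window s t u \<partial>uniform_measure lborel {0..1})"
  unfolding law1[symmetric] by (simp add: integral_distr)
 also have "... = (\<integral>u. indicator {0..1} u * window s t u \<partial>lborel)"
 proof -
  have "uniform_measure lborel {0..1::real} = density lborel (\<lambda>u. ennreal (indicator {0..1} u))"
   by (simp add: uniform_measure_def divide_ennreal_def ennreal_indicator)
  then show ?thesis by (simp add: integral_density)
 qed
 also have "... = (\<integral>u. indicator ?A u \<partial>lborel)"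
  by (intro Bochner_Integration.integral_cong) (auto simp: window_def indicator_def)
 also have "... = measure lborel ?A" by simp
 also have "... = clamp01 (t - k) - clamp01 (s - k)"
 proof (cases "max 0 (s - k) <= min 1 (t - k)")
  case True
  then show ?thesis using assms by (auto simp: clamp01_def min_def max_def split: if_splits)
 next
  case False
  then have "?A = {}" by auto
  then show ?thesis using False assms by (auto simp: clamp01_def min_def max_def split: if_splits)
 qed
 finally show ?thesis .
qed

text \<open>The sum of the jumps up to time \<open>t\<close>. The condition \<open>0 < u \<and> u \<le> 1\<close>, almost surely satisfied, makes
  the path start at \<open>0\<close> and stop at time \<open>k + 1\<close> surely.\<close>

definition path :: "'a => real => real" where
 "path w t = cell_sum (\<lambda>(u, y). h y * (if 0 < u \<and> u <= 1 \<and> k + u <= t then 1 else 0)) w"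

lemma path_measurable[measurable]: "(\<lambda>w. path w t) \<in> borel_measurable M"
 unfolding path_def by measurable

lemma path_diff:
 assumes "s <= t" shows "path w t - path w s = cell_sum (\<lambda>(u, y). h y * window s t u) w"
 unfolding path_def cell_sum_def sum_subtractf[symmetric]
 using assms by (intro sum.cong) (auto simp: window_def)

lemma path_before: "t <= k ==> path w t = 0"
 unfolding path_def cell_sum_def by (intro sum.neutral) auto

lemma cadlag_path: "cadlag_on S (path w)"
 unfolding cadlag_on_def
proof (intro ballI conjI)
 fix t assume "t \<in> S"
 let ?g = "\<lambda>l t. h (X (2 * l + 2) w) * (if 0 < X (2 * l + 1) w \<and> X (2 * l + 1) w <= 1 \<and> k + X (2 * l + 1) w <= t then 1 else 0)"
 have p: "path w = (\<lambda>t. \<Sum>l<nat \<lfloor>X 0 w\<rfloor>. ?g l t)" by (auto simp: path_def cell_sum_def)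
 have R: "((?g l) \<longlongrightarrow> ?g l t) (at t within S \<inter> {t<..})" for l
 proof (rule tendsto_within_subset[of _ _ _ "{t<..}"])
  let ?c = "k + X (2 * l + 1) w"
  have "\<forall>\<^sub>F s in at_right t. ?g l s = ?g l t"
  proof (cases "?c <= t")
   case True
   then show ?thesis by (auto simp: eventually_at_filter)
  next
   case False
   then have "t < ?c" by simp
   then show ?thesis by (rule eventually_mono[OF eventually_at_right_real]) auto
  qed
  then show "((?g l) \<longlongrightarrow> ?g l t) (at t within {t<..})" by (rule tendsto_eventually)
 qed auto
 show "(path w \<longlongrightarrow> path w t) (at t within S \<inter> {t<..})"
  unfolding p by (rule tendsto_sum) (rule R)
 have L: "\<exists>v. ((?g l) \<longlongrightarrow> v) (at t within S \<inter> {..<t})" for l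
 proof -
  let ?c = "k + X (2 * l + 1) w"
  have "\<exists>v. \<forall>\<^sub>F s in at_left t. ?g l s = v"
  proof (cases "?c < t")
   case True
   then have "\<forall>\<^sub>F s in at_left t. ?g l s = ?g l t"
    by (rule eventually_mono[OF eventually_at_left_real]) auto
   then show ?thesis ..
  next
   case False
   then have "\<forall>\<^sub>F s in at_left t. ?g l s = 0" by (auto simp: eventually_at_filter)
   then show ?thesis ..
  qed
  then obtain v where "\<forall>\<^sub>F s in at_left t. ?g l s = v" ..
  then have "((?g l) \<longlongrightarrow> v) (at_left t)" by (rule tendsto_eventually)
  from tendsto_within_subset[OF this, of "S \<inter> {..<t}"] show ?thesis by blast
 qed
 then have "\<forall>l. \<exists>v. ((?g l) \<longlongrightarrow> v) (at t within S \<inter> {..<t})" by blast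
 from choice[OF this] obtain v where "\<And>l. ((?g l) \<longlongrightarrow> v l) (at t within S \<inter> {..<t})" by blast
 then have "(path w \<longlongrightarrow> (\<Sum>l<nat \<lfloor>X 0 w\<rfloor>. v l)) (at t within S \<inter> {..<t})"
  unfolding p by (intro tendsto_sum)
 then show "\<exists>l. (path w \<longlongrightarrow> l) (at t within S \<inter> {..<t})" ..
qed

text \<open>For a given time at most one window contributes, so the exponential of the sum splits into a sum
  over the windows.\<close>

lemma joint_char_path:
 assumes t: "\<And>l. l < r ==> t l <= t (Suc l)"
 shows "expectation (\<lambda>w. iexp (\<Sum>l<r. \<theta> l * (path w (t (Suc l)) - path w (t l)))) =
  exp (of_real rate * (\<Sum>l<r. of_real (clamp01 (t (Suc l) - k) - clamp01 (t l - k)) * (expectation (\<lambda>w. iexp (\<theta> l * h (X 2 w)) - 1))))"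
proof -
 define f where "f = (\<lambda>(u, y). h y * (\<Sum>l<r. \<theta> l * window (t l) (t (Suc l)) u))"
 have fm[measurable]: "f \<in> borel_measurable (borel \<Otimes>\<^sub>M borel)" unfolding f_def by measurable
 have "(\<Sum>l<r. \<theta> l * (path w (t (Suc l)) - path w (t l))) = cell_sum f w" for w
 proof -
  have "(\<Sum>l<r. \<theta> l * (path w (t (Suc l)) - path w (t l))) = (\<Sum>l<r. \<theta> l * cell_sum (\<lambda>(u, y). h y * window (t l) (t (Suc l)) u) w)"
   using t by (intro sum.cong) (simp_all add: path_diff)
  also have "... = cell_sum f w"
   unfolding cell_sum_def f_def sum_distrib_left
   by (subst sum.swap) (simp add: sum_distrib_left mult_ac)
  finally show ?thesis .
 qed
 then have "expectation (\<lambda>w. iexp (\<Sum>l<r. \<theta> l * (path w (t (Suc l)) - path w (t l)))) =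
   exp (of_real rate * expectation (\<lambda>w. iexp (f (X 1 w, X 2 w)) - 1))"
  by (simp only: char_cell_sum[OF fm])
 also have "expectation (\<lambda>w. iexp (f (X 1 w, X 2 w)) - 1) =
   expectation (\<lambda>w. \<Sum>l<r. of_real (window (t l) (t (Suc l)) (X 1 w)) * (iexp (\<theta> l * h (X 2 w)) - 1))"
 proof (rule Bochner_Integration.integral_cong[OF refl])
  fix w
  let ?u = "X 1 w"
  let ?w = "\<lambda>l. window (t l) (t (Suc l)) ?u"
  have mono: "l < l' ==> l' <= r ==> t (Suc l) <= t l'" for l l'
  proof (induction l')
   case (Suc l')
   then show ?case using t[of l'] by (cases "l = l'") (auto intro: order_trans)
  qed simp
  show "iexp (f (?u, X 2 w)) - 1 = (\<Sum>l<r. of_real (?w l) * (iexp (\<theta> l * h (X 2 w)) - 1))"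
  proof (cases "\<exists>l<r. ?w l \<noteq> 0")
   case False
   then have z: "?w l = 0" if "l < r" for l using that by auto
   have "f (?u, X 2 w) = 0" unfolding f_def using z by simp
   moreover have "(\<Sum>l<r. of_real (?w l) * (iexp (\<theta> l * h (X 2 w)) - 1)) = 0" using z by simp
   ultimately show ?thesis by simp
  next
   case True
   then obtain l where l: "l < r" "?w l \<noteq> 0" by blast
   have one: "?w l = 1" using l by (auto simp: window_def split: if_splits)
   have other: "?w l' = 0" if "l' < r" "l' \<noteq> l" for l'
   proof (cases "l' < l")
    case True
    then show ?thesis using mono[of l' l] l by (auto simp: window_def split: if_splits)
   next
    case False
    then show ?thesis using mono[of l l'] l that by (auto simp: window_def split: if_splits)
   qed
   have "(\<Sum>l'<r. \<theta> l' * ?w l') = (\<Sum>l'\<in>{l}. \<theta> l' * ?w l')"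
    using l other by (intro sum.mono_neutral_right) auto
   then have f: "f (?u, X 2 w) = \<theta> l * h (X 2 w)" unfolding f_def by (simp add: one[simplified])
   have "(\<Sum>l'<r. of_real (?w l') * (iexp (\<theta> l' * h (X 2 w)) - 1)) = (\<Sum>l'\<in>{l}. of_real (?w l') * (iexp (\<theta> l' * h (X 2 w)) - 1))"
    using l other by (intro sum.mono_neutral_right) auto
   then show ?thesis by (simp add: f[simplified] one[simplified])
  qed
 qed
 also have "... = (\<Sum>l<r. of_real (clamp01 (t (Suc l) - k) - clamp01 (t l - k)) * expectation (\<lambda>w. iexp (\<theta> l * h (X 2 w)) - 1))"
 proof -
  have i1: "integrable M (\<lambda>w. complex_of_real (window s t (X 1 w)))" for s t
   by (rule integrable_const_bound[of _ 1]) (auto simp: window_def)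
  have i2: "integrable M (\<lambda>w. iexp (\<theta> * h (X 2 w)) - 1)" for \<theta>
   by (intro Bochner_Integration.integrable_diff integrable_const_bound[of "\<lambda>w. iexp (\<theta> * h (X 2 w))" 1]) auto
  have ip: "integrable M (\<lambda>w. complex_of_real (window s t (X 1 w)) * (iexp (\<theta> * h (X 2 w)) - 1))"
   and ep: "expectation (\<lambda>w. complex_of_real (window s t (X 1 w)) * (iexp (\<theta> * h (X 2 w)) - 1)) =
    expectation (\<lambda>w. complex_of_real (window s t (X 1 w))) * expectation (\<lambda>w. iexp (\<theta> * h (X 2 w)) - 1)" for s t \<theta>
   by (rule indep_first_pair(1)[of "\<lambda>u. complex_of_real (window s t u)" "\<lambda>y. iexp (\<theta> * h y) - 1", OF _ _ i1 i2]; measurable)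
     (rule indep_first_pair(2)[of "\<lambda>u. complex_of_real (window s t u)" "\<lambda>y. iexp (\<theta> * h y) - 1", OF _ _ i1 i2]; measurable)
  show ?thesis
   unfolding Bochner_Integration.integral_sum[OF ip] ep
   by (intro sum.cong refl) (simp only: integral_complex_of_real expectation_window t lessThan_iff)
 qed
 finally show ?thesis .
qed

end

lemma clamp01_grid: "clamp01 (real j / 2 ^ g) = real j / 2 ^ g" if "j <= 2 ^ g"
 using that by (auto simp: clamp01_def field_simps min_def max_def)

context poisson_cell
begin

lemma path_after: "k + 1 <= t ==> path w t = path w (k + 1)"
 unfolding path_def cell_sum_def by (intro sum.cong) auto

lemma char_increment:
 assumes "s <= t"
 shows "expectation (\<lambda>w. iexp (\<theta> * (path w t - path w s))) =
  exp (of_real rate * (of_real (clamp01 (t - k) - clamp01 (s - k)) * expectation (\<lambda>w. iexp (\<theta> * h (X 2 w)) - 1)))"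
 using joint_char_path[of 1 "\<lambda>l. if l = 0 then s else t" "\<lambda>_. \<theta>"] assms by simp

lemma indep_increments:
 assumes t: "\<And>l. l < r ==> t l <= t (Suc l)"
 shows "indep_vars (\<lambda>_. borel) (\<lambda>l w. path w (t (Suc l)) - path w (t l)) {..<r}"
proof (rule indep_vars_of_joint_char)
 fix \<theta> :: "nat => real"
 have "(\<Prod>l<r. iexp (\<theta> l * (path w (t (Suc l)) - path w (t l)))) = iexp (\<Sum>l<r. \<theta> l * (path w (t (Suc l)) - path w (t l)))" for w
  by (simp only: exp_sum[symmetric, OF finite_lessThan] of_real_sum sum_distrib_left)
 then have "expectation (\<lambda>w. \<Prod>l<r. iexp (\<theta> l * (path w (t (Suc l)) - path w (t l)))) =
   (\<Prod>l<r. exp (of_real rate * (of_real (clamp01 (t (Suc l) - k) - clamp01 (t l - k)) * expectation (\<lambda>w. iexp (\<theta> l * h (X 2 w)) - 1))))"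
  by (simp only: joint_char_path[where t = t and r = r, OF t] sum_distrib_left exp_sum[OF finite_lessThan])
 also have "... = (\<Prod>l<r. expectation (\<lambda>w. iexp (\<theta> l * (path w (t (Suc l)) - path w (t l)))))"
  by (intro prod.cong refl char_increment[symmetric] t) simp
 finally show "expectation (\<lambda>w. \<Prod>l<r. iexp (\<theta> l * (path w (t (Suc l)) - path w (t l)))) =
   (\<Prod>l<r. expectation (\<lambda>w. iexp (\<theta> l * (path w (t (Suc l)) - path w (t l)))))" .
qed measurable

text \<open>The mean of the total jump in the cell.\<close>

definition drift :: real where "drift = rate * expectation (\<lambda>w. h (X 2 w))"

lemma increment_moments:
 assumes "s <= t" and b: "\<And>y. \<bar>h y\<bar> <= b"
 defines "d \<equiv> clamp01 (t - k) - clamp01 (s - k)"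
 shows "integrable M (\<lambda>w. (path w t - path w s - d * drift)\<^sup>2)"
  and "expectation (\<lambda>w. path w t - path w s - d * drift) = 0"
  and "expectation (\<lambda>w. (path w t - path w s - d * drift)\<^sup>2) = d * (rate * expectation (\<lambda>w. (h (X 2 w))\<^sup>2))"
proof -
 let ?f = "\<lambda>(u, y). h y * window s t u"
 have fb: "\<bar>?f z\<bar> <= b" for z using b[of "snd z"] by (auto simp: window_def split: prod.splits)
 have fm: "?f \<in> borel_measurable (borel \<Otimes>\<^sub>M borel)" by measurable
 have b2: "(h y)\<^sup>2 <= b\<^sup>2" for y using power_mono[OF b[of y] abs_ge_zero, of 2] by simp
 have i1: "integrable M (\<lambda>w. window s t (X 1 w))"
  by (rule integrable_const_bound[of _ 1]) (auto simp: window_def)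
 have i2: "integrable M (\<lambda>w. h (X 2 w))" by (rule integrable_const_bound[of _ b]) (use b in auto)
 have i3: "integrable M (\<lambda>w. (h (X 2 w))\<^sup>2)" by (rule integrable_const_bound[of _ "b\<^sup>2"]) (use b2 in simp_all)
 have e: "expectation (\<lambda>w. ?f (X 1 w, X 2 w)) = d * expectation (\<lambda>w. h (X 2 w))"
  using indep_first_pair(2)[OF window_measurable h i1 i2]
  by (simp only: split mult.commute[of "h _"] expectation_window[OF assms(1)] d_def)
 have e2: "expectation (\<lambda>w. (?f (X 1 w, X 2 w))\<^sup>2) = d * expectation (\<lambda>w. (h (X 2 w))\<^sup>2)"
 proof -
  have "(?f (X 1 w, X 2 w))\<^sup>2 = window s t (X 1 w) * (h (X 2 w))\<^sup>2" for w
   by (simp add: window_def)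
  then show ?thesis
   using indep_first_pair(2)[OF window_measurable _ i1 i3]
   by (simp only: expectation_window[OF assms(1)] d_def borel_measurable_power h)
 qed
 have D: "rate * expectation (\<lambda>w. ?f (X 1 w, X 2 w)) = d * drift" unfolding e drift_def by simp
 note m = moments_cell_sum[of ?f b, OF fm fb, unfolded D e2, folded path_diff[OF assms(1)]]
 show "integrable M (\<lambda>w. (path w t - path w s - d * drift)\<^sup>2)"
  using m(3) by (simp only: path_diff[OF assms(1)])
 show "expectation (\<lambda>w. path w t - path w s - d * drift) = 0"
  using m(1,2) by (simp add: path_diff[OF assms(1)] prob_space)
 show "expectation (\<lambda>w. (path w t - path w s - d * drift)\<^sup>2) = d * (rate * expectation (\<lambda>w. (h (X 2 w))\<^sup>2))"
  using m(4) by (simp only: path_diff[OF assms(1)] mult_ac)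
qed

text \<open>Kolmogorov's inequality on the dyadic grids of \<open>[k, k+1]\<close>, whose constant does not depend
  on the mesh, extends to all times by right-continuity.\<close>

lemma fluctuation_bound:
 assumes b: "\<And>y. \<bar>h y\<bar> <= b" and x: "x > 0"
 shows "\<exists>E\<in>events. prob E <= rate * expectation (\<lambda>w. (h (X 2 w))\<^sup>2) / x\<^sup>2 \<and>
  (\<forall>w\<in>space M - E. \<forall>t. \<bar>path w t - clamp01 (t - k) * drift\<bar> <= x)"
proof -
 define W where "W w t = path w t - clamp01 (t - k) * drift" for w t
 define t where "t g j = k + real j / 2 ^ g" for g j :: nat
 define A where "A g = {w\<in>space M. \<exists>j\<le>2 ^ g. x < \<bar>W w (t g j)\<bar>}" for g
 let ?B = "rate * expectation (\<lambda>w. (h (X 2 w))\<^sup>2)"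
 have Wm[measurable]: "(\<lambda>w. W w s) \<in> borel_measurable M" for s unfolding W_def by measurable
 have [measurable]: "A g \<in> events" for g unfolding A_def by measurable
 have tm: "t g j <= t g (Suc j)" for g j by (simp add: t_def divide_right_mono)
 have PA: "prob (A g) <= ?B / x\<^sup>2" for g
 proof -
  define \<xi> where "\<xi> j w = path w (t g (Suc j)) - path w (t g j) - (clamp01 (t g (Suc j) - k) - clamp01 (t g j - k)) * drift" for j w
  have "indep_vars (\<lambda>_. borel) \<xi> {..<2 ^ g}"
   unfolding \<xi>_def[abs_def]
   by (rule indep_vars_compose2[OF indep_increments[of "2 ^ g" "t g"]]) (use tm in auto)
  moreover have "(\<Sum>i<j. \<xi> i w) = W w (t g j)" for j w
  proof -
   have "(\<Sum>i<j. \<xi> i w) = (\<Sum>i<j. W w (t g (Suc i)) - W w (t g i))"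
    by (intro sum.cong) (simp_all add: \<xi>_def W_def algebra_simps)
   also have "... = W w (t g j) - W w (t g 0)" by (rule sum_lessThan_telescope)
   also have "W w (t g 0) = 0" by (simp add: W_def t_def path_before clamp01_def)
   finally show ?thesis by simp
  qed
  moreover have "integrable M (\<lambda>w. (\<xi> j w)\<^sup>2)" "expectation (\<xi> j) = 0" for j
   unfolding \<xi>_def[abs_def] using increment_moments(1,2)[OF tm b] by blast+
  ultimately have "prob (A g) <= (\<Sum>j<2 ^ g. expectation (\<lambda>w. (\<xi> j w)\<^sup>2)) / x\<^sup>2"
   using kolmogorov_maximal_inequality[of \<xi> "2 ^ g" x] x unfolding A_def by simp
  also have "(\<Sum>j<2 ^ g. expectation (\<lambda>w. (\<xi> j w)\<^sup>2)) = (\<Sum>j<(2::nat) ^ g. 1 / 2 ^ g * ?B)"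
  proof (intro sum.cong refl)
   fix j :: nat assume "j \<in> {..<2 ^ g}"
   then have "clamp01 (t g (Suc j) - k) - clamp01 (t g j - k) = 1 / 2 ^ g"
    using clamp01_grid[of "Suc j" g] clamp01_grid[of j g] by (simp add: t_def diff_divide_distrib[symmetric])
   then show "expectation (\<lambda>w. (\<xi> j w)\<^sup>2) = 1 / 2 ^ g * ?B"
    unfolding \<xi>_def[abs_def] by (subst increment_moments(3)[OF tm b]) simp
  qed
  also have "... = ?B" by simp
  finally show ?thesis .
 qed
 have inc: "incseq A"
 proof (rule incseq_SucI, rule subsetI)
  fix g w assume "w \<in> A g"
  then obtain j where j: "j <= 2 ^ g" "x < \<bar>W w (t g j)\<bar>" and w: "w \<in> space M" by (auto simp: A_def)
  have "t (Suc g) (2 * j) = t g j" by (simp add: t_def)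
  then show "w \<in> A (Suc g)" using j w unfolding A_def by (auto intro!: exI[of _ "2 * j"])
 qed
 have "(\<lambda>g. prob (A g)) \<longlonglongrightarrow> prob (\<Union>g. A g)"
  by (rule finite_Lim_measure_incseq) (auto intro: inc)
 then have P: "prob (\<Union>g. A g) <= ?B / x\<^sup>2"
  by (rule LIMSEQ_le_const2) (use PA in blast)
 have "\<bar>W w s\<bar> <= x" if w: "w \<in> space M - (\<Union>g. A g)" for w s
 proof -
  have grid: "\<bar>W w (t g j)\<bar> <= x" if "j <= 2 ^ g" for g j
   using w that unfolding A_def by fastforce
  consider "s <= k" | "k + 1 <= s" | "k < s" "s < k + 1" by linarith
  then show ?thesis
  proof cases
   case 1
   then show ?thesis using x by (simp add: W_def path_before clamp01_def)
  next
   case 2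
   then have "W w s = W w (t 0 1)" by (simp add: W_def t_def path_after[of s] clamp01_def)
   then show ?thesis using grid[of 1 0] by simp
  next
   case 3
   define j where "j g = nat (\<lfloor>(s - k) * 2 ^ g\<rfloor> + 1)" for g :: nat
   have j: "real (j g) = of_int \<lfloor>(s - k) * 2 ^ g\<rfloor> + 1" for g
    unfolding j_def using 3 by (subst of_nat_nat) (auto simp: add_nonneg_nonneg)
   have j_le: "j g <= 2 ^ g" for g
   proof -
    have "(s - k) * 2 ^ g < 1 * 2 ^ g" using 3 by (intro mult_strict_right_mono) auto
    then have "\<lfloor>(s - k) * 2 ^ g\<rfloor> < 2 ^ g" by (simp add: floor_less_iff)
    then have "\<lfloor>(s - k) * 2 ^ g\<rfloor> + 1 <= 2 ^ g" by simp
    then show ?thesis unfolding j_def by (simp add: nat_le_iff)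
   qed
   have lo: "s < t g (j g)" and hi: "t g (j g) <= s + 1 / 2 ^ g" for g
   proof -
    have "(s - k) * 2 ^ g < real (j g)" "real (j g) <= (s - k) * 2 ^ g + 1" unfolding j by linarith+
    then have "s - k < real (j g) / 2 ^ g" "real (j g) / 2 ^ g <= (s - k) + 1 / 2 ^ g"
     by (simp_all add: field_simps)
    then show "s < t g (j g)" "t g (j g) <= s + 1 / 2 ^ g" by (simp_all add: t_def)
   qed
   have "(\<lambda>g. s + 1 / 2 ^ g) \<longlonglongrightarrow> s + 0"
    using LIMSEQ_realpow_zero[of "1 / 2"] by (intro tendsto_intros) (simp add: power_one_over)
   then have up: "(\<lambda>g. s + 1 / 2 ^ g) \<longlonglongrightarrow> s" by simp
   have "(\<lambda>g. t g (j g)) \<longlonglongrightarrow> s"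
   proof (rule tendsto_sandwich[OF _ _ tendsto_const up])
    show "\<forall>\<^sub>F g in sequentially. s <= t g (j g)" using lo by (simp add: less_imp_le)
    show "\<forall>\<^sub>F g in sequentially. t g (j g) <= s + 1 / 2 ^ g" using hi by simp
   qed
   then have "filterlim (\<lambda>g. t g (j g)) (at_right s) sequentially"
    using lo by (auto simp: filterlim_at intro!: always_eventually less_imp_neq[THEN not_sym])
   moreover have "(W w \<longlongrightarrow> W w s) (at_right s)"
   proof -
    have "(path w \<longlongrightarrow> path w s) (at_right s)"
     using cadlag_path[of UNIV w] by (simp add: cadlag_on_def)
    moreover have "((\<lambda>s. clamp01 (s - k)) \<longlongrightarrow> clamp01 (s - k)) (at_right s)"
     unfolding clamp01_def by (intro tendsto_intros)
    ultimately show ?thesis unfolding W_def by (intro tendsto_diff tendsto_mult tendsto_const)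
   qed
   ultimately have "(\<lambda>g. W w (t g (j g))) \<longlonglongrightarrow> W w s" by (rule filterlim_compose[rotated])
   then have "(\<lambda>g. \<bar>W w (t g (j g))\<bar>) \<longlonglongrightarrow> \<bar>W w s\<bar>" by (rule tendsto_rabs)
   then show ?thesis by (rule LIMSEQ_le_const2) (use grid j_le in blast)
  qed
 qed
 then show ?thesis using P unfolding W_def by (intro bexI[of _ "\<Union>g. A g"]) auto
qed

end

section \<open>Cadlag sums\<close>

lemma cadlag_on_sum:
 assumes "\<And>i. i \<in> I ==> cadlag_on S (f i)"
 shows "cadlag_on S (\<lambda>t. \<Sum>i\<in>I. f i t)"
 unfolding cadlag_on_def
proof (intro ballI conjI)
 fix t assume t: "t \<in> S"
 show "((\<lambda>t. \<Sum>i\<in>I. f i t) \<longlongrightarrow> (\<Sum>i\<in>I. f i t)) (at t within S \<inter> {t<..})"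
  by (intro tendsto_sum) (use assms t in \<open>auto simp: cadlag_on_def\<close>)
 have "\<forall>i. \<exists>l. i \<in> I --> (f i \<longlongrightarrow> l) (at t within S \<inter> {..<t})"
  using assms t unfolding cadlag_on_def by blast
 from choice[OF this] obtain l where "\<And>i. i \<in> I ==> (f i \<longlongrightarrow> l i) (at t within S \<inter> {..<t})" by blast
 then have "((\<lambda>t. \<Sum>i\<in>I. f i t) \<longlongrightarrow> (\<Sum>i\<in>I. l i)) (at t within S \<inter> {..<t})" by (intro tendsto_sum)
 then show "\<exists>l. ((\<lambda>t. \<Sum>i\<in>I. f i t) \<longlongrightarrow> l) (at t within S \<inter> {..<t})" ..
qed

lemma cadlag_on_diff_continuous:
 assumes "cadlag_on S f" "continuous_on UNIV g"
 shows "cadlag_on S (\<lambda>t. f t - g t)"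
 unfolding cadlag_on_def
proof (intro ballI)
 fix t assume t: "t \<in> S"
 have g: "(g \<longlongrightarrow> g t) (at t within A)" for A
  using assms(2) by (metis UNIV_I continuous_on_def subset_UNIV tendsto_within_subset)
 obtain l where "(f \<longlongrightarrow> f t) (at t within S \<inter> {t<..})" "(f \<longlongrightarrow> l) (at t within S \<inter> {..<t})"
  using assms(1) t unfolding cadlag_on_def by blast
 then show "((\<lambda>t. f t - g t) \<longlongrightarrow> f t - g t) (at t within S \<inter> {t<..}) \<and>
   (\<exists>l. ((\<lambda>t. f t - g t) \<longlongrightarrow> l) (at t within S \<inter> {..<t}))"
  using g by (blast intro: tendsto_diff)
qed

text \<open>Uniform convergence allows the exchange with the one-sided limits; the left limits of the
  approximations form a Cauchy sequence.\<close>

lemma uniform_limit_of_cadlag: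
 assumes f: "\<And>n. cadlag_on S (f n)" and u: "uniform_limit S f g sequentially"
 shows "cadlag_on S g"
 unfolding cadlag_on_def
proof (intro ballI conjI)
 fix t assume t: "t \<in> S"
 show "(g \<longlongrightarrow> g t) (at t within S \<inter> {t<..})"
 proof (rule swap_uniform_limit[where f = f and g = "\<lambda>n. f n t" and F = sequentially])
  show "\<forall>\<^sub>F n in sequentially. (f n \<longlongrightarrow> f n t) (at t within S \<inter> {t<..})"
   using f t by (auto simp: cadlag_on_def)
  show "(\<lambda>n. f n t) \<longlonglongrightarrow> g t" using tendsto_uniform_limitI[OF u t] .
  show "uniform_limit (S \<inter> {t<..}) f g sequentially" using u by (rule uniform_limit_on_subset) auto
 qed simp
 show "\<exists>l. (g \<longlongrightarrow> l) (at t within S \<inter> {..<t})"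
 proof (cases "at t within S \<inter> {..<t} = bot")
  case False
  have "\<forall>n. \<exists>l. (f n \<longlongrightarrow> l) (at t within S \<inter> {..<t})" using f t unfolding cadlag_on_def by blast
  from choice[OF this] obtain l where l: "\<And>n. (f n \<longlongrightarrow> l n) (at t within S \<inter> {..<t})" by blast
  have "Cauchy l"
  proof (rule metric_CauchyI)
   fix e :: real assume "e > 0"
   then have "\<forall>\<^sub>F n in sequentially. \<forall>x\<in>S. dist (f n x) (g x) < e / 4"
    using uniform_limitD[OF u, of "e / 4"] by simp
   then obtain N where N: "\<And>n x. n \<ge> N ==> x \<in> S ==> dist (f n x) (g x) < e / 4"
    unfolding eventually_sequentially by blast
   have "dist (l m) (l n) < e" if "m \<ge> N" "n \<ge> N" for m n
   proof -
    have "((\<lambda>x. dist (f m x) (f n x)) \<longlongrightarrow> dist (l m) (l n)) (at t within S \<inter> {..<t})"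
     by (intro tendsto_dist l)
    moreover have "\<forall>\<^sub>F x in at t within S \<inter> {..<t}. dist (f m x) (f n x) <= e / 2"
    proof -
     have "dist (f m x) (f n x) <= e / 2" if "x \<in> S" for x
      using N[OF \<open>m \<ge> N\<close> that] N[OF \<open>n \<ge> N\<close> that] dist_triangle2[of "f m x" "f n x" "g x"] by linarith
     then show ?thesis by (auto simp: eventually_at_filter)
    qed
    ultimately have "dist (l m) (l n) <= e / 2" using False by (intro tendsto_upperbound)
    then show ?thesis using \<open>e > 0\<close> by simp
   qed
   then show "\<exists>M. \<forall>m\<ge>M. \<forall>n\<ge>M. dist (l m) (l n) < e" by blast
  qed
  then obtain L where L: "l \<longlonglongrightarrow> L" by (auto simp: Cauchy_convergent_iff convergent_def)
  have "(g \<longlongrightarrow> L) (at t within S \<inter> {..<t})"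
  proof (rule swap_uniform_limit[where f = f and g = l and F = sequentially])
   show "\<forall>\<^sub>F n in sequentially. (f n \<longlongrightarrow> l n) (at t within S \<inter> {..<t})" using l by simp
   show "uniform_limit (S \<inter> {..<t}) f g sequentially" using u by (rule uniform_limit_on_subset) auto
  qed (use L in auto)
  then show ?thesis ..
 qed simp
qed

lemma cadlag_on_suminf:
 fixes f :: "nat => real => real"
 assumes f: "\<And>n. cadlag_on S (f n)" and b: "\<And>n t. n \<ge> N ==> t \<in> S ==> \<bar>f n t\<bar> <= B n" and B: "summable B"
 shows "cadlag_on S (\<lambda>t. \<Sum>n. f n t)"
proof (rule uniform_limit_of_cadlag)
 show "cadlag_on S (\<lambda>t. \<Sum>i<n. f i t)" for n using f by (rule cadlag_on_sum)
 show "uniform_limit S (\<lambda>n t. \<Sum>i<n. f i t) (\<lambda>t. \<Sum>n. f n t) sequentially"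
  by (rule Weierstrass_m_test_ev[OF _ B]) (use b in \<open>auto simp: eventually_sequentially\<close>)
qed

lemma cadlag_on_half_line:
 assumes "\<And>K::nat. cadlag_on {0..real K} f"
 shows "cadlag_on {0..} f"
 unfolding cadlag_on_def
proof (intro ballI)
 fix t :: real assume t: "t \<in> {0..}"
 define K where "K = nat \<lceil>t\<rceil> + 1"
 have K: "t < real K" unfolding K_def by linarith
 have R: "at t within {0..} \<inter> {t<..} = at t within {0..real K} \<inter> {t<..}"
  by (rule at_within_nhd[of _ "{..<real K}"]) (use K in auto)
 have L: "{0..} \<inter> {..<t} = {0..real K} \<inter> {..<t}" using K by auto
 show "(f \<longlongrightarrow> f t) (at t within {0..} \<inter> {t<..}) \<and> (\<exists>l. (f \<longlongrightarrow> l) (at t within {0..} \<inter> {..<t}))"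
  unfolding R L using assms[of K] t K unfolding cadlag_on_def by auto
qed

section \<open>Dyadic shells of the jump measure\<close>

text \<open>Dyadic shells of \<open>y\<close>-values, not of jump sizes: the image of \<open>shell i\<close> under the function \<open>jump\<close> consists of
  jumps of order \<open>2\<^sup>-\<^sup>i\<^sup>/\<^sup>\<alpha>\<close>, and \<open>shell 0\<close> carries the large jumps.\<close>

definition shell :: "nat => real set" where
 "shell i = (case i of 0 => {y. \<bar>y\<bar> <= 1} | Suc j => {y. 2 ^ j < \<bar>y\<bar> \<and> \<bar>y\<bar> <= 2 ^ Suc j})"

lemma shell_sets[measurable]: "shell i \<in> sets borel"
 unfolding shell_def by (cases i) simp_all

lemma shell_subset: "shell i \<subseteq> {- (2 ^ i)..2 ^ i}" "{2 ^ i / 2<..2 ^ i} \<subseteq> shell i"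
 by (cases i; auto simp: shell_def)+

lemma emeasure_shell: "emeasure lborel (shell i) < \<infinity>" "0 < emeasure lborel (shell i)"
proof -
 have "emeasure lborel (shell i) <= emeasure lborel {- (2 ^ i)..2 ^ i::real}"
  by (rule emeasure_mono[OF shell_subset(1)]) simp
 also have "... < \<infinity>" by (subst emeasure_lborel_Icc) (auto simp: order_trans[of _ 0])
 finally show "emeasure lborel (shell i) < \<infinity>" .
 have "0 < ennreal (2 ^ i - 2 ^ i / 2)" by simp
 also have "... = emeasure lborel {2 ^ i / 2<..2 ^ i::real}" by (subst emeasure_lborel_Ioc) auto
 also have "... <= emeasure lborel (shell i)" by (rule emeasure_mono[OF shell_subset(2)]) simp
 finally show "0 < emeasure lborel (shell i)" .
qed

lemma measure_shell: "0 < measure lborel (shell i)" "measure lborel (shell i) <= 2 * 2 ^ i"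
proof -
 show "0 < measure lborel (shell i)"
  using emeasure_shell[of i] by (simp add: measure_def enn2real_positive_iff)
 have "measure lborel (shell i) <= measure lborel {- (2 ^ i)..2 ^ i::real}"
  by (rule measure_mono_fmeasurable[OF shell_subset(1)]) (auto simp: fmeasurable_def emeasure_lborel_Icc_eq)
 also have "... = 2 * 2 ^ i" by (subst measure_lborel_Icc) (auto simp: order_trans[of _ 0])
 finally show "measure lborel (shell i) <= 2 * 2 ^ i" .
qed

lemma integrable_shell: "integrable lborel (indicator (shell i) :: real => real)"
 using emeasure_shell(1)[of i] by (intro integrable_real_indicator) auto

lemma sum_indicator_shell: "(\<Sum>i<Suc n. indicator (shell i) y) = (indicator {y. \<bar>y\<bar> <= 2 ^ n} y :: real)"
proof (induction n)
 case (Suc n)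
 have m: "(2::real) ^ n <= 2 ^ Suc n" by (rule power_increasing) auto
 have "(\<Sum>i<Suc (Suc n). indicator (shell i) y) = indicator {y. \<bar>y\<bar> <= 2 ^ n} y + (indicator (shell (Suc n)) y :: real)"
  using Suc.IH by simp
 also have "... = indicator {y. \<bar>y\<bar> <= 2 ^ Suc n} y"
  using m by (auto simp: shell_def indicator_def)
 finally show ?case .
qed (simp add: shell_def)

lemma integral_uniform_measure_scaleR:
 fixes g :: "'a => 'b::{banach, second_countable_topology}"
 assumes [measurable]: "A \<in> sets M" "g \<in> borel_measurable M" and A: "0 < measure M A" "emeasure M A < \<infinity>"
 shows "measure M A *\<^sub>R (\<integral>x. g x \<partial>uniform_measure M A) = (\<integral>x. indicator A x *\<^sub>R g x \<partial>M)"
proof -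
 have "uniform_measure M A = density M (\<lambda>x. ennreal (indicator A x / measure M A))"
 proof -
  have "indicator A x / emeasure M A = ennreal (indicator A x / measure M A)" for x
   using A by (subst emeasure_eq_ennreal_measure) (auto simp: divide_ennreal[of 1, symmetric] indicator_def)
  then show ?thesis by (simp add: uniform_measure_def)
 qed
 then have "(\<integral>x. g x \<partial>uniform_measure M A) = (\<integral>x. (indicator A x / measure M A) *\<^sub>R g x \<partial>M)"
  by (simp add: integral_density)
 also have "... = (\<integral>x. (1 / measure M A) *\<^sub>R (indicator A x *\<^sub>R g x) \<partial>M)" by simp
 also have "... = (1 / measure M A) *\<^sub>R (\<integral>x. indicator A x *\<^sub>R g x \<partial>M)" by (rule integral_scaleR_right)
 finally show ?thesis using A by simp
qed

context stable_domain
begin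

lemma jump_bound: "\<bar>J y\<bar> <= \<bar>y\<bar> powr (- 1 / \<alpha>)"
proof -
 have "p <= 1" "r <= 1" using p_plus_r p_nonneg r_nonneg by linarith+
 have *: "(q / z) powr (1 / \<alpha>) <= z powr (- 1 / \<alpha>)" if "0 <= q" "q <= 1" "0 <= z" for q z
 proof -
  have "(q / z) powr (1 / \<alpha>) <= (1 / z) powr (1 / \<alpha>)"
   using that alpha by (intro powr_mono2 divide_right_mono) auto
  also have "... = z powr (- 1 / \<alpha>)" using that by (simp add: powr_minus_divide powr_divide)
  finally show ?thesis .
 qed
 then show ?thesis
  using *[of p y] *[of r "- y"] \<open>p <= 1\<close> \<open>r <= 1\<close> p_nonneg r_nonneg by (auto simp: jump_def)
qed

lemma jump_odd: "\<alpha> = 1 ==> y \<noteq> 0 ==> J (- y) = - J y"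
 using p_eq_r by (auto simp: jump_def)

definition "shell_mean i = (\<integral>y. indicator (shell i) y * J y \<partial>lborel)"
definition "shell_drift i = (if 1 < \<alpha> then shell_mean i else 0)"
definition "shell_square i = (\<integral>y. indicator (shell i) y * (J y)\<^sup>2 \<partial>lborel)"
definition "shell_psi i \<theta> = (\<integral>y. indicator (shell i) y *\<^sub>R compensated_iexp \<alpha> \<theta> (J y) \<partial>lborel)"

lemma shell_odd:
 assumes "\<alpha> = 1" "\<And>x. f (- x) = - f (x::real)"
 shows "(\<integral>y. indicator (shell i) y * f (J y) \<partial>lborel) = (0::real)"
proof -
 have f0: "f 0 = 0" using assms(2)[of 0] by simp
 have J0: "J 0 = 0" by (simp add: jump_def)
 have s: "indicator (shell i) (- y) = (indicator (shell i) y :: real)" for y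
  by (auto simp: shell_def indicator_def split: nat.splits)
 have "(\<integral>y. indicator (shell i) y * f (J y) \<partial>lborel) = (\<integral>y. indicator (shell i) (- y) * f (J (- y)) \<partial>lborel)"
  using lborel_integral_real_affine[of "-1" "\<lambda>y. indicator (shell i) y * f (J y)" 0] by simp
 also have "... = (\<integral>y. - (indicator (shell i) y * f (J y)) \<partial>lborel)"
 proof (rule Bochner_Integration.integral_cong[OF refl])
  fix y
  show "indicator (shell i) (- y) * f (J (- y)) = - (indicator (shell i) y * f (J y))"
   by (cases "y = 0") (simp_all add: f0 J0 s jump_odd[OF assms(1)] assms(2))
 qed
 finally show ?thesis by simp
qed

text \<open>Only \<open>shell 0\<close> is at stake, where the jumps are unbounded; \<open>\<alpha> > 1\<close> makes the first moment of the large
  jumps finite.\<close>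

lemma integrable_shell_jump:
 assumes "1 < \<alpha>" shows "integrable lborel (\<lambda>y. indicator (shell i) y * J y)"
proof -
 define b where "b = (1 + \<alpha>) / 2"
 have b: "1 < b" "b < \<alpha>" "0 < b" using assms by (auto simp: b_def)
 let ?g = "\<lambda>x::real. max (\<bar>x\<bar> - 1) 0"
 have "norm (?g x) <= 1 * power_min (\<alpha> + 1) b x" for x
 proof (cases "\<bar>x\<bar> <= 1")
  case False
  then have "\<bar>x\<bar> powr 1 <= \<bar>x\<bar> powr b" "\<bar>x\<bar> powr b <= \<bar>x\<bar> powr (\<alpha> + 1)" using b by (intro powr_mono; simp)+
  then show ?thesis using False by simp
 qed simp
 then have i: "integrable lborel (\<lambda>y. ?g (J y))"
  by (rule vague_convergence(2)[rotated]) (use b in \<open>auto intro!: continuous_intros\<close>)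
 show ?thesis
 proof (rule Bochner_Integration.integrable_bound[OF Bochner_Integration.integrable_add[OF integrable_shell[of i] i]])
  show "AE y in lborel. norm (indicator (shell i) y * J y) <= norm (indicator (shell i) y + ?g (J y))"
   by (auto simp: indicator_def abs_mult)
 qed measurable
qed

lemma compensator_shell:
 shows "integrable lborel (\<lambda>y. indicator (shell i) y * compensator \<alpha> \<theta> (J y))"
  and "(\<integral>y. indicator (shell i) y * compensator \<alpha> \<theta> (J y) \<partial>lborel) = \<theta> * shell_drift i"
proof -
 consider "\<alpha> < 1" | "\<alpha> = 1" | "1 < \<alpha>" by linarith
 then have "integrable lborel (\<lambda>y. indicator (shell i) y * compensator \<alpha> \<theta> (J y)) \<and>
  (\<integral>y. indicator (shell i) y * compensator \<alpha> \<theta> (J y) \<partial>lborel) = \<theta> * shell_drift i"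
 proof cases
  case 1
  then show ?thesis by (simp add: compensator_def shell_drift_def)
 next
  case 2
  have "integrable lborel (\<lambda>y. indicator (shell i) y * sin (\<theta> * J y))"
   by (rule Bochner_Integration.integrable_bound[OF integrable_shell[of i]]) (auto simp: abs_mult indicator_def)
  moreover have "(\<integral>y. indicator (shell i) y * sin (\<theta> * J y) \<partial>lborel) = 0"
   by (rule shell_odd[OF 2]) simp
  moreover have "compensator \<alpha> \<theta> x = sin (\<theta> * x)" "shell_drift i = 0" for x
   unfolding compensator_def shell_drift_def using 2 by simp_all
  ultimately show ?thesis by simp
 next
  case 3
  have "(\<integral>y. indicator (shell i) y * (\<theta> * J y) \<partial>lborel) = (\<integral>y. \<theta> * (indicator (shell i) y * J y) \<partial>lborel)"
   by (simp add: mult_ac)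
  also have "... = \<theta> * shell_mean i" unfolding shell_mean_def by (rule integral_mult_right_zero)
  finally have "(\<integral>y. indicator (shell i) y * (\<theta> * J y) \<partial>lborel) = \<theta> * shell_mean i" .
  moreover have "integrable lborel (\<lambda>y. indicator (shell i) y * (\<theta> * J y))"
   using integrable_mult_right[of \<theta>, OF integrable_shell_jump[OF 3, of i]] by (simp add: mult_ac)
  ultimately show ?thesis using 3 by (simp add: compensator_def shell_drift_def)
 qed
 then show "integrable lborel (\<lambda>y. indicator (shell i) y * compensator \<alpha> \<theta> (J y))"
  "(\<integral>y. indicator (shell i) y * compensator \<alpha> \<theta> (J y) \<partial>lborel) = \<theta> * shell_drift i" by blast+
qed

text \<open>The part of the exponent due to one shell is that of a compound Poisson process with linear drift.\<close>

lemma shell_psi_eq: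
 "shell_psi i \<theta> = (\<integral>y. indicator (shell i) y *\<^sub>R (iexp (\<theta> * J y) - 1) \<partial>lborel) - \<i> * of_real (\<theta> * shell_drift i)"
proof -
 have i1: "integrable lborel (\<lambda>y. indicator (shell i) y *\<^sub>R (iexp (\<theta> * J y) - 1))"
 proof (rule Bochner_Integration.integrable_bound[OF integrable_mult_right[of 2, OF integrable_shell[of i]]])
  have "norm (iexp x - 1) <= 2" for x using norm_triangle_ineq4[of "iexp x" 1] by simp
  then show "AE y in lborel. norm (indicator (shell i) y *\<^sub>R (iexp (\<theta> * J y) - 1)) <= norm (2 * indicator (shell i) y :: real)"
   by (intro AE_I2) (simp add: indicator_def del: of_real_mult)
 qed measurable
 have i2: "integrable lborel (\<lambda>y. \<i> * of_real (indicator (shell i) y * compensator \<alpha> \<theta> (J y)))"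
  by (intro integrable_mult_right integrable_of_real compensator_shell)
 have "shell_psi i \<theta> = (\<integral>y. indicator (shell i) y *\<^sub>R (iexp (\<theta> * J y) - 1) - \<i> * of_real (indicator (shell i) y * compensator \<alpha> \<theta> (J y)) \<partial>lborel)"
  unfolding shell_psi_def
  by (intro Bochner_Integration.integral_cong) (simp_all add: compensated_iexp_def scaleR_conv_of_real algebra_simps)
 also have "... = (\<integral>y. indicator (shell i) y *\<^sub>R (iexp (\<theta> * J y) - 1) \<partial>lborel) -
   (\<integral>y. \<i> * of_real (indicator (shell i) y * compensator \<alpha> \<theta> (J y)) \<partial>lborel)"
  by (rule Bochner_Integration.integral_diff[OF i1 i2])
 also have "(\<integral>y. \<i> * of_real (indicator (shell i) y * compensator \<alpha> \<theta> (J y)) \<partial>lborel) = \<i> * of_real (\<theta> * shell_drift i)"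
  by (simp only: integral_mult_right_zero integral_complex_of_real compensator_shell(2))
 finally show ?thesis .
qed

lemma shell_psi_sums: "(\<lambda>i. shell_psi i \<theta>) sums psi \<theta>"
proof -
 let ?f = "\<lambda>y. compensated_iexp \<alpha> \<theta> (J y)"
 have int: "integrable lborel (\<lambda>y. indicator (shell i) y *\<^sub>R ?f y)" for i
  by (rule Bochner_Integration.integrable_bound[OF integrable_compensated_jump[of \<theta>]])
    (auto simp: indicator_def)
 have "(\<lambda>n. \<integral>y. indicator {y. \<bar>y\<bar> <= 2 ^ n} y *\<^sub>R ?f y \<partial>lborel) \<longlonglongrightarrow> (\<integral>y. ?f y \<partial>lborel)"
 proof (rule integral_dominated_convergence[of _ _ _ "\<lambda>y. norm (?f y)"])
  show "integrable lborel (\<lambda>y. norm (?f y))" by (intro integrable_norm integrable_compensated_jump)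
  show "AE y in lborel. (\<lambda>n. indicator {y. \<bar>y\<bar> <= 2 ^ n} y *\<^sub>R ?f y) \<longlonglongrightarrow> ?f y"
  proof (intro AE_I2 tendsto_eventually)
   fix y :: real
   obtain m where m: "\<bar>y\<bar> < 2 ^ m" using real_arch_pow[of 2 "\<bar>y\<bar>"] by auto
   have "\<bar>y\<bar> <= 2 ^ n" if "n \<ge> m" for n
    using m power_increasing[OF that, of "2::real"] by linarith
   then show "\<forall>\<^sub>F n in sequentially. indicator {y. \<bar>y\<bar> <= 2 ^ n} y *\<^sub>R ?f y = ?f y"
    unfolding eventually_sequentially by (intro exI[of _ m]) (simp add: indicator_def)
  qed
 qed (auto simp: indicator_def)
 moreover have "(\<integral>y. indicator {y. \<bar>y\<bar> <= 2 ^ n} y *\<^sub>R ?f y \<partial>lborel) = (\<Sum>i<Suc n. shell_psi i \<theta>)" for n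
  unfolding sum_indicator_shell[symmetric] scaleR_sum_left shell_psi_def
  by (rule Bochner_Integration.integral_sum) (rule int)
 ultimately have "(\<lambda>n. \<Sum>i<Suc n. shell_psi i \<theta>) \<longlonglongrightarrow> psi \<theta>" by (simp only: psi_def)
 then show ?thesis unfolding sums_def by (rule LIMSEQ_imp_Suc)
qed

lemma jump_shell_bound: "y \<in> shell (Suc j) ==> \<bar>J y\<bar> <= (2 powr (- 1 / \<alpha>)) ^ j"
proof -
 assume "y \<in> shell (Suc j)"
 then have "2 ^ j <= \<bar>y\<bar>" by (simp add: shell_def)
 then have "\<bar>y\<bar> powr (- 1 / \<alpha>) <= (2 ^ j) powr (- 1 / \<alpha>)"
  using alpha by (intro powr_mono2') auto
 also have "... = (2 powr (- 1 / \<alpha>)) ^ j"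
  by (simp add: powr_realpow[symmetric] powr_powr mult.commute)
 finally show ?thesis using jump_bound[of y] by linarith
qed

text \<open>Both the variances of the jumps in the shells and, below index one, their means decay
  geometrically; this is what makes the sum over the shells converge uniformly.\<close>

lemma shell_bounds:
 obtains \<rho> :: "nat => real" where "\<And>i. \<rho> i > 0" "summable (\<lambda>i. shell_square i / (\<rho> i)\<^sup>2)"
  "summable (\<lambda>i. \<rho> i + \<bar>shell_mean i - shell_drift i\<bar>)"
proof -
 define \<beta> where "\<beta> = 2 powr (- 1 / \<alpha>)"
 have \<beta>: "\<beta> > 0" by (simp add: \<beta>_def)
 have bound: "\<bar>\<integral>y. indicator (shell (Suc j)) y * g y \<partial>lborel\<bar> <= c * (4 * 2 ^ j)"
  if g: "\<And>y. y \<in> shell (Suc j) ==> \<bar>g y\<bar> <= c" and c: "c \<ge> 0" and [measurable]: "g \<in> borel_measurable borel" for g :: "real => real" and j c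
 proof -
  have i: "integrable lborel (\<lambda>y. c * indicator (shell (Suc j)) y)"
   by (rule integrable_mult_right[OF integrable_shell])
  have "\<bar>\<integral>y. indicator (shell (Suc j)) y * g y \<partial>lborel\<bar> <= (\<integral>y. \<bar>indicator (shell (Suc j)) y * g y\<bar> \<partial>lborel)"
   by (rule integral_abs_bound)
  also have "... <= (\<integral>y. c * indicator (shell (Suc j)) y \<partial>lborel)"
   by (rule integral_mono'[OF i]) (use g c in \<open>auto simp: indicator_def\<close>)
  also have "... = c * measure lborel (shell (Suc j))" by simp
  also have "... <= c * (4 * 2 ^ j)" using measure_shell(2)[of "Suc j"] c by (intro mult_left_mono) auto
  finally show ?thesis .
 qed
 define q where "q = 2 * \<beta>\<^sup>2"
 have q: "0 < q" "q < 1"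
 proof -
  have "\<beta>\<^sup>2 = 2 powr (- 2 / \<alpha>)" by (simp add: \<beta>_def powr_power)
  also have "... < 2 powr (- 1)" using alpha by (intro powr_less_mono) (auto simp: field_simps)
  finally show "q < 1" by (simp add: q_def powr_minus)
 qed (use \<beta> in \<open>simp add: q_def\<close>)
 define s where "s = q powr (1 / 4)"
 have s: "0 < s" "s < 1"
  using q powr_less_mono2[of "1 / 4" q 1] by (auto simp: s_def)
 have s4: "s ^ 4 = q" using q by (simp add: s_def powr_power)
 define \<rho> where "\<rho> i = (case i of 0 => 1 | Suc j => s ^ j)" for i
 have 1: "\<rho> i > 0" for i using s by (auto simp: \<rho>_def split: nat.splits)
 have 2: "summable (\<lambda>j. shell_square (Suc j) / (\<rho> (Suc j))\<^sup>2)"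
 proof (rule summable_comparison_test'[of "\<lambda>j. 4 * (s\<^sup>2) ^ j" 0])
  show "summable (\<lambda>j. 4 * (s\<^sup>2) ^ j)"
   using s by (intro summable_mult summable_geometric) (simp add: power_less_one_iff abs_square_less_1)
  fix j
  have "\<bar>shell_square (Suc j)\<bar> <= (\<beta> ^ j)\<^sup>2 * (4 * 2 ^ j)"
   unfolding shell_square_def
  proof (rule bound)
   fix y assume "y \<in> shell (Suc j)"
   then show "\<bar>(J y)\<^sup>2\<bar> <= (\<beta> ^ j)\<^sup>2"
    using power_mono[OF jump_shell_bound[of y j], of 2] by (simp add: \<beta>_def)
  qed auto
  also have "... = 4 * q ^ j" by (simp add: q_def power_mult_distrib power_mult[symmetric] mult.commute)
  also have "... = 4 * (s\<^sup>2) ^ j * (\<rho> (Suc j))\<^sup>2"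
   by (simp add: \<rho>_def s4[symmetric] power_mult[symmetric] power_add[symmetric])
  finally show "norm (shell_square (Suc j) / (\<rho> (Suc j))\<^sup>2) <= 4 * (s\<^sup>2) ^ j"
   using 1[of "Suc j"] by (simp add: divide_le_eq)
 qed
 have 3: "summable (\<lambda>j. \<bar>shell_mean (Suc j) - shell_drift (Suc j)\<bar>)"
 proof -
  consider "\<alpha> < 1" | "\<alpha> = 1" | "1 < \<alpha>" by linarith
  then show ?thesis
  proof cases
   case 1
   have "2 * \<beta> < 1"
   proof -
    have "\<beta> < 2 powr (- 1)" unfolding \<beta>_def using alpha 1 by (intro powr_less_mono) (auto simp: field_simps)
    then show ?thesis by (simp add: powr_minus)
   qed
   then have "summable (\<lambda>j. 4 * (2 * \<beta>) ^ j)" using \<beta> by (intro summable_mult summable_geometric) simp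
   then show ?thesis
   proof (rule summable_comparison_test'[of _ 0])
    fix j
    have "\<bar>shell_mean (Suc j)\<bar> <= \<beta> ^ j * (4 * 2 ^ j)"
     unfolding shell_mean_def by (rule bound) (use jump_shell_bound \<beta> in \<open>auto simp: \<beta>_def\<close>)
    then show "norm \<bar>shell_mean (Suc j) - shell_drift (Suc j)\<bar> <= 4 * (2 * \<beta>) ^ j"
     using 1 by (simp add: shell_drift_def power_mult_distrib mult_ac)
   qed
  next
   case 2
   then have "shell_mean i = 0" for i unfolding shell_mean_def by (rule shell_odd[where f = "\<lambda>x. x"]) simp
   moreover have "shell_drift i = 0" for i unfolding shell_drift_def using 2 by simp
   ultimately show ?thesis by simp
  qed (simp add: shell_drift_def)
 qed
 have 4: "summable (\<lambda>j. \<rho> (Suc j))" using s by (simp add: \<rho>_def summable_geometric)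
 show ?thesis
 proof (rule that[of \<rho>])
  show "summable (\<lambda>i. shell_square i / (\<rho> i)\<^sup>2)" using 2 by (subst summable_Suc_iff[symmetric])
  show "summable (\<lambda>i. \<rho> i + \<bar>shell_mean i - shell_drift i\<bar>)"
   using summable_add[OF 4 3] by (subst summable_Suc_iff[symmetric])
 qed (rule 1)
qed

end

section \<open>Construction of the stable process\<close>

lemma sum_clamp01:
 assumes "0 <= t" "t <= real K"
 shows "(\<Sum>k<K. clamp01 (t - real k)) = t"
 using assms
proof (induction K arbitrary: t)
 case (Suc K)
 show ?case
 proof (cases "t <= real K")
  case True
  then show ?thesis using Suc.IH[of t] Suc.prems by (simp add: clamp01_def)
 next
  case False
  have "(\<Sum>k<K. clamp01 (t - real k)) = (\<Sum>k<K. clamp01 (real K - real k))"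
  proof (intro sum.cong refl)
   fix k assume "k \<in> {..<K}"
   then have "real k + 1 <= real K" by (metis Suc_leI lessThan_iff of_nat_Suc of_nat_le_iff add.commute)
   then show "clamp01 (t - real k) = clamp01 (real K - real k)" using False by (simp add: clamp01_def)
  qed
  also have "... = real K" by (rule Suc.IH) auto
  finally show ?thesis using False Suc.prems by (simp add: clamp01_def)
 qed
qed simp

definition cell_path :: "(real => real) => real => real => (nat => real) => real" where
 "cell_path h k t y = (\<Sum>l<nat \<lfloor>y 0\<rfloor>. h (y (2 * l + 2)) * (if 0 < y (2 * l + 1) \<and> y (2 * l + 1) <= 1 \<and> k + y (2 * l + 1) <= t then 1 else 0))"

lemma measurable_cell_path[measurable]:
 assumes [measurable]: "h \<in> borel_measurable borel"
 shows "cell_path h k t \<in> borel_measurable (PiM UNIV (\<lambda>_. borel))"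
proof -
 have "(\<lambda>y::nat => real. \<Sum>l<n. h (y (2 * l + 2)) * (if 0 < y (2 * l + 1) \<and> y (2 * l + 1) <= 1 \<and> k + y (2 * l + 1) <= t then 1 else 0)) \<in> borel_measurable (PiM UNIV (\<lambda>_. borel))" for n
  by measurable
 then show ?thesis
  unfolding cell_path_def[abs_def] by (rule measurable_compose_countable) measurable
qed

text \<open>Independent variables \<open>X ((k, i), s)\<close> such that for each \<open>(k, i)\<close> they describe the points in the time
  interval \<open>[k, k+1]\<close> with marks in \<open>shell i\<close>.\<close>

locale levy_cells = prob_space M + D: stable_domain \<mu> \<alpha> p r a
 for M :: "'a measure" and \<mu> :: "real measure" and \<alpha> p r :: real and a :: "nat => real" +
 fixes X :: "(nat \<times> nat) \<times> nat => 'a => real"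
 assumes indep: "indep_vars (\<lambda>_. borel) X UNIV"
  and count: "\<And>k i n. prob {w\<in>space M. nat \<lfloor>X ((k, i), 0) w\<rfloor> = n} =
   measure lborel (shell i) ^ n / fact n * exp (- measure lborel (shell i))"
  and time_law: "\<And>k i l. distr M borel (X ((k, i), 2 * l + 1)) = uniform_measure lborel {0..1}"
  and size_law: "\<And>k i l. distr M borel (X ((k, i), 2 * l + 2)) = uniform_measure lborel (shell i)"
begin

abbreviation "h i y \<equiv> indicator (shell i) y * D.J y"

sublocale cell: poisson_cell M "\<lambda>s. X ((k, i), s)" "measure lborel (shell i)" "uniform_measure lborel (shell i)" "h i" "real k" for k i
proof
 have "indep_vars (\<lambda>_. borel) X (Pair (k, i) ` UNIV)" by (rule indep_vars_subset[OF indep]) simp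
 then show "indep_vars (\<lambda>_. borel) (\<lambda>s. X ((k, i), s)) UNIV"
  by (rule indep_vars_reindex) (simp add: inj_on_def)
qed (use count time_law size_law in auto)

lemma indep_cells:
 assumes H: "\<And>c. H c \<in> borel_measurable (PiM UNIV (\<lambda>_. borel))"
 shows "indep_vars (\<lambda>_. borel) (\<lambda>c w. H c (\<lambda>s. X (c, s) w)) UNIV"
proof -
 have "indep_vars (\<lambda>c. PiM ({c} \<times> UNIV) (\<lambda>_. borel)) (\<lambda>c w. restrict (\<lambda>j. X j w) ({c} \<times> UNIV)) UNIV"
  by (rule indep_vars_restrict[OF indep]) (auto simp: disjoint_family_on_def)
 then have "indep_vars (\<lambda>_. borel) (\<lambda>c w. (\<lambda>y. H c (\<lambda>s. y (c, s))) (restrict (\<lambda>j. X j w) ({c} \<times> UNIV))) UNIV"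
 proof (rule indep_vars_compose2)
  fix c :: "nat \<times> nat"
  have "(\<lambda>y s. y (c, s)) \<in> PiM ({c} \<times> UNIV) (\<lambda>_. borel) \<rightarrow>\<^sub>M PiM UNIV (\<lambda>_. borel :: real measure)"
   by (rule measurable_PiM_single') (auto intro: measurable_component_singleton)
  from measurable_compose[OF this H[of c]]
  show "(\<lambda>y. H c (\<lambda>s. y (c, s))) \<in> PiM ({c} \<times> UNIV) (\<lambda>_. borel) \<rightarrow>\<^sub>M borel" .
 qed
 then show ?thesis by simp
qed

lemma integral_size:
 fixes g :: "real => 'b::{banach, second_countable_topology}"
 assumes [measurable]: "g \<in> borel_measurable borel"
 shows "measure lborel (shell i) *\<^sub>R expectation (\<lambda>w. g (X ((k, i), 2) w)) = (\<integral>y. indicator (shell i) y *\<^sub>R g y \<partial>lborel)"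
proof -
 have law: "distr M borel (X ((k, i), 2)) = uniform_measure lborel (shell i)" using size_law[of k i 0] by (simp add: numeral_2_eq_2)
 have "expectation (\<lambda>w. g (X ((k, i), 2) w)) = (\<integral>y. g y \<partial>uniform_measure lborel (shell i))"
  unfolding law[symmetric] by (rule integral_distr[symmetric]) auto
 then show ?thesis
  using integral_uniform_measure_scaleR[of "shell i" lborel g] measure_shell emeasure_shell by simp
qed

text \<open>The compensated jumps of one cell.\<close>

definition "W k i w t = cell.path k i w t - clamp01 (t - real k) * D.shell_drift i"

lemma W_measurable[measurable]: "(\<lambda>w. W k i w t) \<in> borel_measurable M"
 unfolding W_def by measurable

lemma W_before: "t <= real k ==> W k i w t = 0"
 by (simp add: W_def cell.path_before clamp01_def)

lemma cadlag_W: "cadlag_on S (W k i w)"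
 unfolding W_def[abs_def]
 by (rule cadlag_on_diff_continuous[OF cell.cadlag_path]) (auto simp: clamp01_def intro!: continuous_intros)

lemma joint_char_W:
 assumes t: "\<And>l. l < n ==> t l <= t (Suc l)"
 shows "expectation (\<lambda>w. iexp (\<Sum>l<n. \<theta> l * (W k i w (t (Suc l)) - W k i w (t l)))) =
  exp (\<Sum>l<n. of_real (clamp01 (t (Suc l) - k) - clamp01 (t l - k)) * D.shell_psi i (\<theta> l))"
proof -
 let ?d = "\<lambda>l. clamp01 (t (Suc l) - k) - clamp01 (t l - k)"
 let ?E = "\<lambda>\<theta>. expectation (\<lambda>w. iexp (\<theta> * h i (X ((k, i), 2) w)) - 1)"
 let ?D = "\<Sum>l<n. \<theta> l * (?d l * D.shell_drift i)"
 have psi: "of_real (measure lborel (shell i)) * ?E \<theta> - \<i> * of_real (\<theta> * D.shell_drift i) = D.shell_psi i \<theta>" for \<theta>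
 proof -
  have "of_real (measure lborel (shell i)) * ?E \<theta> = (\<integral>y. indicator (shell i) y *\<^sub>R (iexp (\<theta> * h i y) - 1) \<partial>lborel)"
   by (subst integral_size[symmetric, of _ _ k]) (simp_all add: scaleR_conv_of_real)
  also have "... = (\<integral>y. indicator (shell i) y *\<^sub>R (iexp (\<theta> * D.J y) - 1) \<partial>lborel)"
   by (intro Bochner_Integration.integral_cong) (auto simp: indicator_def)
  finally show ?thesis by (simp add: D.shell_psi_eq)
 qed
 have "iexp (\<Sum>l<n. \<theta> l * (W k i w (t (Suc l)) - W k i w (t l))) =
   iexp (\<Sum>l<n. \<theta> l * (cell.path k i w (t (Suc l)) - cell.path k i w (t l))) * exp (- (\<i> * of_real ?D))" for w
 proof -
  have "(\<Sum>l<n. \<theta> l * (W k i w (t (Suc l)) - W k i w (t l))) =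
    (\<Sum>l<n. \<theta> l * (cell.path k i w (t (Suc l)) - cell.path k i w (t l))) - ?D"
   unfolding W_def sum_subtractf[symmetric] by (intro sum.cong refl) (simp add: algebra_simps)
  then show ?thesis by (simp only: exp_add[symmetric] of_real_diff) (simp add: algebra_simps)
 qed
 then have "expectation (\<lambda>w. iexp (\<Sum>l<n. \<theta> l * (W k i w (t (Suc l)) - W k i w (t l)))) =
   exp (of_real (measure lborel (shell i)) * (\<Sum>l<n. of_real (?d l) * ?E (\<theta> l))) * exp (- (\<i> * of_real ?D))"
  by (simp only: integral_mult_left_zero cell.joint_char_path[where t = t and r = n, OF t])
 also have "... = exp (\<Sum>l<n. of_real (?d l) * (of_real (measure lborel (shell i)) * ?E (\<theta> l) - \<i> * of_real (\<theta> l * D.shell_drift i)))"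
  unfolding exp_add[symmetric] of_real_sum sum_distrib_left sum_negf[symmetric] sum.distrib[symmetric]
  by (intro arg_cong[of _ _ exp] sum.cong refl) (simp add: algebra_simps)
 finally show ?thesis unfolding psi .
qed

text \<open>Borel--Cantelli over the shells, for one time interval at a time: by the fluctuation bound the
  exceptional probabilities are summable. Compensation by the drift instead of the mean, for
  \<open>\<alpha> \<le> 1\<close>, adds a summable amount.\<close>

lemma W_uniformly_summable:
 obtains B G where "summable B" "G \<in> events" "prob G = 1"
  "\<And>w k. w \<in> G ==> \<exists>N. \<forall>i\<ge>N. \<forall>t. \<bar>W k i w t\<bar> <= B i"
proof -
 obtain \<rho> :: "nat => real" where \<rho>: "\<And>i. \<rho> i > 0" "summable (\<lambda>i. D.shell_square i / (\<rho> i)\<^sup>2)"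
  "summable (\<lambda>i. \<rho> i + \<bar>D.shell_mean i - D.shell_drift i\<bar>)"
  using D.shell_bounds by blast
 have "AE w in M. \<exists>N. \<forall>i\<ge>N. \<forall>t. \<bar>W k i w t\<bar> <= \<rho> i + \<bar>D.shell_mean i - D.shell_drift i\<bar>" for k
 proof -
  have sq: "measure lborel (shell i) * expectation (\<lambda>w. (h i (X ((k, i), 2) w))\<^sup>2) = D.shell_square i" for i
  proof -
   have "measure lborel (shell i) * expectation (\<lambda>w. (h i (X ((k, i), 2) w))\<^sup>2) = (\<integral>y. indicator (shell i) y * (h i y)\<^sup>2 \<partial>lborel)"
    using integral_size[of "\<lambda>y. (h i y)\<^sup>2" i k] by simp
   also have "... = D.shell_square i"
    unfolding D.shell_square_def by (intro Bochner_Integration.integral_cong) (auto simp: indicator_def)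
   finally show ?thesis .
  qed
  have drift: "cell.drift k i = D.shell_mean i" for i
  proof -
   have "cell.drift k i = (\<integral>y. indicator (shell i) y * h i y \<partial>lborel)"
    using integral_size[of "\<lambda>y. h i y" i k] by (simp add: cell.drift_def)
   also have "... = D.shell_mean i"
    unfolding D.shell_mean_def by (intro Bochner_Integration.integral_cong) (auto simp: indicator_def)
   finally show ?thesis .
  qed
  define Q where "Q j E \<longleftrightarrow> prob E <= D.shell_square (Suc j) / (\<rho> (Suc j))\<^sup>2 \<and>
    (\<forall>w\<in>space M - E. \<forall>t. \<bar>cell.path k (Suc j) w t - clamp01 (t - real k) * D.shell_mean (Suc j)\<bar> <= \<rho> (Suc j))" for j E
  have "\<exists>E. E \<in> events \<and> Q j E" for j
  proof -
   have "\<bar>h (Suc j) y\<bar> <= (2 powr (- 1 / \<alpha>)) ^ j" for y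
    using D.jump_shell_bound[of y j] by (simp add: indicator_def)
   from cell.fluctuation_bound[of "Suc j", OF this \<rho>(1), of k] show ?thesis
    unfolding sq drift Q_def by blast
  qed
  then have "\<forall>j. \<exists>E. E \<in> events \<and> Q j E" by blast
  from choice[OF this] obtain E where "\<forall>j. E j \<in> events \<and> Q j (E j)" ..
  then have E: "\<And>j. E j \<in> events" "\<And>j. prob (E j) <= D.shell_square (Suc j) / (\<rho> (Suc j))\<^sup>2"
   "\<And>j w t. w \<in> space M - E j ==> \<bar>cell.path k (Suc j) w t - clamp01 (t - real k) * D.shell_mean (Suc j)\<bar> <= \<rho> (Suc j)"
   by (simp_all add: Q_def)
  have "summable (\<lambda>j. prob (E j))"
   by (rule summable_comparison_test'[OF summable_Suc_iff[THEN iffD2, OF \<rho>(2)]]) (use E(2) in auto)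
  then have "AE w in M. \<forall>\<^sub>F j in sequentially. w \<in> space M - E j"
   by (intro borel_cantelli_AE1 E(1)) (auto simp: emeasure_eq_measure)
  then show ?thesis
  proof eventually_elim
   case (elim w)
   then obtain N where N: "\<And>j. j \<ge> N ==> w \<in> space M - E j" by (auto simp: eventually_sequentially)
   have "\<bar>W k i w t\<bar> <= \<rho> i + \<bar>D.shell_mean i - D.shell_drift i\<bar>" if "i \<ge> Suc N" for i t
   proof -
    from that obtain j where j: "i = Suc j" "j \<ge> N" by (cases i) auto
    have eq: "W k i w t = (cell.path k i w t - clamp01 (t - real k) * D.shell_mean i) + clamp01 (t - real k) * (D.shell_mean i - D.shell_drift i)"
     by (simp add: W_def algebra_simps)
    have b1: "\<bar>clamp01 (t - real k) * (D.shell_mean i - D.shell_drift i)\<bar> <= 1 * \<bar>D.shell_mean i - D.shell_drift i\<bar>"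
     unfolding abs_mult by (intro mult_right_mono) (auto simp: clamp01_def)
    have b2: "\<bar>cell.path k i w t - clamp01 (t - real k) * D.shell_mean i\<bar> <= \<rho> i"
     using E(3)[OF N[OF j(2)], of t] unfolding j(1)[symmetric] .
    show ?thesis unfolding eq by (rule order_trans[OF abs_triangle_ineq add_mono[OF b2 b1[unfolded mult_1]]])
   qed
   then show ?case by blast
  qed
 qed
 then have "AE w in M. \<forall>k. \<exists>N. \<forall>i\<ge>N. \<forall>t. \<bar>W k i w t\<bar> <= \<rho> i + \<bar>D.shell_mean i - D.shell_drift i\<bar>"
  by (simp add: AE_all_countable)
 then obtain F where F: "F \<in> null_sets M"
  "{w\<in>space M. \<not> (\<forall>k. \<exists>N. \<forall>i\<ge>N. \<forall>t. \<bar>W k i w t\<bar> <= \<rho> i + \<bar>D.shell_mean i - D.shell_drift i\<bar>)} \<subseteq> F"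
  by (auto elim!: AE_E simp: null_sets_def)
 show ?thesis
 proof (rule that[OF \<rho>(3), of "space M - F"])
  show "prob (space M - F) = 1"
   using F(1) by (subst prob_compl) (auto simp: null_sets_def measure_def)
  show "\<exists>N. \<forall>i\<ge>N. \<forall>t. \<bar>W k i w t\<bar> <= \<rho> i + \<bar>D.shell_mean i - D.shell_drift i\<bar>" if "w \<in> space M - F" for w k
   using F(2) that by blast
 qed (use F in auto)
qed

text \<open>Up to time \<open>K\<close> only the intervals \<open>k < K\<close> contribute, so that the process is a finite sum of uniformly
  convergent series. It is set to zero on the exceptional null set, to have cadlag paths surely.\<close>

lemma process_exists:
 obtains V where "\<And>t. random_variable borel (V t)" "\<And>w. V 0 w = 0" "\<And>w. cadlag_on {0..} (\<lambda>t. V t w)"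
  "\<And>n t \<theta>. 0 <= t 0 ==> (\<And>l. l < n ==> t l <= t (Suc l)) ==>
   expectation (\<lambda>w. iexp (\<Sum>l<n. \<theta> l * (V (t (Suc l)) w - V (t l) w))) = exp (\<Sum>l<n. of_real (t (Suc l) - t l) * D.psi (\<theta> l))"
proof -
 obtain B G where B: "summable B" and G[measurable]: "G \<in> events" and PG: "prob G = 1"
  and WB: "\<And>w k. w \<in> G ==> \<exists>N. \<forall>i\<ge>N. \<forall>t. \<bar>W k i w t\<bar> <= B i"
  using W_uniformly_summable by blast
 define Y where "Y k w t = (\<Sum>i. W k i w t)" for k w t
 define V where "V t w = indicator G w * (\<Sum>k<nat \<lceil>t\<rceil>. Y k w t)" for t w
 have Y0: "Y k w t = 0" if "t <= real k" for k w t
  unfolding Y_def using W_before[OF that] by simp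
 have VK: "V t w = indicator G w * (\<Sum>k<K. Y k w t)" if "t <= real K" for t K w
 proof -
  have "(\<Sum>k<nat \<lceil>t\<rceil>. Y k w t) = (\<Sum>k<K. Y k w t)"
  proof (rule sum.mono_neutral_left)
   show "{..<nat \<lceil>t\<rceil>} \<subseteq> {..<K}" using that by (auto simp: nat_le_iff ceiling_le_iff intro: order.strict_trans2)
   show "\<forall>k\<in>{..<K} - {..<nat \<lceil>t\<rceil>}. Y k w t = 0"
    using Y0 by (auto simp: not_less nat_le_iff ceiling_le_iff)
  qed simp
  then show ?thesis by (simp add: V_def)
 qed
 have sm: "summable (\<lambda>i. W k i w t)" if w: "w \<in> G" for k w t
 proof -
  obtain N where "\<forall>i\<ge>N. \<forall>t. \<bar>W k i w t\<bar> <= B i" using WB[OF w] by blast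
  then show ?thesis by (intro summable_comparison_test'[OF B, of N]) auto
 qed
 have meas: "random_variable borel (V t)" for t
  unfolding V_def Y_def by measurable
 have cad: "cadlag_on {0..} (\<lambda>t. V t w)" for w
 proof (rule cadlag_on_half_line)
  fix K :: nat
  have "cadlag_on {0..real K} (\<lambda>t. \<Sum>k<K. indicator G w * Y k w t)"
  proof (rule cadlag_on_sum)
   fix k
   show "cadlag_on {0..real K} (\<lambda>t. indicator G w * Y k w t)"
   proof (cases "w \<in> G")
    case True
    then obtain N where "\<forall>i\<ge>N. \<forall>t. \<bar>W k i w t\<bar> <= B i" using WB by blast
    then have "cadlag_on {0..real K} (Y k w)"
     unfolding Y_def[abs_def] by (intro cadlag_on_suminf[OF cadlag_W _ B]) auto
    then show ?thesis using True by simp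
   next
    case False
    then show ?thesis by (auto simp: cadlag_on_def intro!: exI[of _ 0])
   qed
  qed
  then show "cadlag_on {0..real K} (\<lambda>t. V t w)"
   by (rule cadlag_on_cong) (simp add: VK[of _ K] sum_distrib_left)
 qed
 have char: "expectation (\<lambda>w. iexp (\<Sum>l<n. \<theta> l * (V (t (Suc l)) w - V (t l) w))) = exp (\<Sum>l<n. of_real (t (Suc l) - t l) * D.psi (\<theta> l))"
  if t0: "0 <= t 0" and t: "\<And>l. l < n ==> t l <= t (Suc l)" for n t \<theta>
 proof -
  define K where "K = nat \<lceil>t n\<rceil>"
  have up: "l <= n ==> t l <= t n" and lo: "l <= n ==> 0 <= t l" for l
  proof -
   show "l <= n ==> t l <= t n" by (induction rule: inc_induct) (use t in \<open>auto intro: order_trans\<close>)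
   show "l <= n ==> 0 <= t l" by (induction l) (use t t0 in \<open>auto intro: order_trans\<close>)
  qed
  have K: "t l <= real K" if "l <= n" for l using up[OF that] unfolding K_def by linarith
  define U where "U = (\<lambda>(k, i) w. \<Sum>l<n. \<theta> l * (W k i w (t (Suc l)) - W k i w (t l)))"
  have [measurable]: "random_variable borel (U c)" for c by (cases c) (simp add: U_def)
  have indU: "indep_vars (\<lambda>_. borel) U UNIV"
  proof -
   define H where "H c y = (\<Sum>l<n. \<theta> l *
     ((cell_path (h (snd c)) (real (fst c)) (t (Suc l)) y - clamp01 (t (Suc l) - real (fst c)) * D.shell_drift (snd c)) -
      (cell_path (h (snd c)) (real (fst c)) (t l) y - clamp01 (t l - real (fst c)) * D.shell_drift (snd c))))"
    for c :: "nat \<times> nat" and y :: "nat => real"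
   have "U = (\<lambda>c w. H c (\<lambda>s. X (c, s) w))"
    by (auto simp: fun_eq_iff H_def U_def W_def cell_path_def cell.path_def cell.cell_sum_def)
   moreover have "H c \<in> borel_measurable (PiM UNIV (\<lambda>_. borel))" for c
    unfolding H_def[abs_def] by measurable
   ultimately show ?thesis using indep_cells[of H] by simp
  qed
  define S where "S m w = (\<Sum>c\<in>{..<K} \<times> {..<m}. U c w)" for m w
  have [measurable]: "random_variable borel (S m)" for m unfolding S_def[abs_def] by measurable
  have ES: "expectation (\<lambda>w. iexp (S m w)) = exp (\<Sum>l<n. of_real (t (Suc l) - t l) * (\<Sum>i<m. D.shell_psi i (\<theta> l)))" for m
  proof -
   let ?d = "\<lambda>k l. clamp01 (t (Suc l) - real k) - clamp01 (t l - real k)"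
   have "iexp (S m w) = (\<Prod>c\<in>{..<K} \<times> {..<m}. iexp (U c w))" for w
    by (simp add: S_def sum_distrib_left exp_sum)
   moreover have "expectation (\<lambda>w. \<Prod>c\<in>{..<K} \<times> {..<m}. iexp (U c w)) = (\<Prod>c\<in>{..<K} \<times> {..<m}. expectation (\<lambda>w. iexp (U c w)))"
   proof (rule indep_vars_lebesgue_integral)
    show "indep_vars (\<lambda>_. borel) (\<lambda>c w. iexp (U c w)) ({..<K} \<times> {..<m})"
     by (rule indep_vars_compose2[OF indep_vars_subset[OF indU]]) auto
    show "integrable M (\<lambda>w. iexp (U c w))" for c
     by (rule integrable_const_bound[of _ 1]) auto
   qed simp
   moreover have "(\<Prod>c\<in>{..<K} \<times> {..<m}. expectation (\<lambda>w. iexp (U c w))) =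
     (\<Prod>(k, i)\<in>{..<K} \<times> {..<m}. exp (\<Sum>l<n. of_real (?d k l) * D.shell_psi i (\<theta> l)))"
   proof (intro prod.cong refl)
    fix c assume "c \<in> {..<K} \<times> {..<m}"
    obtain k i where c: "c = (k, i)" by (cases c)
    show "expectation (\<lambda>w. iexp (U c w)) = (case c of (k, i) => exp (\<Sum>l<n. of_real (?d k l) * D.shell_psi i (\<theta> l)))"
     unfolding c U_def split by (rule joint_char_W[where t = t and n = n, OF t])
   qed
   moreover have "... = exp (\<Sum>(k, i)\<in>{..<K} \<times> {..<m}. \<Sum>l<n. of_real (?d k l) * D.shell_psi i (\<theta> l))"
    by (subst exp_sum) (auto simp: split_def)
   moreover have "(\<Sum>(k, i)\<in>{..<K} \<times> {..<m}. \<Sum>l<n. of_real (?d k l) * D.shell_psi i (\<theta> l)) =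
     (\<Sum>l<n. of_real (t (Suc l) - t l) * (\<Sum>i<m. D.shell_psi i (\<theta> l)))"
   proof -
    have "(\<Sum>(k, i)\<in>{..<K} \<times> {..<m}. \<Sum>l<n. of_real (?d k l) * D.shell_psi i (\<theta> l)) =
      (\<Sum>l<n. \<Sum>(k, i)\<in>{..<K} \<times> {..<m}. of_real (?d k l) * D.shell_psi i (\<theta> l))"
     unfolding split_def by (rule sum.swap)
    also have "... = (\<Sum>l<n. (\<Sum>k<K. of_real (?d k l)) * (\<Sum>i<m. D.shell_psi i (\<theta> l)))"
     by (simp only: sum_product sum.cartesian_product)
    also have "... = (\<Sum>l<n. of_real (t (Suc l) - t l) * (\<Sum>i<m. D.shell_psi i (\<theta> l)))"
    proof (intro sum.cong refl)
     fix l assume "l \<in> {..<n}"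
     then have "(\<Sum>k<K. ?d k l) = t (Suc l) - t l"
      using sum_clamp01[of "t (Suc l)" K] sum_clamp01[of "t l" K] K[of l] K[of "Suc l"] lo[of l] lo[of "Suc l"]
      by (simp add: sum_subtractf)
     then show "(\<Sum>k<K. of_real (?d k l)) * (\<Sum>i<m. D.shell_psi i (\<theta> l)) = of_real (t (Suc l) - t l) * (\<Sum>i<m. D.shell_psi i (\<theta> l))"
      by (simp only: of_real_sum[symmetric])
    qed
    finally show ?thesis .
   qed
   ultimately show ?thesis by simp
  qed
  have lim: "(\<lambda>m. S m w) \<longlonglongrightarrow> (\<Sum>l<n. \<theta> l * (V (t (Suc l)) w - V (t l) w))" if w: "w \<in> G" for w
  proof -
   have SK: "S m w = (\<Sum>l<n. \<theta> l * ((\<Sum>k<K. \<Sum>i<m. W k i w (t (Suc l))) - (\<Sum>k<K. \<Sum>i<m. W k i w (t l))))" for m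
   proof -
    have "S m w = (\<Sum>l<n. \<Sum>(k, i)\<in>{..<K} \<times> {..<m}. \<theta> l * (W k i w (t (Suc l)) - W k i w (t l)))"
     unfolding S_def U_def split_def by (rule sum.swap)
    then show ?thesis
     by (simp add: sum.cartesian_product[symmetric] sum_distrib_left[symmetric] sum_subtractf)
   qed
   have "(\<lambda>m. \<Sum>k<K. \<Sum>i<m. W k i w (t l)) \<longlonglongrightarrow> V (t l) w" if "l <= n" for l
   proof -
    have "(\<lambda>m. \<Sum>i<m. W k i w (t l)) \<longlonglongrightarrow> Y k w (t l)" for k
     unfolding Y_def using sm[OF w] by (rule summable_LIMSEQ)
    then have "(\<lambda>m. \<Sum>k<K. \<Sum>i<m. W k i w (t l)) \<longlonglongrightarrow> (\<Sum>k<K. Y k w (t l))" by (intro tendsto_sum)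
    then show ?thesis using VK[OF K[OF that], of w] w by simp
   qed
   then show ?thesis unfolding SK by (intro tendsto_sum tendsto_mult tendsto_const tendsto_diff) auto
  qed
  have "(\<lambda>m. expectation (\<lambda>w. iexp (S m w))) \<longlonglongrightarrow> expectation (\<lambda>w. iexp (\<Sum>l<n. \<theta> l * (V (t (Suc l)) w - V (t l) w)))"
  proof (rule integral_dominated_convergence[of _ _ _ "\<lambda>_. 1"])
   have "AE w in M. w \<in> G" using PG prob_eq_1[OF G] by simp
   then show "AE w in M. (\<lambda>m. iexp (S m w)) \<longlonglongrightarrow> iexp (\<Sum>l<n. \<theta> l * (V (t (Suc l)) w - V (t l) w))"
    by eventually_elim (intro tendsto_intros lim)
   show "(\<lambda>w. iexp (\<Sum>l<n. \<theta> l * (V (t (Suc l)) w - V (t l) w))) \<in> borel_measurable M"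
    using meas by measurable
  qed auto
  moreover have "(\<lambda>m. expectation (\<lambda>w. iexp (S m w))) \<longlonglongrightarrow> exp (\<Sum>l<n. of_real (t (Suc l) - t l) * D.psi (\<theta> l))"
   unfolding ES using D.shell_psi_sums unfolding sums_def by (intro tendsto_intros)
  ultimately show ?thesis by (rule LIMSEQ_unique)
 qed
 show ?thesis
  by (rule that[of V]) (use meas cad char in \<open>auto simp: V_def\<close>)
qed

end

section \<open>The stable process\<close>

lemma (in prob_space) char_distr_eq:
 assumes [measurable]: "random_variable borel Y"
 shows "char (distr M borel Y) \<theta> = expectation (\<lambda>w. iexp (\<theta> * Y w))"
 unfolding char_def by (rule integral_distr) auto

context stable_domain
begin

text \<open>Because \<open>A * jump y = jump (A powr (- \<alpha>) * y)\<close>, this is a linear substitution.\<close>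

lemma psi_scale:
 assumes A: "A > 0" shows "psi (A * \<theta>) = of_real (A powr \<alpha>) * psi \<theta>"
proof -
 define c where "c = A powr (- \<alpha>)"
 have c: "c > 0" using A by (simp add: c_def)
 have "c powr (1 / \<alpha>) = A powr (- 1)" unfolding c_def powr_powr using alpha by simp
 then have c1: "c powr (1 / \<alpha>) = 1 / A" using A by (simp add: powr_minus_divide)
 have J: "J (c * y) = A * J y" for y
 proof -
  have *: "(q / (c * z)) powr (1 / \<alpha>) = A * (q / z) powr (1 / \<alpha>)" if "z \<ge> 0" "q \<ge> 0" for q z
  proof -
   have "(q / (c * z)) powr (1 / \<alpha>) = ((q / z) / c) powr (1 / \<alpha>)" by (simp add: mult.commute)
   also have "... = (q / z) powr (1 / \<alpha>) / c powr (1 / \<alpha>)" by (rule powr_divide)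
   finally show ?thesis using c1 A by simp
  qed
  show ?thesis
   using *[of y p] *[of "- y" r] c p_nonneg r_nonneg by (auto simp: jump_def zero_less_mult_iff)
 qed
 have "psi \<theta> = \<bar>c\<bar> *\<^sub>R (\<integral>y. compensated_iexp \<alpha> \<theta> (J (0 + c * y)) \<partial>lborel)"
  unfolding psi_def by (rule lborel_integral_real_affine) (use c in simp)
 also have "... = of_real c * psi (A * \<theta>)"
  using c by (simp add: J psi_def compensated_iexp_scale scaleR_conv_of_real)
 finally show ?thesis
  using A by (simp add: c_def powr_minus of_real_inverse field_simps)
qed

text \<open>The integrand \<open>cos (jump y) - 1\<close> is negative where the jumps are small but not zero; \<open>p + r = 1\<close>
  provides such \<open>y\<close> on one of the two half-lines.\<close>

lemma Re_psi_neg: "Re (psi 1) < 0"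
proof -
 let ?f = "\<lambda>y. 1 - cos (J y)"
 have Re: "Re (compensated_iexp \<alpha> 1 x) = - (1 - cos x)" for x
  by (simp add: compensated_iexp_def Re_exp)
 have int: "integrable lborel ?f"
  using Bochner_Integration.integrable_minus[OF integrable_Re[OF integrable_compensated_jump[of 1]]]
  unfolding Re minus_minus .
 have eq: "Re (psi 1) = - (\<integral>y. ?f y \<partial>lborel)"
  unfolding psi_def integral_Re[OF integrable_compensated_jump, symmetric] Re by (rule Bochner_Integration.integral_minus)
 have "(\<integral>y. ?f y \<partial>lborel) \<noteq> 0"
 proof
  assume "(\<integral>y. ?f y \<partial>lborel) = 0"
  then have "AE y in lborel. ?f y = 0" using integral_nonneg_eq_0_iff_AE[OF int] by simp
  then obtain F where F: "F \<in> sets lborel" "emeasure lborel F = 0" "{y. ?f y \<noteq> 0} \<subseteq> F"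
   by (auto elim!: AE_E)
  have small: "\<bar>J y\<bar> < 1" if "1 < \<bar>y\<bar>" for y
  proof -
   have "\<bar>y\<bar> powr (- 1 / \<alpha>) < \<bar>y\<bar> powr 0" using alpha that by (intro powr_less_mono) auto
   moreover have "\<bar>y\<bar> powr 0 = 1" using that by auto
   ultimately show ?thesis using jump_bound[of y] by linarith
  qed
  have nz: "?f y \<noteq> 0" if "1 < \<bar>y\<bar>" "J y \<noteq> 0" for y
  proof -
   have "cos \<bar>J y\<bar> < cos 0" using small[OF that(1)] that(2) pi_gt3 by (intro cos_monotone_0_pi) auto
   then show ?thesis by simp
  qed
  have "{1<..<2} \<subseteq> F \<or> {-2<..<-1} \<subseteq> F"
  proof (cases "p > 0")
   case True
   then have "J y \<noteq> 0" if "y > 1" for y using that by (simp add: jump_def)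
   then have "{1<..<2} \<subseteq> F" using nz F(3) by fastforce
   then show ?thesis ..
  next
   case False
   then have "r > 0" using p_plus_r p_nonneg by linarith
   then have "J y \<noteq> 0" if "y < - 1" for y using that by (simp add: jump_def)
   then have "{-2<..<-1} \<subseteq> F" using nz F(3) by fastforce
   then show ?thesis ..
  qed
  then have "emeasure lborel {1<..<2::real} <= 0 \<or> emeasure lborel {-2<..<-1::real} <= 0"
   using emeasure_mono[OF _ F(1)] F(2) by metis
  then show False by simp
 qed
 moreover have "0 <= (\<integral>y. ?f y \<partial>lborel)" by (rule Bochner_Integration.integral_nonneg) simp
 ultimately show ?thesis unfolding eq by linarith
qed

text \<open>The scaling of the exponent gives stability with \<open>D = 0\<close>; a point mass would have a characteristic
  function of modulus one.\<close>

lemma nondegenerate_stable_of_char: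
 assumes \<nu>: "real_distribution \<nu>" and char: "\<And>\<theta>. char \<nu> \<theta> = exp (psi \<theta>)"
 shows "nondegenerate_stable \<alpha> \<nu>"
 unfolding nondegenerate_stable_def
proof (intro conjI allI impI)
 interpret \<nu>: real_distribution \<nu> by fact
 interpret P: pair_prob_space \<nu> \<nu> ..
 show "prob_space \<nu>" "sets \<nu> = sets borel" by (unfold_locales) simp
 show "\<nu> \<noteq> return borel c" for c
 proof
  assume eq: "\<nu> = return borel c"
  have "exp (psi 1) = iexp c"
   unfolding char[symmetric] char_def eq by (subst integral_return) auto
  then have "norm (exp (psi 1)) = 1" by simp
  then show False using Re_psi_neg by simp
 qed
 fix A B :: real assume A: "A > 0" and B: "B > 0"
 define C where "C = (A powr \<alpha> + B powr \<alpha>) powr (1 / \<alpha>)"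
 have s: "A powr \<alpha> + B powr \<alpha> > 0" using A B by (simp add: add_pos_pos)
 have C: "C > 0" "C powr \<alpha> = A powr \<alpha> + B powr \<alpha>"
  using s alpha by (auto simp: C_def powr_powr)
 have "distr (\<nu> \<Otimes>\<^sub>M \<nu>) borel (\<lambda>(y1, y2). A * y1 + B * y2) = distr \<nu> borel (\<lambda>y. C * y + 0)"
 proof (rule Levy_uniqueness)
  have [measurable]: "(\<lambda>(y1, y2). A * y1 + B * y2) \<in> borel_measurable (\<nu> \<Otimes>\<^sub>M \<nu>)" by measurable
  show "real_distribution (distr (\<nu> \<Otimes>\<^sub>M \<nu>) borel (\<lambda>(y1, y2). A * y1 + B * y2))"
   by (rule P.real_distribution_distr) simp
  show "real_distribution (distr \<nu> borel (\<lambda>y. C * y + 0))"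
   by (rule \<nu>.real_distribution_distr) simp
  show "char (distr (\<nu> \<Otimes>\<^sub>M \<nu>) borel (\<lambda>(y1, y2). A * y1 + B * y2)) = char (distr \<nu> borel (\<lambda>y. C * y + 0))"
  proof
   fix \<theta>
   have "char (distr (\<nu> \<Otimes>\<^sub>M \<nu>) borel (\<lambda>(y1, y2). A * y1 + B * y2)) \<theta> = P.expectation (\<lambda>(y1, y2). iexp (A * \<theta> * y1) * iexp (B * \<theta> * y2))"
    by (subst P.char_distr_eq) (auto intro!: Bochner_Integration.integral_cong simp: exp_add[symmetric] algebra_simps)
   also have "... = (\<integral>y1. \<integral>y2. iexp (A * \<theta> * y1) * iexp (B * \<theta> * y2) \<partial>\<nu> \<partial>\<nu>)"
    by (rule P.integral_fst[symmetric], rule P.P.integrable_const_bound[of _ 1]) (auto simp: norm_mult)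
   also have "... = (\<integral>y1. iexp (A * \<theta> * y1) * char \<nu> (B * \<theta>) \<partial>\<nu>)"
    by (simp only: integral_mult_right_zero char_def)
   also have "... = char \<nu> (A * \<theta>) * char \<nu> (B * \<theta>)"
    by (simp only: integral_mult_left_zero char_def)
   also have "... = exp (psi (C * \<theta>))"
    unfolding char psi_scale[OF A] psi_scale[OF B] psi_scale[OF C(1)] C(2) exp_add[symmetric]
    by (simp add: algebra_simps)
   also have "... = char (distr \<nu> borel (\<lambda>y. C * y + 0)) \<theta>"
    by (subst \<nu>.char_distr_eq) (simp_all add: char[symmetric] char_def mult_ac)
   finally show "char (distr (\<nu> \<Otimes>\<^sub>M \<nu>) borel (\<lambda>(y1, y2). A * y1 + B * y2)) \<theta> = char (distr \<nu> borel (\<lambda>y. C * y + 0)) \<theta>" .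
  qed
 qed
 then show "\<exists>D. distr (\<nu> \<Otimes>\<^sub>M \<nu>) borel (\<lambda>(y1, y2). A * y1 + B * y2) =
   distr \<nu> borel (\<lambda>y. (A powr \<alpha> + B powr \<alpha>) powr (1 / \<alpha>) * y + D)"
  unfolding C_def ..
qed

end

context levy_cells
begin

lemma stable_levy_process_exists:
 obtains V where "stable_levy_process \<alpha> M V"
  "\<And>s t \<theta>. 0 <= s ==> s <= t ==> expectation (\<lambda>w. iexp (\<theta> * (V t w - V s w))) = exp (of_real (t - s) * D.psi \<theta>)"
proof -
 obtain V where V: "\<And>t. random_variable borel (V t)" "\<And>w. V 0 w = 0" "\<And>w. cadlag_on {0..} (\<lambda>t. V t w)"
  "\<And>n t \<theta>. 0 <= t 0 ==> (\<And>l. l < n ==> t l <= t (Suc l)) ==>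
   expectation (\<lambda>w. iexp (\<Sum>l<n. \<theta> l * (V (t (Suc l)) w - V (t l) w))) = exp (\<Sum>l<n. of_real (t (Suc l) - t l) * D.psi (\<theta> l))"
  by (rule process_exists) blast
 note [measurable] = V(1)
 have char: "expectation (\<lambda>w. iexp (\<theta> * (V t w - V s w))) = exp (of_real (t - s) * D.psi \<theta>)"
  if "0 <= s" "s <= t" for s t \<theta>
  using V(4)[of "\<lambda>l. if l = 0 then s else t" 1 "\<lambda>_. \<theta>"] that by simp
 have dist: "real_distribution (distr M borel (\<lambda>w. V t w - V s w))" for s t
  by (rule real_distribution_distr) simp
 have char': "char (distr M borel (\<lambda>w. V t w - V s w)) \<theta> = exp (of_real (t - s) * D.psi \<theta>)"
  if "0 <= s" "s <= t" for s t \<theta>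
  using char[OF that] by (subst char_distr_eq) auto
 have levy: "levy_process M V"
  unfolding levy_process_def
 proof (intro conjI allI impI ballI)
  show "prob_space M" by unfold_locales
  fix n :: nat and t :: "nat => real"
  assume t: "0 <= t 0 \<and> (\<forall>i<n. t i <= t (Suc i))"
  show "indep_vars (\<lambda>_. borel) (\<lambda>i w. V (t (Suc i)) w - V (t i) w) {..<n}"
  proof (rule indep_vars_of_joint_char)
   fix \<theta> :: "nat => real"
   have lo: "l <= n ==> 0 <= t l" for l by (induction l) (use t in \<open>auto intro: order_trans\<close>)
   have "(\<Prod>i<n. iexp (\<theta> i * (V (t (Suc i)) w - V (t i) w))) = iexp (\<Sum>l<n. \<theta> l * (V (t (Suc l)) w - V (t l) w))" for w
    by (simp only: exp_sum[symmetric, OF finite_lessThan] of_real_sum sum_distrib_left)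
   then have "expectation (\<lambda>w. \<Prod>i<n. iexp (\<theta> i * (V (t (Suc i)) w - V (t i) w))) = (\<Prod>l<n. exp (of_real (t (Suc l) - t l) * D.psi (\<theta> l)))"
    using V(4)[of t n \<theta>] t by (simp only: exp_sum[OF finite_lessThan])
   also have "... = (\<Prod>i<n. expectation (\<lambda>w. iexp (\<theta> i * (V (t (Suc i)) w - V (t i) w))))"
    using t lo by (intro prod.cong refl char[symmetric]) auto
   finally show "expectation (\<lambda>w. \<Prod>i<n. iexp (\<theta> i * (V (t (Suc i)) w - V (t i) w))) =
     (\<Prod>i<n. expectation (\<lambda>w. iexp (\<theta> i * (V (t (Suc i)) w - V (t i) w))))" .
  qed simp
 next
  fix s t :: real assume "0 <= s" "s <= t"
  then have "char (distr M borel (\<lambda>w. V t w - V s w)) = char (distr M borel (\<lambda>w. V (t - s) w - V 0 w))"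
   by (auto simp: char')
  then have "distr M borel (\<lambda>w. V t w - V s w) = distr M borel (\<lambda>w. V (t - s) w - V 0 w)"
   by (rule Levy_uniqueness[OF dist dist])
  then show "distr M borel (\<lambda>w. V t w - V s w) = distr M borel (V (t - s))" by (simp add: V(2))
 qed (use V in auto)
 moreover have "nondegenerate_stable \<alpha> (distr M borel (V 1))"
  using D.nondegenerate_stable_of_char[OF dist[of 1 0]] char'[of 0 1] by (simp add: V(2))
 ultimately show ?thesis using char by (intro that[of V]) (simp add: stable_levy_process_def)
qed

end

lemma poisson_law:
 assumes "0 < rate"
 defines "L \<equiv> distr (measure_pmf (poisson_pmf rate)) borel real"
 shows "prob_space L" "measure L {x. nat \<lfloor>x\<rfloor> = n} = rate ^ n / fact n * exp (- rate)"
proof -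
 show "prob_space L" unfolding L_def by (rule prob_space.prob_space_distr) (auto intro: prob_space_measure_pmf)
 have "measure L {x. nat \<lfloor>x\<rfloor> = n} = measure (measure_pmf (poisson_pmf rate)) {n}"
  unfolding L_def by (subst measure_distr) (auto intro!: arg_cong[of _ _ "measure _"])
 then show "measure L {x. nat \<lfloor>x\<rfloor> = n} = rate ^ n / fact n * exp (- rate)"
  using assms by (simp add: measure_pmf_single mult_ac)
qed

lemma indep_vars_coordinates:
 assumes I: "I \<noteq> {}" and L: "\<And>i. i \<in> I ==> prob_space (L i)"
 shows "prob_space.indep_vars (PiM I L) L (\<lambda>i w. w i) I"
proof -
 interpret prob_space "PiM I L" by (rule prob_space_PiM) (rule L)
 have "distr (PiM I L) (PiM I L) (\<lambda>x. restrict x I) = distr (PiM I L) (PiM I L) (\<lambda>x. x)"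
  by (rule distr_cong) (auto simp: space_PiM)
 also have "... = PiM I L" by (rule distr_id2) simp
 also have "... = PiM I (\<lambda>i. distr (PiM I L) (L i) (\<lambda>w. w i))"
  by (rule PiM_cong) (auto simp: distr_PiM_component L)
 finally show ?thesis by (subst indep_vars_iff_distr_eq_PiM'[OF I]) auto
qed

text \<open>The coordinates with natural-number index, within a product over the reals.\<close>

lemma independent_variables_exist:
 fixes L :: "'i::countable => real measure"
 assumes L: "\<And>j. prob_space (L j)" "\<And>j. sets (L j) = sets borel"
 obtains N :: "(real => real) measure" and X :: "'i => (real => real) => real" where "prob_space N"
  "prob_space.indep_vars N (\<lambda>_. borel) X UNIV" "\<And>j. distr N borel (X j) = L j"
proof -
 define L' where "L' x = L (from_nat (nat \<lfloor>x\<rfloor>))" for x :: real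
 define N where "N = PiM UNIV L'"
 interpret N: prob_space N unfolding N_def by (rule prob_space_PiM) (simp add: L'_def L)
 have law: "distr N borel (\<lambda>w. w x) = L' x" for x
 proof -
  have "distr N borel (\<lambda>w. w x) = distr N (L' x) (\<lambda>w. w x)" by (rule distr_cong) (auto simp: L'_def L)
  also have "... = L' x" unfolding N_def by (rule distr_PiM_component) (auto simp: L'_def L)
  finally show ?thesis .
 qed
 have "N.indep_vars L' (\<lambda>x w. w x) UNIV" unfolding N_def by (rule indep_vars_coordinates) (auto simp: L'_def L)
 then have "N.indep_vars (\<lambda>_. borel) (\<lambda>x w. w x) UNIV"
  by (rule N.indep_vars_compose2[where Y = "\<lambda>_ x. x", simplified]) (auto simp: L'_def L measurable_ident_sets)
 then have "N.indep_vars (\<lambda>_. borel) (\<lambda>x w. w x) (range (\<lambda>j::'i. real (to_nat j)))"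
  by (rule N.indep_vars_subset) simp
 then have "N.indep_vars (\<lambda>_. borel) (\<lambda>j w. w (real (to_nat (j::'i)))) UNIV"
  by (rule N.indep_vars_reindex) (auto simp: inj_on_def)
 moreover have "distr N borel (\<lambda>w. w (real (to_nat j))) = L j" for j by (simp add: law L'_def)
 ultimately show ?thesis by (intro that[of N "\<lambda>j w. w (real (to_nat j))"]) (auto intro: N.prob_space_axioms)
qed

lemma (in stable_domain) stable_levy_process_exists:
 obtains N :: "(real => real) measure" and V where "stable_levy_process \<alpha> N V"
  "\<And>s t \<theta>. 0 <= s ==> s <= t ==> (\<integral>w. iexp (\<theta> * (V t w - V s w)) \<partial>N) = exp (of_real (t - s) * psi \<theta>)"
proof -
 define L where "L = (\<lambda>((k::nat, i), s::nat). if s = 0 then distr (measure_pmf (poisson_pmf (measure lborel (shell i)))) borel real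
  else if odd s then uniform_measure lborel {0..1} else uniform_measure lborel (shell i))"
 have "prob_space (L j)" for j
 proof -
  have "emeasure lborel (shell i) \<noteq> 0" "emeasure lborel (shell i) \<noteq> \<infinity>" for i
   using emeasure_shell[of i] by auto
  then show ?thesis
   using poisson_law(1)[OF measure_shell(1)] by (auto simp: L_def split: prod.splits intro!: prob_space_uniform_measure)
 qed
 moreover have "sets (L j) = sets borel" for j by (auto simp: L_def split: prod.splits)
 ultimately obtain N :: "(real => real) measure" and X where N: "prob_space N" "prob_space.indep_vars N (\<lambda>_. borel) X UNIV" and law: "\<And>j. distr N borel (X j) = L j"
  using independent_variables_exist[of L] by blast
 interpret N: prob_space N by fact
 have cells: "levy_cells N \<mu> \<alpha> p r a X"
 proof (intro levy_cells.intro levy_cells_axioms.intro)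
  fix k i n :: nat
  have rv: "X j \<in> borel_measurable N" for j using N(2) unfolding N.indep_vars_def by blast
  have "N.prob {w\<in>space N. nat \<lfloor>X ((k, i), 0) w\<rfloor> = n} = measure (distr N borel (X ((k, i), 0))) {x. nat \<lfloor>x\<rfloor> = n}"
   using rv by (subst measure_distr) (auto intro!: arg_cong[of _ _ "measure _"])
  then show "N.prob {w\<in>space N. nat \<lfloor>X ((k, i), 0) w\<rfloor> = n} = measure lborel (shell i) ^ n / fact n * exp (- measure lborel (shell i))"
   unfolding law using poisson_law(2)[OF measure_shell(1)] by (simp add: L_def)
 qed (use N stable_domain_axioms in \<open>simp_all add: law L_def\<close>)
 show ?thesis by (rule levy_cells.stable_levy_process_exists[OF cells]) (rule that)
qed

section \<open>Convergence of the skeletons\<close>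

text \<open>By Skorohod's theorem each coordinate can be realized, with the same laws, as a pointwise
  convergent sequence; the product of the spaces makes the coordinates independent, and dominated
  convergence applies there.\<close>

lemma (in prob_space) independent_weak_convergence:
 fixes \<xi> :: "nat => nat => 'a => real" and F :: "(nat => real) => real"
 assumes \<xi>: "\<And>n. indep_vars (\<lambda>_. borel) (\<xi> n) {..<m}"
  and N: "prob_space N" and \<eta>: "prob_space.indep_vars N (\<lambda>_. borel) \<eta> {..<m}"
  and char: "\<And>i \<theta>. i < m ==> (\<lambda>n. char (distr M borel (\<xi> n i)) \<theta>) \<longlonglongrightarrow> char (distr N borel (\<eta> i)) \<theta>"
  and m: "m > 0" and F: "continuous_on UNIV F" "\<And>y. \<bar>F y\<bar> <= B"
 shows "(\<lambda>n. \<integral>w. F (\<lambda>i\<in>{..<m}. \<xi> n i w) \<partial>M) \<longlonglongrightarrow> (\<integral>w. F (\<lambda>i\<in>{..<m}. \<eta> i w) \<partial>N)"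
proof -
 interpret N: prob_space N by fact
 let ?I = "{..<m}" and ?P = "PiM {..<m} (\<lambda>_. borel) :: (nat => real) measure"
 have I: "?I \<noteq> {}" using m by auto
 have \<xi>_rv: "random_variable borel (\<xi> n i)" if "i \<in> ?I" for n i using \<xi> that unfolding indep_vars_def by blast
 have \<eta>_rv: "\<eta> i \<in> borel_measurable N" if "i \<in> ?I" for i using \<eta> that unfolding N.indep_vars_def by blast
 have F_m: "F \<in> borel_measurable ?P"
 proof -
  have "(\<lambda>y. y) \<in> ?P \<rightarrow>\<^sub>M borel"
  proof (rule measurable_coordinatewise_then_product)
   fix i show "(\<lambda>y. y i) \<in> borel_measurable ?P"
    by (cases "i < m") (auto intro: measurable_component_singleton measurable_cong[THEN iffD2, OF _ measurable_const[of undefined]] simp: space_PiM PiE_def extensional_def)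
  qed
  then show ?thesis by (rule measurable_compose) (rule borel_measurable_continuous_onI[OF F(1)])
 qed
 have law: "distr L ?P (\<lambda>w. \<lambda>i\<in>?I. X i w) = PiM ?I (\<lambda>i. distr L borel (X i))"
  and int: "(\<integral>w. F (\<lambda>i\<in>?I. X i w) \<partial>L) = (\<integral>y. F y \<partial>PiM ?I (\<lambda>i. distr L borel (X i)))"
  if "prob_space L" "prob_space.indep_vars L (\<lambda>_. borel) X ?I" for L :: "'z measure" and X
 proof -
  interpret L: prob_space L by fact
  have X: "X i \<in> borel_measurable L" if "i \<in> ?I" for i using \<open>L.indep_vars _ X ?I\<close> that unfolding L.indep_vars_def by blast
  show law: "distr L ?P (\<lambda>w. \<lambda>i\<in>?I. X i w) = PiM ?I (\<lambda>i. distr L borel (X i))"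
   using L.indep_vars_iff_distr_eq_PiM'[OF I X] that by simp
  show "(\<integral>w. F (\<lambda>i\<in>?I. X i w) \<partial>L) = (\<integral>y. F y \<partial>PiM ?I (\<lambda>i. distr L borel (X i)))"
   unfolding law[symmetric] by (rule integral_distr[symmetric, OF measurable_restrict F_m]) (rule X)
 qed
 define R where "R i \<Omega> Yn Y \<longleftrightarrow> prob_space \<Omega> \<and> (\<forall>n. Yn n \<in> borel_measurable \<Omega>) \<and> Y \<in> borel_measurable \<Omega> \<and>
   (\<forall>n. distr \<Omega> borel (Yn n) = distr M borel (\<xi> n i)) \<and> distr \<Omega> borel Y = distr N borel (\<eta> i) \<and>
   (\<forall>x\<in>space \<Omega>. (\<lambda>n. Yn n x) \<longlonglongrightarrow> Y x)" for i and \<Omega> :: "real measure" and Yn Y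
 have "\<exists>\<Omega> Yn Y. R i \<Omega> Yn Y" if i: "i < m" for i
 proof -
  have 1: "real_distribution (distr M borel (\<xi> n i))" for n using \<xi>_rv i by (intro real_distribution_distr) auto
  have 2: "real_distribution (distr N borel (\<eta> i))" using \<eta>_rv i by (intro N.real_distribution_distr) auto
  from Skorohod[OF 1 2 levy_continuity[OF 1 2 char[OF i]]] show ?thesis
   unfolding R_def by (simp add: measurable_lborel2) blast
 qed
 then have "\<forall>i. \<exists>W. i < m --> R i (fst W) (fst (snd W)) (snd (snd W))" by simp
 from choice[OF this] obtain W where W: "\<And>i. i < m ==> R i (fst (W i)) (fst (snd (W i))) (snd (snd (W i)))" by blast
 define \<Omega> where "\<Omega> i = fst (W i)" for i
 define Yn where "Yn i = fst (snd (W i))" for i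
 define Y where "Y i = snd (snd (W i))" for i
 have S: "\<And>i. i < m ==> prob_space (\<Omega> i)"
  "\<And>i n. i < m ==> Yn i n \<in> borel_measurable (\<Omega> i)" "\<And>i. i < m ==> Y i \<in> borel_measurable (\<Omega> i)"
  "\<And>i n. i < m ==> distr (\<Omega> i) borel (Yn i n) = distr M borel (\<xi> n i)" "\<And>i. i < m ==> distr (\<Omega> i) borel (Y i) = distr N borel (\<eta> i)"
  "\<And>i x. i < m ==> x \<in> space (\<Omega> i) ==> (\<lambda>n. Yn i n x) \<longlonglongrightarrow> Y i x"
  using W unfolding R_def \<Omega>_def Yn_def Y_def by blast+
 define Q where "Q = PiM ?I \<Omega>"
 interpret Q: prob_space Q unfolding Q_def by (rule prob_space_PiM) (use S in auto)
 have coord: "Q.indep_vars \<Omega> (\<lambda>i x. x i) ?I"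
  unfolding Q_def by (rule indep_vars_coordinates[OF I]) (use S in auto)
 have indQ: "Q.indep_vars (\<lambda>_. borel) (\<lambda>i x. X i (x i)) ?I" if "\<And>i. i < m ==> X i \<in> borel_measurable (\<Omega> i)" for X :: "nat => real => real"
  by (rule Q.indep_vars_compose2[OF coord]) (use that in auto)
 have lawQ: "distr Q borel (\<lambda>x. X (x i)) = distr (\<Omega> i) borel X" if i: "i < m" and X: "X \<in> borel_measurable (\<Omega> i)" for i and X :: "real => real"
 proof -
  have "distr (distr Q (\<Omega> i) (\<lambda>x. x i)) borel X = distr Q borel (X \<circ> (\<lambda>x. x i))"
   by (rule distr_distr) (use i X in \<open>auto simp: Q_def\<close>)
  moreover have "distr Q (\<Omega> i) (\<lambda>x. x i) = \<Omega> i" unfolding Q_def by (rule distr_PiM_component) (use i S in auto)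
  ultimately show ?thesis by (simp add: comp_def)
 qed
 have "(\<lambda>n. \<integral>x. F (\<lambda>i\<in>?I. Yn i n (x i)) \<partial>Q) \<longlonglongrightarrow> (\<integral>x. F (\<lambda>i\<in>?I. Y i (x i)) \<partial>Q)"
 proof (rule integral_dominated_convergence[of _ _ _ "\<lambda>_. B"])
  have meas: "(\<lambda>x. F (\<lambda>i\<in>?I. X i (x i))) \<in> borel_measurable Q" if "\<And>i. i < m ==> X i \<in> borel_measurable (\<Omega> i)" for X
  proof (rule measurable_compose[OF measurable_restrict F_m])
   fix i assume i: "i \<in> ?I"
   have "(\<lambda>x. x i) \<in> Q \<rightarrow>\<^sub>M \<Omega> i" unfolding Q_def using i by (rule measurable_component_singleton)
   moreover have "X i \<in> borel_measurable (\<Omega> i)" using i that by simp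
   ultimately show "(\<lambda>x. X i (x i)) \<in> borel_measurable Q" by (rule measurable_compose)
  qed
  show "(\<lambda>x. F (\<lambda>i\<in>?I. Yn i n (x i))) \<in> borel_measurable Q" "(\<lambda>x. F (\<lambda>i\<in>?I. Y i (x i))) \<in> borel_measurable Q" for n
   using S by (auto intro!: meas)
  show "AE x in Q. (\<lambda>n. F (\<lambda>i\<in>?I. Yn i n (x i))) \<longlonglongrightarrow> F (\<lambda>i\<in>?I. Y i (x i))"
  proof (rule AE_I2)
   fix x assume x: "x \<in> space Q"
   have "limitin (product_topology (\<lambda>_. euclidean) UNIV) (\<lambda>n. \<lambda>i\<in>?I. Yn i n (x i)) (\<lambda>i\<in>?I. Y i (x i)) sequentially"
    unfolding limitin_componentwise using S(6) x by (auto simp: Q_def space_PiM PiE_iff restrict_def)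
   then have "(\<lambda>n. \<lambda>i\<in>?I. Yn i n (x i)) \<longlonglongrightarrow> (\<lambda>i\<in>?I. Y i (x i))"
    by (simp add: euclidean_product_topology)
   then show "(\<lambda>n. F (\<lambda>i\<in>?I. Yn i n (x i))) \<longlonglongrightarrow> F (\<lambda>i\<in>?I. Y i (x i))"
    by (rule continuous_on_tendsto_compose[OF F(1)]) auto
  qed
 qed (use F(2) in auto)
 moreover have "(\<integral>x. F (\<lambda>i\<in>?I. Yn i n (x i)) \<partial>Q) = (\<integral>w. F (\<lambda>i\<in>?I. \<xi> n i w) \<partial>M)" for n
 proof -
  have "PiM ?I (\<lambda>i. distr Q borel (\<lambda>x. Yn i n (x i))) = PiM ?I (\<lambda>i. distr M borel (\<xi> n i))"
   by (rule PiM_cong) (auto simp: lawQ S)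
  then show ?thesis
   using int[OF Q.prob_space_axioms indQ[of "\<lambda>i. Yn i n", OF S(2)]] int[OF prob_space_axioms \<xi>[of n]] by simp
 qed
 moreover have "(\<integral>x. F (\<lambda>i\<in>?I. Y i (x i)) \<partial>Q) = (\<integral>w. F (\<lambda>i\<in>?I. \<eta> i w) \<partial>N)"
 proof -
  have "PiM ?I (\<lambda>i. distr Q borel (\<lambda>x. Y i (x i))) = PiM ?I (\<lambda>i. distr N borel (\<eta> i))"
   by (rule PiM_cong) (auto simp: lawQ S)
  then show ?thesis
   using int[OF Q.prob_space_axioms indQ[of Y, OF S(3)]] int[OF N \<eta>] by simp
 qed
 ultimately show ?thesis by simp
qed

lemma to_D01_step_path_min: "to_D01 (step_path m (\<lambda>k. y (min k m))) = to_D01 (step_path m y)"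
proof -
 have "restrict (step_path m (\<lambda>k. y (min k m))) {0..1} = restrict (step_path m y) {0..1}"
 proof (rule restrict_ext)
  fix t :: real assume t: "t \<in> {0..1}"
  then have "real m * t <= real m" "0 <= real m * t" by (auto intro: mult_left_le)
  then have "nat \<lfloor>real m * t\<rfloor> <= m" by linarith
  then show "step_path m (\<lambda>k. y (min k m)) t = step_path m y t" by (simp add: step_path_def min_absorb1)
 qed
 then show ?thesis by (simp add: to_D01_def)
qed

context linear_domain
begin

abbreviation "block n m i \<equiv> n * Suc i div m - n * i div m"
abbreviation "block_sum n m i w \<equiv> walk (int (n * i div m)) (block n m i) w / a n"

lemma skeleton_eq: "skeleton n m w k = \<Phi> * (\<Sum>i<k. block_sum n m i w)"
proof -
 have le: "n * i div m <= n * Suc i div m" for i by (intro div_le_mono) simp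
 have "(\<Sum>i<k. block_sum n m i w) = (\<Sum>i<k. T w (int (n * Suc i div m)) / a n - T w (int (n * i div m)) / a n)"
  using le by (intro sum.cong refl) (simp add: walk_eq_T of_nat_diff diff_divide_distrib)
 also have "... = T w (int (n * k div m)) / a n" by (subst sum_lessThan_telescope) simp
 finally show ?thesis by (simp add: skeleton_def)
qed

lemma block_sum_indep: "indep_vars (\<lambda>_. borel) (block_sum n m) {..<m}"
proof -
 define K where "K i = {int (n * i div m) + 1..int (n * Suc i div m)}" for i
 have mono: "n * i div m <= n * j div m" if "i <= j" for i j using that by (intro div_le_mono mult_le_mono2)
 have "disjoint_family_on K {..<m}"
  unfolding disjoint_family_on_def
 proof (intro ballI impI)
  fix i j :: nat assume "i \<noteq> j"
  then have "Suc i <= j \<or> Suc j <= i" by linarith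
  then show "K i \<inter> K j = {}" using mono[of "Suc i" j] mono[of "Suc j" i] unfolding K_def by auto
 qed
 then have "indep_vars (\<lambda>i. PiM (K i) (\<lambda>_. borel)) (\<lambda>i w. restrict (\<lambda>j. Z j w) (K i)) {..<m}"
  by (intro indep_vars_restrict[OF indep]) auto
 then have "indep_vars (\<lambda>_. borel) (\<lambda>i w. (\<lambda>y. (\<Sum>l<block n m i. y (int (n * i div m) + 1 + int l) - D.centre) / a n) (restrict (\<lambda>j. Z j w) (K i))) {..<m}"
 proof (rule indep_vars_compose2)
  fix i
  have "(\<lambda>y. y (int (n * i div m) + 1 + int l)) \<in> borel_measurable (PiM (K i) (\<lambda>_. borel :: real measure))" if "l < block n m i" for l
   using that by (intro measurable_component_singleton) (auto simp: K_def)
  then show "(\<lambda>y. (\<Sum>l<block n m i. y (int (n * i div m) + 1 + int l) - D.centre) / a n) \<in> borel_measurable (PiM (K i) (\<lambda>_. borel))"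
   by (intro borel_measurable_divide borel_measurable_sum borel_measurable_diff) auto
 qed
 moreover have "(\<Sum>l<block n m i. restrict (\<lambda>j. Z j w) (K i) (int (n * i div m) + 1 + int l) - D.centre) / a n = block_sum n m i w" for i w
  unfolding walk_def by (intro arg_cong2[of _ _ _ _ "(/)"] sum.cong refl) (auto simp: K_def)
 ultimately show ?thesis by (simp only:)
qed

text \<open>A block contains \<open>n / m\<close> steps up to rounding, so that the characteristic function is a power to which
  the Poisson-type limit \<open>power_tendsto_exp\<close> applies.\<close>

lemma char_block_sum:
 assumes "m > 0"
 shows "(\<lambda>n. char (distr M borel (block_sum n m i)) \<theta>) \<longlonglongrightarrow> exp (of_real (1 / real m) * D.psi \<theta>)"
proof -
 let ?c = "\<lambda>n. \<integral>x. iexp (\<theta> * ((x - D.centre) / a n)) \<partial>\<mu>"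
 have char: "char (distr M borel (block_sum n m i)) \<theta> = ?c n ^ block n m i" for n
 proof -
  let ?k = "int (n * i div m)"
  let ?g = "\<lambda>x. iexp (\<theta> * ((x - D.centre) / a n))"
  have int: "integrable M (\<lambda>w. ?g (Z j w))" for j by (rule integrable_const_bound[of _ 1]) auto
  have ind: "indep_vars (\<lambda>_. borel) (\<lambda>l w. ?g (Z (?k + 1 + int l) w)) {..<block n m i}"
   by (rule indep_vars_compose2[OF indep_window[of "\<lambda>x. x" ?k]]) auto
  have "iexp (\<theta> * block_sum n m i w) = (\<Prod>l<block n m i. ?g (Z (?k + 1 + int l) w))" for w
   by (simp only: walk_def exp_sum[symmetric, OF finite_lessThan] sum_distrib_left[symmetric] of_real_sum[symmetric] sum_divide_distrib[symmetric])
  then have "char (distr M borel (block_sum n m i)) \<theta> = (\<Prod>l<block n m i. expectation (\<lambda>w. ?g (Z (?k + 1 + int l) w)))"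
   using indep_vars_lebesgue_integral[OF finite_lessThan ind int] by (subst char_distr_eq) auto
  also have "... = ?c n ^ block n m i" by (subst integral_Z(1)) auto
  finally show ?thesis .
 qed
 have c1: "norm (?c n) <= 1" for n
  using integral_norm_bound[of \<mu> "\<lambda>x. iexp (\<theta> * ((x - D.centre) / a n))"] D.prob_space by simp
 have "(\<lambda>n. real (block n m i) / real n) \<longlonglongrightarrow> 1 / real m"
 proof -
  have f: "(\<lambda>n. real (n * j div m) / real n) \<longlonglongrightarrow> real j / real m" for j
  proof (rule real_tendsto_sandwich)
   show "\<forall>\<^sub>F n in sequentially. real j / real m - 1 / real n <= real (n * j div m) / real n"
    using eventually_gt_at_top[of 0]
   proof eventually_elim
    case (elim n)
    have "real (n * j) / real m - 1 <= real (n * j div m)"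
     using floor_divide_of_nat_eq[of "n * j" m, where 'a = real] by linarith
    from divide_right_mono[OF this, of "real n"] show ?case using elim by (simp add: diff_divide_distrib)
   qed
   show "\<forall>\<^sub>F n in sequentially. real (n * j div m) / real n <= real j / real m"
    using eventually_gt_at_top[of 0]
   proof eventually_elim
    case (elim n)
    have "real (n * j div m) <= real (n * j) / real m"
     using floor_divide_of_nat_eq[of "n * j" m, where 'a = real] by linarith
    from divide_right_mono[OF this, of "real n"] show ?case using elim by (simp add: diff_divide_distrib)
   qed
   show "(\<lambda>n. real j / real m - 1 / real n) \<longlonglongrightarrow> real j / real m"
    using tendsto_diff[OF tendsto_const lim_1_over_n, of "real j / real m"] by simp
  qed simp
  have "real (block n m i) / real n = real (n * Suc i div m) / real n - real (n * i div m) / real n" for n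
   by (subst of_nat_diff) (auto intro!: div_le_mono simp: diff_divide_distrib)
  moreover have "real (Suc i) / real m - real i / real m = 1 / real m" by (simp add: diff_divide_distrib[symmetric])
  ultimately show ?thesis using tendsto_diff[OF f[of "Suc i"] f[of i]] by (simp only:)
 qed
 from power_tendsto_exp[OF c1 D.char_increment_limit this] show ?thesis unfolding char .
qed

theorem partial_sums_converge:
 obtains N :: "(real => real) measure" and L where "stable_levy_process \<alpha> N L"
  "converges_in_distribution M (\<lambda>n w. to_D01 (V n w)) N (\<lambda>w. to_D01 (\<lambda>t. \<Phi> * L t w))"
proof -
 obtain N :: "(real => real) measure" and L where L: "stable_levy_process \<alpha> N L"
  and char_L: "\<And>s t \<theta>. 0 <= s ==> s <= t ==> (\<integral>w. iexp (\<theta> * (L t w - L s w)) \<partial>N) = exp (of_real (t - s) * D.psi \<theta>)"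
  using D.stable_levy_process_exists by blast
 have levy: "levy_process N L" using L by (simp add: stable_levy_process_def)
 interpret N: prob_space N using levy by (simp add: levy_process_def)
 have L_rv: "L t \<in> borel_measurable N" if "t \<ge> 0" for t using levy that by (simp add: levy_process_def)
 have cad: "cadlag_on {0..1} (\<lambda>t. \<Phi> * L t w)" if "w \<in> space N" for w
  by (rule cadlag_on_scaled_levy_path[OF levy that])
 have V_rv: "(\<lambda>w. to_D01 (V n w)) \<in> M \<rightarrow>\<^sub>M borel" for n
 proof (rule measurable_to_D01[OF cadlag_V])
  have [measurable]: "linear_process \<phi> Z i \<in> borel_measurable M" for i
   unfolding linear_process_def[abs_def] by measurable
  show "(\<lambda>w. V n w t) \<in> borel_measurable M" for t unfolding V_def partial_sum_process_def by measurable
 qed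
 have L_D01: "(\<lambda>w. to_D01 (\<lambda>t. \<Phi> * L t w)) \<in> N \<rightarrow>\<^sub>M borel"
  by (rule measurable_to_D01[OF cad]) (auto intro!: borel_measurable_times L_rv)
 let ?s = "\<lambda>m n w. to_D01 (step_path m (skeleton n m w))"
 let ?l = "\<lambda>m w. to_D01 (step_path m (\<lambda>k. \<Phi> * L (real k / real m) w))"
 have s_rv: "?s m n \<in> M \<rightarrow>\<^sub>M borel" for m n
  by (rule measurable_step_path) (simp add: skeleton_def)
 have l_rv: "?l m \<in> N \<rightarrow>\<^sub>M borel" for m
  by (rule measurable_step_path) (auto intro!: borel_measurable_times L_rv)
 have skeleton_limit: "(\<lambda>n. \<integral>w. f (?s m n w) \<partial>M) \<longlonglongrightarrow> (\<integral>w. f (?l m w) \<partial>N)"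
  if m: "m > 0" and f: "continuous_on UNIV f" "\<And>x. \<bar>f x\<bar> <= B" for m B and f :: "D01 => real"
 proof -
  define F where "F y = f (to_D01 (step_path m (\<lambda>k. \<Phi> * (\<Sum>i<min k m. y i))))" for y :: "nat => real"
  define \<eta> where "\<eta> i w = L (real (Suc i) / real m) w - L (real i / real m) w" for i w
  have F: "continuous_on UNIV F"
  proof -
   have "continuous_on UNIV (\<lambda>y :: nat => real. \<lambda>k. \<Phi> * (\<Sum>i<min k m. y i))"
    by (intro continuous_on_coordinatewise_then_product continuous_intros continuous_on_product_coordinates)
   then have "continuous_on UNIV (f \<circ> ((\<lambda>y. to_D01 (step_path m y)) \<circ> (\<lambda>y k. \<Phi> * (\<Sum>i<min k m. y i))))"
    by (intro continuous_on_compose continuous_on_subset[OF continuous_step_path] continuous_on_subset[OF f(1)]) auto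
   then show ?thesis by (simp add: F_def[abs_def] comp_def)
  qed
  have "(\<lambda>n. \<integral>w. F (\<lambda>i\<in>{..<m}. block_sum n m i w) \<partial>M) \<longlonglongrightarrow> (\<integral>w. F (\<lambda>i\<in>{..<m}. \<eta> i w) \<partial>N)"
  proof (rule independent_weak_convergence[OF block_sum_indep N.prob_space_axioms _ _ m F])
   show "N.indep_vars (\<lambda>_. borel) \<eta> {..<m}"
    unfolding \<eta>_def[abs_def] using levy unfolding levy_process_def
    by (auto simp: divide_right_mono dest!: spec[of _ m] spec[of _ "\<lambda>i. real i / real m"])
   show "(\<lambda>n. char (distr M borel (block_sum n m i)) \<theta>) \<longlonglongrightarrow> char (distr N borel (\<eta> i)) \<theta>" for i \<theta>
   proof -
    have "\<eta> i \<in> borel_measurable N" unfolding \<eta>_def[abs_def] by (intro borel_measurable_diff L_rv) auto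
    then have "char (distr N borel (\<eta> i)) \<theta> = exp (of_real (1 / real m) * D.psi \<theta>)"
     using char_L[of "real i / real m" "real (Suc i) / real m" \<theta>]
     by (subst N.char_distr_eq) (simp_all add: \<eta>_def divide_right_mono diff_divide_distrib[symmetric])
    then show ?thesis using char_block_sum[OF m, of i \<theta>] by simp
   qed
   show "\<bar>F y\<bar> <= B" for y unfolding F_def by (rule f)
  qed
  moreover have "F (\<lambda>i\<in>{..<m}. block_sum n m i w) = f (?s m n w)" for n w
  proof -
   have "(\<lambda>k. \<Phi> * (\<Sum>i<min k m. (\<lambda>i\<in>{..<m}. block_sum n m i w) i)) = (\<lambda>k. skeleton n m w (min k m))"
    unfolding skeleton_eq by (intro ext arg_cong[of _ _ "(*) \<Phi>"] sum.cong) auto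
   then show ?thesis unfolding F_def by (simp only: to_D01_step_path_min)
  qed
  moreover have "(\<integral>w. F (\<lambda>i\<in>{..<m}. \<eta> i w) \<partial>N) = (\<integral>w. f (?l m w) \<partial>N)"
  proof (rule Bochner_Integration.integral_cong[OF refl])
   fix w assume "w \<in> space N"
   then have L0: "L 0 w = 0" using levy by (simp add: levy_process_def)
   have "(\<Sum>i<min k m. (\<lambda>i\<in>{..<m}. \<eta> i w) i) = L (real (min k m) / real m) w" for k
   proof -
    have "(\<Sum>i<min k m. (\<lambda>i\<in>{..<m}. \<eta> i w) i) = (\<Sum>i<min k m. L (real (Suc i) / real m) w - L (real i / real m) w)"
     by (intro sum.cong refl) (auto simp: \<eta>_def)
    also have "... = L (real (min k m) / real m) w" by (subst sum_lessThan_telescope) (simp add: L0)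
    finally show ?thesis .
   qed
   then show "F (\<lambda>i\<in>{..<m}. \<eta> i w) = f (?l m w)"
    unfolding F_def using to_D01_step_path_min[of m "\<lambda>k. \<Phi> * L (real k / real m) w"] by simp
  qed
  ultimately show ?thesis by simp
 qed
 have "converges_in_distribution M (\<lambda>n w. to_D01 (V n w)) N (\<lambda>w. to_D01 (\<lambda>t. \<Phi> * L t w))"
 proof (rule converges_in_distributionI_lipschitz[OF prob_space_axioms N.prob_space_axioms V_rv L_D01])
  fix f :: "D01 => real" and K B
  assume lip: "\<And>x y. \<bar>f x - f y\<bar> <= K * dist x y" and fB: "\<And>x. \<bar>f x\<bar> <= B" and K: "0 <= K"
  have f_cont: "continuous_on UNIV f"
   by (rule lipschitz_on_continuous_on[of K]) (use lip K in \<open>auto simp: lipschitz_on_def dist_real_def\<close>)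
  have f_m: "f \<in> borel_measurable borel" by (rule borel_measurable_continuous_onI[OF f_cont])
  have B: "0 <= B" using fB[of undefined] by linarith
  have l_lim: "(\<lambda>m. \<integral>w. f (?l (Suc m) w) \<partial>N) \<longlonglongrightarrow> (\<integral>w. f (to_D01 (\<lambda>t. \<Phi> * L t w)) \<partial>N)"
  proof (rule integral_dominated_convergence[of _ _ _ "\<lambda>_. B"])
   show "AE w in N. (\<lambda>m. f (?l (Suc m) w)) \<longlonglongrightarrow> f (to_D01 (\<lambda>t. \<Phi> * L t w))"
    by (intro AE_I2 continuous_on_tendsto_compose[OF f_cont] step_path_sample_tendsto[OF cad]) auto
  qed (use fB in \<open>auto intro: measurable_compose[OF l_rv f_m] measurable_compose[OF L_D01 f_m] simp del: of_nat_Suc\<close>)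
  show "(\<lambda>n. \<integral>w. f (to_D01 (V n w)) \<partial>M) \<longlonglongrightarrow> (\<integral>w. f (to_D01 (\<lambda>t. \<Phi> * L t w)) \<partial>N)"
  proof (rule LIMSEQ_I)
   fix \<epsilon> :: real assume \<epsilon>: "\<epsilon> > 0"
   define e where "e = \<epsilon> / (3 * (K + 2 * B + 1))"
   have e: "e > 0" "(K + 2 * B) * e <= \<epsilon> / 3"
   proof -
    define D where "D = K + 2 * B + 1"
    have D: "D > 0" using K B by (simp add: D_def)
    have eq: "e = \<epsilon> / (3 * D)" by (simp add: e_def D_def)
    show "e > 0" using D \<epsilon> by (simp add: eq)
    then have "(K + 2 * B) * e <= D * e" by (intro mult_right_mono) (auto simp: D_def)
    also have "... = \<epsilon> / 3" using D by (simp add: eq)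
    finally show "(K + 2 * B) * e <= \<epsilon> / 3" .
   qed
   obtain m0 where "m0 > 0" and m0: "\<And>m. m \<ge> m0 ==> \<forall>\<^sub>F n in sequentially. \<exists>E\<in>events. prob E <= e \<and>
    (\<forall>w\<in>space M - E. dist_M2 (V n w) (step_path m (skeleton n m w)) <= e)"
    by (rule step_approximation[OF e(1)]) blast
   obtain m1 where m1: "\<And>m. m \<ge> m1 ==> \<bar>(\<integral>w. f (?l (Suc m) w) \<partial>N) - (\<integral>w. f (to_D01 (\<lambda>t. \<Phi> * L t w)) \<partial>N)\<bar> < \<epsilon> / 3"
    using LIMSEQ_D[OF l_lim, of "\<epsilon> / 3"] \<epsilon> by auto
   define m where "m = Suc (max m0 m1)"
   have l_close: "\<bar>(\<integral>w. f (?l m w) \<partial>N) - (\<integral>w. f (to_D01 (\<lambda>t. \<Phi> * L t w)) \<partial>N)\<bar> < \<epsilon> / 3"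
    unfolding m_def by (rule m1) simp
   have "\<forall>\<^sub>F n in sequentially. \<bar>(\<integral>w. f (?s m n w) \<partial>M) - (\<integral>w. f (?l m w) \<partial>N)\<bar> < \<epsilon> / 3"
    using tendstoD[OF skeleton_limit[of m f B, OF _ f_cont fB], of "\<epsilon> / 3"] \<epsilon> by (simp add: m_def dist_real_def)
   moreover have "\<forall>\<^sub>F n in sequentially. \<exists>E\<in>events. prob E <= e \<and>
    (\<forall>w\<in>space M - E. dist_M2 (V n w) (step_path m (skeleton n m w)) <= e)"
    by (rule m0) (simp add: m_def)
   ultimately have "\<forall>\<^sub>F n in sequentially. norm ((\<integral>w. f (to_D01 (V n w)) \<partial>M) - (\<integral>w. f (to_D01 (\<lambda>t. \<Phi> * L t w)) \<partial>N)) < \<epsilon>"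
   proof eventually_elim
    case (elim n)
    then obtain E where E[measurable]: "E \<in> events" and PE: "prob E <= e"
     and dE: "\<And>w. w \<in> space M - E ==> dist_M2 (V n w) (step_path m (skeleton n m w)) <= e" by blast
    have iV: "integrable M (\<lambda>w. f (to_D01 (V n w)))" and iS: "integrable M (\<lambda>w. f (?s m n w))"
     by (rule integrable_const_bound[of _ B]; use fB in \<open>auto intro: measurable_compose[OF V_rv f_m] measurable_compose[OF s_rv f_m]\<close>)+
    have iE: "integrable M (\<lambda>w. 2 * B * indicator E w)"
     by (intro integrable_mult_right integrable_real_indicator) (auto simp: emeasure_eq_measure)
    have "\<bar>f (to_D01 (V n w)) - f (?s m n w)\<bar> <= K * e + 2 * B * indicator E w" if "w \<in> space M" for w
    proof (cases "w \<in> E")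
     case True
     have "\<bar>f (to_D01 (V n w)) - f (?s m n w)\<bar> <= 2 * B" using fB[of "to_D01 (V n w)"] fB[of "?s m n w"] by linarith
     then show ?thesis using True K e by (simp add: add_increasing)
    next
     case False
     have "\<bar>f (to_D01 (V n w)) - f (?s m n w)\<bar> <= K * dist (to_D01 (V n w)) (?s m n w)" by (rule lip)
     also have "... <= K * e"
      using dE[of w] that False K by (intro mult_left_mono) (auto simp: dist_to_D01 cadlag_V cadlag_step_path)
     finally show ?thesis using False by simp
    qed
    then have "\<bar>(\<integral>w. f (to_D01 (V n w)) - f (?s m n w) \<partial>M)\<bar> <= (\<integral>w. K * e + 2 * B * indicator E w \<partial>M)"
     by (intro order_trans[OF integral_abs_bound] integral_mono) (use iV iS iE in auto)
    also have "... = K * e + 2 * B * prob E"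
     by (subst Bochner_Integration.integral_add[OF integrable_const iE]) (simp add: prob_space)
    also have "... <= K * e + 2 * B * e" using PE B by (intro add_left_mono mult_left_mono) auto
    also have "... <= \<epsilon> / 3" using e(2) by (simp add: algebra_simps)
    finally have "\<bar>(\<integral>w. f (to_D01 (V n w)) \<partial>M) - (\<integral>w. f (?s m n w) \<partial>M)\<bar> <= \<epsilon> / 3"
     using iV iS by simp
    then show ?case using elim(1) l_close unfolding real_norm_def by linarith
   qed
   then show "\<exists>no. \<forall>n\<ge>no. norm ((\<integral>w. f (to_D01 (V n w)) \<partial>M) - (\<integral>w. f (to_D01 (\<lambda>t. \<Phi> * L t w)) \<partial>N)) < \<epsilon>"
    by (simp add: eventually_sequentially)
  qed
 qed
 then show ?thesis using L by (rule that[rotated])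
qed

end

section \<open>The functional limit theorem\<close>

text \<open>Regular variation in terms of a slowly varying factor implies the form that concerns the tail
  only. The tail is positive everywhere since it is monotone and eventually positive.\<close>

lemma stable_domain_distr:
 fixes Z :: "'a => real"
 assumes M: "prob_space M" and \<alpha>: "0 < \<alpha>" "\<alpha> < 2" and reg: "regularly_varying \<alpha> M Z"
  and sym: "\<alpha> = 1 ==> distr M borel Z = distr M borel (\<lambda>w. - Z w)"
  and a: "\<And>n. n \<ge> 1 ==> a n > 0" "(\<lambda>n. real n * \<P>(w in M. \<bar>Z w\<bar> > a n)) \<longlonglongrightarrow> 1"
 obtains p r where "stable_domain (distr M borel Z) \<alpha> p r a"
proof -
 interpret prob_space M by fact
 define \<mu> where "\<mu> = distr M borel Z"
 have Z[measurable]: "Z \<in> borel_measurable M" using reg by (simp add: regularly_varying_def)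
 have mu: "measure \<mu> A = \<P>(w in M. Z w \<in> A)" if "A \<in> sets borel" for A
  unfolding \<mu>_def using that by (subst measure_distr) (auto intro!: arg_cong[of _ _ "measure M"])
 let ?H = "\<lambda>x. \<P>(w in M. \<bar>Z w\<bar> > x)"
 have tail: "measure \<mu> {y. x < \<bar>y\<bar>} = ?H x" for x by (simp add: mu)
 obtain L p r where L: "slowly_varying L" "\<And>x. x > 0 ==> ?H x = x powr (- \<alpha>) * L x"
  and p: "((\<lambda>x. \<P>(w in M. Z w > x) / ?H x) \<longlongrightarrow> p) at_top"
  and r: "((\<lambda>x. \<P>(w in M. Z w < - x) / ?H x) \<longlongrightarrow> r) at_top"
  using reg unfolding regularly_varying_def by blast
 interpret \<mu>: real_distribution \<mu> unfolding \<mu>_def by (rule real_distribution_distr) simp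
 have "stable_domain \<mu> \<alpha> p r a"
 proof (intro stable_domain.intro stable_domain_axioms.intro)
  show "real_distribution \<mu>" ..
  show "0 < measure \<mu> {y. x < \<bar>y\<bar>}" for x
  proof -
   have "\<forall>\<^sub>F y in at_top. 0 < L y \<and> max x 1 <= y"
    using L(1) by (intro eventually_conj eventually_ge_at_top) (simp add: slowly_varying_def)
   then obtain y where y: "0 < L y" "max x 1 <= y" using eventually_happens'[OF trivial_limit_at_top_linorder] by blast
   then have "0 < ?H y" by (simp add: L(2))
   also have "... <= ?H x" using y(2) by (intro finite_measure_mono) auto
   finally show ?thesis unfolding tail .
  qed
  show "((\<lambda>x. measure \<mu> {y. c * x < \<bar>y\<bar>} / measure \<mu> {y. x < \<bar>y\<bar>}) \<longlongrightarrow> c powr (- \<alpha>)) at_top" if c: "c > 0" for c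
  proof -
   have "((\<lambda>x. c powr (- \<alpha>) * (L (c * x) / L x)) \<longlongrightarrow> c powr (- \<alpha>) * 1) at_top"
    using L(1) c by (intro tendsto_mult tendsto_const) (simp add: slowly_varying_def)
   moreover have "\<forall>\<^sub>F x in at_top. c powr (- \<alpha>) * (L (c * x) / L x) = measure \<mu> {y. c * x < \<bar>y\<bar>} / measure \<mu> {y. x < \<bar>y\<bar>}"
    using eventually_gt_at_top[of 0] by eventually_elim (use c in \<open>simp add: tail L(2) powr_mult\<close>)
   ultimately show ?thesis using tendsto_cong by fastforce
  qed
  show "((\<lambda>x. measure \<mu> {x<..} / measure \<mu> {y. x < \<bar>y\<bar>}) \<longlongrightarrow> p) at_top" using p by (simp add: mu)
  show "((\<lambda>x. measure \<mu> {..<- x} / measure \<mu> {y. x < \<bar>y\<bar>}) \<longlongrightarrow> r) at_top" using r by (simp add: mu)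
  show "(\<lambda>n. real n * measure \<mu> {y. a n < \<bar>y\<bar>}) \<longlonglongrightarrow> 1" using a(2) by (simp add: tail)
  show "distr \<mu> borel uminus = \<mu>" if "\<alpha> = 1"
   unfolding \<mu>_def by (subst distr_distr) (use sym[OF that] in \<open>simp_all add: comp_def\<close>)
 qed (use \<alpha> a(1) in auto)
 then show ?thesis unfolding \<mu>_def by (rule that)
qed

theorem theorem3p1:
  fixes M :: "'a measure" and Z :: "int \<Rightarrow> 'a \<Rightarrow> real"
    and \<alpha> \<Phi> :: real and a b :: "nat \<Rightarrow> real" and \<phi> :: "nat \<Rightarrow> real"
  assumes "prob_space M"
    and "0 < \<alpha>" "\<alpha> < 2"
    and "prob_space.indep_vars M (\<lambda>_. borel) Z UNIV"
    and "\<And>i. distr M borel (Z i) = distr M borel (Z 1)"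
    and "regularly_varying \<alpha> M (Z 1)"
    and "\<alpha> = 1 \<Longrightarrow> distr M borel (Z 1) = distr M borel (\<lambda>\<omega>. - Z 1 \<omega>)"
    and "\<And>n. n \<ge> 1 \<Longrightarrow> a n > 0"
    and "(\<lambda>n. real n * \<P>(\<omega> in M. \<bar>Z 1 \<omega>\<bar> > a n)) \<longlonglongrightarrow> 1"
    and "\<exists>\<delta>. 0 < \<delta> \<and> \<delta> < min 1 \<alpha> \<and> summable (\<lambda>i. \<bar>\<phi> i\<bar> powr \<delta>)"
    and "\<Phi> = (\<Sum>i. \<phi> i)" "\<Phi> \<noteq> 0"
    and "\<And>s. 0 \<le> (\<Sum>i=0..s. \<phi> i) / \<Phi> \<and> (\<Sum>i=0..s. \<phi> i) / \<Phi> \<le> 1"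
    and "\<And>n. b n = (if \<alpha> \<le> 1 then 0 else \<Phi> * prob_space.expectation M (Z 1))"
  shows "(\<forall>t. AE \<omega> in M. summable (\<lambda>i. \<phi> i * Z (t - int i) \<omega>)) \<and>
    (\<exists>(N :: (real \<Rightarrow> real) measure) V. stable_levy_process \<alpha> N V \<and>
      converges_in_distribution
        M (\<lambda>n \<omega>. to_D01 (partial_sum_process a b (linear_process \<phi> Z) n \<omega>))
        N (\<lambda>\<omega>. to_D01 (\<lambda>t. \<Phi> * V t \<omega>)))"
proof -
 interpret prob_space M by fact
 define \<mu> where "\<mu> = distr M borel (Z 1)"
 obtain p r where sd: "stable_domain \<mu> \<alpha> p r a"
  unfolding \<mu>_def by (rule stable_domain_distr[OF assms(1-3,6-9)])
 obtain \<delta> where \<delta>: "0 < \<delta>" "\<delta> < 1" "\<delta> < \<alpha>" "summable (\<lambda>i. \<bar>\<phi> i\<bar> powr \<delta>)" using assms(10) by auto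
 have iid: "iid_domain M \<mu> \<alpha> p r a Z"
  by (intro iid_domain.intro iid_domain_axioms.intro) (use assms(1,4,5) sd in \<open>auto simp: \<mu>_def\<close>)
 then have ld: "linear_domain M \<mu> \<alpha> p r a Z \<phi> \<Phi> \<delta>"
  by (intro linear_domain.intro linear_domain_axioms.intro) (use \<delta> assms(11-13) in auto)
 interpret linear_domain M \<mu> \<alpha> p r a Z \<phi> \<Phi> \<delta> by (rule ld)
 have "b n = \<Phi> * D.centre" for n
  unfolding assms(14) D.centre_def using integral_Z(1)[of "\<lambda>x. x" 1] by simp
 then have b: "b = (\<lambda>_. \<Phi> * D.centre)" by auto
 have "AE w in M. summable (\<lambda>i. \<phi> i * Z (t - int i) w)" for t
  using AE_summable[of t] by eventually_elim (rule summable_rabs_cancel)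
 moreover obtain N :: "(real => real) measure" and L where "stable_levy_process \<alpha> N L"
  "converges_in_distribution M (\<lambda>n w. to_D01 (V n w)) N (\<lambda>w. to_D01 (\<lambda>t. \<Phi> * L t w))"
  by (rule partial_sums_converge)
 ultimately show ?thesis unfolding b V_def by blast
qed

end
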